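(* Let $d\ge1$, let $\Omega\subset\mathbb R^d$ be a bounded domain, and let $\delta>0$. Set $H_\Omega=L^2(\Omega;\mathbb C)$, $V_\Omega=H_0^1(\Omega;\mathbb C)$, $V_\Omega'=H^{-1}(\Omega;\mathbb C)$. Then there exists a bounded real-valued scalar coefficient $\mathfrak b$ on $[0,1]\times\Omega$ such that the isotropic coefficient matrix $\mathfrak B(t,x)=\mathfrak b(t,x)\,\mathrm{Id}_d$ is real symmetric and uniformly elliptic, and satisfies $$\mathfrak B\in C^{0,1/2}([0,1];L^\infty(\Omega;\mathbb R^{d\times d})),\qquad \|\mathfrak B-\mathrm{Id}_d\|_{C^{0,1/2}([0,1];L^\infty(\Omega;\mathbb R^{d\times d}))}<\delta.$$ Moreover, $$\mathfrak B\notin C^{0,\alpha}([0,1];L^\infty(\Omega;\mathbb R^{d\times d}))\qquad\text{for every }\tfrac12<\alpha<1.$$ There also exist a real-valued forcing term $F\in C([0,1];H_\Omega)\cap L^2(0,1;H_\Omega)$ and a real-valued function $$U\in C([0,1];V_\Omega)\cap C^1([0,1];V_\Omega')\cap W^{1,1}(0,1;H_\Omega),$$ which is, in particular, an element of $L^2(0,1;V_\Omega)\cap H^1(0,1;V_\Omega')$, such that $U(0)=0$ and $U$ is the unique Lions variational solution of $$U'(t)-\operatorname{div}(\mathfrak B(t,\cdot)\nabla U(t))=F(t)$$ in $V_\Omega'$ for every $t\in[0,1]$, but $U'\notin L^2(0,1;H_\Omega)$. Consequently, $$-\operatorname{div}(\mathfrak B\nabla U)\notin L^2(0,1;H_\Omega),$$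 and maximal $L^2$-regularity cannot hold for this diffusion coefficient on $\Omega$.
   Context: A domain is a nonempty connected open set. $V_\Omega'$ is the anti-dual of $V_\Omega$, and $V_\Omega\hookrightarrow H_\Omega\hookrightarrow V_\Omega'$ is the usual Gelfand triple. Uniform ellipticity of $\mathfrak B=\mathfrak b\,\mathrm{Id}_d$ means there are $0<\lambda\le\Lambda<\infty$ with $\lambda\le\mathfrak b\le\Lambda$ a.e. The operator $-\operatorname{div}(\mathfrak B(t,\cdot)\nabla\,\cdot):V_\Omega\to V_\Omega'$ is defined by $v\mapsto\big(w\mapsto\int_\Omega\mathfrak B(t,x)\nabla v(x)\cdot\overline{\nabla w(x)}\,dx\big)$. $\mathbb R^{d\times d}$ carries a fixed matrix norm (for instance the operator norm). For $0<\alpha<1$ and a Banach space $X$, $C^{0,\alpha}([0,T];X)$ is the Hölder space with norm $\|g\|_{C^{0,\alpha}([0,T];X)}=\sup_{t}\|g(t)\|_X+\sup_{s\ne t}\|g(t)-g(s)\|_X/|t-s|^\alpha$. For $F\in L^2(0,1;V_\Omega')$, the Lions variational solution with zero initial value is the unique $U\in L^2(0,1;V_\Omega)\cap H^1(0,1;V_\Omega')$ with $U(0)=0$ satisfying the equation in $V_\Omega'$ for a.e. $t$. Maximal $L^2$-regularity for the coefficient means that for every $F\in L^2(0,1;H_\Omega)$ this solution satisfies $U'\in L^2(0,1;H_\Omega)$ (equivalently, $-\operatorname{div}(\mathfrak B\nabla U)\in L^2(0,1;H_\Omega)$). *)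

theory Defs
  imports "HOL-Analysis.Analysis" "HOL-Probability.Essential_Supremum"
begin

section \<open>Function spaces as carriers with a seminorm\<close>

text \<open>
  The spaces below depend on the variable domain \<open>\<Omega>\<close>, so they are not types. A space is a carrier
  of representatives (functions, with pointwise linear structure) together with a seminorm;
  two representatives denote the same element iff their difference has seminorm zero.
\<close>

record ('x, 'b) fspace =
  carr :: "('x \<Rightarrow> 'b) set"
  nrm :: "('x \<Rightarrow> 'b) \<Rightarrow> real"

definition domain :: "'a::topological_space set \<Rightarrow> bool" where
  "domain \<Omega> \<longleftrightarrow> \<Omega> \<noteq> {} \<and> connected \<Omega> \<and> open \<Omega>"

definition is_norm :: "('a::real_vector \<Rightarrow> real) \<Rightarrow> bool" where
  "is_norm \<nu> \<longleftrightarrow> (\<forall>x. 0 \<le> \<nu> x) \<and> (\<forall>x. \<nu> x = 0 \<longleftrightarrow> x = 0) \<and>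
     (\<forall>c x. \<nu> (c *\<^sub>R x) = \<bar>c\<bar> * \<nu> x) \<and> (\<forall>x y. \<nu> (x + y) \<le> \<nu> x + \<nu> y)"


section \<open>Test functions\<close>

fun Ck :: "nat \<Rightarrow> ('a::euclidean_space \<Rightarrow> 'b::real_normed_vector) \<Rightarrow> bool" where
  "Ck 0 f \<longleftrightarrow> continuous_on UNIV f"
| "Ck (Suc k) f \<longleftrightarrow> f differentiable_on UNIV \<and>
     (\<forall>e\<in>Basis. Ck k (\<lambda>x. frechet_derivative f (at x) e))"

text \<open>\<open>C\<^sub>c\<^sup>\<infinity>(S)\<close>; elements are extended by zero to the whole space.\<close>

definition test_functions :: "'a::euclidean_space set \<Rightarrow> ('a \<Rightarrow> 'b::real_normed_vector) set" where
  "test_functions S =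
     {\<phi>. (\<forall>k. Ck k \<phi>) \<and> compact (closure {x. \<phi> x \<noteq> 0}) \<and> closure {x. \<phi> x \<noteq> 0} \<subseteq> S}"


section \<open>Functions of time with values in a space\<close>

definition continuous_in :: "('x, 'b::real_normed_vector) fspace \<Rightarrow> real set \<Rightarrow> (real \<Rightarrow> 'x \<Rightarrow> 'b) \<Rightarrow> bool"
  where "continuous_in X S u \<longleftrightarrow> (\<forall>t\<in>S. u t \<in> carr X) \<and>
     (\<forall>t\<in>S. ((\<lambda>s. nrm X (\<lambda>x. u s x - u t x)) \<longlongrightarrow> 0) (at t within S))"

text \<open>\<open>u \<in> C\<^sup>1(S; X)\<close> with derivative \<open>D\<close>.\<close>

definition C1_derivative_in ::
    "('x, 'b::real_normed_vector) fspace \<Rightarrow> real set \<Rightarrow> (real \<Rightarrow> 'x \<Rightarrow> 'b) \<Rightarrow> (real \<Rightarrow> 'x \<Rightarrow> 'b) \<Rightarrow> bool"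
  where "C1_derivative_in X S u D \<longleftrightarrow> continuous_in X S u \<and> continuous_in X S D \<and>
     (\<forall>t\<in>S. ((\<lambda>s. nrm X (\<lambda>x. (u s x - u t x) /\<^sub>R (s - t) - D t x)) \<longlongrightarrow> 0) (at t within S))"

definition holder_in ::
    "('x, 'b::real_normed_vector) fspace \<Rightarrow> real \<Rightarrow> real \<Rightarrow> (real \<Rightarrow> 'x \<Rightarrow> 'b) \<Rightarrow> bool"
  where "holder_in X \<alpha> T g \<longleftrightarrow> (\<forall>t\<in>{0..T}. g t \<in> carr X) \<and>
     bdd_above {nrm X (g t) | t. t \<in> {0..T}} \<and>
     bdd_above {nrm X (\<lambda>x. g t x - g s x) / \<bar>t - s\<bar> powr \<alpha> | s t. s \<in> {0..T} \<and> t \<in> {0..T} \<and> s \<noteq> t}"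

text \<open>Meaningful only for \<open>g\<close> satisfying \<^const>\<open>holder_in\<close> (otherwise a supremum may be of an unbounded set).\<close>

definition holder_norm ::
    "('x, 'b::real_normed_vector) fspace \<Rightarrow> real \<Rightarrow> real \<Rightarrow> (real \<Rightarrow> 'x \<Rightarrow> 'b) \<Rightarrow> real"
  where "holder_norm X \<alpha> T g =
     Sup {nrm X (g t) | t. t \<in> {0..T}} +
     Sup {nrm X (\<lambda>x. g t x - g s x) / \<bar>t - s\<bar> powr \<alpha> | s t. s \<in> {0..T} \<and> t \<in> {0..T} \<and> s \<noteq> t}"

text \<open>
  Bochner theory over a bounded time interval \<open>I\<close>. The library's Bochner integral needs the values in a
  Banach space type, so strong measurability and the integral are defined, in the same way as
  there, by approximation with simple functions. As \<open>I\<close> has finite measure, a simple function is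
  automatically integrable; its integral is taken pointwise.
\<close>

definition strongly_measurable_in ::
    "('x, 'b::real_normed_vector) fspace \<Rightarrow> real set \<Rightarrow> (real \<Rightarrow> 'x \<Rightarrow> 'b) \<Rightarrow> bool"
  where "strongly_measurable_in X I u \<longleftrightarrow>
     (\<exists>s. (\<forall>i. simple_function (lebesgue_on I) (s i) \<and> s i ` I \<subseteq> carr X) \<and>
          (AE t in lebesgue_on I. u t \<in> carr X \<and> (\<lambda>i::nat. nrm X (\<lambda>x. u t x - s i t x)) \<longlonglongrightarrow> 0))"

definition has_bochner_integral_in ::
    "('x, 'b::real_normed_vector) fspace \<Rightarrow> real set \<Rightarrow> (real \<Rightarrow> 'x \<Rightarrow> 'b) \<Rightarrow> ('x \<Rightarrow> 'b) \<Rightarrow> bool"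
  where "has_bochner_integral_in X I u y \<longleftrightarrow> strongly_measurable_in X I u \<and> y \<in> carr X \<and>
     (\<exists>s. (\<forall>i. simple_function (lebesgue_on I) (s i) \<and> s i ` I \<subseteq> carr X) \<and>
          (\<lambda>i::nat. \<integral>\<^sup>+t. ennreal (nrm X (\<lambda>x. u t x - s i t x)) \<partial>lebesgue_on I) \<longlonglongrightarrow> 0 \<and>
          (\<lambda>i. nrm X (\<lambda>x. Bochner_Integration.simple_bochner_integral (lebesgue_on I) (\<lambda>t. s i t x) - y x)) \<longlonglongrightarrow> 0)"

definition Lp_in ::
    "('x, 'b::real_normed_vector) fspace \<Rightarrow> real \<Rightarrow> real set \<Rightarrow> (real \<Rightarrow> 'x \<Rightarrow> 'b) \<Rightarrow> bool"
  where "Lp_in X p I u \<longleftrightarrow> strongly_measurable_in X I u \<and>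
     integrable (lebesgue_on I) (\<lambda>t. nrm X (u t) powr p)"

definition weak_derivative_in ::
    "('x, 'b::real_normed_vector) fspace \<Rightarrow> real set \<Rightarrow> (real \<Rightarrow> 'x \<Rightarrow> 'b) \<Rightarrow> (real \<Rightarrow> 'x \<Rightarrow> 'b) \<Rightarrow> bool"
  where "weak_derivative_in X I u g \<longleftrightarrow>
     (\<forall>\<phi> \<in> (test_functions I :: (real \<Rightarrow> real) set). \<exists>y.
        has_bochner_integral_in X I (\<lambda>t x. deriv \<phi> t *\<^sub>R u t x) y \<and>
        has_bochner_integral_in X I (\<lambda>t x. \<phi> t *\<^sub>R g t x) (\<lambda>x. - y x))"

definition W1p_in ::
    "('x, 'b::real_normed_vector) fspace \<Rightarrow> real \<Rightarrow> real set \<Rightarrow> (real \<Rightarrow> 'x \<Rightarrow> 'b) \<Rightarrow> bool"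
  where "W1p_in X p I u \<longleftrightarrow> Lp_in X p I u \<and> (\<exists>g. Lp_in X p I g \<and> weak_derivative_in X I u g)"


section \<open>The spaces over the domain\<close>

definition L2 :: "(real^'n) set \<Rightarrow> (real^'n, complex) fspace" where
  "L2 \<Omega> = \<lparr> carr = {f \<in> borel_measurable (lebesgue_on \<Omega>).
                       integrable (lebesgue_on \<Omega>) (\<lambda>x. (cmod (f x))\<^sup>2)},
            nrm = (\<lambda>f. sqrt (LINT x|lebesgue_on \<Omega>. (cmod (f x))\<^sup>2)) \<rparr>"

definition Linf :: "(real^'n^'n \<Rightarrow> real) \<Rightarrow> (real^'n) set \<Rightarrow> (real^'n, real^'n^'n) fspace" where
  "Linf \<nu> \<Omega> = \<lparr> carr = {G \<in> borel_measurable (lebesgue_on \<Omega>).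
                          esssup (lebesgue_on \<Omega>) (\<lambda>x. ereal (\<nu> (G x))) < \<infinity>},
                nrm = (\<lambda>G. real_of_ereal (esssup (lebesgue_on \<Omega>) (\<lambda>x. ereal (\<nu> (G x))))) \<rparr>"

definition is_weak_gradient ::
    "(real^'n) set \<Rightarrow> (real^'n \<Rightarrow> complex) \<Rightarrow> (real^'n \<Rightarrow> complex^'n) \<Rightarrow> bool"
  where "is_weak_gradient \<Omega> v g \<longleftrightarrow> (\<forall>i. (\<lambda>x. g x $ i) \<in> carr (L2 \<Omega>)) \<and>
     (\<forall>\<phi> \<in> (test_functions \<Omega> :: (real^'n \<Rightarrow> complex) set). \<forall>i.
        (LINT x|lebesgue_on \<Omega>. v x * frechet_derivative \<phi> (at x) (axis i 1)) =
        - (LINT x|lebesgue_on \<Omega>. g x $ i * \<phi> x))"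

text \<open>A weak gradient is unique only up to null sets; an arbitrary version is chosen.\<close>

definition weak_gradient :: "(real^'n) set \<Rightarrow> (real^'n \<Rightarrow> complex) \<Rightarrow> real^'n \<Rightarrow> complex^'n" where
  "weak_gradient \<Omega> v = (SOME g. is_weak_gradient \<Omega> v g)"

definition H1 :: "(real^'n) set \<Rightarrow> (real^'n, complex) fspace" where
  "H1 \<Omega> = \<lparr> carr = {v \<in> carr (L2 \<Omega>). \<exists>g. is_weak_gradient \<Omega> v g},
            nrm = (\<lambda>v. sqrt ((LINT x|lebesgue_on \<Omega>. (cmod (v x))\<^sup>2) +
                             (LINT x|lebesgue_on \<Omega>. (norm (weak_gradient \<Omega> v x))\<^sup>2))) \<rparr>"

definition H10 :: "(real^'n) set \<Rightarrow> (real^'n, complex) fspace" where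
  "H10 \<Omega> = \<lparr> carr = {v \<in> carr (H1 \<Omega>). \<exists>\<phi>. (\<forall>k::nat. \<phi> k \<in> test_functions \<Omega>) \<and>
                       (\<lambda>k. nrm (H1 \<Omega>) (\<lambda>x. v x - \<phi> k x)) \<longlonglongrightarrow> 0},
             nrm = nrm (H1 \<Omega>) \<rparr>"

text \<open>Bounded antilinear functionals; only their values on the carrier of \<open>X\<close> matter.\<close>

definition antidual :: "('x, complex) fspace \<Rightarrow> ('x \<Rightarrow> complex, complex) fspace" where
  "antidual X = \<lparr>
     carr = {l. (\<forall>v\<in>carr X. \<forall>w\<in>carr X. l (\<lambda>x. v x + w x) = l v + l w) \<and>
                (\<forall>c. \<forall>v\<in>carr X. l (\<lambda>x. c * v x) = cnj c * l v) \<and>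
                (\<exists>C. \<forall>v\<in>carr X. cmod (l v) \<le> C * nrm X v)},
     nrm = (\<lambda>l. Sup {cmod (l v) | v. v \<in> carr X \<and> nrm X v \<le> 1}) \<rparr>"

abbreviation Hm1 :: "(real^'n) set \<Rightarrow> (real^'n \<Rightarrow> complex, complex) fspace" where
  "Hm1 \<Omega> \<equiv> antidual (H10 \<Omega>)"

text \<open>The embedding \<open>H\<^sub>\<Omega> \<hookrightarrow> V\<^sub>\<Omega>'\<close> of the Gelfand triple.\<close>

definition embed_H :: "(real^'n) set \<Rightarrow> (real^'n \<Rightarrow> complex) \<Rightarrow> (real^'n \<Rightarrow> complex) \<Rightarrow> complex" where
  "embed_H \<Omega> h w = (LINT x|lebesgue_on \<Omega>. h x * cnj (w x))"

text \<open>\<open>\<ell> \<in> L\<^sup>2(0,1;H\<^sub>\<Omega>)\<close> for a \<open>V\<^sub>\<Omega>'\<close>-valued function \<open>\<ell>\<close>, via this embedding.\<close>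

definition in_L2_H :: "(real^'n) set \<Rightarrow> (real \<Rightarrow> (real^'n \<Rightarrow> complex) \<Rightarrow> complex) \<Rightarrow> bool" where
  "in_L2_H \<Omega> l \<longleftrightarrow> (\<exists>G. Lp_in (L2 \<Omega>) 2 {0<..<1} G \<and>
     (AE t in lebesgue_on {0<..<1}. \<forall>w\<in>carr (H10 \<Omega>). l t w = embed_H \<Omega> (G t) w))"


section \<open>The parabolic problem\<close>

definition isotropic :: "(real \<Rightarrow> real^'n \<Rightarrow> real) \<Rightarrow> real \<Rightarrow> real^'n \<Rightarrow> real^'n^'n" where
  "isotropic b t x = b t x *\<^sub>R mat 1"

definition uniformly_elliptic :: "(real^'n) set \<Rightarrow> (real \<Rightarrow> real^'n \<Rightarrow> real) \<Rightarrow> bool" where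
  "uniformly_elliptic \<Omega> b \<longleftrightarrow> (\<exists>c C. 0 < c \<and> c \<le> C \<and>
     (AE (t, x) in lebesgue_on ({0..1} \<times> \<Omega>). c \<le> b t x \<and> b t x \<le> C))"

text \<open>\<open>-div(A \<nabla>v)\<close> as an element of \<open>V\<^sub>\<Omega>'\<close>.\<close>

definition neg_div :: "(real^'n) set \<Rightarrow> (real^'n \<Rightarrow> real^'n^'n) \<Rightarrow> (real^'n \<Rightarrow> complex) \<Rightarrow>
    (real^'n \<Rightarrow> complex) \<Rightarrow> complex" where
  "neg_div \<Omega> A v w = (LINT x|lebesgue_on \<Omega>.
     (\<Sum>i\<in>UNIV. (\<Sum>j\<in>UNIV. complex_of_real (A x $ i $ j) * weak_gradient \<Omega> v x $ j) *
        cnj (weak_gradient \<Omega> w x $ i)))"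

text \<open>
  Lions variational solution on \<open>(0,1)\<close> with zero initial value, for \<open>F \<in> L\<^sup>2(0,1;V\<^sub>\<Omega>')\<close>. As \<open>U\<close> is
  determined only up to null sets in time, the initial value is that of the representative in
  \<open>C([0,1];H\<^sub>\<Omega>)\<close>.
\<close>

definition lions_solution :: "(real^'n) set \<Rightarrow> (real \<Rightarrow> real^'n \<Rightarrow> real^'n^'n) \<Rightarrow>
    (real \<Rightarrow> (real^'n \<Rightarrow> complex) \<Rightarrow> complex) \<Rightarrow> (real \<Rightarrow> real^'n \<Rightarrow> complex) \<Rightarrow> bool" where
  "lions_solution \<Omega> B F U \<longleftrightarrow>
     Lp_in (H10 \<Omega>) 2 {0<..<1} U \<and>
     (\<exists>D. Lp_in (Hm1 \<Omega>) 2 {0<..<1} D \<and>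
          weak_derivative_in (Hm1 \<Omega>) {0<..<1} (\<lambda>t. embed_H \<Omega> (U t)) D \<and>
          (AE t in lebesgue_on {0<..<1}. \<forall>w\<in>carr (H10 \<Omega>).
             D t w + neg_div \<Omega> (B t) (U t) w = F t w)) \<and>
     (\<exists>W. continuous_in (L2 \<Omega>) {0..1} W \<and>
          (AE t in lebesgue_on {0<..<1}. nrm (L2 \<Omega>) (\<lambda>x. U t x - W t x) = 0) \<and>
          nrm (L2 \<Omega>) (W 0) = 0)"

definition unique_lions_solution :: "(real^'n) set \<Rightarrow> (real \<Rightarrow> real^'n \<Rightarrow> real^'n^'n) \<Rightarrow>
    (real \<Rightarrow> (real^'n \<Rightarrow> complex) \<Rightarrow> complex) \<Rightarrow> (real \<Rightarrow> real^'n \<Rightarrow> complex) \<Rightarrow> bool" where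
  "unique_lions_solution \<Omega> B F U \<longleftrightarrow> lions_solution \<Omega> B F U \<and>
     (\<forall>W. lions_solution \<Omega> B F W \<longrightarrow>
        (AE t in lebesgue_on {0<..<1}. nrm (H10 \<Omega>) (\<lambda>x. W t x - U t x) = 0))"

definition maximal_L2_regularity :: "(real^'n) set \<Rightarrow> (real \<Rightarrow> real^'n \<Rightarrow> real^'n^'n) \<Rightarrow> bool" where
  "maximal_L2_regularity \<Omega> B \<longleftrightarrow>
     (\<forall>F U D. Lp_in (L2 \<Omega>) 2 {0<..<1} F \<and> lions_solution \<Omega> B (\<lambda>t. embed_H \<Omega> (F t)) U \<and>
        Lp_in (Hm1 \<Omega>) 2 {0<..<1} D \<and>
        weak_derivative_in (Hm1 \<Omega>) {0<..<1} (\<lambda>t. embed_H \<Omega> (U t)) D \<longrightarrow> in_L2_H \<Omega> D)"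

definition real_valued :: "(real^'n) set \<Rightarrow> (real \<Rightarrow> real^'n \<Rightarrow> complex) \<Rightarrow> bool" where
  "real_valued \<Omega> u \<longleftrightarrow> (\<forall>t\<in>{0..1}. AE x in lebesgue_on \<Omega>. u t x \<in> \<real>)"

end

theory Submission imports Defs "HOL-Computational_Algebra.Polynomial" begin

text \<open>
The solution is written down first, and the coefficient is fitted to it. Let \<open>y\<close> be one coordinate,
\<open>theta\<close> a cutoff function in a small cube which does not depend on \<open>y\<close> near its centre, and
\<open>u = t theta (y + phi_y)\<close> for a small potential \<open>phi(t, y)\<close> supported near the centre. As the
\<open>y\<close>-derivative of \<open>y + phi_y\<close> is \<open>1 + phi_yy\<close>, the coefficient
\<open>b = (1 + phi_t) / (1 + phi_yy)\<close> turns the flux into \<open>1 + phi_t\<close>, and the divergence of this flux is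
\<open>phi_ty\<close>, which is exactly the oscillating part of the time derivative of \<open>u\<close>. So this part cancels
in the equation, and the force remains continuous in \<open>L2\<close> however large \<open>phi_ty\<close> is
(\<open>coef_pd_u\<close>, \<open>divergence_flux\<close>, \<open>equation\<close>).

The potential is a lacunary sum of terms \<open>N_j^-3 a_j(t) hat(y) cos (N_j y)\<close>, where \<open>a_j\<close> is the
square of a sine of frequency \<open>N_j^2\<close>, switched on in a time window at distance about \<open>1/j\<close> from
the final time \<open>1\<close>. In \<open>phi_t\<close> and \<open>phi_yy\<close> the \<open>j\<close>-th term has size \<open>1/N_j\<close> and varies in time at
rate \<open>N_j^2\<close>, so the coefficient is Hoelder continuous in time with the exponent \<open>1/2\<close> and no better one
(\<open>lacunary_sum\<close>, \<open>coef_holder\<close>, \<open>coef_not_holder\<close>), and a small factor \<open>kappa\<close> in front of the sum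
makes \<open>b\<close> as close to \<open>1\<close> as desired. In \<open>phi_ty\<close> the terms have size one. They are almost
orthogonal in space (\<open>gram_off_diagonal\<close>, \<open>gram_diagonal_ge\<close>), so the square of the \<open>L2\<close> norm of the time
derivative has an integral over \<open>(0,1)\<close> comparable with the sum of the lengths of the windows, a
harmonic series (\<open>U'_not_square_integrable\<close>). At time \<open>t\<close> at most \<open>O(1/(1 - t))\<close> windows are open, and the
norm itself is \<open>O(1/sqrt (1 - t))\<close>, which is integrable (\<open>U'_Lp_1\<close>). In \<open>H^-1\<close> only the size of \<open>phi_t\<close>
counts, because \<open>phi_ty\<close> is its derivative; hence \<open>u\<close> is continuously differentiable there up to the
final time (\<open>U_C1\<close>).

That \<open>u\<close> is the only variational solution is the energy estimate for a bounded measurable coercive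
coefficient (\<open>lions_solution_unique\<close>). The pairing of a solution with its own derivative is reached through
increments: the increment of the squared norm over a short time interval is the integral of the
derivative, paired with the sum of the values at the end points, and in the mean these values are close to
the values in between.
\<close>

section \<open>Smooth functions\<close>

abbreviation "cr \<equiv> complex_of_real"

definition smooth :: "('a::euclidean_space => 'b::real_normed_vector) => bool" where
 "smooth f \<longleftrightarrow> (\<forall>k. Ck k f)"

lemma Ck_continuous: "Ck k f ==> continuous_on UNIV f"
 by (cases k) (auto simp: differentiable_imp_continuous_on)

lemma Ck_SucI:
 assumes "!!x. (f has_derivative D x) (at x)" and "!!e. e \<in> Basis ==> Ck k (%x. D x e)"
 shows "Ck (Suc k) f"
proof -
 have "frechet_derivative f (at x) = D x" for x
  using frechet_derivative_at[OF assms(1)[of x]] by simp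
 then show ?thesis
  using assms by (auto simp: differentiable_on_def differentiable_def)
qed

lemma Ck_Suc_has_derivative:
 "Ck (Suc k) f ==> (f has_derivative frechet_derivative f (at x)) (at x)"
 by (simp add: differentiable_on_def frechet_derivative_works)

lemma Ck_SucD: "Ck (Suc k) f ==> Ck k f"
proof (induction k arbitrary: f)
 case 0
 then show ?case by (auto simp: differentiable_imp_continuous_on)
next
 case (Suc k)
 show ?case
  using Suc.prems Suc.IH unfolding Ck.simps(2)[of "Suc k"] Ck.simps(2)[of k] by blast
qed

lemma Ck_const: "Ck k (%x. c)"
proof (induction k arbitrary: c)
 case (Suc k)
 show ?case by (rule Ck_SucI[where D="%_ _. 0"]) (auto simp: Suc)
qed auto

lemma Ck_add: "Ck k f ==> Ck k g ==> Ck k (%x. f x + g x)"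
proof (induction k arbitrary: f g)
 case 0 then show ?case by (auto intro: continuous_intros)
next
 case (Suc k)
 show ?case
  by (rule Ck_SucI[OF has_derivative_add[OF Ck_Suc_has_derivative Ck_Suc_has_derivative]])
   (use Suc in auto)
qed

lemma Ck_mult:
 fixes f g :: "'a::euclidean_space => 'b::real_normed_algebra"
 shows "Ck k f ==> Ck k g ==> Ck k (%x. f x * g x)"
proof (induction k arbitrary: f g)
 case 0 then show ?case by (auto intro: continuous_intros)
next
 case (Suc k)
 show ?case
 proof (rule Ck_SucI[OF has_derivative_mult[OF Ck_Suc_has_derivative Ck_Suc_has_derivative]])
  show "Ck (Suc k) f" "Ck (Suc k) g" using Suc by auto
  fix e :: 'a assume "e \<in> Basis"
  then show "Ck k (%x. f x * frechet_derivative g (at x) e + frechet_derivative f (at x) e * g x)"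
   using Suc.prems Ck_SucD[OF Suc.prems(1)] Ck_SucD[OF Suc.prems(2)]
   by (intro Ck_add Suc.IH) auto
 qed
qed

lemma Ck_bounded_linear: "bounded_linear L ==> Ck k f ==> Ck k (%x. L (f x))"
proof (induction k arbitrary: f)
 case 0 then show ?case
  by (auto intro: continuous_on_compose2[OF bounded_linear.continuous_on[OF _ continuous_on_id]])
next
 case (Suc k)
 show ?case
  by (rule Ck_SucI[OF bounded_linear.has_derivative[OF Suc.prems(1) Ck_Suc_has_derivative]])
   (use Suc in auto)
qed

lemma Ck_inverse:
 fixes f :: "'a::euclidean_space => real"
 assumes "!!x. f x ~= 0"
 shows "Ck k f ==> Ck k (%x. inverse (f x))"
proof (induction k)
 case 0 then show ?case using assms by (auto intro: continuous_intros)
next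
 case (Suc k)
 show ?case
 proof (rule Ck_SucI[OF Deriv.has_derivative_inverse[OF assms Ck_Suc_has_derivative[OF Suc.prems]]])
  fix e :: 'a assume e: "e \<in> Basis"
  have "Ck k (%x. (-1) * (inverse (f x) * frechet_derivative f (at x) e * inverse (f x)))"
   using Suc e Ck_SucD[OF Suc.prems] by (intro Ck_mult Ck_const) auto
  then show "Ck k (%x. - (inverse (f x) * frechet_derivative f (at x) e * inverse (f x)))"
   by simp
 qed
qed

lemma Ck_compose_affine:
 fixes g :: "real => 'b::real_normed_vector" and L :: "'a::euclidean_space => real"
 assumes L: "bounded_linear L"
 shows "Ck k g ==> Ck k (%x. g (L x + c))"
proof (induction k arbitrary: g)
 case 0
 have "continuous_on UNIV (%x. L x + c)"
  by (intro continuous_on_add linear_continuous_on L continuous_on_const)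
 then show ?case using 0 by (auto intro: continuous_on_compose2)
next
 case (Suc k)
 show ?case
 proof (rule Ck_SucI)
  fix x
  have "((%x. L x + c) has_derivative L) (at x)"
   using has_derivative_add[OF bounded_linear_imp_has_derivative[OF L] has_derivative_const] by simp
  from has_derivative_compose[OF this Ck_Suc_has_derivative[OF Suc.prems]]
  show "((%x. g (L x + c)) has_derivative (%e. frechet_derivative g (at (L x + c)) (L e))) (at x)" .
 next
  fix e :: 'a assume "e \<in> Basis"
  have lin: "frechet_derivative g (at z) (L e) = L e *\<^sub>R frechet_derivative g (at z) 1" for z
  proof -
   have "linear (frechet_derivative g (at z))"
    using has_derivative_linear[OF Ck_Suc_has_derivative[OF Suc.prems]] .
   from linear_scale[OF this, of "L e" 1] show ?thesis by simp
  qed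
  have "Ck k (%x. frechet_derivative g (at (L x + c)) 1)"
   using Suc.prems by (intro Suc.IH) auto
  then show "Ck k (%x. frechet_derivative g (at (L x + c)) (L e))"
   unfolding lin by (rule Ck_bounded_linear[OF bounded_linear_scaleR_right])
 qed
qed

lemma smooth_const: "smooth (%x. c)"
 and smooth_add: "smooth f ==> smooth g ==> smooth (%x. f x + g x)"
 and smooth_bounded_linear: "bounded_linear L ==> smooth f ==> smooth (%x. L (f x))"
 by (auto simp: smooth_def Ck_const Ck_add Ck_bounded_linear)

lemma smooth_mult:
 fixes f g :: "'a::euclidean_space => 'b::real_normed_algebra"
 shows "smooth f ==> smooth g ==> smooth (%x. f x * g x)"
 by (auto simp: smooth_def Ck_mult)

lemma smooth_uminus: "smooth f ==> smooth (%x. - f x)"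
 using smooth_bounded_linear[OF bounded_linear_minus[OF bounded_linear_ident]] .

lemma smooth_diff: "smooth f ==> smooth g ==> smooth (%x. f x - g x)"
 using smooth_add[OF _ smooth_uminus, of f g] by simp

lemma smooth_inverse:
 fixes f :: "'a::euclidean_space => real"
 shows "(!!x. f x ~= 0) ==> smooth f ==> smooth (%x. inverse (f x))"
 by (auto simp: smooth_def Ck_inverse)

lemma smooth_divide:
 fixes f g :: "'a::euclidean_space => real"
 shows "smooth f ==> smooth g ==> (!!x. g x ~= 0) ==> smooth (%x. f x / g x)"
 unfolding divide_inverse by (intro smooth_mult smooth_inverse)

lemma smooth_sum: "(!!i. i \<in> I ==> smooth (f i)) ==> smooth (%x. \<Sum>i\<in>I. f i x)"
 by (induction I rule: infinite_finite_induct) (auto intro: smooth_const smooth_add)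

lemma smooth_prod:
 fixes f :: "'i => 'a::euclidean_space => 'b::real_normed_field"
 shows "(!!i. i \<in> I ==> smooth (f i)) ==> smooth (%x. \<Prod>i\<in>I. f i x)"
 by (induction I rule: infinite_finite_induct) (auto intro: smooth_const smooth_mult)

lemma smooth_of_real: "smooth f ==> smooth (%x. of_real (f x) :: complex)"
 using smooth_bounded_linear[OF bounded_linear_of_real] .

lemma smooth_compose_affine:
 fixes g :: "real => 'b::real_normed_vector"
 shows "bounded_linear L ==> smooth g ==> smooth (%x. g (L x + c))"
 by (auto simp: smooth_def Ck_compose_affine)

lemma smooth_compose_coord:
 fixes g :: "real => 'b::real_normed_vector"
 shows "smooth g ==> smooth (%x::real^'n. g (x $ i - c))"
 using smooth_compose_affine[OF bounded_linear_vec_nth, of g i "-c"] by simp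

lemma smooth_compose_scale:
 fixes g :: "real => 'b::real_normed_vector"
 shows "smooth g ==> smooth (%x. g (a * x + c))"
 by (rule smooth_compose_affine[OF bounded_linear_mult_right])

lemma smooth_continuous: "smooth f ==> continuous_on A f"
 unfolding smooth_def using Ck_continuous continuous_on_subset by blast

lemma smooth_has_derivative: "smooth f ==> (f has_derivative frechet_derivative f (at x)) (at x)"
 unfolding smooth_def using Ck_Suc_has_derivative by blast

lemma smooth_frechet_derivative:
 "smooth f ==> e \<in> Basis ==> smooth (%x. frechet_derivative f (at x) e)"
 unfolding smooth_def using Ck.simps(2) by blast

lemma smooth_has_real_derivative:
 fixes g :: "real => real"
 assumes "smooth g" shows "(g has_real_derivative deriv g x) (at x)"
 using smooth_has_derivative[OF assms, of x]
 by (auto simp: DERIV_deriv_iff_real_differentiable differentiable_def)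

lemma smooth_deriv:
 fixes g :: "real => real"
 assumes "smooth g" shows "smooth (deriv g)"
proof -
 have "frechet_derivative g (at x) 1 = deriv g x" for x
  by (subst frechet_derivative_at[symmetric,
     OF smooth_has_real_derivative[OF assms, THEN has_field_derivative_imp_has_derivative]]) simp
 then show ?thesis using smooth_frechet_derivative[OF assms, of 1] by simp
qed

text \<open>This gives smoothness without computing higher derivatives: the derivatives of \<open>cos\<close> and of
\<open>flat\<close> stay in an explicit family.\<close>

lemma smooth_chain:
 fixes G :: "nat => real => real"
 assumes "!!n x. (G n has_real_derivative G (Suc n) x) (at x)"
 shows "smooth (G n)"
proof -
 have "Ck k (G n)" for k
 proof (induction k arbitrary: n)
  case 0
  then show ?case by (auto simp: continuous_on_eq_continuous_at intro!: DERIV_isCont[OF assms])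
 next
  case (Suc k)
  show ?case
   by (rule Ck_SucI[OF assms[THEN has_field_derivative_imp_has_derivative]]) (use Suc in auto)
 qed
 then show ?thesis by (simp add: smooth_def)
qed

lemma smooth_cos: "smooth (cos :: real => real)"
proof -
 have "((%x. cos (x + real n * (pi/2))) has_real_derivative cos (x + real (Suc n) * (pi/2))) (at x)" for n x
 proof -
  have "cos (x + real (Suc n) * (pi/2)) = cos ((x + real n * (pi/2)) + pi/2)"
   by (simp add: algebra_simps add_divide_distrib)
  also have "\<dots> = - sin (x + real n * (pi/2))" by (simp add: cos_add)
  finally have eq: "cos (x + real (Suc n) * (pi/2)) = - sin (x + real n * (pi/2))" .
  show ?thesis unfolding eq by (auto intro!: derivative_eq_intros)
 qed
 from smooth_chain[where G="%n x. cos (x + real n * (pi/2))" and n=0, OF this] show ?thesis by simp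
qed

text \<open>The family of functions \<open>P(1/x) exp (-1/x)\<close>, continued by zero, is closed under differentiation.\<close>

definition flat :: "real poly => real => real" where
 "flat P x = (if x <= 0 then 0 else poly P (inverse x) * exp (- inverse x))"

lemma poly_div_exp_tendsto_0: "((%z. poly P z / exp z) \<longlongrightarrow> (0::real)) at_top"
proof -
 have "((%z. \<Sum>i\<le>degree P. coeff P i * (z ^ i / exp z)) \<longlongrightarrow> (\<Sum>i\<le>degree P. coeff P i * 0)) at_top"
  by (intro tendsto_intros tendsto_power_div_exp_0)
 then show ?thesis by (simp add: poly_altdef sum_divide_distrib)
qed

lemma flat_has_derivative:
 "(flat P has_real_derivative flat (monom 1 2 * (P - pderiv P)) x) (at x)"
proof (cases x "0::real" rule: linorder_cases)
 case less
 have "eventually (%y. y < 0) (nhds x)" using less using eventually_nhds_in_open[of "{..<0}" x] by simp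
 then have "eventually (%y. 0 = flat P y) (nhds x)" by eventually_elim (auto simp: flat_def)
 moreover have "((%y. 0) has_real_derivative 0) (at x)" by simp
 ultimately have "(flat P has_real_derivative 0) (at x)"
  using DERIV_cong_ev[OF refl, of "%y. 0" "flat P" x 0 0] by simp
 then show ?thesis using less by (simp add: flat_def)
next
 case greater
 have "eventually (%y. 0 < y) (nhds x)" using greater using eventually_nhds_in_open[of "{0<..}" x] by simp
 then have ev: "eventually (%y. poly P (inverse y) * exp (- inverse y) = flat P y) (nhds x)"
  by eventually_elim (auto simp: flat_def)
 have "((%y. poly P (inverse y) * exp (- inverse y)) has_real_derivative
   flat (monom 1 2 * (P - pderiv P)) x) (at x)"
  using greater by (auto intro!: derivative_eq_intros poly_DERIV[THEN DERIV_chain2]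
   simp: flat_def poly_monom field_simps power2_eq_square)
 then show ?thesis using DERIV_cong_ev[OF refl ev refl] by simp
next
 case equal
 have "((%y. flat P y / y) \<longlongrightarrow> 0) (at_right 0)"
 proof -
  have "((%z. poly (pCons 0 P) z / exp z) \<longlongrightarrow> 0) at_top" by (rule poly_div_exp_tendsto_0)
  then have "((%y. poly (pCons 0 P) (inverse y) / exp (inverse y)) \<longlongrightarrow> 0) (at_right 0)"
   by (rule filterlim_compose[OF _ filterlim_inverse_at_top_right])
  moreover have "eventually (%y. poly (pCons 0 P) (inverse y) / exp (inverse y) = flat P y / y) (at_right 0)"
   by (rule eventually_at_right_less[THEN eventually_mono]) (auto simp: flat_def exp_minus field_simps)
  ultimately show ?thesis by (rule Lim_transform_eventually)
 qed
 moreover have "((%y. flat P y / y) \<longlongrightarrow> 0) (at_left 0)"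
  by (rule tendsto_eventually, rule eventually_at_left_real[of "-1", THEN eventually_mono]) (auto simp: flat_def)
 ultimately have "((%y. flat P y / y) \<longlongrightarrow> 0) (at 0)" by (simp add: filterlim_split_at)
 then show ?thesis using equal by (simp add: has_field_derivative_iff flat_def)
qed

lemma smooth_flat: "smooth (flat P)"
proof -
 have "smooth (flat (((%P. monom 1 2 * (P - pderiv P)) ^^ n) P))" for n
  by (rule smooth_chain[where G="%n. flat (((%P. monom 1 2 * (P - pderiv P)) ^^ n) P)"])
   (use flat_has_derivative in simp)
 from this[of 0] show ?thesis by simp
qed

text \<open>A smooth step from \<open>0\<close> to \<open>1\<close> on the unit interval.\<close>

definition step :: "real => real" where
 "step x = flat 1 x / (flat 1 x + flat 1 (1 - x))"

lemma flat_1: "flat 1 x = (if x <= 0 then 0 else exp (- inverse x))"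
 by (simp add: flat_def)

lemma step_denominator_pos: "0 < flat 1 x + flat 1 (1 - x)"
 by (auto simp: flat_1 add_pos_pos)

lemma smooth_step: "smooth step"
proof -
 have "smooth (%x. flat 1 (1 - x))"
  using smooth_compose_scale[OF smooth_flat, of 1 "-1" 1] by (simp add: algebra_simps)
 then show ?thesis
  unfolding step_def[abs_def] using step_denominator_pos
  by (intro smooth_divide smooth_add smooth_flat) (auto simp: less_le)
qed

lemma step_eq_0: "x <= 0 ==> step x = 0"
 and step_eq_1: "1 <= x ==> step x = 1"
 and step_nonneg: "0 <= step x"
 and step_le_1: "step x <= 1"
 using step_denominator_pos[of x] by (auto simp: step_def flat_1 field_simps)

section \<open>Square-integrable functions\<close>

definition sqint :: "'a measure => ('a => 'b::{banach, second_countable_topology}) => bool" where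
 "sqint M f \<longleftrightarrow> f \<in> borel_measurable M \<and> integrable M (%x. (norm (f x))\<^sup>2)"

definition l2norm :: "'a measure => ('a => 'b::{banach, second_countable_topology}) => real" where
 "l2norm M f = sqrt (LINT x|M. (norm (f x))\<^sup>2)"

lemma l2norm_nonneg: "0 <= l2norm M f"
 by (simp add: l2norm_def)

lemma l2norm_sq: "(l2norm M f)\<^sup>2 = (LINT x|M. (norm (f x))\<^sup>2)"
 by (simp add: l2norm_def)

lemma sqint_product:
 assumes "sqint M f" "sqint M g"
 shows "integrable M (%x. norm (f x) * norm (g x))"
proof (rule Bochner_Integration.integrable_bound)
 show "integrable M (%x. (norm (f x))\<^sup>2 + (norm (g x))\<^sup>2)"
  using assms by (auto simp: sqint_def)
 show "(%x. norm (f x) * norm (g x)) \<in> borel_measurable M"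
  using assms by (auto simp: sqint_def)
 show "AE x in M. norm (norm (f x) * norm (g x)) <= norm ((norm (f x))\<^sup>2 + (norm (g x))\<^sup>2)"
 proof (intro AE_I2)
  fix x
  have "2 * (norm (f x) * norm (g x)) <= (norm (f x))\<^sup>2 + (norm (g x))\<^sup>2"
   using sum_squares_bound[of "norm (f x)" "norm (g x)"] by simp
  moreover have "0 <= norm (f x) * norm (g x)" by simp
  ultimately show "norm (norm (f x) * norm (g x)) <= norm ((norm (f x))\<^sup>2 + (norm (g x))\<^sup>2)"
   unfolding real_norm_def by linarith
 qed
qed

lemma integral_product_le:
 assumes f: "sqint M f" and g: "sqint M g"
 shows "(LINT x|M. norm (f x) * norm (g x)) <= l2norm M f * l2norm M g"
proof -
 define A B P where "A = (LINT x|M. (norm (f x))\<^sup>2)" and "B = (LINT x|M. (norm (g x))\<^sup>2)"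
  and "P = (LINT x|M. norm (f x) * norm (g x))"
 have int: "integrable M (%x. (norm (f x))\<^sup>2)" "integrable M (%x. (norm (g x))\<^sup>2)"
  "integrable M (%x. norm (f x) * norm (g x))"
  using f g sqint_product[OF f g] by (auto simp: sqint_def)
 have AB: "0 <= A" "0 <= B" by (auto simp: A_def B_def)
 have quad: "0 <= s\<^sup>2 * A + 2 * s * P + B" for s
 proof -
  have "0 <= (LINT x|M. (s * norm (f x) + norm (g x))\<^sup>2)" by simp
  also have "\<dots> = (LINT x|M. s\<^sup>2 * (norm (f x))\<^sup>2 + 2 * s * (norm (f x) * norm (g x)) + (norm (g x))\<^sup>2)"
   by (rule Bochner_Integration.integral_cong) (auto simp: power2_eq_square algebra_simps)
  also have "\<dots> = s\<^sup>2 * A + 2 * s * P + B"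
   using int by (simp add: A_def B_def P_def)
  finally show ?thesis .
 qed
 have "P\<^sup>2 <= A * B"
 proof (cases "A = 0")
  case True
  have "P = 0"
  proof (rule ccontr)
   assume "P ~= 0"
   then have "2 * (- (B + 1) / (2 * P)) * P = - (B + 1)" by simp
   then show False using quad[of "- (B + 1) / (2 * P)"] True by simp
  qed
  then show ?thesis using True by simp
 next
  case False
  then have A: "0 < A" using AB by simp
  have "(- P / A)\<^sup>2 * A + 2 * (- P / A) * P + B = B - P\<^sup>2 / A"
   using A by (simp add: power2_eq_square field_simps)
  then have "P\<^sup>2 / A <= B" using quad[of "- P / A"] by simp
  then show ?thesis using A by (simp add: field_simps)
 qed
 then have "\<bar>P\<bar> <= sqrt (A * B)" by (simp add: real_le_rsqrt)
 then show ?thesis by (simp add: l2norm_def A_def B_def P_def real_sqrt_mult)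
qed

lemma sqint_add_l2norm_triangle:
 assumes f: "sqint M f" and g: "sqint M g"
 shows "sqint M (%x. f x + g x)" and "l2norm M (%x. f x + g x) <= l2norm M f + l2norm M g"
proof -
 have int: "integrable M (%x. (norm (f x))\<^sup>2)" "integrable M (%x. (norm (g x))\<^sup>2)"
  "integrable M (%x. norm (f x) * norm (g x))"
  using f g sqint_product[OF f g] by (auto simp: sqint_def)
 have bnd: "(norm (f x + g x))\<^sup>2 <= (norm (f x))\<^sup>2 + 2 * (norm (f x) * norm (g x)) + (norm (g x))\<^sup>2" for x
  using power_mono[OF norm_triangle_ineq[of "f x" "g x"], of 2] by (simp add: power2_sum)
 have int3: "integrable M (%x. (norm (f x))\<^sup>2 + 2 * (norm (f x) * norm (g x)) + (norm (g x))\<^sup>2)"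
  using int by simp
 have int4: "integrable M (%x. (norm (f x + g x))\<^sup>2)"
  by (rule Bochner_Integration.integrable_bound[OF int3])
   (use f g bnd in \<open>auto simp: sqint_def intro!: AE_I2 order_trans[OF bnd]\<close>)
 then show "sqint M (%x. f x + g x)" using f g by (auto simp: sqint_def)
 have "(LINT x|M. (norm (f x + g x))\<^sup>2)
   <= (LINT x|M. (norm (f x))\<^sup>2 + 2 * (norm (f x) * norm (g x)) + (norm (g x))\<^sup>2)"
  by (rule integral_mono[OF int4 int3 bnd])
 also have "\<dots> = (l2norm M f)\<^sup>2 + 2 * (LINT x|M. norm (f x) * norm (g x)) + (l2norm M g)\<^sup>2"
  using int by (simp add: l2norm_sq)
 also have "\<dots> <= (l2norm M f + l2norm M g)\<^sup>2"
  using integral_product_le[OF f g] by (simp add: power2_sum)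
 finally show "l2norm M (%x. f x + g x) <= l2norm M f + l2norm M g"
  unfolding l2norm_def[of M "%x. f x + g x"]
  by (intro real_le_lsqrt) (auto intro: add_nonneg_nonneg l2norm_nonneg)
qed

lemma l2norm_cong_AE:
 assumes "f \<in> borel_measurable M" "g \<in> borel_measurable M" "AE x in M. f x = g x"
 shows "l2norm M f = l2norm M g"
 unfolding l2norm_def using assms by (intro arg_cong[where f=sqrt] integral_cong_AE) auto

lemma l2norm_mono:
 assumes "sqint M g" "f \<in> borel_measurable M" "AE x in M. norm (f x) <= norm (g x)"
 shows "sqint M f" "l2norm M f <= l2norm M g"
proof -
 have *: "AE x in M. (norm (f x))\<^sup>2 <= (norm (g x))\<^sup>2"
  using assms(3) by eventually_elim (simp add: power_mono)
 have "integrable M (%x. (norm (f x))\<^sup>2)"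
  by (rule Bochner_Integration.integrable_bound[where f="%x. (norm (g x))\<^sup>2"]) (use assms * in \<open>auto simp: sqint_def\<close>)
 then show "sqint M f" using assms by (simp add: sqint_def)
 then show "l2norm M f <= l2norm M g"
  unfolding l2norm_def using assms * by (intro real_sqrt_le_mono integral_mono_AE) (auto simp: sqint_def)
qed

lemma l2norm_eq_0_iff:
 assumes "sqint M f" shows "l2norm M f = 0 \<longleftrightarrow> (AE x in M. f x = 0)"
 using integral_nonneg_eq_0_iff_AE[of M "%x. (norm (f x))\<^sup>2"] assms
 by (simp add: l2norm_def sqint_def)

lemma l2norm_cmult:
 fixes f :: "'a => complex"
 shows "sqint M f ==> sqint M (%x. c * f x)" "l2norm M (%x. c * f x) = cmod c * l2norm M f"
 by (auto simp: sqint_def l2norm_def norm_mult power_mult_distrib real_sqrt_mult)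

section \<open>Seminormed spaces of representatives\<close>

text \<open>The common properties of the spaces of representatives: functions that agree almost everywhere are
kept apart, so the norm is only a seminorm.\<close>

definition seminormed :: "('x, complex) fspace => bool" where
 "seminormed X \<longleftrightarrow> (%x. 0) \<in> carr X \<and>
   (\<forall>u\<in>carr X. \<forall>v\<in>carr X. (%x. u x + v x) \<in> carr X \<and> nrm X (%x. u x + v x) <= nrm X u + nrm X v) \<and>
   (\<forall>c. \<forall>u\<in>carr X. (%x. c * u x) \<in> carr X \<and> nrm X (%x. c * u x) = cmod c * nrm X u) \<and>
   (\<forall>u\<in>carr X. 0 <= nrm X u)"

lemma antidualI:
 assumes "!!v w. v \<in> carr X ==> w \<in> carr X ==> l (%x. v x + w x) = l v + l w"
  and "!!c v. v \<in> carr X ==> l (%x. c * v x) = cnj c * l v"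
  and "!!v. v \<in> carr X ==> cmod (l v) <= C * nrm X v"
 shows "l \<in> carr (antidual X)"
 using assms unfolding antidual_def fspace.simps by blast

lemma antidual_add: "l \<in> carr (antidual X) ==> v \<in> carr X ==> w \<in> carr X ==> l (%x. v x + w x) = l v + l w"
 and antidual_cmult: "l \<in> carr (antidual X) ==> v \<in> carr X ==> l (%x. c * v x) = cnj c * l v"
 by (auto simp: antidual_def)

context
 fixes X :: "('x, complex) fspace" assumes X: "seminormed X"
begin

lemma carr_zero: "(%x. 0) \<in> carr X"
 and carr_add: "u \<in> carr X ==> v \<in> carr X ==> (%x. u x + v x) \<in> carr X"
 and nrm_triangle: "u \<in> carr X ==> v \<in> carr X ==> nrm X (%x. u x + v x) <= nrm X u + nrm X v"
 and carr_cmult: "u \<in> carr X ==> (%x. c * u x) \<in> carr X"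
 and nrm_cmult: "u \<in> carr X ==> nrm X (%x. c * u x) = cmod c * nrm X u"
 and nrm_nonneg: "u \<in> carr X ==> 0 <= nrm X u"
 using X unfolding seminormed_def by blast+

lemma nrm_zero: "nrm X (%x. 0) = 0"
 using nrm_cmult[OF carr_zero, of 0] by simp

lemma carr_scaleR: "u \<in> carr X ==> (%x. r *\<^sub>R u x) \<in> carr X"
 using carr_cmult[of u "of_real r"] by (simp add: scaleR_conv_of_real)

lemma nrm_scaleR: "u \<in> carr X ==> nrm X (%x. r *\<^sub>R u x) = \<bar>r\<bar> * nrm X u"
 using nrm_cmult[of u "of_real r"] by (simp add: scaleR_conv_of_real)

lemma carr_minus: "u \<in> carr X ==> (%x. - u x) \<in> carr X"
 using carr_cmult[of u "-1"] by simp

lemma nrm_minus: "u \<in> carr X ==> nrm X (%x. - u x) = nrm X u"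
 using nrm_cmult[of u "-1"] by simp

lemma carr_diff: "u \<in> carr X ==> v \<in> carr X ==> (%x. u x - v x) \<in> carr X"
 using carr_add[OF _ carr_minus, of u v] by simp

lemma nrm_diff_le: "u \<in> carr X ==> v \<in> carr X ==> nrm X (%x. u x - v x) <= nrm X u + nrm X v"
 using nrm_triangle[OF _ carr_minus, of u v] nrm_minus[of v] by simp

lemma nrm_diff_commute: "u \<in> carr X ==> v \<in> carr X ==> nrm X (%x. u x - v x) = nrm X (%x. v x - u x)"
 using nrm_minus[OF carr_diff, of u v] by simp

lemma nrm_triangle_sub:
 assumes "u \<in> carr X" "v \<in> carr X" "w \<in> carr X"
 shows "nrm X (%x. u x - w x) <= nrm X (%x. u x - v x) + nrm X (%x. v x - w x)"
 using nrm_triangle[OF carr_diff[OF assms(1,2)] carr_diff[OF assms(2,3)]] by simp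

lemma nrm_abs_diff_le:
 assumes "u \<in> carr X" "v \<in> carr X"
 shows "\<bar>nrm X u - nrm X v\<bar> <= nrm X (%x. u x - v x)"
 using nrm_triangle[OF carr_diff[OF assms] assms(2)] nrm_triangle[OF carr_diff[OF assms(2,1)] assms(1)]
  nrm_diff_commute[OF assms] by simp

lemma carr_sum: "(!!i. i \<in> I ==> u i \<in> carr X) ==> (%x. \<Sum>i\<in>I. u i x) \<in> carr X"
 by (induction I rule: infinite_finite_induct) (auto simp: carr_zero intro: carr_add)

lemma nrm_sum_le: "(!!i. i \<in> I ==> u i \<in> carr X) ==> nrm X (%x. \<Sum>i\<in>I. u i x) <= (\<Sum>i\<in>I. nrm X (u i))"
proof (induction I rule: infinite_finite_induct)
 case (insert i I)
 then show ?case using nrm_triangle[of "u i" "%x. \<Sum>i\<in>I. u i x"] carr_sum[of I u] by fastforce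
qed (auto simp: nrm_zero)

lemma antidual_obtain_bound:
 assumes "l \<in> carr (antidual X)"
 obtains C where "!!v. v \<in> carr X ==> cmod (l v) <= C * nrm X v"
 using assms unfolding antidual_def fspace.simps by blast

lemma antidual_bdd_above:
 assumes "l \<in> carr (antidual X)"
 shows "bdd_above {cmod (l v) | v. v \<in> carr X \<and> nrm X v <= 1}"
proof -
 obtain C where C: "!!v. v \<in> carr X ==> cmod (l v) <= C * nrm X v"
  by (rule antidual_obtain_bound[OF assms]) blast
 show ?thesis
 proof (rule bdd_aboveI)
  fix z assume "z \<in> {cmod (l v) | v. v \<in> carr X \<and> nrm X v <= 1}"
  then obtain u where u: "u \<in> carr X" "nrm X u <= 1" "z = cmod (l u)" by auto
  have "z <= C * nrm X u" using C u by simp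
  also have "\<dots> <= \<bar>C\<bar> * 1" using u nrm_nonneg by (intro mult_mono) auto
  finally show "z <= \<bar>C\<bar>" by simp
 qed
qed

lemma antidual_pairing:
 assumes l: "l \<in> carr (antidual X)" and v: "v \<in> carr X"
 shows "cmod (l v) <= nrm (antidual X) l * nrm X v"
proof -
 obtain C where C: "!!v. v \<in> carr X ==> cmod (l v) <= C * nrm X v"
  by (rule antidual_obtain_bound[OF l]) blast
 show ?thesis
 proof (cases "nrm X v = 0")
  case True
  then show ?thesis using C[OF v] by simp
 next
  case False
  then have pos: "0 < nrm X v" using nrm_nonneg[OF v] by simp
  define w where "w = (%x. cr (inverse (nrm X v)) * v x)"
  have w: "w \<in> carr X" unfolding w_def by (rule carr_cmult[OF v])
  have "nrm X w = 1" unfolding w_def nrm_cmult[OF v] using pos by (simp add: norm_inverse)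
  then have "cmod (l w) <= nrm (antidual X) l"
   using w unfolding antidual_def fspace.simps
   by (intro cSup_upper[OF _ antidual_bdd_above[OF l]]) auto
  moreover have "cmod (l w) = inverse (nrm X v) * cmod (l v)"
   unfolding w_def antidual_cmult[OF l v] using pos by (simp add: norm_mult norm_inverse)
  ultimately show ?thesis using pos by (simp add: field_simps)
 qed
qed

lemma nrm_antidual_le:
 assumes "!!v. v \<in> carr X ==> cmod (l v) <= C * nrm X v" and "0 <= C"
 shows "nrm (antidual X) l <= C"
 unfolding antidual_def fspace.simps
proof (rule cSup_least)
 show "{cmod (l v) |v. v \<in> carr X \<and> nrm X v <= 1} ~= {}" using carr_zero nrm_zero by force
 fix z assume "z \<in> {cmod (l v) | v. v \<in> carr X \<and> nrm X v <= 1}"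
 then obtain u where u: "u \<in> carr X" "nrm X u <= 1" "z = cmod (l u)" by auto
 have "z <= C * nrm X u" using assms u by simp
 also have "\<dots> <= C" using u assms(2) by (intro mult_left_le) auto
 finally show "z <= C" .
qed

lemma nrm_antidual_nonneg: "l \<in> carr (antidual X) ==> 0 <= nrm (antidual X) l"
proof -
 assume l: "l \<in> carr (antidual X)"
 have "0 <= cmod (l (%x. 0))" by simp
 also have "\<dots> <= nrm (antidual X) l"
  unfolding antidual_def fspace.simps
  by (rule cSup_upper[OF _ antidual_bdd_above[OF l]]) (use carr_zero nrm_zero in force)
 finally show ?thesis .
qed

lemma seminormed_antidual: "seminormed (antidual X)"
 unfolding seminormed_def
proof (intro conjI ballI allI)
 show "(%x. 0) \<in> carr (antidual X)" by (auto simp: antidual_def intro!: exI[of _ 0])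
next
 fix k l assume k: "k \<in> carr (antidual X)" and l: "l \<in> carr (antidual X)"
 have bnd: "cmod (k v + l v) <= (nrm (antidual X) k + nrm (antidual X) l) * nrm X v" if "v \<in> carr X" for v
  using norm_triangle_ineq[of "k v" "l v"] antidual_pairing[OF k that] antidual_pairing[OF l that]
  by (simp add: distrib_right)
 show "(%x. k x + l x) \<in> carr (antidual X)"
  by (rule antidualI[OF _ _ bnd]) (simp_all add: antidual_add[OF k] antidual_add[OF l] antidual_cmult[OF k]
   antidual_cmult[OF l] algebra_simps)
 show "nrm (antidual X) (%x. k x + l x) <= nrm (antidual X) k + nrm (antidual X) l"
  by (rule nrm_antidual_le[OF bnd]) (auto intro: nrm_antidual_nonneg k l add_nonneg_nonneg)
next
 fix c l assume l: "l \<in> carr (antidual X)"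
 have cl: "(%x. c * l x) \<in> carr (antidual X)" for c
 proof -
  have "cmod (c * l v) <= (cmod c * nrm (antidual X) l) * nrm X v" if "v \<in> carr X" for v
   using mult_left_mono[OF antidual_pairing[OF l that], of "cmod c"] by (simp add: norm_mult mult.assoc)
  then show ?thesis
   by (rule antidualI[rotated 2]) (simp_all add: antidual_add[OF l] antidual_cmult[OF l] algebra_simps)
 qed
 have le: "nrm (antidual X) (%x. c * l x) <= cmod c * nrm (antidual X) l" if "l \<in> carr (antidual X)" for c l
  by (rule nrm_antidual_le)
   (use mult_left_mono[OF antidual_pairing[OF that], of _ "cmod c"] that
    in \<open>auto simp: norm_mult mult.assoc nrm_antidual_nonneg\<close>)
 show "(%x. c * l x) \<in> carr (antidual X)" by (rule cl)
 show "nrm (antidual X) (%x. c * l x) = cmod c * nrm (antidual X) l"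
 proof (cases "c = 0")
  case True
  then show ?thesis using le[OF l, of 0] nrm_antidual_nonneg[OF cl[of 0]] by simp
 next
  case False
  have "nrm (antidual X) (%x. inverse c * (c * l x)) <= cmod (inverse c) * nrm (antidual X) (%x. c * l x)"
   by (rule le[OF cl])
  then have "cmod c * nrm (antidual X) l <= nrm (antidual X) (%x. c * l x)"
   using False by (simp add: mult.assoc[symmetric] norm_inverse norm_divide field_simps)
  then show ?thesis using le[OF l, of c] by simp
 qed
next
 fix l assume "l \<in> carr (antidual X)" then show "0 <= nrm (antidual X) l" by (rule nrm_antidual_nonneg)
qed

end

section \<open>Test functions and weak gradients\<close>

lemma test_functions_iff:
 "\<phi> \<in> test_functions S \<longleftrightarrow> smooth \<phi> \<and> compact (closure {x. \<phi> x ~= 0}) \<and> closure {x. \<phi> x ~= 0} \<subseteq> S"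
 by (simp add: test_functions_def smooth_def)

lemma test_functionsI:
 assumes "smooth \<phi>" "compact K" "K \<subseteq> S" "!!x. x \<notin> K ==> \<phi> x = 0"
 shows "\<phi> \<in> test_functions S"
proof -
 have cl: "closure {x. \<phi> x ~= 0} \<subseteq> K"
  using assms by (intro closure_minimal) (auto intro: compact_imp_closed)
 then have "compact (closure {x. \<phi> x ~= 0})"
  using assms(2) by (metis closed_closure compact_Int_closed inf.absorb_iff2)
 then show ?thesis using assms cl by (simp add: test_functions_iff)
qed

lemma test_functionsE:
 assumes "\<phi> \<in> test_functions S"
 obtains K where "smooth \<phi>" "compact K" "K \<subseteq> S" "!!x. x \<notin> K ==> \<phi> x = 0"
  "!!x. x \<notin> K ==> frechet_derivative \<phi> (at x) = (%_. 0)"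
proof (rule that)
 show "smooth \<phi>" "compact (closure {x. \<phi> x ~= 0})" "closure {x. \<phi> x ~= 0} \<subseteq> S"
  using assms by (simp_all add: test_functions_iff)
 fix x assume x: "x \<notin> closure {x. \<phi> x ~= 0}"
 then show "\<phi> x = 0" using closure_subset[of "{x. \<phi> x ~= 0}"] by blast
 have "((%x. 0) has_derivative (%_. 0)) (at x)" by (rule has_derivative_const)
 then have "(\<phi> has_derivative (%_. 0)) (at x)"
  by (rule has_derivative_transform_within_open[where s="- closure {x. \<phi> x ~= 0}"])
   (use x closure_subset[of "{x. \<phi> x ~= 0}"] in auto)
 then show "frechet_derivative \<phi> (at x) = (%_. 0)" by (metis frechet_derivative_at)
qed

lemma test_functions_smooth: "\<phi> \<in> test_functions S ==> smooth \<phi>"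
 by (simp add: test_functions_iff)

lemma test_functions_mult_smooth:
 fixes \<phi> :: "'a::euclidean_space => 'b::real_normed_algebra"
 assumes "\<phi> \<in> test_functions S" "smooth g"
 shows "(%x. g x * \<phi> x) \<in> test_functions S"
proof -
 obtain K where K: "smooth \<phi>" "compact K" "K \<subseteq> S" "!!x. x \<notin> K ==> \<phi> x = 0"
  by (rule test_functionsE[OF assms(1)]) blast
 show ?thesis by (rule test_functionsI[OF smooth_mult[OF assms(2) K(1)] K(2,3)]) (simp add: K(4))
qed

lemma test_functions_add:
 assumes "\<phi> \<in> test_functions S" "\<psi> \<in> test_functions S"
 shows "(%x. \<phi> x + \<psi> x) \<in> test_functions S"
proof -
 obtain K where K: "smooth \<phi>" "compact K" "K \<subseteq> S" "!!x. x \<notin> K ==> \<phi> x = 0"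
  by (rule test_functionsE[OF assms(1)]) blast
 obtain L where L: "smooth \<psi>" "compact L" "L \<subseteq> S" "!!x. x \<notin> L ==> \<psi> x = 0"
  by (rule test_functionsE[OF assms(2)]) blast
 show ?thesis
  by (rule test_functionsI[OF smooth_add[OF K(1) L(1)] compact_Un[OF K(2) L(2)]])
   (use K L in auto)
qed

lemma test_functions_bounded_linear:
 assumes "\<phi> \<in> test_functions S" "bounded_linear L"
 shows "(%x. L (\<phi> x)) \<in> test_functions S"
proof -
 obtain K where K: "smooth \<phi>" "compact K" "K \<subseteq> S" "!!x. x \<notin> K ==> \<phi> x = 0"
  by (rule test_functionsE[OF assms(1)]) blast
 show ?thesis
  by (rule test_functionsI[OF smooth_bounded_linear[OF assms(2) K(1)] K(2,3)])
   (simp add: K(4) linear_0[OF bounded_linear.linear[OF assms(2)]])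
qed

lemma test_functions_zero: "(%x. 0) \<in> test_functions S"
 by (rule test_functionsI[where K="{}"]) (auto intro: smooth_const)

lemma test_functions_frechet_derivative:
 assumes "\<phi> \<in> test_functions S" "e \<in> Basis"
 shows "(%x. frechet_derivative \<phi> (at x) e) \<in> test_functions S"
proof -
 obtain K where K: "smooth \<phi>" "compact K" "K \<subseteq> S" "!!x. x \<notin> K ==> frechet_derivative \<phi> (at x) = (%_. 0)"
  by (rule test_functionsE[OF assms(1)]) blast
 show ?thesis
  by (rule test_functionsI[OF smooth_frechet_derivative[OF K(1) assms(2)] K(2,3)]) (simp add: K(4))
qed

lemma test_functions_bounded:
 assumes "\<phi> \<in> test_functions S"
 obtains B where "!!x. norm (\<phi> x) <= B"
proof -
 obtain K where K: "smooth \<phi>" "compact K" "K \<subseteq> S" "!!x. x \<notin> K ==> \<phi> x = 0"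
  by (rule test_functionsE[OF assms]) blast
 have "compact (\<phi> ` K)" using K by (intro compact_continuous_image smooth_continuous)
 then obtain B where "!!x. x \<in> K ==> norm (\<phi> x) <= B"
  using compact_imp_bounded[of "\<phi> ` K"] unfolding bounded_iff by blast
 then have "norm (\<phi> x) <= max B 0" for x
  using K(4)[of x] by (cases "x \<in> K") (auto simp: le_max_iff_disj)
 then show ?thesis by (rule that)
qed

lemma has_vector_derivative_at_tendsto:
 fixes g :: "real => 'b::real_normed_vector"
 shows "(g has_vector_derivative D) (at t within S) \<longleftrightarrow> ((%s. (g s - g t) /\<^sub>R (s - t)) \<longlongrightarrow> D) (at t within S)"
proof -
 have "norm (g s - g t - (s - t) *\<^sub>R D) / norm (s - t) = norm ((g s - g t) /\<^sub>R (s - t) - D)" if "s ~= t" for s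
 proof -
  have "(g s - g t) /\<^sub>R (s - t) - D = (g s - g t - (s - t) *\<^sub>R D) /\<^sub>R (s - t)"
   using that by (simp add: scaleR_diff_right)
  then show ?thesis by (simp add: divide_inverse_commute)
 qed
 then have ev: "eventually (%s. norm (g s - g t - (s - t) *\<^sub>R D) / norm (s - t)
   = norm ((g s - g t) /\<^sub>R (s - t) - D)) (at t within S)"
  by (auto simp: eventually_at_filter)
 show ?thesis
  unfolding has_vector_derivative_def has_derivative_iff_norm tendsto_cong[OF ev] tendsto_norm_zero_iff LIM_zero_iff
  by (simp add: bounded_linear_scaleR_left)
qed

text \<open>Difference quotients have integral zero by translation invariance.\<close>

lemma integral_partial_derivative_eq_0:
 fixes f :: "'a::euclidean_space => complex"
 assumes f: "f \<in> test_functions S" and e: "e \<in> Basis"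
 shows "(LINT x|lborel. frechet_derivative f (at x) e) = 0"
proof -
 define Df where "Df x = frechet_derivative f (at x) e" for x
 obtain K where sf: "smooth f" and K: "compact K" "!!x. x \<notin> K ==> f x = 0"
  by (rule test_functionsE[OF f]) blast
 obtain B where B: "!!x. norm (Df x) <= B"
  using test_functions_bounded[OF test_functions_frechet_derivative[OF f e]] unfolding Df_def by blast
 have B0: "0 <= B" using order_trans[OF norm_ge_zero B] .
 obtain R where R: "!!x. f x ~= 0 ==> norm x <= R"
  using compact_imp_bounded[OF K(1)] K(2) unfolding bounded_iff by blast
 have cf: "continuous_on UNIV f" using sf by (rule smooth_continuous)
 have lip: "norm (f (x + h *\<^sub>R e) - f x) <= B * \<bar>h\<bar>" for x h
 proof -
  have der: "((%t. f (x + t *\<^sub>R e)) has_derivative (%s. s *\<^sub>R Df (x + t *\<^sub>R e))) (at t)" for t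
  proof -
   have "((%t. x + t *\<^sub>R e) has_derivative (%s. s *\<^sub>R e)) (at t)"
    by (auto intro!: derivative_eq_intros)
   from has_derivative_compose[OF this smooth_has_derivative[OF sf]]
   have "((%t. f (x + t *\<^sub>R e)) has_derivative (%s. frechet_derivative f (at (x + t *\<^sub>R e)) (s *\<^sub>R e))) (at t)" .
   moreover have "linear (frechet_derivative f (at (x + t *\<^sub>R e)))"
    using has_derivative_linear[OF smooth_has_derivative[OF sf]] .
   ultimately show ?thesis by (simp add: linear_scale Df_def)
  qed
  have "onorm (%s. s *\<^sub>R Df (x + t *\<^sub>R e)) <= B" for t
   by (rule onorm_bound[OF B0]) (use B in \<open>auto simp: mult.commute[of B] intro!: mult_left_mono\<close>)
  then have "norm (f (x + h *\<^sub>R e) - f (x + 0 *\<^sub>R e)) <= B * norm (h - 0)"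
   by (intro differentiable_bound[of UNIV "%t. f (x + t *\<^sub>R e)"]) (auto intro: der)
  then show ?thesis by simp
 qed
 define g where "g n x = real (Suc n) *\<^sub>R (f (x + inverse (real (Suc n)) *\<^sub>R e) - f x)" for n x
 have fint: "integrable lborel f"
 proof -
  have "integrable lborel (%x. indicator (cball 0 R) x *\<^sub>R f x)"
   using cf by (intro borel_integrable_compact) (auto intro: continuous_on_subset)
  moreover have "(%x. indicator (cball 0 R) x *\<^sub>R f x) = f"
   using R by (fastforce simp: indicator_def)
  ultimately show ?thesis by simp
 qed
 have shift: "has_bochner_integral lborel (%x. f (x + c)) (LINT x|lborel. f x)" for c
 proof -
  have *: "lborel = distr lborel borel ((+) c)" by (rule lborel_distr_plus[symmetric])
  have m: "f \<in> borel_measurable borel" using cf by (rule borel_measurable_continuous_onI)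
  have "integrable lborel (%x. f (c + x))"
   using fint by (subst (asm) *) (simp add: integrable_distr_eq m)
  moreover have "(LINT x|lborel. f (c + x)) = (LINT x|lborel. f x)"
   by (subst (2) *) (simp add: integral_distr m)
  ultimately show ?thesis by (simp add: has_bochner_integral_iff add.commute)
 qed
 have int0: "(LINT x|lborel. g n x) = 0" for n
  using shift[of "inverse (real (Suc n)) *\<^sub>R e"] fint
  by (simp add: g_def has_bochner_integral_iff)
 have "(%n. LINT x|lborel. g n x) \<longlonglongrightarrow> (LINT x|lborel. Df x)"
 proof (rule integral_dominated_convergence[where w="%x. B * indicator (cball 0 (R + 1)) x"])
  show "Df \<in> borel_measurable lborel"
   using smooth_continuous[OF smooth_frechet_derivative[OF sf e], of UNIV]
   unfolding Df_def by (simp add: borel_measurable_continuous_onI)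
  show "g n \<in> borel_measurable lborel" for n
   unfolding g_def using cf
   by (intro borel_measurable_scaleR borel_measurable_diff borel_measurable_const)
    (auto intro!: borel_measurable_continuous_onI continuous_intros continuous_on_compose2[OF cf])
  show "integrable lborel (%x. B * indicator (cball 0 (R + 1)) x)"
   by (intro integrable_mult_right integrable_real_indicator) (auto intro: emeasure_bounded_finite[unfolded infinity_ennreal_def])
  show "AE x in lborel. (%n. g n x) \<longlonglongrightarrow> Df x"
  proof (intro AE_I2)
   fix x
   have "((%t. x + t *\<^sub>R e) has_derivative (%s. s *\<^sub>R e)) (at 0)"
    by (auto intro!: derivative_eq_intros)
   moreover have "(f has_derivative frechet_derivative f (at x)) (at (x + 0 *\<^sub>R e))"
    using smooth_has_derivative[OF sf] by simp
   ultimately have "((%t. f (x + t *\<^sub>R e)) has_derivative (%s. frechet_derivative f (at x) (s *\<^sub>R e))) (at 0)"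
    by (rule has_derivative_compose)
   then have "((%t. f (x + t *\<^sub>R e)) has_vector_derivative Df x) (at 0)"
    using linear_scale[OF has_derivative_linear[OF smooth_has_derivative[OF sf]]]
    by (simp add: has_vector_derivative_def Df_def)
   then have "((%t. (f (x + t *\<^sub>R e) - f x) /\<^sub>R t) \<longlongrightarrow> Df x) (at 0)"
    by (simp add: has_vector_derivative_at_tendsto)
   moreover have "filterlim (%n. inverse (real (Suc n))) (at 0) sequentially"
    using LIMSEQ_inverse_real_of_nat by (auto simp: filterlim_at)
   ultimately have "(%n. (f (x + inverse (real (Suc n)) *\<^sub>R e) - f x) /\<^sub>R inverse (real (Suc n))) \<longlonglongrightarrow> Df x"
    by (rule filterlim_compose)
   then show "(%n. g n x) \<longlonglongrightarrow> Df x" by (simp add: g_def)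
  qed
  show "AE x in lborel. norm (g n x) <= B * indicator (cball 0 (R + 1)) x" for n
  proof (intro AE_I2)
   fix x
   show "norm (g n x) <= B * indicator (cball 0 (R + 1)) x"
   proof (cases "x \<in> cball 0 (R + 1)")
    case True
    have "norm (g n x) <= real (Suc n) * (B * \<bar>inverse (real (Suc n))\<bar>)"
     unfolding g_def norm_scaleR
     using lip[of x "inverse (real (Suc n))"] by (intro mult_mono) (auto simp del: of_nat_Suc)
    also have "\<dots> = B" by (simp del: of_nat_Suc)
    finally show ?thesis using True by simp
   next
    case False
    then have "norm x > R + 1" by simp
    moreover have "norm x <= norm (x + inverse (real (Suc n)) *\<^sub>R e) + norm (inverse (real (Suc n)) *\<^sub>R e)"
     by (metis add_diff_cancel_right' norm_triangle_ineq4)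
    moreover have "norm (inverse (real (Suc n)) *\<^sub>R e) <= 1" using e by (simp add: field_simps)
    ultimately have "f x = 0" "f (x + inverse (real (Suc n)) *\<^sub>R e) = 0"
     using R[of x] R[of "x + inverse (real (Suc n)) *\<^sub>R e"] by fastforce+
    then show ?thesis using B0 by (simp add: g_def)
   qed
  qed
 qed
 then show ?thesis using int0 by (simp add: Df_def LIMSEQ_const_iff)
qed

lemma L2_carr: "f \<in> carr (L2 \<Omega>) \<longleftrightarrow> sqint (lebesgue_on \<Omega>) f"
 by (simp add: L2_def sqint_def)

lemma L2_nrm: "nrm (L2 \<Omega>) f = l2norm (lebesgue_on \<Omega>) f"
 by (simp add: L2_def l2norm_def)

lemma seminormed_L2: "seminormed (L2 \<Omega>)"
 unfolding seminormed_def L2_carr L2_nrm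
 by (auto simp: L2_carr sqint_add_l2norm_triangle l2norm_cmult l2norm_nonneg) (simp add: sqint_def)

lemma sqint_mult_integrable:
 fixes f g :: "'a => complex"
 assumes "sqint M f" "sqint M g"
 shows "integrable M (%x. f x * g x)" "cmod (LINT x|M. f x * g x) <= l2norm M f * l2norm M g"
proof -
 show int: "integrable M (%x. f x * g x)"
  by (rule Bochner_Integration.integrable_bound[OF sqint_product[OF assms]])
   (use assms in \<open>auto simp: sqint_def norm_mult\<close>)
 have "cmod (LINT x|M. f x * g x) <= (LINT x|M. cmod (f x) * cmod (g x))"
  using integral_norm_bound[of M "%x. f x * g x"] by (simp add: norm_mult)
 then show "cmod (LINT x|M. f x * g x) <= l2norm M f * l2norm M g"
  using integral_product_le[OF assms] by linarith
qed

lemma sqint_cnj: "sqint M (f :: _ => complex) ==> sqint M (%x. cnj (f x))"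
 and l2norm_cnj: "l2norm M (%x. cnj (f x)) = l2norm M (f :: _ => complex)"
 by (auto simp: sqint_def l2norm_def
   intro: measurable_compose[OF _ borel_measurable_continuous_onI[OF continuous_on_cnj[OF continuous_on_id]]])

lemma axis_Basis: "axis i (1::real) \<in> Basis"
 by (auto simp: Basis_vec_def)

definition grad :: "(real^'n => complex) => real^'n => complex^'n" where
 "grad v x = (\<chi> i. frechet_derivative v (at x) (axis i 1))"

lemma frechet_derivative_mult:
 fixes f g :: "'a::euclidean_space => 'b::real_normed_algebra"
 assumes "smooth f" "smooth g"
 shows "frechet_derivative (%x. f x * g x) (at x) e =
  f x * frechet_derivative g (at x) e + frechet_derivative f (at x) e * g x"
 using frechet_derivative_at[OF has_derivative_mult[OF smooth_has_derivative[OF assms(1)] smooth_has_derivative[OF assms(2)]]]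
 by metis

locale bounded_open =
 fixes \<Omega> :: "(real^'n) set"
 assumes open_Omega: "open \<Omega>" and bounded_Omega: "bounded \<Omega>"
begin

abbreviation M :: "(real^'n) measure" where "M \<equiv> lebesgue_on \<Omega>"
text \<open>The Gelfand triple \<open>VV\<close>, \<open>HH\<close>, \<open>VV'\<close> of the domain.\<close>

abbreviation "HH \<equiv> L2 \<Omega>"
abbreviation "VV \<equiv> H10 \<Omega>"
abbreviation "VV' \<equiv> Hm1 \<Omega>"
abbreviation "emb \<equiv> embed_H \<Omega>"
abbreviation "meas \<equiv> borel_measurable M"
abbreviation "tests \<equiv> test_functions \<Omega>"

lemma Omega_lebesgue: "\<Omega> \<in> sets lebesgue"
 using open_Omega by (simp add: borel_open)

sublocale finite_measure M
 by (intro finite_measure_lebesgue_on bounded_set_imp_lmeasurable bounded_Omega Omega_lebesgue)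

lemma continuous_measurable: "continuous_on UNIV f ==> f \<in> meas"
 by (rule continuous_imp_measurable_on_sets_lebesgue[OF _ Omega_lebesgue]) (auto intro: continuous_on_subset)

lemma smooth_measurable: "smooth f ==> f \<in> meas"
 by (intro continuous_measurable smooth_continuous)

lemma sqint_bounded:
 fixes f :: "real^'n => 'b::{banach, second_countable_topology}"
 assumes f: "f \<in> meas" and C: "!!x. x \<in> \<Omega> ==> norm (f x) <= C"
 shows "sqint M f" "l2norm M f <= \<bar>C\<bar> * sqrt (measure M \<Omega>)"
proof -
 have sq: "(norm (f x))\<^sup>2 <= C\<^sup>2" if "x \<in> \<Omega>" for x
  using C[OF that] by (intro power_mono) auto
 show *: "sqint M f"
  unfolding sqint_def using sq f by (auto intro!: integrable_const_bound[where B="C\<^sup>2"])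
 have "(LINT x|M. (norm (f x))\<^sup>2) <= (LINT x|M. C\<^sup>2)"
  using * sq by (intro integral_mono) (auto simp: sqint_def)
 then have "l2norm M f <= sqrt (C\<^sup>2 * measure M \<Omega>)" unfolding l2norm_def by (intro real_sqrt_le_mono) (simp add: mult.commute)
 then show "l2norm M f <= \<bar>C\<bar> * sqrt (measure M \<Omega>)" by (simp add: real_sqrt_mult)
qed

lemma sqint_integrable:
 fixes f :: "real^'n => complex"
 shows "sqint M f ==> integrable M f"
 using sqint_mult_integrable(1)[of M f "%_. 1"] sqint_bounded(1)[of "%_. 1::complex" 1] by simp

lemma test_sqint:
 fixes \<phi> :: "real^'n => complex"
 assumes "\<phi> \<in> test_functions S" shows "sqint M \<phi>"
proof -
 obtain B where "!!x. cmod (\<phi> x) <= B" by (rule test_functions_bounded[OF assms]) blast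
 then show ?thesis by (intro sqint_bounded(1)[OF smooth_measurable[OF test_functions_smooth[OF assms]]])
qed

lemma l2norm_dominated:
 fixes f :: "nat => real^'n => 'b::{banach, second_countable_topology}"
 assumes "!!n. f n \<in> meas" and C: "!!n x. x \<in> \<Omega> ==> norm (f n x) <= C"
  and lim: "!!x. x \<in> \<Omega> ==> (%n. f n x) \<longlonglongrightarrow> 0"
 shows "(%n. l2norm M (f n)) \<longlonglongrightarrow> 0"
proof -
 have "(%n. LINT x|M. (norm (f n x))\<^sup>2) \<longlonglongrightarrow> (LINT x|M. 0)"
 proof (rule integral_dominated_convergence[where w="%_. C\<^sup>2"])
  show "AE x in M. (%n. (norm (f n x))\<^sup>2) \<longlonglongrightarrow> 0"
   using tendsto_power[OF tendsto_norm_zero[OF lim], where n=2] by (auto intro!: AE_I2)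
  show "AE x in M. norm ((norm (f n x))\<^sup>2) <= C\<^sup>2" for n
   using C by (auto intro!: AE_I2 power_mono)
 qed (use assms in auto)
 from tendsto_real_sqrt[OF this] show ?thesis by (simp add: l2norm_def)
qed

lemma l2norm_dominated_at:
 fixes f :: "real => real^'n => 'b::{banach, second_countable_topology}"
 assumes "!!s. s \<in> S ==> f s \<in> meas"
  and "!!s x. s \<in> S ==> x \<in> \<Omega> ==> norm (f s x) <= C"
  and "!!x. x \<in> \<Omega> ==> ((%s. f s x) \<longlongrightarrow> 0) (at t within S)"
 shows "((%s. l2norm M (f s)) \<longlongrightarrow> 0) (at t within S)"
 unfolding tendsto_at_iff_sequentially o_def
proof (intro allI impI)
 fix X :: "nat => real" assume X: "\<forall>i. X i \<in> S - {t}" "X \<longlonglongrightarrow> t"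
 show "(%n. l2norm M (f (X n))) \<longlonglongrightarrow> 0"
 proof (rule l2norm_dominated[where C=C])
  show "(%n. f (X n) x) \<longlonglongrightarrow> 0" if "x \<in> \<Omega>" for x
   using assms(3)[OF that] X unfolding tendsto_at_iff_sequentially o_def by blast
 qed (use assms X in auto)
qed

lemma integral_test_function:
 fixes f :: "real^'n => complex"
 assumes "f \<in> tests"
 shows "(LINT x|M. f x) = (LINT x|lborel. f x)"
proof -
 obtain K where K: "smooth f" "K \<subseteq> \<Omega>" "!!x. x \<notin> K ==> f x = 0"
  by (rule test_functionsE[OF assms]) blast
 have "(LINT x|M. f x) = integral\<^sup>L lebesgue (%x. if x \<in> \<Omega> then f x else 0)"
  by (rule Lebesgue_Measure.integral_restrict_UNIV[OF Omega_lebesgue, symmetric])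
 also have "(%x. if x \<in> \<Omega> then f x else 0) = f" using K(2,3) by (intro ext) auto
 also have "integral\<^sup>L lebesgue f = integral\<^sup>L lborel f"
  by (rule integral_completion)
   (use smooth_continuous[OF K(1), of UNIV] in \<open>simp add: borel_measurable_continuous_onI\<close>)
 finally show ?thesis .
qed

text \<open>The product is a test function, and integrals of derivatives of test functions vanish.\<close>

lemma integral_by_parts:
 fixes v \<phi> :: "real^'n => complex"
 assumes v: "smooth v" and \<phi>: "\<phi> \<in> tests"
 shows "(LINT x|M. v x * frechet_derivative \<phi> (at x) (axis i 1)) =
  - (LINT x|M. frechet_derivative v (at x) (axis i 1) * \<phi> x)"
proof -
 have s\<phi>: "smooth \<phi>" using \<phi> by (rule test_functions_smooth)
 have t: "(%x. v x * \<phi> x) \<in> tests" by (rule test_functions_mult_smooth[OF \<phi> v])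
 have "(LINT x|M. frechet_derivative (%x. v x * \<phi> x) (at x) (axis i 1)) = 0"
  using integral_test_function[OF test_functions_frechet_derivative[OF t axis_Basis]]
   integral_partial_derivative_eq_0[OF t axis_Basis] by simp
 moreover have "integrable M (%x. v x * frechet_derivative \<phi> (at x) (axis i 1))"
  by (intro sqint_integrable test_sqint[where S=\<Omega>] test_functions_mult_smooth test_functions_frechet_derivative \<phi> v axis_Basis)
 moreover have "integrable M (%x. frechet_derivative v (at x) (axis i 1) * \<phi> x)"
  by (intro sqint_integrable test_sqint[where S=\<Omega>] test_functions_mult_smooth smooth_frechet_derivative \<phi> v axis_Basis)
 ultimately show ?thesis
  by (simp add: frechet_derivative_mult[OF v s\<phi>] add_eq_0_iff)
qed

text \<open>The indicator function of a box is the limit of products of steep steps, which are test functions.\<close>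

lemma integral_box_eq_0:
 fixes g :: "real^'n => complex"
 assumes g: "sqint M g" and zero: "!!\<phi>. \<phi> \<in> tests ==> (LINT x|M. g x * \<phi> x) = 0"
  and sub: "cbox a b \<subseteq> \<Omega>"
 shows "(LINT x|M. indicator (box a b) x *\<^sub>R g x) = 0"
proof -
 define \<psi> :: "nat => real^'n => real"
  where "\<psi> n x = (\<Prod>i\<in>UNIV. step (real n * (x $ i - a $ i)) * step (real n * (b $ i - x $ i)))" for n x
 have smooth_coord: "smooth (%x::real^'n. step (c * x $ i + d))" for c d i
  using smooth_compose_affine[OF bounded_linear_const_mult[OF bounded_linear_vec_nth] smooth_step, of c i d] .
 have sm: "smooth (\<psi> n)" for n
  unfolding \<psi>_def
  using smooth_coord[of "real n" _ "- (real n * a $ _)"] smooth_coord[of "- real n" _ "real n * b $ _"]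
  by (intro smooth_prod smooth_mult) (auto simp: algebra_simps)
 have supp: "\<psi> n x = 0" if x: "x \<notin> cbox a b" for n x
 proof -
  obtain i where "x $ i < a $ i \<or> b $ i < x $ i" using x by (auto simp: mem_box_cart not_le)
  then have "step (real n * (x $ i - a $ i)) * step (real n * (b $ i - x $ i)) = 0"
   by (auto simp: mult_nonneg_nonpos intro!: step_eq_0)
  then show ?thesis unfolding \<psi>_def by (simp add: prod_zero_iff) blast
 qed
 have t: "(%x. of_real (\<psi> n x) :: complex) \<in> tests" for n
  by (rule test_functionsI[OF smooth_of_real[OF sm] compact_cbox sub]) (simp add: supp)
 have bnd: "0 <= \<psi> n x \<and> \<psi> n x <= 1" for n x
  unfolding \<psi>_def by (intro conjI prod_nonneg prod_le_1) (auto simp: step_nonneg step_le_1 mult_le_one)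
 have lim1: "(%n. step (real n * c)) \<longlonglongrightarrow> (if 0 < c then 1 else 0)" for c
 proof (cases "0 < c")
  case True
  have "eventually (%n. 1 / c <= real n) sequentially"
   using filterlim_real_sequentially unfolding filterlim_at_top by blast
  then have "eventually (%n. step (real n * c) = 1) sequentially"
   by eventually_elim (use True in \<open>auto intro!: step_eq_1 simp: field_simps\<close>)
  then show ?thesis using True by (simp add: tendsto_eventually)
 next
  case False
  then show ?thesis by (simp add: step_eq_0 mult_nonneg_nonpos)
 qed
 have lim: "(%n. \<psi> n x) \<longlonglongrightarrow> indicator (box a b) x" for x
 proof -
  have "(%n. \<psi> n x) \<longlonglongrightarrow> (\<Prod>i\<in>UNIV. (if 0 < x $ i - a $ i then 1 else 0) * (if 0 < b $ i - x $ i then 1 else 0))"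
   unfolding \<psi>_def by (intro tendsto_prod tendsto_mult lim1)
  also have "(\<Prod>i\<in>UNIV. (if 0 < x $ i - a $ i then 1 else 0) * (if 0 < b $ i - x $ i then 1 else (0::real))) = indicator (box a b) x"
  proof (cases "x \<in> box a b")
   case False
   then obtain i where "\<not> (a $ i < x $ i \<and> x $ i < b $ i)" by (auto simp: mem_box_cart)
   then have "(if 0 < x $ i - a $ i then 1 else 0) * (if 0 < b $ i - x $ i then 1 else (0::real)) = 0" by auto
   then have "(\<Prod>i\<in>UNIV. (if 0 < x $ i - a $ i then 1 else 0) * (if 0 < b $ i - x $ i then 1 else (0::real))) = 0"
    by (intro prod_zero[OF finite] bexI[of _ i]) (assumption | rule UNIV_I)+
   then show ?thesis using False by (simp only: indicator_simps if_False not_False_eq_True)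
  qed (simp add: mem_box_cart)
  finally show ?thesis .
 qed
 have "(%n. LINT x|M. g x * of_real (\<psi> n x)) \<longlonglongrightarrow> (LINT x|M. indicator (box a b) x *\<^sub>R g x)"
 proof (rule integral_dominated_convergence[where w="%x. norm (g x)"])
  show "AE x in M. (%n. g x * of_real (\<psi> n x)) \<longlonglongrightarrow> indicator (box a b) x *\<^sub>R g x"
   using tendsto_mult[OF tendsto_const tendsto_of_real[OF lim]]
   by (auto intro!: AE_I2 simp: scaleR_conv_of_real mult.commute)
  show "AE x in M. norm (g x * of_real (\<psi> n x)) <= norm (g x)" for n
   using bnd by (auto intro!: AE_I2 mult_left_le simp: norm_mult)
  show "(%x. indicator (box a b) x *\<^sub>R g x) \<in> meas"
   using g sub box_subset_cbox[of a b] by (intro borel_measurable_scaleR borel_measurable_indicator)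
    (auto simp: sqint_def sets_restrict_space_iff Omega_lebesgue intro!: sets_completionI_sets)
  show "(%x. g x * of_real (\<psi> n x)) \<in> meas" for n
   using g test_sqint[OF t, of n] unfolding sqint_def by (intro borel_measurable_times) blast+
  show "integrable M (%x. norm (g x))" using sqint_integrable[OF g] by simp
 qed
 then show ?thesis using zero[OF t] by (simp add: LIMSEQ_const_iff)
qed

text \<open>Boxes generate the Borel sets, so the integrals over all measurable subsets of a box vanish; the domain is a
countable union of boxes.\<close>

lemma fundamental_lemma:
 fixes g :: "real^'n => complex"
 assumes g: "sqint M g" and zero: "!!\<phi>. \<phi> \<in> tests ==> (LINT x|M. g x * \<phi> x) = 0"
 shows "AE x in M. g x = 0"
proof -
 have cb: "AE x in lebesgue. x \<in> cbox p q \<longrightarrow> g x = 0" if pq: "cbox p q \<subseteq> \<Omega>" for p q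
 proof -
  define H where "H x = (if x \<in> box p q then g x else 0)" for x
  have Hm: "H x = (if x \<in> \<Omega> then indicator (box p q) x *\<^sub>R g x else 0)" for x
   using pq box_subset_cbox[of p q] by (auto simp: H_def)
  have ind: "box a b \<in> sets M" if "box a b \<subseteq> \<Omega>" for a b
   using that by (auto simp: sets_restrict_space_iff Omega_lebesgue intro!: sets_completionI_sets)
  have Hint: "integrable lebesgue H"
  proof -
   have "integrable M (%x. indicator (box p q) x *\<^sub>R g x)"
    by (intro integrable_mult_indicator sqint_integrable g ind) (use pq box_subset_cbox[of p q] in blast)
   then have "integrable lebesgue (%x. if x \<in> \<Omega> then indicator (box p q) x *\<^sub>R g x else 0)"
    using Lebesgue_Measure.integrable_restrict_UNIV[OF Omega_lebesgue, of "%x. indicator (box p q) x *\<^sub>R g x"]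
    by (simp only:)
   moreover have "H = (%x. if x \<in> \<Omega> then indicator (box p q) x *\<^sub>R g x else 0)" using Hm by (rule ext)
   ultimately show ?thesis by simp
  qed
  have basic: "(LINT x:box a b|lebesgue. H x) = 0" for a b
  proof -
   define a' b' where "a' = (\<Sum>i\<in>Basis. max (a\<bullet>i) (p\<bullet>i) *\<^sub>R i)" and "b' = (\<Sum>i\<in>Basis. min (b\<bullet>i) (q\<bullet>i) *\<^sub>R i)"
   have eq: "box a b \<inter> box p q = box a' b'" unfolding a'_def b'_def by (rule box_Int_box)
   have "cbox a' b' \<subseteq> cbox p q" by (auto simp: a'_def b'_def mem_box)
   then have sub: "cbox a' b' \<subseteq> \<Omega>" using pq by blast
   have "(LINT x:box a b|lebesgue. H x) = integral\<^sup>L lebesgue (%x. if x \<in> \<Omega> then indicator (box a' b') x *\<^sub>R g x else 0)"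
    unfolding set_lebesgue_integral_def
    by (rule Bochner_Integration.integral_cong) (use eq Hm in \<open>auto simp: indicator_def split: if_splits\<close>)
   also have "\<dots> = (LINT x|M. indicator (box a' b') x *\<^sub>R g x)"
    by (rule Lebesgue_Measure.integral_restrict_UNIV[OF Omega_lebesgue])
   finally show ?thesis using integral_box_eq_0[OF g zero sub] by simp
  qed
  have borel: "(LINT x:A|lebesgue. H x) = 0" if "A \<in> sets borel" for A
  proof -
   have A: "A \<in> sigma_sets UNIV (range (%(a, b). box a b))"
    using that unfolding borel_eq_box by (simp add: sets_measure_of)
   have all: "sets (borel :: (real^'n) measure) = sigma_sets UNIV (range (%(a, b). box a b))"
    unfolding borel_eq_box by (simp add: sets_measure_of)
   have leb: "S \<in> sets lebesgue" if "S \<in> sigma_sets UNIV (range (%(a, b). box a b))" for S :: "(real^'n) set"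
    by (rule sets_completionI_sets, subst sets_lborel, subst all, rule that)
   have set_int: "set_integrable lebesgue S H" if "S \<in> sets lebesgue" for S
    unfolding set_integrable_def using Hint that by (intro integrable_mult_indicator)
   have IS: "Int_stable (range (%(a, b). box a b :: (real^'n) set))"
    by (auto simp: Int_stable_def box_Int_box)
   have cl: "range (%(a, b). box a b :: (real^'n) set) \<subseteq> Pow UNIV" by simp
   from IS cl A show ?thesis
   proof (induction rule: sigma_sets_induct_disjoint)
    case (compl A)
    have AL: "A \<in> sets lebesgue" by (rule leb[OF compl(1)])
    have UN: "(LINT x:UNIV|lebesgue. H x) = 0"
    proof -
     have "(LINT x:UNIV|lebesgue. H x) = (LINT x:box p q|lebesgue. H x)"
      unfolding set_lebesgue_integral_def
      by (rule Bochner_Integration.integral_cong) (auto simp: H_def)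
     then show ?thesis using basic by simp
    qed
    have "(LINT x:UNIV|lebesgue. H x) = (LINT x:(UNIV - A) \<union> A|lebesgue. H x)" by simp
    also have "\<dots> = (LINT x:UNIV - A|lebesgue. H x) + (LINT x:A|lebesgue. H x)"
     using AL by (intro set_integral_Un set_int) auto
    finally show ?case using compl UN by simp
   next
    case (union A)
    have AL: "A i \<in> sets lebesgue" for i by (rule leb[OF range_subsetD[OF union(2)]])
    have "(LINT x:(\<Union>i. A i)|lebesgue. H x) = (\<Sum>i. (LINT x:A i|lebesgue. H x))"
    proof (rule lebesgue_integral_countable_add)
     show "!!i j. i ~= j ==> A i \<inter> A j = {}" using union(1) by (auto simp: disjoint_family_on_def)
     show "set_integrable lebesgue (\<Union>i. A i) H" using AL by (intro set_int) auto
    qed (use AL in auto)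
    then show ?case using union by simp
   qed (use basic in \<open>auto simp: set_lebesgue_integral_def\<close>)
  qed
  have leb: "(LINT x:A|lebesgue. H x) = 0" if "A \<in> sets lebesgue" for A
  proof -
   from that
   obtain S N N' where A: "A = S \<union> N" "N \<subseteq> N'" "N' \<in> null_sets lborel" "S \<in> sets lborel"
    by (rule sets_completionE)
   have N: "N' \<in> null_sets lebesgue" using A(3) by (rule null_sets_completionI)
   have S: "S \<in> sets lebesgue" using A(4) by (rule sets_completionI_sets)
   have "(LINT x:A|lebesgue. H x) = (LINT x:S|lebesgue. H x)"
    unfolding set_lebesgue_integral_def
   proof (rule integral_cong_AE)
    show "AE x in lebesgue. indicat_real A x *\<^sub>R H x = indicat_real S x *\<^sub>R H x"
     using AE_not_in[OF N] by eventually_elim (use A in \<open>auto simp: indicator_def\<close>)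
   qed (intro borel_measurable_scaleR borel_measurable_indicator borel_measurable_integrable[OF Hint] S
     that)+
   then show "(LINT x:A|lebesgue. H x) = 0" using borel A(4) by simp
  qed
  have HO: "(%x. if x \<in> \<Omega> then H x else 0) = H" by (auto simp: Hm)
  have Hsub: "indicator A x *\<^sub>R H x = (if x \<in> \<Omega> then indicator A x *\<^sub>R H x else 0)" for A x
   by (simp add: Hm)
  have "AE x in M. H x = 0"
  proof (rule density_zero)
   show "integrable M H"
    using Hint Lebesgue_Measure.integrable_restrict_UNIV[OF Omega_lebesgue, of H]
    unfolding HO by simp
   fix A assume "A \<in> sets M"
   then have "A \<in> sets lebesgue" by (simp add: sets_restrict_space_iff Omega_lebesgue)
   from leb[OF this] show "(LINT x:A|M. H x) = 0"
    unfolding set_lebesgue_integral_def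
    using Lebesgue_Measure.integral_restrict_UNIV[OF Omega_lebesgue, of "%x. indicator A x *\<^sub>R H x"]
    by (simp flip: Hsub)
  qed
  then have "AE x in lebesgue. x \<in> \<Omega> \<longrightarrow> H x = 0"
   by (simp add: AE_restrict_space_iff Omega_lebesgue)
  moreover have "AE x in lebesgue. x \<notin> cbox p q - box p q"
   using negligible_frontier_interval[of p q] by (intro AE_not_in) (simp add: negligible_iff_null_sets)
  ultimately show ?thesis by eventually_elim (use pq in \<open>auto simp: H_def\<close>)
 qed
 obtain \<D> where D: "countable \<D>" "\<D> \<subseteq> Pow \<Omega>" "!!X. X \<in> \<D> ==> \<exists>a b. X = cbox a b" "\<Union>\<D> = \<Omega>"
  using open_countable_Union_open_cbox[OF open_Omega] by blast
 have "AE x in lebesgue. \<forall>X\<in>\<D>. x \<in> X \<longrightarrow> g x = 0"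
  unfolding AE_ball_countable[OF D(1)]
 proof
  fix X assume X: "X \<in> \<D>"
  then obtain a b where "X = cbox a b" using D(3) by blast
  moreover have "X \<subseteq> \<Omega>" using X D(2) by blast
  ultimately show "AE x in lebesgue. x \<in> X \<longrightarrow> g x = 0" using cb[of a b] by simp
 qed
 then have "AE x in lebesgue. x \<in> \<Omega> \<longrightarrow> g x = 0"
  by eventually_elim (use D(4) in auto)
 then show ?thesis by (simp add: AE_restrict_space_iff Omega_lebesgue)
qed

end

lemma borel_measurable_cnj: "f \<in> borel_measurable M ==> (%x. cnj (f x)) \<in> borel_measurable M"
 by (rule measurable_compose[OF _ borel_measurable_continuous_onI[OF continuous_on_cnj[OF continuous_on_id]]])

lemma borel_measurable_of_real: "f \<in> borel_measurable M ==> (%x. cr (f x)) \<in> borel_measurable M"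
 by (rule measurable_compose[OF _ borel_measurable_continuous_onI[OF continuous_on_of_real[OF continuous_on_id]]])

lemma complex_integral_cnj: "cnj (integral\<^sup>L M f) = (LINT x|M. cnj (f x))"
 by (rule Bochner_Integration.integral_cnj[symmetric])

lemma sqint_diff: "sqint M f ==> sqint M g ==> sqint M (%x. f x - g x :: complex)"
 using sqint_add_l2norm_triangle(1)[OF _ l2norm_cmult(1), of M f g "-1"] by simp

lemma is_weak_gradient_add:
 assumes "is_weak_gradient \<Omega> v g" "is_weak_gradient \<Omega> w h" "sqint (lebesgue_on \<Omega>) v" "sqint (lebesgue_on \<Omega>) w"
  and S: "bounded_open \<Omega>"
 shows "is_weak_gradient \<Omega> (%x. v x + w x) (%x. g x + h x)"
proof -
 interpret bounded_open \<Omega> by (rule S)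
 show ?thesis
  unfolding is_weak_gradient_def
 proof (intro conjI allI ballI)
  fix i show "(%x. (g x + h x) $ i) \<in> carr (L2 \<Omega>)"
   using assms(1,2) by (simp add: is_weak_gradient_def L2_carr sqint_add_l2norm_triangle)
 next
  fix \<phi> :: "real^'a => complex" and i
  assume t: "\<phi> \<in> test_functions \<Omega>"
  have sd: "sqint M (%x. frechet_derivative \<phi> (at x) (axis i 1))"
   by (rule test_sqint[OF test_functions_frechet_derivative[OF t axis_Basis]])
  have "sqint M (%x. g x $ i)" "sqint M (%x. h x $ i)"
   using assms(1,2) by (simp_all add: is_weak_gradient_def L2_carr)
  then show "(LINT x|M. (v x + w x) * frechet_derivative \<phi> (at x) (axis i 1)) = - (LINT x|M. (g x + h x) $ i * \<phi> x)"
   using t assms(1,2) sqint_mult_integrable(1)[OF assms(3) sd] sqint_mult_integrable(1)[OF assms(4) sd]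
    sqint_mult_integrable(1)[OF _ test_sqint[OF t]]
   by (simp add: is_weak_gradient_def distrib_right)
 qed
qed

lemma is_weak_gradient_cmult:
 assumes "is_weak_gradient \<Omega> v g"
 shows "is_weak_gradient \<Omega> (%x. c * v x) (%x. c *s g x)"
 using assms by (simp add: is_weak_gradient_def L2_carr l2norm_cmult mult.assoc)

context bounded_open
begin

lemma is_weak_gradient_grad:
 assumes "v \<in> tests" shows "is_weak_gradient \<Omega> v (grad v)"
 unfolding is_weak_gradient_def
 using integral_by_parts[OF test_functions_smooth[OF assms]]
  test_sqint[OF test_functions_frechet_derivative[OF assms axis_Basis]]
 by (auto simp: grad_def L2_carr)

text \<open>The difference of two weak gradients integrates to zero against every test function.\<close>

lemma weak_gradient_unique:
 assumes g: "is_weak_gradient \<Omega> v g" and g': "is_weak_gradient \<Omega> v g'"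
 shows "AE x in M. g x = g' x"
proof -
 have "AE x in M. g x $ i - g' x $ i = 0" for i
 proof (rule fundamental_lemma)
  have s: "sqint M (%x. g x $ i)" "sqint M (%x. g' x $ i)" using g g' by (simp_all add: is_weak_gradient_def L2_carr)
  then show "sqint M (%x. g x $ i - g' x $ i)"
   by (rule sqint_diff)
  fix \<phi> :: "real^'n => complex" assume t: "\<phi> \<in> tests"
  have "(LINT x|M. v x * frechet_derivative \<phi> (at x) (axis i 1)) = - (LINT x|M. g x $ i * \<phi> x)"
   "(LINT x|M. v x * frechet_derivative \<phi> (at x) (axis i 1)) = - (LINT x|M. g' x $ i * \<phi> x)"
   using g g' t unfolding is_weak_gradient_def by blast+
  then have "(LINT x|M. g x $ i * \<phi> x) = (LINT x|M. g' x $ i * \<phi> x)" by simp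
  then show "(LINT x|M. (g x $ i - g' x $ i) * \<phi> x) = 0"
   using s[THEN sqint_mult_integrable(1)[OF _ test_sqint[OF t]]] by (simp add: left_diff_distrib)
 qed
 then have "AE x in M. \<forall>i. g x $ i - g' x $ i = 0" by (simp add: AE_all_countable)
 then show ?thesis by eventually_elim (simp add: vec_eq_iff)
qed

abbreviation wg :: "(real^'n => complex) => real^'n => complex^'n" where
 "wg \<equiv> weak_gradient \<Omega>"

lemma weak_gradient_works: "v \<in> carr (H1 \<Omega>) ==> is_weak_gradient \<Omega> v (wg v)"
 unfolding weak_gradient_def H1_def by (auto intro: someI[of "is_weak_gradient \<Omega> v"])

lemma weak_gradient_eq: "is_weak_gradient \<Omega> v g ==> AE x in M. wg v x = g x"
proof -
 assume g: "is_weak_gradient \<Omega> v g"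
 then have "is_weak_gradient \<Omega> v (wg v)" unfolding weak_gradient_def by (rule someI[of "is_weak_gradient \<Omega> v"])
 then show ?thesis using g by (rule weak_gradient_unique)
qed

lemma H1_sqint: "v \<in> carr (H1 \<Omega>) ==> sqint M v"
 by (simp add: H1_def L2_carr)

lemma H1_I: "sqint M v ==> is_weak_gradient \<Omega> v g ==> v \<in> carr (H1 \<Omega>)"
 by (auto simp: H1_def L2_carr)

lemma sqint_vec:
 fixes g :: "real^'n => complex^'n"
 assumes "!!i. sqint M (%x. g x $ i)" shows "sqint M g"
proof -
 have "(%x. g x $ i) \<in> meas" for i using assms[of i] by (simp add: sqint_def)
 then have "g \<in> meas"
  unfolding borel_measurable_euclidean_space[of g]
  by (auto simp: Basis_vec_def inner_axis intro!: borel_measurable_inner)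
 moreover have "(norm (g x))\<^sup>2 = (\<Sum>i\<in>UNIV. (cmod (g x $ i))\<^sup>2)" for x
  by (simp add: norm_vec_def L2_set_def sum_nonneg)
 ultimately show ?thesis using assms by (simp add: sqint_def)
qed

lemma sqint_weak_gradient: "v \<in> carr (H1 \<Omega>) ==> sqint M (wg v)"
 using weak_gradient_works[of v] by (intro sqint_vec) (simp add: is_weak_gradient_def L2_carr)

text \<open>A function together with its gradient; the norm of \<open>H\<^sup>1\<close> is the \<open>L\<^sup>2\<close> norm of this pair.\<close>

definition jet :: "(real^'n => complex) => real^'n => complex \<times> (complex^'n)" where
 "jet v x = (v x, wg v x)"

lemma sqint_jet: "v \<in> carr (H1 \<Omega>) ==> sqint M (jet v)"
 using H1_sqint[of v] sqint_weak_gradient[of v]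
 by (auto simp: sqint_def jet_def[abs_def] norm_Pair)

lemma H1_nrm: "v \<in> carr (H1 \<Omega>) ==> nrm (H1 \<Omega>) v = l2norm M (jet v)"
 using H1_sqint[of v] sqint_weak_gradient[of v]
 by (simp add: H1_def l2norm_def sqint_def jet_def norm_Pair)

lemma H1_add:
 assumes v: "v \<in> carr (H1 \<Omega>)" and w: "w \<in> carr (H1 \<Omega>)"
 shows "(%x. v x + w x) \<in> carr (H1 \<Omega>)" "AE x in M. wg (%x. v x + w x) x = wg v x + wg w x"
  "AE x in M. jet (%x. v x + w x) x = jet v x + jet w x"
proof -
 have *: "is_weak_gradient \<Omega> (%x. v x + w x) (%x. wg v x + wg w x)"
  by (intro is_weak_gradient_add weak_gradient_works H1_sqint v w bounded_open_axioms)
 show "(%x. v x + w x) \<in> carr (H1 \<Omega>)"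
  by (rule H1_I[OF _ *]) (simp add: sqint_add_l2norm_triangle H1_sqint v w)
 show wg: "AE x in M. wg (%x. v x + w x) x = wg v x + wg w x" by (rule weak_gradient_eq[OF *])
 show "AE x in M. jet (%x. v x + w x) x = jet v x + jet w x"
  using wg by eventually_elim (simp add: jet_def)
qed

lemma H1_cmult:
 assumes v: "v \<in> carr (H1 \<Omega>)"
 shows "(%x. c * v x) \<in> carr (H1 \<Omega>)" "AE x in M. wg (%x. c * v x) x = c *s wg v x"
  "nrm (H1 \<Omega>) (%x. c * v x) = cmod c * nrm (H1 \<Omega>) v"
proof -
 have *: "is_weak_gradient \<Omega> (%x. c * v x) (%x. c *s wg v x)"
  by (intro is_weak_gradient_cmult weak_gradient_works v)
 show c: "(%x. c * v x) \<in> carr (H1 \<Omega>)"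
  by (rule H1_I[OF _ *]) (simp add: l2norm_cmult H1_sqint v)
 show wg: "AE x in M. wg (%x. c * v x) x = c *s wg v x" by (rule weak_gradient_eq[OF *])
 have n: "norm (c *s g) = cmod c * norm g" for g :: "complex^'n"
  by (simp add: norm_vec_def L2_set_def norm_mult power_mult_distrib sum_distrib_left[symmetric] real_sqrt_mult)
 have "(LINT x|M. (norm (wg (%x. c * v x) x))\<^sup>2) = (LINT x|M. (cmod c)\<^sup>2 * (norm (wg v x))\<^sup>2)"
 proof (rule integral_cong_AE)
  show "AE x in M. (norm (wg (%x. c * v x) x))\<^sup>2 = (cmod c)\<^sup>2 * (norm (wg v x))\<^sup>2"
   using wg by eventually_elim (simp add: n power_mult_distrib)
 qed (use sqint_weak_gradient[OF c] sqint_weak_gradient[OF v] in \<open>auto simp: sqint_def\<close>)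
 then show "nrm (H1 \<Omega>) (%x. c * v x) = cmod c * nrm (H1 \<Omega>) v"
  by (simp add: H1_def norm_mult power_mult_distrib distrib_left[symmetric] real_sqrt_mult)
qed

lemma test_H1: "\<phi> \<in> tests ==> \<phi> \<in> carr (H1 \<Omega>)"
 by (rule H1_I[OF test_sqint is_weak_gradient_grad])

lemma seminormed_H1: "seminormed (H1 \<Omega>)"
 unfolding seminormed_def
proof (intro conjI ballI allI)
 show "(%x. 0) \<in> carr (H1 \<Omega>)" by (rule test_H1[OF test_functions_zero])
 fix u v assume u: "u \<in> carr (H1 \<Omega>)" and v: "v \<in> carr (H1 \<Omega>)"
 show add: "(%x. u x + v x) \<in> carr (H1 \<Omega>)" by (rule H1_add(1)[OF u v])
 have "l2norm M (jet (%x. u x + v x)) = l2norm M (%x. jet u x + jet v x)"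
  using sqint_jet[OF add] sqint_jet[OF u] sqint_jet[OF v]
  by (intro l2norm_cong_AE H1_add(3) u v) (auto simp: sqint_def)
 also have "\<dots> <= l2norm M (jet u) + l2norm M (jet v)"
  by (intro sqint_add_l2norm_triangle sqint_jet u v)
 finally show "nrm (H1 \<Omega>) (%x. u x + v x) <= nrm (H1 \<Omega>) u + nrm (H1 \<Omega>) v"
  by (simp add: H1_nrm u v add)
next
 fix c u assume u: "u \<in> carr (H1 \<Omega>)"
 show "(%x. c * u x) \<in> carr (H1 \<Omega>)" "nrm (H1 \<Omega>) (%x. c * u x) = cmod c * nrm (H1 \<Omega>) u"
  by (rule H1_cmult[OF u])+
next
 fix u assume u: "u \<in> carr (H1 \<Omega>)"
 show "0 <= nrm (H1 \<Omega>) u" by (simp add: H1_nrm u l2norm_nonneg)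
qed

lemma H10_nrm: "nrm VV = nrm (H1 \<Omega>)"
 by (simp add: H10_def)

lemma H10_H1: "v \<in> carr VV ==> v \<in> carr (H1 \<Omega>)"
 by (simp add: H10_def)

lemma H10_sqint: "v \<in> carr VV ==> sqint M v"
 by (intro H1_sqint H10_H1)

lemma H10_I:
 assumes "v \<in> carr (H1 \<Omega>)" "!!k::nat. \<phi> k \<in> tests"
  "(%k. nrm (H1 \<Omega>) (%x. v x - \<phi> k x)) \<longlonglongrightarrow> 0"
 shows "v \<in> carr VV"
 using assms by (auto simp: H10_def)

lemma test_H10: "\<phi> \<in> tests ==> \<phi> \<in> carr VV"
 by (rule H10_I[where \<phi>="%_. \<phi>"]) (auto simp: test_H1 nrm_zero[OF seminormed_H1])

lemma seminormed_H10: "seminormed VV"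
 unfolding seminormed_def H10_nrm
proof (intro conjI ballI allI)
 show "(%x. 0) \<in> carr VV" by (rule test_H10[OF test_functions_zero])
 fix u v assume u: "u \<in> carr VV" and v: "v \<in> carr VV"
 show "nrm (H1 \<Omega>) (%x. u x + v x) <= nrm (H1 \<Omega>) u + nrm (H1 \<Omega>) v"
  by (intro nrm_triangle[OF seminormed_H1] H10_H1 u v)
 obtain \<phi> \<psi> where \<phi>: "!!k. \<phi> k \<in> tests" "(%k::nat. nrm (H1 \<Omega>) (%x. u x - \<phi> k x)) \<longlonglongrightarrow> 0"
  and \<psi>: "!!k. \<psi> k \<in> tests" "(%k::nat. nrm (H1 \<Omega>) (%x. v x - \<psi> k x)) \<longlonglongrightarrow> 0"
  using u v by (auto simp: H10_def)
 show "(%x. u x + v x) \<in> carr VV"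
 proof (rule H10_I)
  show "(%x. u x + v x) \<in> carr (H1 \<Omega>)" by (intro H1_add H10_H1 u v)
  show "(%x. \<phi> k x + \<psi> k x) \<in> tests" for k by (intro test_functions_add \<phi> \<psi>)
  have bound: "nrm (H1 \<Omega>) (%x. (u x + v x) - (\<phi> k x + \<psi> k x))
    <= nrm (H1 \<Omega>) (%x. u x - \<phi> k x) + nrm (H1 \<Omega>) (%x. v x - \<psi> k x)" for k
   using nrm_triangle[OF seminormed_H1 carr_diff[OF seminormed_H1 H10_H1[OF u] test_H1[OF \<phi>(1)[of k]]]
     carr_diff[OF seminormed_H1 H10_H1[OF v] test_H1[OF \<psi>(1)[of k]]]]
   by (simp add: algebra_simps)
  show "(%k. nrm (H1 \<Omega>) (%x. (u x + v x) - (\<phi> k x + \<psi> k x))) \<longlonglongrightarrow> 0"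
  proof (rule tendsto_sandwich[OF _ _ tendsto_const])
   show "(%k. nrm (H1 \<Omega>) (%x. u x - \<phi> k x) + nrm (H1 \<Omega>) (%x. v x - \<psi> k x)) \<longlonglongrightarrow> 0"
    using tendsto_add[OF \<phi>(2) \<psi>(2)] by simp
   have "(%x. (u x + v x) - (\<phi> k x + \<psi> k x)) \<in> carr (H1 \<Omega>)" for k
    by (intro carr_diff[OF seminormed_H1] H1_add H10_H1 u v test_H1 \<phi> \<psi>)
   then show "\<forall>\<^sub>F k in sequentially. 0 <= nrm (H1 \<Omega>) (%x. (u x + v x) - (\<phi> k x + \<psi> k x))"
    by (intro always_eventually allI nrm_nonneg[OF seminormed_H1])
  qed (use bound in auto)
 qed
next
 fix c u assume u: "u \<in> carr VV"
 show "nrm (H1 \<Omega>) (%x. c * u x) = cmod c * nrm (H1 \<Omega>) u" by (rule H1_cmult(3)[OF H10_H1[OF u]])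
 obtain \<phi> where \<phi>: "!!k. \<phi> k \<in> tests" "(%k::nat. nrm (H1 \<Omega>) (%x. u x - \<phi> k x)) \<longlonglongrightarrow> 0"
  using u by (auto simp: H10_def)
 show "(%x. c * u x) \<in> carr VV"
 proof (rule H10_I)
  show "(%x. c * u x) \<in> carr (H1 \<Omega>)" by (intro H1_cmult H10_H1 u)
  show "(%x. c * \<phi> k x) \<in> tests" for k
   by (intro test_functions_mult_smooth smooth_const \<phi>)
  have "nrm (H1 \<Omega>) (%x. c * u x - c * \<phi> k x) = cmod c * nrm (H1 \<Omega>) (%x. u x - \<phi> k x)" for k
   using nrm_cmult[OF seminormed_H1 carr_diff[OF seminormed_H1 H10_H1[OF u] test_H1[OF \<phi>(1)[of k]]], of c]
   by (simp add: right_diff_distrib)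
  then show "(%k. nrm (H1 \<Omega>) (%x. c * u x - c * \<phi> k x)) \<longlonglongrightarrow> 0"
   using tendsto_mult[OF tendsto_const \<phi>(2), of "cmod c"] by simp
 qed
next
 fix u assume u: "u \<in> carr VV"
 show "0 <= nrm (H1 \<Omega>) u" by (rule nrm_nonneg[OF seminormed_H1 H10_H1[OF u]])
qed

lemmas seminormed_Hm1 = seminormed_antidual[OF seminormed_H10]

lemma l2norm_le_H1: "v \<in> carr VV ==> l2norm M v <= nrm VV v"
 and l2norm_weak_gradient_le_H1: "v \<in> carr VV ==> l2norm M (wg v) <= nrm VV v"
 and H10_nrm_sq: "v \<in> carr VV ==> (nrm VV v)\<^sup>2 = (l2norm M v)\<^sup>2 + (l2norm M (wg v))\<^sup>2"
 by (auto simp: H10_nrm H1_def l2norm_def)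

lemma H10_nrm_test:
 assumes "\<phi> \<in> tests"
 shows "nrm VV \<phi> = l2norm M (%x. (\<phi> x, grad \<phi> x))"
proof -
 have "grad \<phi> \<in> meas"
  using is_weak_gradient_grad[OF assms] sqint_vec[of "grad \<phi>"]
  by (auto simp: is_weak_gradient_def L2_carr sqint_def)
 moreover have "AE x in M. jet \<phi> x = (\<phi> x, grad \<phi> x)"
  using weak_gradient_eq[OF is_weak_gradient_grad[OF assms]] by eventually_elim (simp add: jet_def)
 ultimately show ?thesis
  unfolding H10_nrm H1_nrm[OF test_H1[OF assms]]
  using sqint_jet[OF test_H1[OF assms]] test_sqint[OF assms]
  by (intro l2norm_cong_AE) (auto simp: sqint_def)
qed

subsection \<open>The embedding into the antidual\<close>

lemma embed_H_bound: "sqint M h ==> sqint M w ==> cmod (emb h w) <= l2norm M h * l2norm M w"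
 unfolding embed_H_def using sqint_mult_integrable(2)[OF _ sqint_cnj, of M h w] by (simp add: l2norm_cnj)

lemma embed_H_integrable: "sqint M h ==> sqint M w ==> integrable M (%x. h x * cnj (w x))"
 using sqint_mult_integrable(1)[OF _ sqint_cnj] by blast

lemma embed_H_bound_H10: "sqint M h ==> w \<in> carr VV ==> cmod (emb h w) <= l2norm M h * nrm VV w"
 using embed_H_bound[OF _ H10_sqint] mult_left_mono[OF l2norm_le_H1 l2norm_nonneg] by (meson order_trans)

lemma embed_H_antidual:
 assumes h: "sqint M h" shows "emb h \<in> carr VV'"
proof (rule antidualI[OF _ _ embed_H_bound_H10[OF h]])
 fix v w assume "v \<in> carr VV" "w \<in> carr VV"
 then show "emb h (%x. v x + w x) = emb h v + emb h w"
  unfolding embed_H_def complex_cnj_add distrib_left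
  by (intro Bochner_Integration.integral_add embed_H_integrable h H10_sqint)
next
 fix c v show "emb h (%x. c * v x) = cnj c * emb h v"
  by (simp add: embed_H_def mult.left_commute)
qed

lemma embed_H_nrm_le: "sqint M h ==> nrm VV' (emb h) <= l2norm M h"
 by (rule nrm_antidual_le[OF seminormed_H10 embed_H_bound_H10 l2norm_nonneg])

lemma nrm_Hm1_cong: "(!!w. w \<in> carr VV ==> l w = l' w) ==> nrm VV' l = nrm VV' l'"
proof -
 assume eq: "!!w. w \<in> carr VV ==> l w = l' w"
 have "{cmod (l v) |v. v \<in> carr VV \<and> nrm VV v <= 1} =
  {cmod (l' v) |v. v \<in> carr VV \<and> nrm VV v <= 1}"
  by (intro Collect_cong iff_exI) (auto simp: eq)
 then show ?thesis by (simp add: antidual_def)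
qed

lemma embed_H_diff:
 "sqint M h ==> sqint M k ==> sqint M w ==> emb (%x. h x - k x) w = emb h w - emb k w"
 unfolding embed_H_def left_diff_distrib by (intro Bochner_Integration.integral_diff embed_H_integrable)

lemma embed_H_minus: "emb (%x. - h x) w = - emb h w"
 by (simp add: embed_H_def)

lemma embed_H_scaleR: "emb (%x. r *\<^sub>R h x) w = r *\<^sub>R emb h w"
 by (simp add: embed_H_def scaleR_conv_of_real mult.assoc)

text \<open>Test functions belong to \<open>H10\<close>, so \<open>L2\<close> embeds injectively into the antidual.\<close>

lemma embed_H_eq_0:
 assumes h: "sqint M h" and zero: "!!w. w \<in> carr VV ==> emb h w = 0"
 shows "AE x in M. h x = 0"
proof (rule fundamental_lemma[OF h])
 fix \<phi> :: "real^'n => complex" assume "\<phi> \<in> tests"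
 then have "(%x. cnj (\<phi> x)) \<in> carr VV"
  by (rule test_H10[OF test_functions_bounded_linear[OF _ bounded_linear_cnj]])
 from zero[OF this] show "(LINT x|M. h x * \<phi> x) = 0" by (simp add: embed_H_def)
qed

text \<open>A derivative has small norm in \<open>H\<^sup>-\<^sup>1\<close> if its primitive is small in \<open>L\<^sup>2\<close>.\<close>

lemma embed_H_derivative:
 assumes \<phi>: "\<phi> \<in> tests" and w: "w \<in> carr VV"
 shows "emb (%x. frechet_derivative \<phi> (at x) (axis i 1)) w = - (LINT x|M. \<phi> x * cnj (wg w x $ i))"
proof -
 define \<psi> where "\<psi> = (%x. cnj (\<phi> x))"
 have \<psi>: "\<psi> \<in> tests"
  unfolding \<psi>_def by (rule test_functions_bounded_linear[OF \<phi> bounded_linear_cnj])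
 have d: "frechet_derivative \<psi> (at x) (axis i 1) = cnj (frechet_derivative \<phi> (at x) (axis i 1))" for x
  unfolding \<psi>_def
  using frechet_derivative_at[OF bounded_linear.has_derivative[OF bounded_linear_cnj smooth_has_derivative[OF test_functions_smooth[OF \<phi>]]]]
  by metis
 have "(LINT x|M. w x * frechet_derivative \<psi> (at x) (axis i 1)) = - (LINT x|M. wg w x $ i * \<psi> x)"
  using weak_gradient_works[OF H10_H1[OF w]] \<psi> by (simp add: is_weak_gradient_def)
 moreover have "emb (%x. frechet_derivative \<phi> (at x) (axis i 1)) w = cnj (LINT x|M. w x * frechet_derivative \<psi> (at x) (axis i 1))"
  unfolding embed_H_def complex_integral_cnj
  by (rule Bochner_Integration.integral_cong) (simp_all add: d mult.commute)
 moreover have "(LINT x|M. \<phi> x * cnj (wg w x $ i)) = cnj (LINT x|M. wg w x $ i * \<psi> x)"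
  unfolding complex_integral_cnj
  by (rule Bochner_Integration.integral_cong) (simp_all add: \<psi>_def mult.commute)
 ultimately show ?thesis by simp
qed

lemma embed_H_derivative_bound:
 assumes \<phi>: "\<phi> \<in> tests" and w: "w \<in> carr VV"
 shows "cmod (emb (%x. frechet_derivative \<phi> (at x) (axis i 1)) w) <= l2norm M \<phi> * nrm VV w"
proof -
 have s: "sqint M (%x. wg w x $ i)"
  using weak_gradient_works[OF H10_H1[OF w]] by (simp add: is_weak_gradient_def L2_carr)
 have "cmod (emb (%x. frechet_derivative \<phi> (at x) (axis i 1)) w) <= l2norm M \<phi> * l2norm M (%x. wg w x $ i)"
  unfolding embed_H_derivative[OF \<phi> w]
  using sqint_mult_integrable(2)[OF test_sqint[OF \<phi>] sqint_cnj[OF s]] by (simp add: l2norm_cnj)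
 also have "l2norm M (%x. wg w x $ i) <= l2norm M (wg w)"
  using s by (intro l2norm_mono(2)[OF sqint_weak_gradient[OF H10_H1[OF w]]]) (auto simp: sqint_def intro!: AE_I2 Finite_Cartesian_Product.norm_nth_le)
 also have "\<dots> <= nrm VV w" by (rule l2norm_weak_gradient_le_H1[OF w])
 finally show ?thesis by (simp add: mult_left_mono l2norm_nonneg)
qed

subsection \<open>The elliptic form\<close>

definition form :: "(real^'n => real) => (real^'n => complex) => (real^'n => complex) => complex" where
 "form b v w = (LINT x|M. of_real (b x) * (\<Sum>i\<in>UNIV. wg v x $ i * cnj (wg w x $ i)))"

lemma neg_div_isotropic: "neg_div \<Omega> (isotropic b t) v w = form (b t) v w"
proof -
 have "(\<Sum>i\<in>UNIV. (\<Sum>j\<in>UNIV. cr (isotropic b t x $ i $ j) * wg v x $ j) * cnj (wg w x $ i))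
   = of_real (b t x) * (\<Sum>i\<in>UNIV. wg v x $ i * cnj (wg w x $ i))" for x
 proof -
  have "cr (isotropic b t x $ i $ j) * wg v x $ j = (if j = i then of_real (b t x) * wg v x $ i else 0)" for i j
   by (simp add: isotropic_def mat_def)
  then have "(\<Sum>j\<in>UNIV. cr (isotropic b t x $ i $ j) * wg v x $ j) = of_real (b t x) * wg v x $ i" for i
   by simp
  then show ?thesis by (simp add: sum_distrib_left mult.assoc)
 qed
 then show ?thesis by (simp add: neg_div_def form_def)
qed

lemma norm_sum_cnj_le:
 fixes g h :: "complex^'n"
 shows "cmod (\<Sum>i\<in>UNIV. g $ i * cnj (h $ i)) <= norm g * norm h"
proof -
 have "cmod (\<Sum>i\<in>UNIV. g $ i * cnj (h $ i)) <= (\<Sum>i\<in>UNIV. cmod (g $ i) * cmod (h $ i))"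
  by (rule order_trans[OF norm_sum]) (simp add: norm_mult)
 also have "\<dots> = (\<Sum>i\<in>UNIV. \<bar>cmod (g $ i)\<bar> * \<bar>cmod (h $ i)\<bar>)" by simp
 also have "\<dots> <= norm g * norm h" unfolding norm_vec_def by (rule L2_set_mult_ineq)
 finally show ?thesis .
qed

context
 fixes b :: "real^'n => real" and C :: real
 assumes b_meas: "b \<in> meas" and C: "0 <= C" and b_le: "!!x. x \<in> \<Omega> ==> \<bar>b x\<bar> <= C"
begin

lemma form_integrand:
 assumes v: "v \<in> carr VV" and w: "w \<in> carr VV"
 shows "integrable M (%x. of_real (b x) * (\<Sum>i\<in>UNIV. wg v x $ i * cnj (wg w x $ i)))"
  and "cmod (form b v w) <= C * l2norm M (wg v) * l2norm M (wg w)"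
proof -
 have sv: "sqint M (wg v)" and sw: "sqint M (wg w)" using sqint_weak_gradient[OF H10_H1] v w by auto
 have comp: "(%x. wg v x $ i) \<in> meas" "(%x. wg w x $ i) \<in> meas" for i
  using weak_gradient_works[OF H10_H1] v w by (auto simp: is_weak_gradient_def L2_carr sqint_def)
 have bound: "cmod (of_real (b x) * (\<Sum>i\<in>UNIV. wg v x $ i * cnj (wg w x $ i))) <= C * (norm (wg v x) * norm (wg w x))"
  if "x \<in> \<Omega>" for x
  using b_le[OF that] unfolding norm_mult by (intro mult_mono norm_sum_cnj_le) auto
 have dom: "integrable M (%x. C * (norm (wg v x) * norm (wg w x)))"
  using sqint_product[OF sv sw] by simp
 show int: "integrable M (%x. of_real (b x) * (\<Sum>i\<in>UNIV. wg v x $ i * cnj (wg w x $ i)))"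
 proof (rule Bochner_Integration.integrable_bound[OF dom])
  show "(%x. of_real (b x) * (\<Sum>i\<in>UNIV. wg v x $ i * cnj (wg w x $ i))) \<in> meas"
   by (intro borel_measurable_times borel_measurable_of_real b_meas borel_measurable_sum comp borel_measurable_cnj)
 qed (use bound in \<open>auto intro!: AE_I2 order_trans[OF bound]\<close>)
 have "cmod (form b v w) <= (LINT x|M. cmod (of_real (b x) * (\<Sum>i\<in>UNIV. wg v x $ i * cnj (wg w x $ i))))"
  unfolding form_def by (rule integral_norm_bound)
 also have "\<dots> <= (LINT x|M. C * (norm (wg v x) * norm (wg w x)))"
  using int by (intro integral_mono dom bound integrable_norm) auto
 also have "\<dots> = C * (LINT x|M. norm (wg v x) * norm (wg w x))" by simp
 also have "\<dots> <= C * (l2norm M (wg v) * l2norm M (wg w))"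
  by (intro mult_left_mono integral_product_le sv sw C)
 finally show "cmod (form b v w) <= C * l2norm M (wg v) * l2norm M (wg w)" by (simp add: mult.assoc)
qed

lemma form_add_left:
 assumes "u \<in> carr VV" "v \<in> carr VV" "w \<in> carr VV"
 shows "form b (%x. u x + v x) w = form b u w + form b v w"
proof -
 have add: "(%x. u x + v x) \<in> carr VV" by (rule carr_add[OF seminormed_H10 assms(1,2)])
 have "form b (%x. u x + v x) w = (LINT x|M. of_real (b x) * (\<Sum>i\<in>UNIV. wg u x $ i * cnj (wg w x $ i))
   + of_real (b x) * (\<Sum>i\<in>UNIV. wg v x $ i * cnj (wg w x $ i)))"
  unfolding form_def
 proof (rule integral_cong_AE)
  show "AE x in M. of_real (b x) * (\<Sum>i\<in>UNIV. wg (%x. u x + v x) x $ i * cnj (wg w x $ i)) =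
   of_real (b x) * (\<Sum>i\<in>UNIV. wg u x $ i * cnj (wg w x $ i)) + of_real (b x) * (\<Sum>i\<in>UNIV. wg v x $ i * cnj (wg w x $ i))"
   using H1_add(2)[OF H10_H1[OF assms(1)] H10_H1[OF assms(2)]]
   by eventually_elim (simp add: distrib_right sum.distrib distrib_left)
 qed (use form_integrand(1) assms add in \<open>auto intro!: borel_measurable_integrable simp del: sum_distrib_left\<close>)
 then show ?thesis using form_integrand(1) assms by (simp add: form_def)
qed

lemma form_add_right:
 assumes "u \<in> carr VV" "v \<in> carr VV" "w \<in> carr VV"
 shows "form b w (%x. u x + v x) = form b w u + form b w v"
proof -
 have add: "(%x. u x + v x) \<in> carr VV" by (rule carr_add[OF seminormed_H10 assms(1,2)])
 have "form b w (%x. u x + v x) = (LINT x|M. of_real (b x) * (\<Sum>i\<in>UNIV. wg w x $ i * cnj (wg u x $ i))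
   + of_real (b x) * (\<Sum>i\<in>UNIV. wg w x $ i * cnj (wg v x $ i)))"
  unfolding form_def
 proof (rule integral_cong_AE)
  show "AE x in M. of_real (b x) * (\<Sum>i\<in>UNIV. wg w x $ i * cnj (wg (%x. u x + v x) x $ i)) =
   of_real (b x) * (\<Sum>i\<in>UNIV. wg w x $ i * cnj (wg u x $ i)) + of_real (b x) * (\<Sum>i\<in>UNIV. wg w x $ i * cnj (wg v x $ i))"
   using H1_add(2)[OF H10_H1[OF assms(1)] H10_H1[OF assms(2)]]
   by eventually_elim (simp add: sum.distrib distrib_left)
 qed (use form_integrand(1) assms add in \<open>auto intro!: borel_measurable_integrable simp del: sum_distrib_left\<close>)
 then show ?thesis using form_integrand(1) assms by (simp add: form_def)
qed

lemma form_minus_left: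
 assumes "u \<in> carr VV" "w \<in> carr VV"
 shows "form b (%x. - u x) w = - form b u w"
proof -
 have m: "(%x. - u x) \<in> carr VV" by (rule carr_minus[OF seminormed_H10 assms(1)])
 have "form b (%x. 0) w = 0"
  using form_integrand(2)[of "%x. 0" w] assms l2norm_weak_gradient_le_H1[of "%x. 0"]
   nrm_zero[OF seminormed_H10] carr_zero[OF seminormed_H10] l2norm_nonneg[of M "wg (%x. 0)"] by simp
 then show ?thesis using form_add_left[OF assms(1) m assms(2)] by (simp add: eq_neg_iff_add_eq_0 add.commute)
qed

lemma form_diff_left:
 assumes "u \<in> carr VV" "v \<in> carr VV" "w \<in> carr VV"
 shows "form b (%x. u x - v x) w = form b u w - form b v w"
 using form_add_left[OF assms(1) carr_minus[OF seminormed_H10 assms(2)] assms(3)] form_minus_left[OF assms(2,3)]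
 by simp

text \<open>Only the gradient is controlled; in the uniqueness proof the function itself is controlled by the time derivative.\<close>

lemma form_coercive:
 assumes v: "v \<in> carr VV" and c: "!!x. x \<in> \<Omega> ==> c <= b x"
 shows "c * (l2norm M (wg v))\<^sup>2 <= Re (form b v v)"
proof -
 have eq: "Re (of_real (b x) * (\<Sum>i\<in>UNIV. wg v x $ i * cnj (wg v x $ i))) = b x * (norm (wg v x))\<^sup>2" for x
  by (simp add: norm_vec_def L2_set_def sum_nonneg complex_norm_square[symmetric] flip: of_real_sum of_real_mult of_real_power)
 have "c * (l2norm M (wg v))\<^sup>2 = (LINT x|M. c * (norm (wg v x))\<^sup>2)" by (simp add: l2norm_sq)
 also have "\<dots> <= (LINT x|M. Re (of_real (b x) * (\<Sum>i\<in>UNIV. wg v x $ i * cnj (wg v x $ i))))"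
 proof (rule integral_mono)
  show "integrable M (%x. c * (norm (wg v x))\<^sup>2)"
   using sqint_weak_gradient[OF H10_H1[OF v]] by (simp add: sqint_def)
  show "integrable M (%x. Re (of_real (b x) * (\<Sum>i\<in>UNIV. wg v x $ i * cnj (wg v x $ i))))"
   using form_integrand(1)[OF v v] by (rule integrable_Re)
 qed (use c in \<open>auto simp only: eq space_restrict_space intro!: mult_right_mono\<close>, auto intro!: c)
 also have "\<dots> = Re (form b v v)" unfolding form_def by (rule integral_Re[OF form_integrand(1)[OF v v]])
 finally show ?thesis .
qed

end

end

section \<open>Vector-valued functions of time\<close>

abbreviation T :: "real measure" where "T \<equiv> lebesgue_on {0<..<1}"

lemma T_finite: "finite_measure T"
 by (intro finite_measure_lebesgue_on) auto

lemma measure_T: "measure T {0<..<1} = 1"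
 by (simp add: measure_restrict_space)

lemma AE_T_limit_measurable:
 fixes f :: "real => 'b::euclidean_space"
 assumes s: "!!i. s i \<in> borel_measurable T" and lim: "AE t in T. (%i::nat. s i t) \<longlonglongrightarrow> f t"
 shows "f \<in> borel_measurable T"
proof -
 define g where "g t = lim (%i. s i t)" for t
 have g: "g \<in> borel_measurable T" unfolding g_def by (rule borel_measurable_lim_metric[OF s])
 have "AE t in T. g t = f t" using lim by eventually_elim (simp add: g_def limI)
 then have ae: "AE t in lebesgue. (if t \<in> {0<..<1} then g t else 0) = (if t \<in> {0<..<1} then f t else 0)"
  by (auto simp: AE_restrict_space_iff elim!: eventually_mono)
 have "(%t. if t \<in> {0<..<1} then g t else 0) \<in> borel_measurable lebesgue"
  using g by (subst borel_measurable_if) auto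
 from borel_measurable_AE[OF this ae] show ?thesis by (subst (asm) borel_measurable_if) auto
qed

text \<open>Midpoints of a uniform partition of the unit interval. Evaluation at the midpoint of the current cell turns
a continuous function of time into simple functions.\<close>

definition grid :: "nat => real => real" where
 "grid i t = (of_int \<lfloor>real (Suc i) * t\<rfloor> + 1/2) / real (Suc i)"

lemma grid_mem:
 assumes "t \<in> {0<..<1}" shows "grid i t \<in> {0<..<1}"
proof -
 have "0 <= \<lfloor>real (Suc i) * t\<rfloor>" using assms by simp
 moreover have "\<lfloor>real (Suc i) * t\<rfloor> < int (Suc i)"
  using assms by (subst floor_less_iff) (simp del: of_nat_Suc)
 then have "\<lfloor>real (Suc i) * t\<rfloor> <= int i" by simp
 moreover define k where "k = real_of_int \<lfloor>real (Suc i) * t\<rfloor>"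
 ultimately have "0 < k + 1/2" "k + 1/2 < real (Suc i)" unfolding k_def by linarith+
 then have "0 < (k + 1/2) / real (Suc i)" "(k + 1/2) / real (Suc i) < 1"
  by (simp_all add: divide_less_eq_1_pos del: of_nat_Suc)
 then show ?thesis unfolding grid_def k_def by simp
qed

lemma grid_tendsto: "(%i. grid i t) \<longlonglongrightarrow> t"
proof -
 have "\<bar>grid i t - t\<bar> <= inverse (real (Suc i))" for i
 proof -
  have "\<bar>of_int \<lfloor>real (Suc i) * t\<rfloor> + 1/2 - real (Suc i) * t\<bar> <= 1" by linarith
  moreover have "grid i t - t = (of_int \<lfloor>real (Suc i) * t\<rfloor> + 1/2 - real (Suc i) * t) * inverse (real (Suc i))"
   by (simp add: grid_def field_simps del: of_nat_Suc)
  ultimately show ?thesis by (simp add: abs_mult del: of_nat_Suc)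
 qed
 then have "(%i. grid i t - t) \<longlonglongrightarrow> 0"
  by (intro Lim_null_comparison[OF _ LIMSEQ_inverse_real_of_nat]) (auto intro: always_eventually)
 then show ?thesis by (simp add: LIM_zero_iff)
qed

lemma grid_simple: "simple_function T (grid i)"
proof (rule simple_function_borel_measurable)
 have "(%t. t) \<in> borel_measurable T" by (intro continuous_imp_measurable_on_sets_lebesgue) auto
 moreover have "grid i \<in> borel_measurable borel" unfolding grid_def[abs_def] by measurable
 ultimately show "grid i \<in> borel_measurable T" by (rule measurable_compose)
 have "grid i ` space T \<subseteq> (%k. (of_int k + 1/2) / real (Suc i)) ` {0..int i}"
 proof
  fix y assume "y \<in> grid i ` space T"
  then obtain t where t: "0 < t" "t < 1" "y = grid i t" by auto
  have "0 <= \<lfloor>real (Suc i) * t\<rfloor>" using t by simp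
  moreover have "\<lfloor>real (Suc i) * t\<rfloor> < int (Suc i)"
   using t by (subst floor_less_iff) (simp del: of_nat_Suc)
  ultimately show "y \<in> (%k. (of_int k + 1/2) / real (Suc i)) ` {0..int i}"
   using t by (auto simp: grid_def)
 qed
 then show "finite (grid i ` space T)" by (rule finite_subset) simp
qed

lemma simple_bochner_integrable_T: "simple_function T f ==> Bochner_Integration.simple_bochner_integrable T f"
 by (rule Bochner_Integration.simple_bochner_integrable.intros) (simp_all only: finite_measure.emeasure_finite[OF T_finite] not_False_eq_True infinity_ennreal_def)

lemma strongly_measurable_continuous:
 assumes X: "seminormed X" and u: "continuous_in X {0<..<1} u"
 shows "strongly_measurable_in X {0<..<1} u"
 unfolding strongly_measurable_in_def
proof (intro exI conjI allI)
 fix i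
 show "simple_function T (%t. u (grid i t))" by (rule simple_function_compose1[OF grid_simple])
 show "(%t. u (grid i t)) ` {0<..<1} \<subseteq> carr X"
  using u grid_mem unfolding continuous_in_def by blast
next
 show "AE t in T. u t \<in> carr X \<and> (%i. nrm X (%x. u t x - u (grid i t) x)) \<longlonglongrightarrow> 0"
 proof (rule AE_I2)
  fix t assume "t \<in> space T"
  then have t: "t \<in> {0<..<1}" by simp
  have car: "u s \<in> carr X" if "s \<in> {0<..<1}" for s using u that by (simp add: continuous_in_def)
  have "((%s. nrm X (%x. u s x - u t x)) \<longlongrightarrow> nrm X (%x. u t x - u t x)) (at t within {0<..<1})"
   using u t nrm_zero[OF X] by (simp add: continuous_in_def)
  then have "continuous (at t within {0<..<1}) (%s. nrm X (%x. u s x - u t x))"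
   by (simp add: continuous_within)
  from continuous_within_tendsto_compose'[OF this _ grid_tendsto]
  have "(%i. nrm X (%x. u (grid i t) x - u t x)) \<longlonglongrightarrow> nrm X (%x. u t x - u t x)"
   using grid_mem[OF t] by blast
  then show "u t \<in> carr X \<and> (%i. nrm X (%x. u t x - u (grid i t) x)) \<longlonglongrightarrow> 0"
   using car[OF t] nrm_zero[OF X] nrm_diff_commute[OF X car[OF t] car[OF grid_mem[OF t]]] by simp
 qed
qed

lemma strongly_measurable_inE:
 assumes "strongly_measurable_in X S u"
 obtains s where "!!i::nat. simple_function (lebesgue_on S) (s i)" "!!i. s i ` S \<subseteq> carr X"
  "AE t in lebesgue_on S. u t \<in> carr X \<and> (%i. nrm X (%x. u t x - s i t x)) \<longlonglongrightarrow> 0"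
 using assms unfolding strongly_measurable_in_def by blast

lemma strongly_measurable_carr:
 assumes "strongly_measurable_in X S u" shows "AE t in lebesgue_on S. u t \<in> carr X"
proof -
 obtain s :: "nat => _" where "AE t in lebesgue_on S. u t \<in> carr X \<and> (%i. nrm X (%x. u t x - s i t x)) \<longlonglongrightarrow> 0"
  by (rule strongly_measurable_inE[OF assms]) blast
 then show ?thesis by eventually_elim simp
qed

lemma strongly_measurable_nrm:
 assumes X: "seminormed X" and u: "strongly_measurable_in X {0<..<1} u"
 shows "(%t. nrm X (u t)) \<in> borel_measurable T"
proof -
 obtain s where s: "!!i. simple_function T (s i)" "!!i. s i ` {0<..<1} \<subseteq> carr X"
  and ae: "AE t in T. u t \<in> carr X \<and> (%i::nat. nrm X (%x. u t x - s i t x)) \<longlonglongrightarrow> 0"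
  by (rule strongly_measurable_inE[OF u]) blast
 show ?thesis
 proof (rule AE_T_limit_measurable)
  show "(%t. nrm X (s i t)) \<in> borel_measurable T" for i
   by (rule borel_measurable_simple_function[OF simple_function_compose1[OF s(1)]])
  show "AE t in T. (%i. nrm X (s i t)) \<longlonglongrightarrow> nrm X (u t)"
   using ae AE_space
  proof eventually_elim
   fix t assume t: "u t \<in> carr X \<and> (%i. nrm X (%x. u t x - s i t x)) \<longlonglongrightarrow> 0" "t \<in> space T"
   then have car: "s i t \<in> carr X" for i using s(2)[of i] by auto
   have le: "norm (nrm X (s i t) - nrm X (u t)) <= nrm X (%x. u t x - s i t x)" for i
    using nrm_abs_diff_le[OF X conjunct1[OF t(1)] car, of i] by (simp add: abs_minus_commute)
   have "(%i. nrm X (s i t) - nrm X (u t)) \<longlonglongrightarrow> 0"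
    by (rule Lim_null_comparison[OF always_eventually[OF allI[OF le]] conjunct2[OF t(1)]])
   then show "(%i. nrm X (s i t)) \<longlonglongrightarrow> nrm X (u t)" by (simp add: LIM_zero_iff)
  qed
 qed
qed

lemma strongly_measurable_diff:
 assumes X: "seminormed X" and u: "strongly_measurable_in X {0<..<1} u" and v: "strongly_measurable_in X {0<..<1} v"
 shows "strongly_measurable_in X {0<..<1} (%t x. u t x - v t x)"
proof -
 obtain s where s: "!!i. simple_function T (s i)" "!!i. s i ` {0<..<1} \<subseteq> carr X"
  and aes: "AE t in T. u t \<in> carr X \<and> (%i::nat. nrm X (%x. u t x - s i t x)) \<longlonglongrightarrow> 0"
  by (rule strongly_measurable_inE[OF u]) blast
 obtain r where r: "!!i. simple_function T (r i)" "!!i. r i ` {0<..<1} \<subseteq> carr X"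
  and aer: "AE t in T. v t \<in> carr X \<and> (%i::nat. nrm X (%x. v t x - r i t x)) \<longlonglongrightarrow> 0"
  by (rule strongly_measurable_inE[OF v]) blast
 show ?thesis
  unfolding strongly_measurable_in_def
 proof (intro exI conjI allI)
  fix i
  show "simple_function T (%t x. s i t x - r i t x)"
   by (rule simple_function_compose2[OF s(1) r(1), where h="%a b x. a x - b x"])
  show "(%t x. s i t x - r i t x) ` {0<..<1} \<subseteq> carr X"
   using s(2)[of i] r(2)[of i] carr_diff[OF X] by blast
 next
  show "AE t in T. (%x. u t x - v t x) \<in> carr X \<and>
   (%i. nrm X (%x. (u t x - v t x) - (s i t x - r i t x))) \<longlonglongrightarrow> 0"
   using aes aer AE_space
  proof eventually_elim
   fix t assume a: "u t \<in> carr X \<and> (%i. nrm X (%x. u t x - s i t x)) \<longlonglongrightarrow> 0"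
    and b: "v t \<in> carr X \<and> (%i. nrm X (%x. v t x - r i t x)) \<longlonglongrightarrow> 0" and "t \<in> space T"
   then have sr: "s i t \<in> carr X" "r i t \<in> carr X" for i using s(2)[of i] r(2)[of i] by auto
   have d: "(%x. u t x - s i t x) \<in> carr X" "(%x. v t x - r i t x) \<in> carr X" for i
    using a b sr carr_diff[OF X] by blast+
   have "(%i. nrm X (%x. (u t x - s i t x) - (v t x - r i t x))) \<longlonglongrightarrow> 0"
   proof (rule Lim_null_comparison)
    show "(%i. nrm X (%x. u t x - s i t x) + nrm X (%x. v t x - r i t x)) \<longlonglongrightarrow> 0"
     using tendsto_add[OF conjunct2[OF a] conjunct2[OF b]] by (simp only: add_0)
    show "\<forall>\<^sub>F i in sequentially. norm (nrm X (%x. (u t x - s i t x) - (v t x - r i t x)))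
      <= nrm X (%x. u t x - s i t x) + nrm X (%x. v t x - r i t x)"
     using nrm_diff_le[OF X d] nrm_nonneg[OF X carr_diff[OF X d]]
     by (intro always_eventually allI) (simp only: real_norm_def abs_of_nonneg)
   qed
   then show "(%x. u t x - v t x) \<in> carr X \<and>
     (%i. nrm X (%x. (u t x - v t x) - (s i t x - r i t x))) \<longlonglongrightarrow> 0"
    using carr_diff[OF X conjunct1[OF a] conjunct1[OF b]] by (simp add: algebra_simps)
  qed
 qed
qed

lemma strongly_measurable_simple:
 assumes X: "seminormed X" and s: "simple_function T s" "s ` {0<..<1} \<subseteq> carr X"
 shows "strongly_measurable_in X {0<..<1} s"
 unfolding strongly_measurable_in_def using s
 by (intro exI[of _ "%_. s"]) (auto simp: nrm_zero[OF X] intro!: AE_I2)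

lemma Lp_in_2: "Lp_in X 2 {0<..<1} u \<longleftrightarrow> strongly_measurable_in X {0<..<1} u \<and> integrable T (%t. (nrm X (u t))\<^sup>2)"
 if "seminormed X"
proof -
 have "integrable T (%t. nrm X (u t) powr 2) \<longleftrightarrow> integrable T (%t. (nrm X (u t))\<^sup>2)"
  if u: "strongly_measurable_in X {0<..<1} u"
 proof (rule integrable_cong_AE)
  note m = strongly_measurable_nrm[OF \<open>seminormed X\<close> u]
  show "(%t. nrm X (u t) powr 2) \<in> borel_measurable T" "(%t. (nrm X (u t))\<^sup>2) \<in> borel_measurable T"
   using m by auto
  have "AE t in T. u t \<in> carr X" using u by (rule strongly_measurable_carr)
  then show "AE t in T. nrm X (u t) powr 2 = (nrm X (u t))\<^sup>2"
   by eventually_elim (use nrm_nonneg[OF \<open>seminormed X\<close>] in \<open>auto simp: powr_numeral\<close>)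
 qed
 then show ?thesis by (auto simp: Lp_in_def)
qed

lemma Lp_in_2_diff:
 assumes X: "seminormed X" and u: "Lp_in X 2 {0<..<1} u" and v: "Lp_in X 2 {0<..<1} v"
 shows "Lp_in X 2 {0<..<1} (%t x. u t x - v t x)"
proof -
 have s: "strongly_measurable_in X {0<..<1} u" "strongly_measurable_in X {0<..<1} v"
  using u v by (auto simp: Lp_in_def)
 have sm: "strongly_measurable_in X {0<..<1} (%t x. u t x - v t x)"
  by (rule strongly_measurable_diff[OF X s])
 have "integrable T (%t. (nrm X (%x. u t x - v t x))\<^sup>2)"
 proof (rule Bochner_Integration.integrable_bound)
  show "integrable T (%t. 2 * (nrm X (u t))\<^sup>2 + 2 * (nrm X (v t))\<^sup>2)"
   using u v by (simp add: Lp_in_2[OF X])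
  show "(%t. (nrm X (%x. u t x - v t x))\<^sup>2) \<in> borel_measurable T"
   using strongly_measurable_nrm[OF X sm] by simp
  have "AE t in T. u t \<in> carr X" "AE t in T. v t \<in> carr X" by (rule strongly_measurable_carr[OF s(1)], rule strongly_measurable_carr[OF s(2)])
  then show "AE t in T. norm ((nrm X (%x. u t x - v t x))\<^sup>2) <= norm (2 * (nrm X (u t))\<^sup>2 + 2 * (nrm X (v t))\<^sup>2)"
  proof eventually_elim
   fix t assume c: "u t \<in> carr X" "v t \<in> carr X"
   have "(nrm X (%x. u t x - v t x))\<^sup>2 <= (nrm X (u t) + nrm X (v t))\<^sup>2"
    using nrm_diff_le[OF X c] nrm_nonneg[OF X carr_diff[OF X c]] by (intro power_mono)
   also have "\<dots> <= 2 * (nrm X (u t))\<^sup>2 + 2 * (nrm X (v t))\<^sup>2"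
    using sum_squares_bound[of "nrm X (u t)" "nrm X (v t)"] by (simp add: power2_sum)
   finally show "norm ((nrm X (%x. u t x - v t x))\<^sup>2) <= norm (2 * (nrm X (u t))\<^sup>2 + 2 * (nrm X (v t))\<^sup>2)" by simp
  qed
 qed
 then show ?thesis using sm by (simp add: Lp_in_2[OF X])
qed

lemma continuous_in_subset: "continuous_in X S u ==> R \<subseteq> S ==> continuous_in X R u"
 unfolding continuous_in_def by (meson subsetD tendsto_within_subset)

lemma continuous_in_nrm:
 assumes X: "seminormed X" and u: "continuous_in X S u"
 shows "continuous_on S (%t. nrm X (u t))"
 unfolding continuous_on_def
proof
 fix t assume t: "t \<in> S"
 have "((%s. nrm X (u s) - nrm X (u t)) \<longlongrightarrow> 0) (at t within S)"
 proof (rule Lim_null_comparison)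
  show "((%s. nrm X (%x. u s x - u t x)) \<longlongrightarrow> 0) (at t within S)" using u t by (simp add: continuous_in_def)
  show "\<forall>\<^sub>F s in at t within S. norm (nrm X (u s) - nrm X (u t)) <= nrm X (%x. u s x - u t x)"
   using u t nrm_abs_diff_le[OF X] unfolding continuous_in_def eventually_at_filter by (auto intro!: always_eventually)
 qed
 then show "((%s. nrm X (u s)) \<longlongrightarrow> nrm X (u t)) (at t within S)" by (simp add: LIM_zero_iff)
qed

lemma Lp_in_continuous:
 assumes X: "seminormed X" and u: "continuous_in X {0..1} u" and p: "0 < p"
 shows "Lp_in X p {0<..<1} u"
proof -
 have sm: "strongly_measurable_in X {0<..<1} u"
  by (rule strongly_measurable_continuous[OF X continuous_in_subset[OF u]]) auto
 have "compact ((%t. nrm X (u t)) ` {0..1})"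
  by (intro compact_continuous_image continuous_in_nrm[OF X u]) simp
 then obtain B where B: "!!t. t \<in> {0..1} ==> norm (nrm X (u t)) <= B"
  using compact_imp_bounded[of "(%t. nrm X (u t)) ` {0..1}"] unfolding bounded_iff by blast
 have "integrable T (%t. nrm X (u t) powr p)"
 proof (rule finite_measure.integrable_const_bound[OF T_finite, where B="B powr p"])
  show "(%t. nrm X (u t) powr p) \<in> borel_measurable T" using strongly_measurable_nrm[OF X sm] by simp
  show "AE t in T. norm (nrm X (u t) powr p) <= B powr p"
   using B u nrm_nonneg[OF X] p by (intro AE_I2) (auto simp: continuous_in_def intro!: powr_mono2)
 qed
 then show ?thesis using sm by (simp add: Lp_in_def)
qed

lemma integral_compact_support_derivative:
 fixes F :: "real => complex"
 assumes der: "!!t. t \<in> {0<..<1} ==> (F has_vector_derivative f t) (at t)"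
  and cont: "continuous_on {0<..<1} f" and ab: "0 < a" "a <= b" "b < 1"
  and zero: "!!t. t <= a \<or> b <= t ==> F t = 0 \<and> f t = 0"
 shows "(LINT t|T. f t) = 0"
proof -
 have hi: "(f has_integral F b - F a) {a..b}"
 proof (rule fundamental_theorem_of_calculus[OF ab(2)])
  fix t assume "t \<in> {a..b}"
  then have "t \<in> {0<..<1}" using ab by auto
  from has_vector_derivative_at_within[OF der[OF this]]
  show "(F has_vector_derivative f t) (at t within {a..b})" .
 qed
 have sub: "{a..b} \<subseteq> {0<..<1}" using ab by auto
 have ai: "f absolutely_integrable_on {a..b}"
  using absolutely_integrable_continuous_real[OF continuous_on_subset[OF cont sub]] .
 have int: "integrable (lebesgue_on {a..b}) f"
  using ai by (simp add: absolutely_integrable_imp_integrable)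
 have "(LINT t|T. f t) = integral\<^sup>L lebesgue (%t. if t \<in> {0<..<1} then f t else 0)"
  by (rule Lebesgue_Measure.integral_restrict_UNIV[symmetric]) simp
 also have "(%t. if t \<in> {0<..<1} then f t else 0) = (%t. if t \<in> {a..b} then f t else 0)"
 proof (rule ext)
  fix t show "(if t \<in> {0<..<1} then f t else 0) = (if t \<in> {a..b} then f t else 0)"
  proof (cases "t \<in> {a..b}")
   case True
   then have "t \<in> {0<..<1}" using sub by blast
   then show ?thesis using True by (simp only: if_True)
  next
   case False
   then have "f t = 0" using zero[of t] by auto
   then show ?thesis by simp
  qed
 qed
 also have "integral\<^sup>L lebesgue \<dots> = integral\<^sup>L (lebesgue_on {a..b}) f"
  by (rule Lebesgue_Measure.integral_restrict_UNIV) simp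
 also have "\<dots> = integral {a..b} f"
  by (rule lebesgue_integral_eq_integral[OF int]) simp
 also have "\<dots> = F b - F a" using hi by (rule integral_unique)
 finally show ?thesis using zero by simp
qed

lemma test_functions_interval:
 fixes \<phi> :: "real => real"
 assumes "\<phi> \<in> test_functions {0<..<1}"
 obtains a b where "0 < a" "a < b" "b < 1" "!!t. t <= a \<or> b <= t ==> \<phi> t = 0" "!!t. t <= a \<or> b <= t ==> deriv \<phi> t = 0"
  "smooth \<phi>"
proof -
 obtain K where K: "smooth \<phi>" "compact K" "K \<subseteq> {0<..<1}" "!!t. t \<notin> K ==> \<phi> t = 0"
   "!!t. t \<notin> K ==> frechet_derivative \<phi> (at t) = (%_. 0)"
  by (rule test_functionsE[OF assms]) blast
 have d0: "deriv \<phi> t = 0" if "t \<notin> K" for t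
 proof -
  have "frechet_derivative \<phi> (at t) = (%h. deriv \<phi> t * h)"
   using frechet_derivative_at[OF smooth_has_real_derivative[OF K(1), of t, THEN has_field_derivative_imp_has_derivative]]
   by simp
  then have "(%h. deriv \<phi> t * h) = (%_. 0)" using K(5)[OF that] by simp
  from fun_cong[OF this, of 1] show ?thesis by simp
 qed
 have "\<exists>a b. 0 < a \<and> a < b \<and> b < 1 \<and> K \<subseteq> {a<..<b}"
 proof (cases "K = {}")
  case True
  then show ?thesis by (intro exI[of _ "1/3"] exI[of _ "2/3"]) auto
 next
  case False
  obtain p where p: "p \<in> K" "!!t. t \<in> K ==> p <= t" using compact_attains_inf[OF K(2) False] by blast
  obtain q where q: "q \<in> K" "!!t. t \<in> K ==> t <= q" using compact_attains_sup[OF K(2) False] by blast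
  have pq: "0 < p" "q < 1" "p <= q" using p q K(3) by auto
  have "K \<subseteq> {p/2<..<(1+q)/2}"
  proof
   fix t assume "t \<in> K"
   then show "t \<in> {p/2<..<(1+q)/2}" using p(2)[of t] q(2)[of t] pq by auto
  qed
  then show ?thesis using pq by (intro exI[of _ "p/2"] exI[of _ "(1+q)/2"]) auto
 qed
 then obtain a b where ab: "0 < a" "a < b" "b < 1" "K \<subseteq> {a<..<b}" by blast
 have out: "t \<notin> K" if "t <= a \<or> b <= t" for t using ab(4) that by auto
 show ?thesis
 proof (rule that[OF ab(1-3) _ _ K(1)])
  show "\<phi> t = 0" "deriv \<phi> t = 0" if "t <= a \<or> b <= t" for t
   using K(4)[OF out[OF that]] d0[OF out[OF that]] by simp_all
 qed
qed

context bounded_open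
begin

lemma continuous_in_L2:
 assumes meas: "!!t. t \<in> S ==> f t \<in> meas"
  and cont: "!!x. x \<in> \<Omega> ==> continuous_on S (%t. f t x)"
  and bnd: "!!t. t \<in> S ==> \<exists>e>0. \<exists>C. \<forall>s\<in>S. \<bar>s - t\<bar> < e \<longrightarrow> (\<forall>x\<in>\<Omega>. cmod (f s x) <= C)"
 shows "continuous_in HH S f"
 unfolding continuous_in_def L2_carr L2_nrm
proof (intro conjI ballI)
 fix t assume t: "t \<in> S"
 obtain e C where e: "0 < e" and C: "!!s x. s \<in> S ==> \<bar>s - t\<bar> < e ==> x \<in> \<Omega> ==> cmod (f s x) <= C"
  using bnd[OF t] by blast
 show "sqint M (f t)" by (rule sqint_bounded(1)[OF meas[OF t], of C]) (use C[OF t] e in auto)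
 have "((%s. l2norm M (%x. f s x - f t x)) \<longlongrightarrow> 0) (at t within (S \<inter> ball t e))"
 proof (rule l2norm_dominated_at)
  show "(%x. f s x - f t x) \<in> meas" if "s \<in> S \<inter> ball t e" for s
   using that t meas by (intro borel_measurable_diff) auto
  show "cmod (f s x - f t x) <= C + C" if "s \<in> S \<inter> ball t e" "x \<in> \<Omega>" for s x
   using that t e C[of s x] C[of t x] by (intro norm_triangle_le_diff add_mono) (auto simp: dist_real_def abs_minus_commute)
  show "((%s. f s x - f t x) \<longlongrightarrow> 0) (at t within S \<inter> ball t e)" if "x \<in> \<Omega>" for x
  proof -
   have "((%s. f s x) \<longlongrightarrow> f t x) (at t within S)" using cont[OF that] t by (simp add: continuous_on_def)
   then have "((%s. f s x) \<longlongrightarrow> f t x) (at t within S \<inter> ball t e)" by (rule tendsto_within_subset) auto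
   then show ?thesis by (simp add: LIM_zero)
  qed
 qed
 then show "((%s. l2norm M (%x. f s x - f t x)) \<longlongrightarrow> 0) (at t within S)"
  by (subst at_within_nhd[of t "ball t e" S "S \<inter> ball t e"]) (use e in auto)
qed

lemma continuous_in_Hm1:
 assumes "continuous_in HH S f"
 shows "continuous_in VV' S (%t. emb (f t))"
 unfolding continuous_in_def
proof (intro conjI ballI)
 have sq: "sqint M (f t)" if "t \<in> S" for t using assms that by (simp add: continuous_in_def L2_carr)
 fix t assume t: "t \<in> S"
 show "emb (f t) \<in> carr VV'" by (rule embed_H_antidual[OF sq[OF t]])
 show "((%s. nrm VV' (%w. emb (f s) w - emb (f t) w)) \<longlongrightarrow> 0) (at t within S)"
 proof (rule Lim_null_comparison)
  show "((%s. l2norm M (%x. f s x - f t x)) \<longlongrightarrow> 0) (at t within S)"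
   using assms t by (simp add: continuous_in_def L2_nrm)
  show "\<forall>\<^sub>F s in at t within S. norm (nrm VV' (%w. emb (f s) w - emb (f t) w)) <= l2norm M (%x. f s x - f t x)"
   unfolding eventually_at_filter
  proof (intro always_eventually allI impI)
   fix s assume s: "s \<in> S"
   have d: "sqint M (%x. f s x - f t x)" by (rule sqint_diff[OF sq[OF s] sq[OF t]])
   have "nrm VV' (%w. emb (f s) w - emb (f t) w) = nrm VV' (emb (%x. f s x - f t x))"
    by (rule nrm_Hm1_cong) (simp add: embed_H_diff sq s t H10_sqint)
   then show "norm (nrm VV' (%w. emb (f s) w - emb (f t) w)) <= l2norm M (%x. f s x - f t x)"
    using embed_H_nrm_le[OF d] nrm_nonneg[OF seminormed_Hm1 embed_H_antidual[OF d]] by simp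
  qed
 qed
qed

text \<open>The sums over the midpoints of a partition converge pointwise in space by dominated convergence in time, and then
in \<open>L2\<close> by dominated convergence in space.\<close>

lemma bochner_integral_L2:
 assumes meas: "!!t. t \<in> {0<..<1} ==> f t \<in> meas"
  and cont: "!!x. x \<in> \<Omega> ==> continuous_on {0<..<1} (%t. f t x)"
  and bnd: "!!t x. t \<in> {0<..<1} ==> x \<in> \<Omega> ==> cmod (f t x) <= C"
 shows "has_bochner_integral_in HH {0<..<1} f (%x. LINT t|T. f t x)"
proof -
 have sm: "strongly_measurable_in HH {0<..<1} f"
  using meas cont bnd by (intro strongly_measurable_continuous seminormed_L2 continuous_in_L2 exI[of _ 1]) (auto intro!: exI[of _ C])
 define S where "S i t = f (grid i t)" for i t
 have Ssimple: "simple_function T (S i)" for i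
  unfolding S_def by (rule simple_function_compose1[OF grid_simple])
 have ft: "sqint M (f t)" if "t \<in> {0<..<1}" for t by (rule sqint_bounded(1)[OF meas[OF that] bnd[OF that]])
 have Scarr: "S i ` {0<..<1} \<subseteq> carr HH" for i
  using ft grid_mem by (auto simp: S_def L2_carr)
 have Slim: "(%i. S i t x) \<longlonglongrightarrow> f t x" if t: "t \<in> {0<..<1}" and x: "x \<in> \<Omega>" for t x
  unfolding S_def
  using continuous_on_tendsto_compose[OF cont[OF x] grid_tendsto t] grid_mem[OF t] by simp
 have approx: "(%i. \<integral>\<^sup>+t. ennreal (nrm HH (%x. f t x - S i t x)) \<partial>T) \<longlonglongrightarrow> (\<integral>\<^sup>+t. 0 \<partial>T)"
 proof (rule nn_integral_dominated_convergence[where w="%_. ennreal (\<bar>2 * C\<bar> * sqrt (measure M \<Omega>))"])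
  show "(%t. ennreal (nrm HH (%x. f t x - S i t x))) \<in> borel_measurable T" for i
   by (intro measurable_compose[OF _ measurable_ennreal] strongly_measurable_nrm[OF seminormed_L2]
     strongly_measurable_diff seminormed_L2 sm strongly_measurable_simple Ssimple Scarr)
  show "(\<integral>\<^sup>+t. ennreal (\<bar>2 * C\<bar> * sqrt (measure M \<Omega>)) \<partial>T) < \<infinity>"
   using finite_measure.emeasure_finite[OF T_finite, of "space T"]
   by (simp add: ennreal_mult_less_top less_top)
  have b: "cmod (f t x - S i t x) <= 2 * C" if "t \<in> {0<..<1}" "x \<in> \<Omega>" for t x i
   using norm_triangle_ineq4[of "f t x" "S i t x"] bnd[OF that] bnd[OF grid_mem[OF that(1)] that(2), of i]
   by (simp add: S_def)
  have m: "(%x. f t x - S i t x) \<in> meas" if "t \<in> {0<..<1}" for t i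
   unfolding S_def by (intro borel_measurable_diff meas grid_mem that)
  show "AE t in T. ennreal (nrm HH (%x. f t x - S i t x)) <= ennreal (\<bar>2 * C\<bar> * sqrt (measure M \<Omega>))" for i
   using sqint_bounded(2)[OF m b] by (intro AE_I2 ennreal_leI) (auto simp: L2_nrm)
  show "AE t in T. (%i. ennreal (nrm HH (%x. f t x - S i t x))) \<longlonglongrightarrow> 0"
  proof (rule AE_I2)
   fix t assume "t \<in> space T"
   then have t: "t \<in> {0<..<1}" by simp
   have "(%i. l2norm M (%x. f t x - S i t x)) \<longlonglongrightarrow> 0"
   proof (rule l2norm_dominated[where C="2*C", OF m[OF t] b[OF t]])
    show "(%i. f t x - S i t x) \<longlonglongrightarrow> 0" if "x \<in> \<Omega>" for x
     using tendsto_diff[OF tendsto_const[of "f t x"] Slim[OF t that]] by simp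
   qed
   then show "(%i. ennreal (nrm HH (%x. f t x - S i t x))) \<longlonglongrightarrow> 0"
    unfolding L2_nrm using tendsto_ennrealI by fastforce
  qed
 qed auto
 define y where "y x = (LINT t|T. f t x)" for x
 define z where "z i x = Bochner_Integration.simple_bochner_integral T (%t. S i t x)" for i x
 have z_sum: "z i x = (\<Sum>g\<in>grid i ` space T. measure T {t\<in>space T. grid i t = g} *\<^sub>R f g x)" for i x
  unfolding z_def
  by (rule Bochner_Integration.simple_bochner_integral_partition[OF simple_bochner_integrable_T[OF simple_function_compose1[OF Ssimple]] grid_simple])
   (auto simp: S_def)
 have z_meas: "z i \<in> meas" for i
  unfolding z_sum[abs_def] using grid_mem
  by (intro borel_measurable_sum borel_measurable_scaleR borel_measurable_const meas) auto
 have z_int: "z i x = (LINT t|T. S i t x)" for i x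
  unfolding z_def
  by (rule Bochner_Integration.simple_bochner_integrable_eq_integral[OF simple_bochner_integrable_T[OF simple_function_compose1[OF Ssimple]]])
 have fm: "(%t. f t x) \<in> borel_measurable T" if "x \<in> \<Omega>" for x
  by (rule continuous_imp_measurable_on_sets_lebesgue[OF cont[OF that]]) simp
 have T1: "measure T (space T) = 1" using measure_T by simp
 have zlim: "(%i. z i x) \<longlonglongrightarrow> y x" if x: "x \<in> \<Omega>" for x
  unfolding z_int y_def
 proof (rule integral_dominated_convergence[where w="%_. C"])
  show "(%t. S i t x) \<in> borel_measurable T" for i
   by (intro borel_measurable_simple_function simple_function_compose1[OF Ssimple])
  show "integrable T (%_. C)" by (rule finite_measure.integrable_const[OF T_finite])
  show "AE t in T. norm (S i t x) <= C" for i
   using bnd[OF grid_mem x] by (intro AE_I2) (auto simp: S_def)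
 qed (use Slim x fm in \<open>auto intro!: AE_I2\<close>)
 have zb: "cmod (z i x) <= \<bar>C\<bar>" if x: "x \<in> \<Omega>" for i x
 proof -
  have "cmod (z i x) <= (LINT t|T. cmod (S i t x))" unfolding z_int by (rule integral_norm_bound)
  also have "\<dots> <= (LINT t|T. \<bar>C\<bar>)"
  proof (rule integral_mono_AE)
   show "integrable T (%t. cmod (S i t x))"
   proof (rule finite_measure.integrable_const_bound[OF T_finite, where B=C])
    show "(%t. cmod (S i t x)) \<in> borel_measurable T"
     by (rule borel_measurable_simple_function[OF simple_function_compose1[OF Ssimple]])
    show "AE t in T. norm (cmod (S i t x)) <= C"
     using bnd[OF grid_mem x] by (intro AE_I2) (auto simp: S_def)
   qed
   show "AE t in T. cmod (S i t x) <= \<bar>C\<bar>"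
    using order_trans[OF bnd[OF grid_mem x] abs_ge_self] by (intro AE_I2) (auto simp: S_def)
  qed (rule finite_measure.integrable_const[OF T_finite])
  also have "\<dots> = \<bar>C\<bar>" using T1 by simp
  finally show ?thesis .
 qed
 have y_meas: "y \<in> meas"
  by (rule borel_measurable_LIMSEQ_metric[where f=z, OF z_meas]) (simp add: zlim)
 have yb: "cmod (y x) <= \<bar>C\<bar>" if x: "x \<in> \<Omega>" for x
  using tendsto_norm[OF zlim[OF x]] by (rule Lim_bounded) (use zb[OF x] in auto)
 have ysq: "sqint M y" by (rule sqint_bounded(1)[OF y_meas yb])
 have "(%i. l2norm M (%x. z i x - y x)) \<longlonglongrightarrow> 0"
 proof (rule l2norm_dominated[where C="2 * \<bar>C\<bar>"])
  show "(%x. z i x - y x) \<in> meas" for i using z_meas y_meas by (rule borel_measurable_diff)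
  show "cmod (z i x - y x) <= 2 * \<bar>C\<bar>" if "x \<in> \<Omega>" for i x
   using norm_triangle_ineq4[of "z i x" "y x"] zb[OF that, of i] yb[OF that] by simp
  show "(%i. z i x - y x) \<longlonglongrightarrow> 0" if "x \<in> \<Omega>" for x using zlim[OF that] by (simp add: LIM_zero)
 qed
 then show ?thesis
  unfolding has_bochner_integral_in_def y_def[symmetric]
  using sm ysq approx Ssimple Scarr
  by (intro conjI exI[of _ S]) (auto simp: L2_carr L2_nrm z_def)
qed

text \<open>The embedding is linear and does not increase norms, so it maps approximating simple functions to approximating
simple functions.\<close>

lemma bochner_integral_Hm1:
 assumes "has_bochner_integral_in HH {0<..<1} f y"
 shows "has_bochner_integral_in VV' {0<..<1} (%t. emb (f t)) (emb y)"
proof -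
 obtain s where s: "!!i. simple_function T (s i)" "!!i. s i ` {0<..<1} \<subseteq> carr HH"
  and lim: "(%i::nat. \<integral>\<^sup>+t. ennreal (nrm HH (%x. f t x - s i t x)) \<partial>T) \<longlonglongrightarrow> 0"
  and int: "(%i. nrm HH (%x. Bochner_Integration.simple_bochner_integral T (%t. s i t x) - y x)) \<longlonglongrightarrow> 0"
  and sm: "strongly_measurable_in HH {0<..<1} f" and y: "sqint M y"
  using assms unfolding has_bochner_integral_in_def L2_carr by blast
 have le: "nrm VV' (%w. emb h w - emb k w) <= nrm HH (%x. h x - k x)"
  "0 <= nrm VV' (%w. emb h w - emb k w)"
  if h: "sqint M h" and k: "sqint M k" for h k
 proof -
  have "nrm VV' (%w. emb h w - emb k w) = nrm VV' (emb (%x. h x - k x))"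
   by (rule nrm_Hm1_cong) (simp add: embed_H_diff h k H10_sqint)
  then show "nrm VV' (%w. emb h w - emb k w) <= nrm HH (%x. h x - k x)"
   using embed_H_nrm_le[OF sqint_diff[OF h k]] by (simp add: L2_nrm)
  show "0 <= nrm VV' (%w. emb h w - emb k w)"
   by (intro nrm_nonneg[OF seminormed_Hm1] carr_diff[OF seminormed_Hm1] embed_H_antidual h k)
 qed
 have es: "simple_function T (%t. emb (s i t))" for i by (rule simple_function_compose1[OF s(1)])
 have ec: "(%t. emb (s i t)) ` {0<..<1} \<subseteq> carr VV'" for i
  using s(2)[of i] embed_H_antidual by (auto simp: L2_carr)
 have st: "sqint M (s i t)" if "t \<in> {0<..<1}" for i t
  using s(2)[of i] that unfolding L2_carr[symmetric] by blast
 have fae: "AE t in T. sqint M (f t)"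
  using strongly_measurable_carr[OF sm] by (simp add: L2_carr)
 have sm': "strongly_measurable_in VV' {0<..<1} (%t. emb (f t))"
 proof -
  obtain r where r: "!!i. simple_function T (r i)" "!!i. r i ` {0<..<1} \<subseteq> carr HH"
   and aer: "AE t in T. f t \<in> carr HH \<and> (%i::nat. nrm HH (%x. f t x - r i t x)) \<longlonglongrightarrow> 0"
   by (rule strongly_measurable_inE[OF sm]) blast
  show ?thesis
   unfolding strongly_measurable_in_def
  proof (intro exI conjI allI)
   fix i
   show "simple_function T (%t. emb (r i t))" by (rule simple_function_compose1[OF r(1)])
   show "(%t. emb (r i t)) ` {0<..<1} \<subseteq> carr VV'"
    using r(2)[of i] embed_H_antidual by (auto simp: L2_carr)
  next
   show "AE t in T. emb (f t) \<in> carr VV' \<and>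
     (%i. nrm VV' (%w. emb (f t) w - emb (r i t) w)) \<longlonglongrightarrow> 0"
    using aer AE_space
   proof eventually_elim
    fix t assume t: "f t \<in> carr HH \<and> (%i. nrm HH (%x. f t x - r i t x)) \<longlonglongrightarrow> 0" "t \<in> space T"
    have rt: "sqint M (r i t)" for i
     unfolding L2_carr[symmetric] using r(2)[of i] t(2) by auto
    have ft: "sqint M (f t)" using t by (simp add: L2_carr)
    have "(%i. nrm VV' (%w. emb (f t) w - emb (r i t) w)) \<longlonglongrightarrow> 0"
     using le[OF ft rt]
     by (intro Lim_null_comparison[OF always_eventually conjunct2[OF t(1)]] allI) (simp only: real_norm_def abs_of_nonneg)
    then show "emb (f t) \<in> carr VV' \<and>
     (%i. nrm VV' (%w. emb (f t) w - emb (r i t) w)) \<longlonglongrightarrow> 0"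
     using embed_H_antidual[OF ft] by simp
   qed
  qed
 qed
 have lim': "(%i. \<integral>\<^sup>+t. ennreal (nrm VV' (%w. emb (f t) w - emb (s i t) w)) \<partial>T) \<longlonglongrightarrow> 0"
 proof (rule tendsto_sandwich[OF _ _ tendsto_const lim])
  show "\<forall>\<^sub>F i in sequentially. (\<integral>\<^sup>+t. ennreal (nrm VV' (%w. emb (f t) w - emb (s i t) w)) \<partial>T)
    <= (\<integral>\<^sup>+t. ennreal (nrm HH (%x. f t x - s i t x)) \<partial>T)"
  proof (rule always_eventually, rule allI, rule nn_integral_mono_AE)
   fix i
   show "AE t in T. ennreal (nrm VV' (%w. emb (f t) w - emb (s i t) w))
     <= ennreal (nrm HH (%x. f t x - s i t x))"
    using fae AE_space by eventually_elim (auto intro!: ennreal_leI le st)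
  qed
 qed auto
 define z where "z i x = Bochner_Integration.simple_bochner_integral T (%t. s i t x)" for i x
 have z_sum: "z i x = (\<Sum>h\<in>s i ` space T. measure T {t\<in>space T. s i t = h} *\<^sub>R h x)" for i x
  unfolding z_def
  by (rule Bochner_Integration.simple_bochner_integral_partition[OF simple_bochner_integrable_T[OF simple_function_compose1[OF s(1)]] s(1)]) auto
 have hs: "sqint M h" if "h \<in> s i ` space T" for h i using that st by auto
 have z_sq: "sqint M (z i)" for i
  unfolding z_sum[abs_def] L2_carr[symmetric]
  by (intro carr_sum[OF seminormed_L2] carr_scaleR[OF seminormed_L2] hs[folded L2_carr])
 have z_embed: "Bochner_Integration.simple_bochner_integral T (%t. emb (s i t) w) = emb (z i) w" if w: "w \<in> carr VV" for i w
 proof -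
  have "Bochner_Integration.simple_bochner_integral T (%t. emb (s i t) w) =
    (\<Sum>h\<in>s i ` space T. measure T {t\<in>space T. s i t = h} *\<^sub>R emb h w)"
   by (rule Bochner_Integration.simple_bochner_integral_partition[OF simple_bochner_integrable_T[OF simple_function_compose1[OF s(1)]] s(1)]) auto
  also have "\<dots> = (\<Sum>h\<in>s i ` space T. LINT x|M. measure T {t\<in>space T. s i t = h} *\<^sub>R (h x * cnj (w x)))"
   by (simp add: embed_H_def)
  also have "\<dots> = (LINT x|M. (\<Sum>h\<in>s i ` space T. measure T {t\<in>space T. s i t = h} *\<^sub>R (h x * cnj (w x))))"
   by (rule Bochner_Integration.integral_sum[symmetric])
    (intro integrable_scaleR_right embed_H_integrable hs H10_sqint w, assumption)
  also have "\<dots> = emb (z i) w"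
   by (simp add: embed_H_def z_sum sum_distrib_right)
  finally show ?thesis .
 qed
 have "(%i. nrm VV' (%w. Bochner_Integration.simple_bochner_integral T (%t. emb (s i t) w) - emb y w)) \<longlonglongrightarrow> 0"
 proof (rule Lim_null_comparison[OF _ int])
  have eq: "nrm VV' (%w. Bochner_Integration.simple_bochner_integral T (%t. emb (s i t) w) - emb y w)
    = nrm VV' (%w. emb (z i) w - emb y w)" for i
   by (rule nrm_Hm1_cong) (simp add: z_embed)
  show "\<forall>\<^sub>F i in sequentially. norm (nrm VV' (%w. Bochner_Integration.simple_bochner_integral T (%t. emb (s i t) w) - emb y w))
    <= nrm HH (%x. Bochner_Integration.simple_bochner_integral T (%t. s i t x) - y x)"
   unfolding eq using le[OF z_sq y] by (intro always_eventually) (auto simp: z_def)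
 qed
 then show ?thesis
  unfolding has_bochner_integral_in_def using sm' embed_H_antidual[OF y] es ec lim'
  by (intro conjI exI[of _ "%i t. emb (s i t)"]) auto
qed

text \<open>Integration by parts at every point of space. Bounds are needed only on compact time intervals, because the
test function has compact support; so the derivative may blow up at the final time.\<close>

lemma weak_derivative_L2:
 fixes u u' :: "real => real^'n => complex"
 assumes der: "!!t x. t \<in> {0<..<1} ==> x \<in> \<Omega> ==> ((%t. u t x) has_vector_derivative u' t x) (at t)"
  and meas: "!!t. t \<in> {0<..<1} ==> u t \<in> meas" "!!t. t \<in> {0<..<1} ==> u' t \<in> meas"
  and cont: "!!x. x \<in> \<Omega> ==> continuous_on {0<..<1} (%t. u' t x)"
  and bnd: "!!a b. 0 < a ==> b < 1 ==> \<exists>C. \<forall>t\<in>{a..b}. \<forall>x\<in>\<Omega>. cmod (u t x) <= C \<and> cmod (u' t x) <= C"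
  and phi: "\<phi> \<in> test_functions {0<..<1}"
 shows "\<exists>y. has_bochner_integral_in HH {0<..<1} (%t x. deriv \<phi> t *\<^sub>R u t x) y \<and>
   has_bochner_integral_in HH {0<..<1} (%t x. \<phi> t *\<^sub>R u' t x) (%x. - y x)"
proof -
 obtain a b where ab: "0 < a" "a < b" "b < 1" and z: "!!t. t <= a \<or> b <= t ==> \<phi> t = 0" "!!t. t <= a \<or> b <= t ==> deriv \<phi> t = 0"
  and sm: "smooth \<phi>"
  by (rule test_functions_interval[OF phi]) blast
 obtain C where C: "!!t x. t \<in> {a..b} ==> x \<in> \<Omega> ==> cmod (u t x) <= C \<and> cmod (u' t x) <= C"
  using bnd[OF ab(1,3)] by blast
 have "compact (\<phi> ` {a..b})" "compact (deriv \<phi> ` {a..b})"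
  using sm by (auto intro!: compact_continuous_image smooth_continuous smooth_deriv)
 then obtain B1 B2 where B: "!!t. t \<in> {a..b} ==> norm (\<phi> t) <= B1" "!!t. t \<in> {a..b} ==> norm (deriv \<phi> t) <= B2"
  using compact_imp_bounded[of "\<phi> ` {a..b}"] compact_imp_bounded[of "deriv \<phi> ` {a..b}"] unfolding bounded_iff by (metis imageI)
 define B where "B = \<bar>B1\<bar> + \<bar>B2\<bar>"
 have B': "\<bar>\<phi> t\<bar> <= B" "\<bar>deriv \<phi> t\<bar> <= B" for t
  using B[of t] z[of t] by (cases "t \<in> {a..b}"; force simp: B_def)+
 have cu: "continuous_on {0<..<1} (%t. u t x)" if "x \<in> \<Omega>" for x
  using der[OF _ that] by (intro continuous_at_imp_continuous_on ballI has_vector_derivative_continuous) blast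
 have c1: "continuous_on {0<..<1} (%t. deriv \<phi> t *\<^sub>R u t x)" if "x \<in> \<Omega>" for x
  by (intro continuous_on_scaleR cu that smooth_continuous smooth_deriv sm)
 have c2: "continuous_on {0<..<1} (%t. \<phi> t *\<^sub>R u' t x)" if "x \<in> \<Omega>" for x
  by (intro continuous_on_scaleR cont that smooth_continuous sm)
 have b1: "cmod (deriv \<phi> t *\<^sub>R u t x) <= B * \<bar>C\<bar>" if "x \<in> \<Omega>" for t x
 proof (cases "t \<in> {a..b}")
  case True
  have "cmod (u t x) <= \<bar>C\<bar>" by (rule order_trans[OF conjunct1[OF C[OF True that]] abs_ge_self])
  then show ?thesis using B'(2)[of t] by (simp add: mult_mono)
 qed (use z(2)[of t] B'(2)[of t] in auto)
 have b2: "cmod (\<phi> t *\<^sub>R u' t x) <= B * \<bar>C\<bar>" if "x \<in> \<Omega>" for t x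
 proof (cases "t \<in> {a..b}")
  case True
  have "cmod (u' t x) <= \<bar>C\<bar>" by (rule order_trans[OF conjunct2[OF C[OF True that]] abs_ge_self])
  then show ?thesis using B'(1)[of t] by (simp add: mult_mono)
 qed (use z(1)[of t] B'(1)[of t] in auto)
 have i1: "has_bochner_integral_in HH {0<..<1} (%t x. deriv \<phi> t *\<^sub>R u t x) (%x. LINT t|T. deriv \<phi> t *\<^sub>R u t x)"
  by (rule bochner_integral_L2[OF _ c1 b1]) (use meas in auto)
 have i2: "has_bochner_integral_in HH {0<..<1} (%t x. \<phi> t *\<^sub>R u' t x) (%x. LINT t|T. \<phi> t *\<^sub>R u' t x)"
  by (rule bochner_integral_L2[OF _ c2 b2]) (use meas in auto)
 have eq: "(LINT t|T. \<phi> t *\<^sub>R u' t x) = - (LINT t|T. deriv \<phi> t *\<^sub>R u t x)" if x: "x \<in> \<Omega>" for x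
 proof -
  have int: "integrable T (%t. deriv \<phi> t *\<^sub>R u t x)" "integrable T (%t. \<phi> t *\<^sub>R u' t x)"
   using b1[OF x] b2[OF x] c1[OF x] c2[OF x]
   by (auto intro!: finite_measure.integrable_const_bound[OF T_finite, where B="B * \<bar>C\<bar>"] AE_I2
     continuous_imp_measurable_on_sets_lebesgue)
  have "(LINT t|T. \<phi> t *\<^sub>R u' t x + deriv \<phi> t *\<^sub>R u t x) = 0"
  proof (rule integral_compact_support_derivative[where F="%t. \<phi> t *\<^sub>R u t x" and a=a and b=b])
   fix t :: real assume t: "t \<in> {0<..<1}"
   have "(\<phi> has_field_derivative deriv \<phi> t) (at t)" by (rule smooth_has_real_derivative[OF sm])
   from has_vector_derivative_scaleR[OF this der[OF t x]]
   show "((%t. \<phi> t *\<^sub>R u t x) has_vector_derivative \<phi> t *\<^sub>R u' t x + deriv \<phi> t *\<^sub>R u t x) (at t)" .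
  qed (use ab z c1[OF x] c2[OF x] in \<open>auto intro!: continuous_on_add\<close>)
  then show ?thesis using int by (simp add: add_eq_0_iff)
 qed
 have i2': "has_bochner_integral_in HH {0<..<1} (%t x. \<phi> t *\<^sub>R u' t x) (%x. - (LINT t|T. deriv \<phi> t *\<^sub>R u t x))"
 proof -
  have sp: "space M = \<Omega>" by simp
  have ysq: "sqint M (%x. - (LINT t|T. deriv \<phi> t *\<^sub>R u t x))"
   using i1 l2norm_cmult(1)[of M _ "-1"] by (simp add: has_bochner_integral_in_def L2_carr)
  have nrm_eq: "nrm HH (%x. h x - (LINT t|T. \<phi> t *\<^sub>R u' t x)) = nrm HH (%x. h x - - (LINT t|T. deriv \<phi> t *\<^sub>R u t x))" for h
   unfolding L2_nrm l2norm_def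
   by (intro arg_cong[where f=sqrt] Bochner_Integration.integral_cong refl) (simp add: eq)
  show ?thesis using i2 ysq unfolding has_bochner_integral_in_def nrm_eq by (simp add: L2_carr)
 qed
 show ?thesis using i1 i2' by blast
qed

end

section \<open>Uniqueness of the variational solution\<close>

subsection \<open>Auxiliary facts on functions of time\<close>

lemma has_integral_T:
 fixes f :: "real => 'b::euclidean_space"
 assumes "integrable T f" shows "(f has_integral (LINT t|T. f t)) {0..1}"
proof -
 have "(f has_integral (LINT t|T. f t)) {0<..<1}"
  by (rule has_integral_integral_lebesgue_on[OF assms]) simp
 then show ?thesis by (simp add: has_integral_Icc_iff_Ioo)
qed

lemma integrable_T_continuous:
 fixes f :: "real => 'b::euclidean_space"
 assumes "continuous_on {0..1} f" shows "integrable T f"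
proof -
 obtain B where B: "!!t. t \<in> {0..1} ==> norm (f t) <= B"
  using compact_imp_bounded[OF compact_continuous_image[OF assms compact_Icc]] unfolding bounded_iff by blast
 show ?thesis
 proof (rule finite_measure.integrable_const_bound[OF T_finite])
  show "AE t in T. norm (f t) <= B" using B by (intro AE_I2) auto
  show "f \<in> borel_measurable T"
   by (rule continuous_imp_measurable_on_sets_lebesgue[OF continuous_on_subset[OF assms]]) auto
 qed
qed

lemma AE_T_negligible:
 assumes "AE t in T. P t"
 obtains N where "negligible N" "!!t. t \<in> {0<..<1} ==> t \<notin> N ==> P t"
proof -
 obtain N where N: "!!t. t \<in> space T - N ==> P t" "N \<in> null_sets T" by (rule AE_E3[OF assms]) blast
 have "negligible N" using N(2) by (simp add: null_sets_restrict_space negligible_iff_null_sets)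
 moreover have "P t" if "t \<in> {0<..<1}" "t \<notin> N" for t using N(1)[of t] that by simp
 ultimately show ?thesis by (rule that)
qed

lemma integral_le_negligible:
 fixes f g :: "real => real"
 assumes f: "f integrable_on S" and g: "g integrable_on S" and N: "negligible N"
  and le: "!!x. x \<in> S ==> x \<notin> N ==> f x <= g x"
 shows "integral S f <= integral S g"
proof -
 define h where "h x = (if x \<in> N then g x else f x)" for x
 have eq: "h x = f x" if "x \<in> S - N" for x using that by (simp add: h_def)
 have "integral S f = integral S h" by (rule integral_spike[OF N eq])
 moreover have "h integrable_on S" by (rule integrable_spike[OF f N eq])
 moreover have "h x <= g x" if "x \<in> S" for x using le[OF that] by (simp add: h_def)
 ultimately show ?thesis using integral_le[OF _ g, of h] by simp
qed

lemma deriv_step_bound: "\<exists>L\<ge>0. \<forall>x. \<bar>deriv step x\<bar> <= L"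
 and deriv_step_eq_0: "x \<notin> {0..1} ==> deriv step x = 0"
proof -
 have zero: "deriv step x = 0" if "x \<notin> {0..1}" for x
 proof -
  have "(step has_real_derivative 0) (at x)"
  proof (cases "x < 0")
   case True
   have "((%_. 0) has_real_derivative 0) (at x)" by simp
   then show ?thesis
    by (rule has_field_derivative_transform_within_open[where S="{..<0}"]) (use True in \<open>auto simp: step_eq_0\<close>)
  next
   case False
   have "((%_. 1) has_real_derivative 0) (at x)" by simp
   then show ?thesis
    by (rule has_field_derivative_transform_within_open[where S="{1<..}"]) (use False that in \<open>auto simp: step_eq_1\<close>)
  qed
  then show ?thesis by (rule DERIV_imp_deriv)
 qed
 then show "x \<notin> {0..1} ==> deriv step x = 0" .
 have "compact (deriv step ` {0..1})"
  by (intro compact_continuous_image smooth_continuous smooth_deriv smooth_step compact_Icc)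
 then obtain L where L: "!!x. x \<in> {0..1} ==> norm (deriv step x) <= L"
  using compact_imp_bounded[of "deriv step ` {0..1}"] unfolding bounded_iff by blast
 have "\<bar>deriv step x\<bar> <= \<bar>L\<bar>" for x
  using L[of x] zero[of x] by (cases "x \<in> {0..1}") auto
 then show "\<exists>L\<ge>0. \<forall>x. \<bar>deriv step x\<bar> <= L" by (intro exI[of _ "\<bar>L\<bar>"]) auto
qed

lemma has_deriv_scaled_step: "((%\<tau>. step (s * (\<tau> - q))) has_real_derivative s * deriv step (s * (\<tau> - q))) (at \<tau>)"
proof -
 have "((%\<tau>. s * (\<tau> - q)) has_real_derivative s) (at \<tau>)" by (auto intro!: derivative_eq_intros)
 from DERIV_chain2[OF smooth_has_real_derivative[OF smooth_step] this] show ?thesis by (simp add: mult.commute)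
qed

text \<open>The derivative of a steep step has integral one and concentrates at a point.\<close>

lemma scaled_step_approximates_delta:
 fixes c :: "real => complex"
 assumes c: "continuous_on {0..1} c" and p: "p \<in> {0..1}"
  and s: "!!n. 0 < s n" and q: "!!n. 0 <= q n" "!!n. q n + 1 / s n <= 1"
  and lim: "q \<longlonglongrightarrow> p" "(%n. 1 / s n) \<longlonglongrightarrow> 0"
 shows "(%n::nat. integral {0..1} (%\<tau>. (s n * deriv step (s n * (\<tau> - q n))) *\<^sub>R c \<tau>)) \<longlonglongrightarrow> c p"
proof -
 define k where "k n \<tau> = s n * deriv step (s n * (\<tau> - q n))" for n \<tau>
 obtain L where L: "0 <= L" "!!x. \<bar>deriv step x\<bar> <= L" using deriv_step_bound by blast
 have kc: "continuous_on {0..1} (k n)" for n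
 proof -
  have "smooth (%\<tau>. deriv step (s n * \<tau> + (- s n * q n)))" by (rule smooth_compose_scale[OF smooth_deriv[OF smooth_step]])
  then have "continuous_on {0..1} (%\<tau>. deriv step (s n * \<tau> + (- s n * q n)))" by (rule smooth_continuous)
  then have "continuous_on {0..1} (%\<tau>. s n * deriv step (s n * \<tau> + (- s n * q n)))"
   by (intro continuous_on_mult continuous_on_const)
  then show ?thesis by (simp add: k_def[abs_def] algebra_simps)
 qed
 have k1: "(k n has_integral 1) {0..1}" for n
 proof -
  have "(k n has_integral (step (s n * (1 - q n)) - step (s n * (0 - q n)))) {0..1}"
   unfolding k_def[abs_def]
   by (rule fundamental_theorem_of_calculus)
    (auto simp flip: has_real_derivative_iff_has_vector_derivative
     intro!: DERIV_subset[OF has_deriv_scaled_step])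
  moreover have "s n * (0 - q n) <= 0" using q s[of n] by (simp add: mult_nonneg_nonneg less_imp_le)
  moreover have "1 <= s n * (1 - q n)" using q(2)[of n] s[of n] by (simp add: field_simps)
  ultimately show ?thesis by (simp add: step_eq_0 step_eq_1)
 qed
 show ?thesis
  unfolding LIMSEQ_def k_def[symmetric]
 proof (intro allI impI)
  fix \<epsilon> :: real assume e: "0 < \<epsilon>"
  define osc where "osc = \<epsilon> / (2 * (L + 1))"
  have osc: "0 < osc" using e L(1) by (simp add: osc_def)
  from c p osc obtain \<delta> where d: "0 < \<delta>" "!!\<tau>. \<tau> \<in> {0..1} ==> dist \<tau> p < \<delta> ==> dist (c \<tau>) (c p) < osc"
   unfolding continuous_on_iff by metis
  obtain n0 where n0: "!!n. n \<ge> n0 ==> dist (q n) p < \<delta>/2" "!!n. n \<ge> n0 ==> dist (1 / s n) 0 < \<delta>/2"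
  proof -
   obtain n1 where "!!n. n \<ge> n1 ==> dist (q n) p < \<delta>/2" using lim(1) d(1) unfolding LIMSEQ_def by (meson half_gt_zero)
   moreover obtain n2 where "!!n. n \<ge> n2 ==> dist (1 / s n) 0 < \<delta>/2" using lim(2) d(1) unfolding LIMSEQ_def by (meson half_gt_zero)
   ultimately show ?thesis using that[of "max n1 n2"] by simp
  qed
  have "dist (integral {0..1} (%\<tau>. k n \<tau> *\<^sub>R c \<tau>)) (c p) < \<epsilon>" if n: "n \<ge> n0" for n
  proof -
   have i1: "((%\<tau>. k n \<tau> *\<^sub>R c p) has_integral c p) {0..1}" using has_integral_scaleR_left[OF k1] by simp
   have i2: "(%\<tau>. k n \<tau> *\<^sub>R c \<tau>) integrable_on {0..1}"
    by (intro integrable_continuous_real continuous_on_scaleR kc c)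
   have "integral {0..1} (%\<tau>. k n \<tau> *\<^sub>R c \<tau>) - c p = integral {0..1} (%\<tau>. k n \<tau> *\<^sub>R (c \<tau> - c p))"
    using Henstock_Kurzweil_Integration.integral_diff[OF i2 has_integral_integrable[OF i1]] integral_unique[OF i1]
    by (simp add: scaleR_diff_right)
   also have "norm \<dots> <= integral {0..1} (%\<tau>. if \<tau> \<in> {q n..q n + 1 / s n} then L * s n * osc else 0)"
   proof (rule integral_norm_bound_integral)
    show "(%\<tau>. k n \<tau> *\<^sub>R (c \<tau> - c p)) integrable_on {0..1}"
     by (intro integrable_continuous_real continuous_on_scaleR kc continuous_on_diff c continuous_on_const)
    show "(%\<tau>. if \<tau> \<in> {q n..q n + 1 / s n} then L * s n * osc else 0) integrable_on {0..1}"
    proof -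
     have eq: "{q n..q n + 1 / s n} \<inter> {0..1} = {q n..q n + 1 / s n}" using q[of n] by auto
     show ?thesis
      unfolding Henstock_Kurzweil_Integration.integrable_restrict_Int eq by (rule Henstock_Kurzweil_Integration.integrable_const_ivl)
    qed
    fix \<tau> :: real assume t: "\<tau> \<in> {0..1}"
    show "norm (k n \<tau> *\<^sub>R (c \<tau> - c p)) <= (if \<tau> \<in> {q n..q n + 1 / s n} then L * s n * osc else 0)"
    proof (cases "\<tau> \<in> {q n..q n + 1 / s n}")
     case True
     have "1 / s n < \<delta>/2" using n0(2)[OF n] s[of n] unfolding dist_real_def by simp
     moreover have "\<bar>q n - p\<bar> < \<delta>/2" using n0(1)[OF n] unfolding dist_real_def .
     moreover have "q n <= \<tau>" "\<tau> <= q n + 1 / s n" using True by auto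
     ultimately have "dist \<tau> p < \<delta>" unfolding dist_real_def by linarith
     then have "norm (c \<tau> - c p) <= osc" using d(2)[OF t] by (simp add: dist_norm less_imp_le)
     moreover have "\<bar>k n \<tau>\<bar> <= L * s n"
      using L(2)[of "s n * (\<tau> - q n)"] s[of n] by (simp add: k_def abs_mult mult.commute mult_right_mono)
     ultimately show ?thesis using True L(1) s[of n] by (simp add: mult_mono)
    next
     case False
     have "s n * (\<tau> - q n) \<notin> {0..1}"
     proof
      assume "s n * (\<tau> - q n) \<in> {0..1}"
      then have "0 <= \<tau> - q n" "\<tau> - q n <= 1 / s n" using s[of n] by (simp_all add: zero_le_mult_iff field_simps)
      then show False using False by simp
     qed
     then show ?thesis using False deriv_step_eq_0[of "s n * (\<tau> - q n)"] by (auto simp: k_def)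
    qed
   qed
   also have "\<dots> = L * osc"
   proof -
    have "{q n..q n + 1 / s n} \<inter> {0..1} = {q n..q n + 1 / s n}" using q[of n] by auto
    then have "integral {0..1} (%\<tau>. if \<tau> \<in> {q n..q n + 1 / s n} then L * s n * osc else 0) = integral {q n..q n + 1 / s n} (%_. L * s n * osc)"
     unfolding Henstock_Kurzweil_Integration.integral_restrict_Int by (rule arg_cong[where f="%A. integral A _"])
    then show ?thesis using s[of n] by simp
   qed
   also have "L * osc < \<epsilon>"
   proof -
    have "L * osc <= (L + 1) * osc" using osc by (simp add: mult_right_mono)
    also have "\<dots> = \<epsilon> / 2" using L(1) by (simp add: osc_def field_simps)
    finally show ?thesis using e by simp
   qed
   finally show ?thesis by (simp add: dist_norm)
  qed
  then show "\<exists>no. \<forall>n\<ge>no. dist (integral {0..1} (%\<tau>. k n \<tau> *\<^sub>R c \<tau>)) (c p) < \<epsilon>" by blast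
 qed
qed

text \<open>The test functions are trapezoidal: they rise steeply near \<open>0\<close> and fall steeply near \<open>t\<close>, so their derivatives
tend to the difference of two point evaluations.\<close>

lemma du_bois_reymond:
 fixes c d :: "real => complex"
 assumes c: "continuous_on {0..1} c" and d: "integrable T d"
  and weak: "!!\<phi>. \<phi> \<in> test_functions {0<..<1} ==> (LINT t|T. deriv \<phi> t *\<^sub>R c t) = - (LINT t|T. \<phi> t *\<^sub>R d t)"
  and t: "0 < t" "t < 1"
 shows "integral {0..t} d = c t - c 0"
proof -
 obtain n0 :: nat where n0: "3 / t < real n0" "3 < real n0"
  using reals_Archimedean2[of "max (3 / t) 3"] by (auto simp: max_less_iff_conj)
 define s where "s n = real (n + n0)" for n
 have s: "3 / t < s n" "3 < s n" for n using n0 by (auto simp: s_def)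
 then have s0: "0 < s n" for n by (smt (verit))
 have st: "3 < s n * t" "3 / s n < t" for n using s(1)[of n] t s0[of n] by (simp_all add: field_simps)
 have slim: "(%n. 1 / s n) \<longlonglongrightarrow> 0"
  unfolding s_def using LIMSEQ_ignore_initial_segment[OF lim_1_over_n, of n0] by simp
 define q1 q2 where "q1 n = 1 / s n" and "q2 n = t - 1 / s n" for n
 define \<phi> where "\<phi> n \<tau> = step (s n * (\<tau> - q1 n)) - step (s n * (\<tau> - q2 n))" for n \<tau>
 have d\<phi>: "(\<phi> n has_real_derivative s n * deriv step (s n * (\<tau> - q1 n)) - s n * deriv step (s n * (\<tau> - q2 n))) (at \<tau>)" for n \<tau>
  unfolding \<phi>_def[abs_def] by (intro DERIV_diff has_deriv_scaled_step)
 have sm: "smooth (\<phi> n)" for n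
 proof -
  have "smooth (%\<tau>. step (s n * \<tau> + (- s n * q)))" for q by (rule smooth_compose_scale[OF smooth_step])
  then have "smooth (%\<tau>. step (s n * (\<tau> - q)))" for q by (simp add: algebra_simps)
  then show ?thesis unfolding \<phi>_def[abs_def] by (intro smooth_diff)
 qed
 have test: "\<phi> n \<in> test_functions {0<..<1}" for n
 proof (rule test_functionsI[OF sm, of "{1 / s n..t}"])
  have "0 < 1 / s n" using s0[of n] by simp
  then show "{1 / s n..t} \<subseteq> {0<..<1}" using t by (auto intro: less_le_trans le_less_trans simp del: zero_less_divide_1_iff)
  fix \<tau> assume \<tau>: "\<tau> \<notin> {1 / s n..t}"
  show "\<phi> n \<tau> = 0"
  proof (cases "\<tau> < 1 / s n")
   case True
   have "s n * (\<tau> - q1 n) <= 0" using True s0[of n] by (simp add: q1_def field_simps)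
   moreover have "\<tau> - q2 n <= 0" using True st(2)[of n] s0[of n] by (simp add: q2_def field_simps)
   then have "s n * (\<tau> - q2 n) <= 0" using s0[of n] by (simp add: mult_nonneg_nonpos)
   ultimately show ?thesis by (simp add: \<phi>_def step_eq_0)
  next
   case False
   then have tt: "t < \<tau>" using \<tau> by auto
   then have "s n * t < s n * \<tau>" using s0[of n] by simp
   moreover have "s n * (\<tau> - q1 n) = s n * \<tau> - 1" "s n * (\<tau> - q2 n) = s n * \<tau> - s n * t + 1"
    using s0[of n] by (simp_all add: q1_def q2_def right_diff_distrib)
   ultimately have "1 <= s n * (\<tau> - q1 n)" "1 <= s n * (\<tau> - q2 n)"
    using st(1)[of n] by linarith+
   then show ?thesis by (simp add: \<phi>_def step_eq_1)
  qed
 qed simp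
 have left: "(%n. LINT \<tau>|T. deriv (\<phi> n) \<tau> *\<^sub>R c \<tau>) \<longlonglongrightarrow> c 0 - c t"
 proof -
  have cont: "continuous_on {0..1} (%\<tau>. (s n * deriv step (s n * (\<tau> - q))) *\<^sub>R c \<tau>)" for n q
  proof -
   have "smooth (%\<tau>. deriv step (s n * \<tau> + (- s n * q)))" by (rule smooth_compose_scale[OF smooth_deriv[OF smooth_step]])
   then have "continuous_on {0..1} (%\<tau>. deriv step (s n * \<tau> + (- s n * q)))" by (rule smooth_continuous)
   then have "continuous_on {0..1} (%\<tau>. (s n * deriv step (s n * \<tau> + (- s n * q))) *\<^sub>R c \<tau>)"
    by (intro continuous_on_mult continuous_on_const continuous_on_scaleR c)
   then show ?thesis by (simp add: algebra_simps)
  qed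
  have "(LINT \<tau>|T. deriv (\<phi> n) \<tau> *\<^sub>R c \<tau>) =
   integral {0..1} (%\<tau>. (s n * deriv step (s n * (\<tau> - q1 n))) *\<^sub>R c \<tau>) -
   integral {0..1} (%\<tau>. (s n * deriv step (s n * (\<tau> - q2 n))) *\<^sub>R c \<tau>)" for n
  proof -
   have "(LINT \<tau>|T. deriv (\<phi> n) \<tau> *\<^sub>R c \<tau>) =
    (LINT \<tau>|T. (s n * deriv step (s n * (\<tau> - q1 n))) *\<^sub>R c \<tau> - (s n * deriv step (s n * (\<tau> - q2 n))) *\<^sub>R c \<tau>)"
    by (simp add: DERIV_imp_deriv[OF d\<phi>] scaleR_diff_left)
   then show ?thesis
    using integrable_T_continuous[OF cont] integral_unique[OF has_integral_T[OF integrable_T_continuous[OF cont]]]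
    by simp
  qed
  moreover have "(%n. integral {0..1} (%\<tau>. (s n * deriv step (s n * (\<tau> - q1 n))) *\<^sub>R c \<tau>)) \<longlonglongrightarrow> c 0"
  proof (rule scaled_step_approximates_delta[OF c _ s0 _ _ _ slim])
   show "0 <= q1 n" "q1 n + 1 / s n <= 1" for n using s(2)[of n] by (simp_all add: q1_def field_simps)
   show "q1 \<longlonglongrightarrow> 0" using slim by (simp add: q1_def[abs_def])
  qed simp
  moreover have "(%n. integral {0..1} (%\<tau>. (s n * deriv step (s n * (\<tau> - q2 n))) *\<^sub>R c \<tau>)) \<longlonglongrightarrow> c t"
  proof (rule scaled_step_approximates_delta[OF c _ s0 _ _ _ slim])
   show "0 <= q2 n" "q2 n + 1 / s n <= 1" for n using st(1)[of n] s0[of n] t by (simp_all add: q2_def field_simps)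
   show "q2 \<longlonglongrightarrow> t" using tendsto_diff[OF tendsto_const[of t] slim] by (simp add: q2_def[abs_def])
  qed (use t in simp)
  ultimately show ?thesis by (simp add: tendsto_diff)
 qed
 have right: "(%n. LINT \<tau>|T. \<phi> n \<tau> *\<^sub>R d \<tau>) \<longlonglongrightarrow> (LINT \<tau>|T. (if \<tau> < t then 1 else 0) *\<^sub>R d \<tau>)"
 proof (rule integral_dominated_convergence[where w="%\<tau>. norm (d \<tau>)"])
  have idm: "(%\<tau>. \<tau>) \<in> borel_measurable T" by (intro continuous_imp_measurable_on_sets_lebesgue) auto
  show "(%\<tau>. (if \<tau> < t then 1 else 0) *\<^sub>R d \<tau>) \<in> borel_measurable T"
   using idm d by (intro borel_measurable_scaleR measurable_compose[OF idm, of "%\<tau>. if \<tau> < t then 1 else 0"]) auto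
  show "(%\<tau>. \<phi> n \<tau> *\<^sub>R d \<tau>) \<in> borel_measurable T" for n
   by (rule borel_measurable_scaleR[OF continuous_imp_measurable_on_sets_lebesgue[OF smooth_continuous[OF sm]]
      borel_measurable_integrable[OF d]]) simp
  show "integrable T (%\<tau>. norm (d \<tau>))" using d by simp
  have "\<bar>\<phi> n \<tau>\<bar> <= 1" for n \<tau>
   using step_nonneg[of "s n * (\<tau> - q1 n)"] step_le_1[of "s n * (\<tau> - q1 n)"]
    step_nonneg[of "s n * (\<tau> - q2 n)"] step_le_1[of "s n * (\<tau> - q2 n)"] by (simp add: \<phi>_def abs_le_iff)
  then show "AE \<tau> in T. norm (\<phi> n \<tau> *\<^sub>R d \<tau>) <= norm (d \<tau>)" for n
   by (auto intro!: AE_I2 mult_left_le_one_le)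
  show "AE \<tau> in T. (%n. \<phi> n \<tau> *\<^sub>R d \<tau>) \<longlonglongrightarrow> (if \<tau> < t then 1 else 0) *\<^sub>R d \<tau>"
  proof (rule AE_I2)
   fix \<tau> assume "\<tau> \<in> space T"
   then have \<tau>: "0 < \<tau>" by simp
   have sinf: "filterlim s at_top sequentially"
    unfolding s_def by (rule filterlim_compose[OF filterlim_real_sequentially filterlim_add_const_nat_at_top])
   have e1: "\<forall>\<^sub>F n in sequentially. 2 / \<tau> <= s n" using sinf unfolding filterlim_at_top by blast
   have "\<forall>\<^sub>F n in sequentially. \<phi> n \<tau> = (if \<tau> < t then 1 else 0)"
   proof (cases "\<tau> < t")
    case True
    have "\<forall>\<^sub>F n in sequentially. 1 / (t - \<tau>) <= s n" using sinf unfolding filterlim_at_top by blast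
    with e1 show ?thesis
    proof eventually_elim
     case (elim n)
     have "1 <= s n * (\<tau> - q1 n)" using elim(1) \<tau> s0[of n] by (simp add: q1_def field_simps)
     moreover have "1 <= s n * (t - \<tau>)" using elim(2) True by (simp add: field_simps)
     then have "s n * (\<tau> - q2 n) <= 0" using s0[of n] by (simp add: q2_def algebra_simps)
     ultimately show ?case using True by (simp add: \<phi>_def step_eq_0 step_eq_1)
    qed
   next
    case False
    from e1 show ?thesis
    proof eventually_elim
     case (elim n)
     have "1 <= s n * (\<tau> - q1 n)" using elim \<tau> s0[of n] by (simp add: q1_def field_simps)
     moreover have "s n * t <= s n * \<tau>" using False s0[of n] by simp
     then have "1 <= s n * (\<tau> - q2 n)" using s0[of n] by (simp add: q2_def field_simps)
     ultimately show ?case using False by (simp add: \<phi>_def step_eq_1)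
    qed
   qed
   then show "(%n. \<phi> n \<tau> *\<^sub>R d \<tau>) \<longlonglongrightarrow> (if \<tau> < t then 1 else 0) *\<^sub>R d \<tau>"
    by (intro tendsto_scaleR tendsto_const tendsto_eventually)
  qed
 qed
 have "(%n. LINT \<tau>|T. deriv (\<phi> n) \<tau> *\<^sub>R c \<tau>) \<longlonglongrightarrow> - (LINT \<tau>|T. (if \<tau> < t then 1 else 0) *\<^sub>R d \<tau>)"
  unfolding weak[OF test] by (rule tendsto_minus[OF right])
 then have eq: "c 0 - c t = - (LINT \<tau>|T. (if \<tau> < t then 1 else 0) *\<^sub>R d \<tau>)"
  using left LIMSEQ_unique by blast
 have "(LINT \<tau>|T. (if \<tau> < t then 1 else 0) *\<^sub>R d \<tau>) = integral {0..t} d"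
 proof -
  have int: "integrable T (%\<tau>. (if \<tau> < t then 1 else 0) *\<^sub>R d \<tau>)"
  proof (rule Bochner_Integration.integrable_bound[OF d])
   have idm: "(%\<tau>. \<tau>) \<in> borel_measurable T" by (intro continuous_imp_measurable_on_sets_lebesgue) auto
   show "(%\<tau>. (if \<tau> < t then 1 else 0) *\<^sub>R d \<tau>) \<in> borel_measurable T"
    using idm d by (intro borel_measurable_scaleR measurable_compose[OF idm, of "%\<tau>. if \<tau> < t then 1 else 0"]) auto
  qed auto
  have "(LINT \<tau>|T. (if \<tau> < t then 1 else 0) *\<^sub>R d \<tau>) = integral {0..1} (%\<tau>. (if \<tau> < t then 1 else 0) *\<^sub>R d \<tau>)"
   by (rule integral_unique[OF has_integral_T[OF int], symmetric])
  also have "\<dots> = integral {0..1} (%\<tau>. if \<tau> \<in> {0..t} then d \<tau> else 0)"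
   by (rule integral_spike[of "{t}"]) auto
  also have "\<dots> = integral ({0..t} \<inter> {0..1}) d" by (rule Henstock_Kurzweil_Integration.integral_restrict_Int)
  also have "{0..t} \<inter> {0..1} = {0..t}" using t by auto
  finally show ?thesis .
 qed
 then show ?thesis using eq by (simp add: algebra_simps minus_equation_iff)
qed

text \<open>The bound contains the values of \<open>r\<close> at single times, which a sum over a partition would not control. So it is
integrated over all intervals of a fixed length \<open>h\<close>; the left side then telescopes to averages of \<open>f\<close> over
intervals of length \<open>h\<close> at both ends, which tend to the values at the ends by continuity.\<close>

lemma increment_inequality:
 fixes f \<gamma> r :: "real => real"
 assumes f: "continuous_on {0..1} f" and \<gamma>: "\<gamma> integrable_on {0..1}" and r: "r integrable_on {0..1}"
  and r0: "!!t. t \<in> {0..1} ==> 0 <= r t" and N: "negligible N" and h0: "0 < h0"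
  and le: "!!s t. 0 < s ==> s < t ==> t < 1 ==> s \<notin> N ==> t \<notin> N ==> t - s <= h0 ==>
   f t - f s <= integral {s..t} \<gamma> + (t - s) * (r s + r t)"
 shows "f 1 - f 0 <= integral {0..1} \<gamma> + 2 * integral {0..1} r"
proof -
 define \<phi> where "\<phi> t = f t - integral {0..t} \<gamma>" for t
 have cont: "continuous_on {0..1} \<phi>"
  unfolding \<phi>_def by (intro continuous_on_diff f indefinite_integral_continuous_1 \<gamma>)
 have inc: "\<phi> t - \<phi> s <= (t - s) * (r s + r t)"
  if "0 < s" "s < t" "t < 1" "s \<notin> N" "t \<notin> N" "t - s <= h0" for s t
 proof -
  have "\<gamma> integrable_on {0..t}" by (rule integrable_subinterval_real[OF \<gamma>]) (use that in auto)
  then have "integral {0..s} \<gamma> + integral {s..t} \<gamma> = integral {0..t} \<gamma>"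
   using that by (intro Henstock_Kurzweil_Integration.integral_combine) auto
  then show ?thesis using le[OF that] by (simp add: \<phi>_def)
 qed
 have key: "\<phi> 1 - \<phi> 0 <= 2 * integral {0..1} r + 2 * \<epsilon>" if e: "0 < \<epsilon>" for \<epsilon>
 proof -
  obtain d0 where d0: "0 < d0" "!!t. t \<in> {0..1} ==> dist t 0 < d0 ==> dist (\<phi> t) (\<phi> 0) < \<epsilon>"
   using cont e unfolding continuous_on_iff by (metis atLeastAtMost_iff order_refl zero_le_one)
  obtain d1 where d1: "0 < d1" "!!t. t \<in> {0..1} ==> dist t 1 < d1 ==> dist (\<phi> t) (\<phi> 1) < \<epsilon>"
   using cont e unfolding continuous_on_iff by (metis atLeastAtMost_iff order_refl zero_le_one)
  define h where "h = Min {h0, d0/2, d1/2, 1/2}"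
  have h: "0 < h" "h <= h0" "h < d0" "h < d1" "h < 1" using h0 d0(1) d1(1) by (auto simp: h_def)
  have shift: "((%x. g (x - h)) has_integral i) {a + h..b + h}" if "(g has_integral i) {a..b}" for g :: "real => real" and a b i
  proof -
   have "((%x. g (1 *\<^sub>R x + - h)) has_integral (1 / \<bar>1\<bar> ^ DIM(real)) *\<^sub>R i) ((%x. (1 / 1) *\<^sub>R x + - ((1 / 1) *\<^sub>R - h)) ` cbox a b)"
    by (rule has_integral_affinity) (use that in auto)
   moreover have "(%x. x + h) ` {a..b} = {a + h..b + h}" by (simp add: add.commute)
   ultimately show ?thesis by simp
  qed
  have ph: "\<phi> integrable_on {a..b}" if "0 <= a" "b <= 1" for a b
   by (intro integrable_continuous_real continuous_on_subset[OF cont]) (use that in auto)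
  have rh: "r integrable_on {a..b}" if "0 <= a" "b <= 1" for a b
   by (rule integrable_subinterval_real[OF r]) (use that in auto)
  have s\<phi>: "((%x. \<phi> (x - h)) has_integral integral {0..1 - h} \<phi>) {h..1}"
   using shift[OF integrable_integral[OF ph[of 0 "1 - h"]]] h by simp
  have sr: "((%x. r (x - h)) has_integral integral {0..1 - h} r) {h..1}"
   using shift[OF integrable_integral[OF rh[of 0 "1 - h"]]] h by simp
  define N' where "N' = N \<union> ((+) h) ` N \<union> {h, 1}"
  have N': "negligible N'" unfolding N'_def using N by (intro negligible_Un negligible_translation) auto
  have "integral {h..1} (%x. \<phi> x - \<phi> (x - h)) <= integral {h..1} (%x. h * (r (x - h) + r x))"
  proof (rule integral_le_negligible[OF _ _ N'])
   show "(%x. \<phi> x - \<phi> (x - h)) integrable_on {h..1}"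
    using ph[of h 1] s\<phi> h by (intro Henstock_Kurzweil_Integration.integrable_diff) (auto intro: has_integral_integrable)
   show "(%x. h * (r (x - h) + r x)) integrable_on {h..1}"
   proof -
    have "r integrable_on {h..1}" by (rule rh) (use h in auto)
    from integrable_cmul[OF Henstock_Kurzweil_Integration.integrable_add[OF has_integral_integrable[OF sr] this], of h]
    show ?thesis by simp
   qed
   fix x assume x: "x \<in> {h..1}" "x \<notin> N'"
   have "x - h \<notin> N"
   proof
    assume "x - h \<in> N"
    then have "h + (x - h) \<in> ((+) h) ` N" by (rule imageI)
    then show False using x by (simp add: N'_def)
   qed
   then show "\<phi> x - \<phi> (x - h) <= h * (r (x - h) + r x)"
    using inc[of "x - h" x] x h by (auto simp: N'_def)
  qed
  also have "\<dots> = h * (integral {0..1 - h} r + integral {h..1} r)"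
   using rh[of h 1] sr h by (simp add: Henstock_Kurzweil_Integration.integral_add has_integral_integrable[OF sr] integral_unique[OF sr])
  also have "\<dots> <= h * (integral {0..1} r + integral {0..1} r)"
   using h rh r0 by (intro mult_left_mono add_mono integral_subset_le) auto
  finally have upper: "integral {h..1} (%x. \<phi> x - \<phi> (x - h)) <= 2 * h * integral {0..1} r" by simp
  have "integral {h..1} (%x. \<phi> x - \<phi> (x - h)) = integral {h..1} \<phi> - integral {0..1 - h} \<phi>"
   using ph[of h 1] h by (simp add: Henstock_Kurzweil_Integration.integral_diff has_integral_integrable[OF s\<phi>] integral_unique[OF s\<phi>])
  also have "\<dots> = integral {1 - h..1} \<phi> - integral {0..h} \<phi>"
  proof -
   have "integral {0..h} \<phi> + integral {h..1} \<phi> = integral {0..1} \<phi>"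
    by (rule Henstock_Kurzweil_Integration.integral_combine) (use h ph in auto)
   moreover have "integral {0..1 - h} \<phi> + integral {1 - h..1} \<phi> = integral {0..1} \<phi>"
    by (rule Henstock_Kurzweil_Integration.integral_combine) (use h ph in auto)
   ultimately show ?thesis by simp
  qed
  finally have eq: "integral {h..1} (%x. \<phi> x - \<phi> (x - h)) = integral {1 - h..1} \<phi> - integral {0..h} \<phi>" .
  have "integral {1 - h..1} (%_. \<phi> 1 - \<epsilon>) <= integral {1 - h..1} \<phi>"
  proof (rule integral_le)
   fix x assume x: "x \<in> {1 - h..1}"
   then have "dist (\<phi> x) (\<phi> 1) < \<epsilon>" using h by (intro d1(2)) (auto simp: dist_real_def)
   then show "\<phi> 1 - \<epsilon> <= \<phi> x" by (simp add: dist_real_def)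
  qed (use h ph in auto)
  then have l1: "h * (\<phi> 1 - \<epsilon>) <= integral {1 - h..1} \<phi>" using h by simp
  have "integral {0..h} \<phi> <= integral {0..h} (%_. \<phi> 0 + \<epsilon>)"
  proof (rule integral_le)
   fix x assume x: "x \<in> {0..h}"
   then have "dist (\<phi> x) (\<phi> 0) < \<epsilon>" using h by (intro d0(2)) (auto simp: dist_real_def)
   then show "\<phi> x <= \<phi> 0 + \<epsilon>" by (simp add: dist_real_def)
  qed (use h ph in auto)
  then have l2: "integral {0..h} \<phi> <= h * (\<phi> 0 + \<epsilon>)" using h by simp
  have "h * (\<phi> 1 - \<phi> 0 - 2 * \<epsilon>) <= h * (2 * integral {0..1} r)"
   using upper eq l1 l2 by (simp add: algebra_simps)
  then show ?thesis using h(1) by simp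
 qed
 have "\<phi> 1 - \<phi> 0 <= 2 * integral {0..1} r"
 proof (rule field_le_epsilon)
  fix e :: real assume "0 < e"
  then show "\<phi> 1 - \<phi> 0 <= 2 * integral {0..1} r + e" using key[of "e/2"] by simp
 qed
 then show ?thesis by (simp add: \<phi>_def)
qed

subsection \<open>Approximation by continuous functions of time\<close>

text \<open>The set is squeezed between a closed and an open set, and a Urysohn function separates them.\<close>

lemma indicator_continuous_approx:
 assumes A: "A \<in> sets lebesgue" and e: "0 < (e::real)"
 obtains \<psi> :: "real => real" where "continuous_on UNIV \<psi>" "!!t. 0 <= \<psi> t \<and> \<psi> t <= 1"
  "(LINT t|T. \<bar>indicator A t - \<psi> t\<bar>) <= e"
proof -
 obtain K where K: "closed K" "K \<subseteq> A" "A - K \<in> lmeasurable" "emeasure lebesgue (A - K) < ennreal (e/2)"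
  using sets_lebesgue_inner_closed[OF A, of "e/2"] e by auto
 obtain G where G: "open G" "A \<subseteq> G" "G - A \<in> lmeasurable" "emeasure lebesgue (G - A) < ennreal (e/2)"
  using sets_lebesgue_outer_open[OF A, of "e/2"] e by auto
 obtain \<psi> :: "real => real" where \<psi>: "continuous_on UNIV \<psi>" "!!t. \<psi> t \<in> closed_segment 1 0"
  "!!t. t \<in> K ==> \<psi> t = 1" "!!t. t \<in> - G ==> \<psi> t = 0"
 proof (rule Urysohn[of K "- G" "1::real" 0])
  show "closed K" "closed (- G)" using K G by (auto simp: closed_Compl)
  show "K \<inter> - G = {}" using K G by auto
 qed blast
 have \<psi>01: "0 <= \<psi> t \<and> \<psi> t <= 1" for t
  using \<psi>(2)[of t] by (simp add: closed_segment_eq_real_ivl)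
 have meas: "(A - K) \<union> (G - A) \<in> lmeasurable" using K G by (intro fmeasurable.Un) auto
 have "measure lebesgue ((A - K) \<union> (G - A)) <= measure lebesgue (A - K) + measure lebesgue (G - A)"
  using K G by (intro measure_Un_le) auto
 also have "\<dots> <= e/2 + e/2"
  using K(3,4) G(3,4) e by (intro add_mono) (auto simp: emeasure_eq_measure2 ennreal_less_iff less_imp_le)
 finally have le: "measure lebesgue ((A - K) \<union> (G - A)) <= e" by simp
 have pt: "\<bar>indicator A t - \<psi> t\<bar> <= indicator ((A - K) \<union> (G - A)) t" for t
  using \<psi>01[of t] \<psi>(3)[of t] \<psi>(4)[of t] K(2) G(2) by (auto simp: indicator_def abs_if)
 have Tm: "B \<in> sets lebesgue ==> (indicator B :: real => real) \<in> borel_measurable T" for B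
  by (rule measurable_restrict_space1) (rule borel_measurable_indicator)
 have int2: "integrable T (indicator ((A - K) \<union> (G - A)) :: real => real)"
  using meas by (intro finite_measure.integrable_const_bound[OF T_finite, where B=1] Tm) (auto intro!: AE_I2)
 have \<psi>m: "\<psi> \<in> borel_measurable T"
  by (rule continuous_imp_measurable_on_sets_lebesgue[OF continuous_on_subset[OF \<psi>(1)]]) auto
 have "(LINT t|T. \<bar>indicator A t - \<psi> t\<bar>) <= (LINT t|T. indicator ((A - K) \<union> (G - A)) t)"
  using pt int2 Tm[OF A] \<psi>m
  by (intro integral_mono Bochner_Integration.integrable_bound[OF int2]) (auto intro!: AE_I2)
 also have "\<dots> = measure T (((A - K) \<union> (G - A)) \<inter> space T)" by simp
 also have "\<dots> = measure lebesgue (((A - K) \<union> (G - A)) \<inter> {0<..<1})"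
  using meas by (subst measure_restrict_space) auto
 also have "\<dots> <= measure lebesgue ((A - K) \<union> (G - A))"
  using meas by (intro measure_mono_fmeasurable) auto
 finally have "(LINT t|T. \<bar>indicator A t - \<psi> t\<bar>) <= e" using le by simp
 with \<psi>(1) \<psi>01 show ?thesis by (rule that)
qed

text \<open>Where an approximating simple function is more than twice as large as its target, it is replaced by zero; after
that, dominated convergence applies.\<close>

lemma Lp_in_2_simple_approx:
 assumes X: "seminormed X" and u: "Lp_in X 2 {0<..<1} u" and e: "0 < e"
 obtains s where "simple_function T s" "s ` {0<..<1} \<subseteq> carr X"
  "(LINT t|T. (nrm X (%x. u t x - s t x))\<^sup>2) <= e"
proof -
 have um: "strongly_measurable_in X {0<..<1} u" and ui: "integrable T (%t. (nrm X (u t))\<^sup>2)"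
  using u by (auto simp: Lp_in_2[OF X])
 obtain s where s: "!!i::nat. simple_function T (s i)" "!!i. s i ` {0<..<1} \<subseteq> carr X"
  and lim: "AE t in T. u t \<in> carr X \<and> (%i. nrm X (%x. u t x - s i t x)) \<longlonglongrightarrow> 0"
  by (rule strongly_measurable_inE[OF um]) blast
 define A where "A i = {t \<in> space T. nrm X (s i t) <= 2 * nrm X (u t)}" for i
 define r where "r i t = (if t \<in> A i then s i t else (%x. 0))" for i t
 have A: "A i \<in> sets T" for i
 proof -
  have "(%t. nrm X (s i t)) \<in> borel_measurable T"
   by (rule borel_measurable_simple_function[OF simple_function_compose1[OF s(1)]])
  then show ?thesis unfolding A_def using strongly_measurable_nrm[OF X um] by measurable
 qed
 have rs: "simple_function T (r i)" for i
  unfolding r_def using A[of i] sets.sets_into_space[OF A[of i]]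
  by (intro simple_function_If_set s) (auto simp: Int_absorb2)
 have rc: "r i ` {0<..<1} \<subseteq> carr X" for i
  using s(2)[of i] carr_zero[OF X] by (auto simp: r_def)
 have dm: "(%t. nrm X (%x. u t x - r i t x)) \<in> borel_measurable T" for i
  by (rule strongly_measurable_nrm[OF X strongly_measurable_diff[OF X um strongly_measurable_simple[OF X rs rc]]])
 have "(%i. LINT t|T. (nrm X (%x. u t x - r i t x))\<^sup>2) \<longlonglongrightarrow> (LINT t|T. 0)"
 proof (rule integral_dominated_convergence[where w="%t. 9 * (nrm X (u t))\<^sup>2"])
  show "integrable T (%t. 9 * (nrm X (u t))\<^sup>2)" using ui by simp
  show "AE t in T. (%i. (nrm X (%x. u t x - r i t x))\<^sup>2) \<longlonglongrightarrow> 0"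
   using lim AE_space
  proof eventually_elim
   fix t assume t: "u t \<in> carr X \<and> (%i. nrm X (%x. u t x - s i t x)) \<longlonglongrightarrow> 0" "t \<in> space T"
   have ut: "u t \<in> carr X" using t by simp
   have st: "s i t \<in> carr X" for i using s(2)[of i] t(2) by auto
   have rt: "r i t \<in> carr X" for i using rc[of i] t(2) by auto
   have "nrm X (%x. u t x - r i t x) <= nrm X (%x. u t x - s i t x)" for i
   proof (cases "t \<in> A i")
    case False
    then have "2 * nrm X (u t) < nrm X (s i t)" using t(2) by (simp add: A_def)
    moreover have "nrm X (s i t) <= nrm X (u t) + nrm X (%x. u t x - s i t x)"
     using nrm_abs_diff_le[OF X ut st, of i] by linarith
    ultimately show ?thesis using False by (simp add: r_def)
   qed (simp add: r_def)
   then have le: "norm (nrm X (%x. u t x - r i t x)) <= nrm X (%x. u t x - s i t x)" for i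
    using nrm_nonneg[OF X carr_diff[OF X ut rt], of i] by simp
   have "(%i. nrm X (%x. u t x - r i t x)) \<longlonglongrightarrow> 0"
    by (rule Lim_null_comparison[OF always_eventually[OF allI[OF le]] conjunct2[OF t(1)]])
   from tendsto_power[OF this, of 2] show "(%i. (nrm X (%x. u t x - r i t x))\<^sup>2) \<longlonglongrightarrow> 0" by simp
  qed
  show "AE t in T. norm ((nrm X (%x. u t x - r i t x))\<^sup>2) <= 9 * (nrm X (u t))\<^sup>2" for i
   using lim AE_space
  proof eventually_elim
   fix t assume t: "u t \<in> carr X \<and> (%i. nrm X (%x. u t x - s i t x)) \<longlonglongrightarrow> 0" "t \<in> space T"
   have ut: "u t \<in> carr X" using t by simp
   have rt: "r i t \<in> carr X" using rc[of i] t(2) by auto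
   have "nrm X (r i t) <= 2 * nrm X (u t)"
    using nrm_zero[OF X] nrm_nonneg[OF X ut] by (auto simp: r_def A_def)
   then have "nrm X (%x. u t x - r i t x) <= 3 * nrm X (u t)" using nrm_diff_le[OF X ut rt] by simp
   then have "(nrm X (%x. u t x - r i t x))\<^sup>2 <= (3 * nrm X (u t))\<^sup>2"
    using nrm_nonneg[OF X carr_diff[OF X ut rt]] by (intro power_mono)
   then show "norm ((nrm X (%x. u t x - r i t x))\<^sup>2) <= 9 * (nrm X (u t))\<^sup>2"
    by (simp add: power_mult_distrib)
  qed
 qed (use dm in auto)
 then have "\<forall>\<^sub>F i in sequentially. (LINT t|T. (nrm X (%x. u t x - r i t x))\<^sup>2) < e"
  using e by (intro order_tendstoD(2)[where y="LINT t|T. 0"]) auto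
 then obtain i where "(LINT t|T. (nrm X (%x. u t x - r i t x))\<^sup>2) < e"
  using eventually_happens'[OF sequentially_bot] by blast
 then show ?thesis by (intro that[OF rs rc, of i]) simp
qed

text \<open>The indicator functions in a simple function are replaced by continuous functions. The modulus of continuity is
stated uniformly, as it is used for pairs of times.\<close>

lemma Lp_in_2_continuous_approx:
 assumes X: "seminormed X" and u: "Lp_in X 2 {0<..<1} u" and e: "0 < (e::real)"
 obtains v h where "!!t. v t \<in> carr X" "0 < h"
  "!!s t. s \<in> {0..1} ==> t \<in> {0..1} ==> \<bar>s - t\<bar> <= h ==> nrm X (%x. v s x - v t x) <= e"
  "Lp_in X 2 {0<..<1} (%t x. u t x - v t x)"
  "(LINT t|T. (nrm X (%x. u t x - v t x))\<^sup>2) <= e\<^sup>2"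
proof -
 have e4: "0 < e\<^sup>2/4" using e by simp
 obtain s where s: "simple_function T s" "s ` {0<..<1} \<subseteq> carr X"
  and sle: "(LINT t|T. (nrm X (%x. u t x - s t x))\<^sup>2) <= e\<^sup>2/4"
  by (rule Lp_in_2_simple_approx[OF X u e4]) blast
 define W where "W = s ` {0<..<1}"
 have W: "finite W" "W \<subseteq> carr X"
  using simple_functionD(1)[OF s(1)] s(2) by (auto simp: W_def)
 define S where "S = (\<Sum>w\<in>W. nrm X w)"
 have nW: "0 <= nrm X w" if "w \<in> W" for w using that W(2) nrm_nonneg[OF X] by blast
 have S0: "0 <= S" unfolding S_def by (intro sum_nonneg nW)
 define A where "A w = {t \<in> {0<..<1}. s t = w}" for w
 have AL: "A w \<in> sets lebesgue" for w
 proof -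
  have "s -` {w} \<inter> space T \<in> sets T" by (rule simple_functionD(2)[OF s(1)])
  moreover have "s -` {w} \<inter> space T = A w" by (auto simp: A_def)
  ultimately show ?thesis by (simp add: sets_restrict_space_iff)
 qed
 define K where "K = S\<^sup>2 + 1"
 define \<eta> where "\<eta> = e\<^sup>2 / (4 * K)"
 have S1: "0 < K" by (simp add: K_def add_nonneg_pos)
 have \<eta>: "0 < \<eta>" using e S1 by (simp add: \<eta>_def)
 have "\<exists>\<psi>::real => real. continuous_on UNIV \<psi> \<and> (\<forall>t. 0 <= \<psi> t \<and> \<psi> t <= 1) \<and> (LINT t|T. \<bar>indicator (A w) t - \<psi> t\<bar>) <= \<eta>" for w
  by (rule indicator_continuous_approx[OF AL \<eta>]) blast
 then obtain \<psi> :: "_ => real => real" where \<psi>: "!!w. continuous_on UNIV (\<psi> w)" "!!w t. 0 <= \<psi> w t \<and> \<psi> w t <= 1"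
  "!!w. (LINT t|T. \<bar>indicator (A w) t - \<psi> w t\<bar>) <= \<eta>"
  by metis
 define v where "v t x = (\<Sum>w\<in>W. \<psi> w t *\<^sub>R w x)" for t x
 have vc: "v t \<in> carr X" for t
  unfolding v_def[abs_def] using W(2) by (intro carr_sum[OF X] carr_scaleR[OF X]) auto
 define G where "G p = (\<Sum>w\<in>W. \<bar>\<psi> w (fst p) - \<psi> w (snd p)\<bar> * nrm X w)" for p :: "real \<times> real"
 have vG: "nrm X (%x. v a x - v b x) <= G (a, b)" for a b
 proof -
  have "(%x. v a x - v b x) = (%x. \<Sum>w\<in>W. (\<psi> w a - \<psi> w b) *\<^sub>R w x)"
   by (simp add: v_def sum_subtractf scaleR_diff_left)
  then have "nrm X (%x. v a x - v b x) <= (\<Sum>w\<in>W. nrm X (%x. (\<psi> w a - \<psi> w b) *\<^sub>R w x))"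
   using W(2) by (simp only:) (intro nrm_sum_le[OF X] carr_scaleR[OF X], auto)
  also have "\<dots> = G (a, b)"
   unfolding G_def by (rule sum.cong) (use W(2) nrm_scaleR[OF X] in auto)
  finally show ?thesis .
 qed
 have Gc: "continuous_on ({0..1} \<times> {0..1}) G"
  unfolding G_def using \<psi>(1)
  by (intro continuous_on_sum continuous_on_mult continuous_on_const continuous_on_rabs continuous_on_diff
    continuous_on_compose2[OF \<psi>(1)] continuous_on_fst continuous_on_snd continuous_on_id) auto
 then have "uniformly_continuous_on ({0..1} \<times> {0..1}) G"
  by (intro compact_uniformly_continuous compact_Times compact_Icc)
 then obtain d where d: "0 < d" "!!p q. p \<in> {0..1} \<times> {0..1} ==> q \<in> {0..1} \<times> {0..1} ==> dist q p < d ==> dist (G q) (G p) < e"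
  unfolding uniformly_continuous_on_def using e by metis
 have h: "nrm X (%x. v a x - v b x) <= e" if "a \<in> {0..1}" "b \<in> {0..1}" "\<bar>a - b\<bar> <= d/2" for a b
 proof -
  have "dist (G (a, b)) (G (b, b)) < e"
   by (rule d(2)) (use that d(1) in \<open>auto simp: dist_Pair_Pair dist_real_def\<close>)
  moreover have "G (b, b) = 0" by (simp add: G_def)
  ultimately have "G (a, b) < e" by (simp add: dist_real_def)
  then show ?thesis using vG[of a b] by simp
 qed
 have vcont: "continuous_in X {0..1} v"
  unfolding continuous_in_def
 proof (intro conjI ballI vc)
  fix t :: real assume t: "t \<in> {0..1}"
  show "((%a. nrm X (%x. v a x - v t x)) \<longlongrightarrow> 0) (at t within {0..1})"
  proof (rule Lim_null_comparison)
   show "\<forall>\<^sub>F a in at t within {0..1}. norm (nrm X (%x. v a x - v t x)) <= G (a, t)"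
    using vG nrm_nonneg[OF X carr_diff[OF X vc vc]] by (intro always_eventually allI) simp
   have "continuous_on {0..1} (%a. G (a, t))"
    by (rule continuous_on_compose2[OF Gc]) (use t in \<open>auto intro!: continuous_intros\<close>)
   then have "((%a. G (a, t)) \<longlongrightarrow> G (t, t)) (at t within {0..1})" using t by (simp add: continuous_on_def)
   then show "((%a. G (a, t)) \<longlongrightarrow> 0) (at t within {0..1})" by (simp add: G_def)
  qed
 qed
 have vL: "Lp_in X 2 {0<..<1} v" by (rule Lp_in_continuous[OF X vcont]) simp
 have uv: "Lp_in X 2 {0<..<1} (%t x. u t x - v t x)" by (rule Lp_in_2_diff[OF X u vL])
 have sL: "Lp_in X 2 {0<..<1} s"
 proof -
  have "integrable T (%t. (nrm X (s t))\<^sup>2)"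
   using simple_function_compose1[OF s(1), of "%h. (nrm X h)\<^sup>2"]
   by (intro finite_measure.integrable_const_bound[OF T_finite, where B="S\<^sup>2"] borel_measurable_simple_function)
     (use W(1) nW in \<open>auto intro!: AE_I2 power_mono member_le_sum simp: S_def W_def\<close>)
  then show ?thesis using strongly_measurable_simple[OF X s] by (simp add: Lp_in_2[OF X])
 qed
 have usL: "Lp_in X 2 {0<..<1} (%t x. u t x - s t x)" by (rule Lp_in_2_diff[OF X u sL])
 have svL: "Lp_in X 2 {0<..<1} (%t x. s t x - v t x)" by (rule Lp_in_2_diff[OF X sL vL])
 have abs_int: "integrable T (%t. \<bar>indicator (A w) t - \<psi> w t\<bar>)" for w
 proof (rule finite_measure.integrable_const_bound[OF T_finite, where B=1])
  have "(indicator (A w) :: real => real) \<in> borel_measurable T"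
   by (rule measurable_restrict_space1) (rule borel_measurable_indicator[OF AL])
  moreover have "\<psi> w \<in> borel_measurable T"
   by (rule continuous_imp_measurable_on_sets_lebesgue[OF continuous_on_subset[OF \<psi>(1)]]) auto
  ultimately show "(%t. \<bar>indicator (A w) t - \<psi> w t\<bar>) \<in> borel_measurable T" by simp
  show "AE t in T. norm \<bar>indicator (A w) t - \<psi> w t\<bar> <= 1"
  proof (rule AE_I2)
   fix t show "norm \<bar>indicator (A w) t - \<psi> w t\<bar> <= 1"
    using \<psi>(2)[of w t] by (auto simp: indicator_def abs_le_iff)
  qed
 qed
 have sv: "(LINT t|T. (nrm X (%x. s t x - v t x))\<^sup>2) <= e\<^sup>2/4"
 proof -
  have "(nrm X (%x. s t x - v t x))\<^sup>2 <= (\<Sum>w\<in>W. S * nrm X w * \<bar>indicator (A w) t - \<psi> w t\<bar>)" if t: "t \<in> {0<..<1}" for t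
  proof -
   have "s t x = (\<Sum>w\<in>W. indicator (A w) t *\<^sub>R w x)" for x
   proof -
    have "(\<Sum>w\<in>W. indicator (A w) t *\<^sub>R w x) = (\<Sum>w\<in>W. if w = s t then w x else 0)"
     by (rule sum.cong) (use t in \<open>auto simp: A_def indicator_def\<close>)
    then show ?thesis using t W(1) by (simp add: W_def)
   qed
   then have "(%x. s t x - v t x) = (%x. \<Sum>w\<in>W. (indicator (A w) t - \<psi> w t) *\<^sub>R w x)"
    by (simp add: v_def sum_subtractf scaleR_diff_left)
   then have "nrm X (%x. s t x - v t x) <= (\<Sum>w\<in>W. nrm X (%x. (indicator (A w) t - \<psi> w t) *\<^sub>R w x))"
    using W(2) by (simp only:) (intro nrm_sum_le[OF X] carr_scaleR[OF X], auto)
   also have "\<dots> = (\<Sum>w\<in>W. \<bar>indicator (A w) t - \<psi> w t\<bar> * nrm X w)"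
    by (rule sum.cong) (use W(2) nrm_scaleR[OF X] in auto)
   finally have le: "nrm X (%x. s t x - v t x) <= (\<Sum>w\<in>W. \<bar>indicator (A w) t - \<psi> w t\<bar> * nrm X w)" .
   have le1: "\<bar>indicator (A w) t - \<psi> w t\<bar> <= 1" for w
    using \<psi>(2)[of w t] by (auto simp: indicator_def abs_le_iff)
   have leS: "(\<Sum>w\<in>W. \<bar>indicator (A w) t - \<psi> w t\<bar> * nrm X w) <= S"
    unfolding S_def using le1 nW by (intro sum_mono mult_left_le_one_le) auto
   have st: "s t \<in> carr X" using t s(2) by auto
   have n0: "0 <= nrm X (%x. s t x - v t x)" by (rule nrm_nonneg[OF X carr_diff[OF X st vc]])
   have "(nrm X (%x. s t x - v t x))\<^sup>2 <= S * (\<Sum>w\<in>W. \<bar>indicator (A w) t - \<psi> w t\<bar> * nrm X w)"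
    unfolding power2_eq_square using le leS n0 S0 by (intro mult_mono) auto
   then show ?thesis by (simp add: sum_distrib_left mult_ac)
  qed
  then have "(LINT t|T. (nrm X (%x. s t x - v t x))\<^sup>2) <= (LINT t|T. (\<Sum>w\<in>W. S * nrm X w * \<bar>indicator (A w) t - \<psi> w t\<bar>))"
   using svL abs_int by (intro integral_mono) (auto simp: Lp_in_2[OF X])
  also have "\<dots> = (\<Sum>w\<in>W. S * nrm X w * (LINT t|T. \<bar>indicator (A w) t - \<psi> w t\<bar>))"
   using abs_int by simp
  also have "\<dots> <= (\<Sum>w\<in>W. S * nrm X w * \<eta>)"
   using \<psi>(3) nW S0 by (intro sum_mono mult_left_mono) auto
  also have "\<dots> = S\<^sup>2 * \<eta>" by (simp add: S_def sum_distrib_left sum_distrib_right power2_eq_square mult_ac)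
  also have "\<dots> <= e\<^sup>2/4"
  proof -
   have "S\<^sup>2 * \<eta> <= K * \<eta>" using \<eta> by (intro mult_right_mono) (auto simp: K_def)
   also have "\<dots> = e\<^sup>2/4" using S1 by (simp add: \<eta>_def)
   finally show ?thesis .
  qed
  finally show ?thesis .
 qed
 have "(LINT t|T. (nrm X (%x. u t x - v t x))\<^sup>2)
   <= (LINT t|T. 2 * (nrm X (%x. u t x - s t x))\<^sup>2 + 2 * (nrm X (%x. s t x - v t x))\<^sup>2)"
 proof (rule integral_mono_AE)
  show "integrable T (%t. (nrm X (%x. u t x - v t x))\<^sup>2)" using uv by (simp add: Lp_in_2[OF X])
  show "integrable T (%t. 2 * (nrm X (%x. u t x - s t x))\<^sup>2 + 2 * (nrm X (%x. s t x - v t x))\<^sup>2)"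
   using usL svL by (simp add: Lp_in_2[OF X])
  have "AE t in T. u t \<in> carr X" using u by (auto simp: Lp_in_def intro: strongly_measurable_carr)
  then show "AE t in T. (nrm X (%x. u t x - v t x))\<^sup>2 <= 2 * (nrm X (%x. u t x - s t x))\<^sup>2 + 2 * (nrm X (%x. s t x - v t x))\<^sup>2"
   using AE_space
  proof eventually_elim
   fix t assume ut: "u t \<in> carr X" and "t \<in> space T"
   then have st: "s t \<in> carr X" using s(2) by auto
   have "(nrm X (%x. u t x - v t x))\<^sup>2 <= (nrm X (%x. u t x - s t x) + nrm X (%x. s t x - v t x))\<^sup>2"
    by (intro power_mono nrm_triangle_sub[OF X ut st vc] nrm_nonneg[OF X carr_diff[OF X ut vc]])
   also have "\<dots> <= 2 * (nrm X (%x. u t x - s t x))\<^sup>2 + 2 * (nrm X (%x. s t x - v t x))\<^sup>2"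
    using sum_squares_bound[of "nrm X (%x. u t x - s t x)" "nrm X (%x. s t x - v t x)"] by (simp add: power2_sum)
   finally show "(nrm X (%x. u t x - v t x))\<^sup>2 <= 2 * (nrm X (%x. u t x - s t x))\<^sup>2 + 2 * (nrm X (%x. s t x - v t x))\<^sup>2" .
  qed
 qed
 also have "\<dots> = 2 * (LINT t|T. (nrm X (%x. u t x - s t x))\<^sup>2) + 2 * (LINT t|T. (nrm X (%x. s t x - v t x))\<^sup>2)"
  using usL svL by (simp add: Lp_in_2[OF X])
 also have "\<dots> <= e\<^sup>2" using sle sv by simp
 finally have fin: "(LINT t|T. (nrm X (%x. u t x - v t x))\<^sup>2) <= e\<^sup>2" .
 show ?thesis by (rule that[of v "d/2", OF vc _ h uv fin]) (use d(1) in auto)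
qed

subsection \<open>The integrated equation and the energy estimate\<close>

context bounded_open
begin

lemma Hm1_pairing_measurable:
 assumes l: "strongly_measurable_in VV' {0<..<1} l" and w: "w \<in> carr VV"
 shows "(%t. l t w) \<in> borel_measurable T"
proof -
 obtain s where s: "!!i::nat. simple_function T (s i)" "!!i. s i ` {0<..<1} \<subseteq> carr VV'"
  and lim: "AE t in T. l t \<in> carr VV' \<and> (%i. nrm VV' (%x. l t x - s i t x)) \<longlonglongrightarrow> 0"
  by (rule strongly_measurable_inE[OF l]) blast
 show ?thesis
 proof (rule AE_T_limit_measurable)
  show "(%t. s i t w) \<in> borel_measurable T" for i
   by (rule borel_measurable_simple_function[OF simple_function_compose1[OF s(1), of "%h. h w"]])
  show "AE t in T. (%i. s i t w) \<longlonglongrightarrow> l t w"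
   using lim AE_space
  proof eventually_elim
   fix t assume t: "l t \<in> carr VV' \<and> (%i. nrm VV' (%x. l t x - s i t x)) \<longlonglongrightarrow> 0" "t \<in> space T"
   have st: "s i t \<in> carr VV'" for i using s(2)[of i] t(2) by auto
   have le: "norm (l t w - s i t w) <= nrm VV' (%x. l t x - s i t x) * nrm VV w" for i
    by (rule antidual_pairing[OF seminormed_H10 carr_diff[OF seminormed_Hm1 conjunct1[OF t(1)] st] w])
   have "(%i. nrm VV' (%x. l t x - s i t x) * nrm VV w) \<longlonglongrightarrow> 0"
    using tendsto_mult[OF conjunct2[OF t(1)] tendsto_const[of "nrm VV w"]] by simp
   then have "(%i. l t w - s i t w) \<longlonglongrightarrow> 0"
    by (rule Lim_null_comparison[OF always_eventually[OF allI[OF le]]])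
   from tendsto_diff[OF tendsto_const[of "l t w"] this] show "(%i. s i t w) \<longlonglongrightarrow> l t w" by simp
  qed
 qed
qed

text \<open>Evaluation at a fixed element is a bounded functional on the antidual, so it commutes with the integral.\<close>

lemma Hm1_bochner_pairing:
 assumes f: "has_bochner_integral_in VV' {0<..<1} f y" and w: "w \<in> carr VV"
 shows "(LINT t|T. f t w) = y w"
proof -
 obtain s where s: "!!i::nat. simple_function T (s i)" "!!i. s i ` {0<..<1} \<subseteq> carr VV'"
  and lim: "(%i. \<integral>\<^sup>+t. ennreal (nrm VV' (%x. f t x - s i t x)) \<partial>T) \<longlonglongrightarrow> 0"
  and int: "(%i. nrm VV' (%x. Bochner_Integration.simple_bochner_integral T (%t. s i t x) - y x)) \<longlonglongrightarrow> 0"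
  and sm: "strongly_measurable_in VV' {0<..<1} f" and y: "y \<in> carr VV'"
  using f unfolding has_bochner_integral_in_def by blast
 have "has_bochner_integral T (%t. f t w) (y w)"
 proof (rule has_bochner_integral.intros)
  show "(%t. f t w) \<in> borel_measurable T" by (rule Hm1_pairing_measurable[OF sm w])
  show "Bochner_Integration.simple_bochner_integrable T (%t. s i t w)" for i
   by (rule simple_bochner_integrable_T[OF simple_function_compose1[OF s(1), of "%h. h w"]])
  show "(%i. \<integral>\<^sup>+t. norm (f t w - s i t w) \<partial>T) \<longlonglongrightarrow> 0"
  proof (rule tendsto_sandwich[OF _ _ tendsto_const])
   show "(%i. (\<integral>\<^sup>+t. ennreal (nrm VV' (%x. f t x - s i t x)) \<partial>T) * ennreal (nrm VV w)) \<longlonglongrightarrow> 0"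
    using tendsto_mult_ennreal[OF lim tendsto_const[of "ennreal (nrm VV w)"]] by simp
   show "\<forall>\<^sub>F i in sequentially. (\<integral>\<^sup>+t. norm (f t w - s i t w) \<partial>T)
     <= (\<integral>\<^sup>+t. ennreal (nrm VV' (%x. f t x - s i t x)) \<partial>T) * ennreal (nrm VV w)"
   proof (rule always_eventually, rule allI)
    fix i
    have dm: "(%t. ennreal (nrm VV' (%x. f t x - s i t x))) \<in> borel_measurable T"
     by (rule measurable_compose[OF strongly_measurable_nrm[OF seminormed_Hm1 strongly_measurable_diff[OF seminormed_Hm1 sm
      strongly_measurable_simple[OF seminormed_Hm1 s]]] measurable_ennreal])
    have "(\<integral>\<^sup>+t. norm (f t w - s i t w) \<partial>T) <= (\<integral>\<^sup>+t. ennreal (nrm VV' (%x. f t x - s i t x)) * ennreal (nrm VV w) \<partial>T)"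
    proof (rule nn_integral_mono_AE)
     show "AE t in T. ennreal (norm (f t w - s i t w)) <= ennreal (nrm VV' (%x. f t x - s i t x)) * ennreal (nrm VV w)"
      using strongly_measurable_carr[OF sm] AE_space
     proof eventually_elim
      fix t assume ft: "f t \<in> carr VV'" and "t \<in> space T"
      then have st: "s i t \<in> carr VV'" using s(2)[of i] by auto
      have d: "(%x. f t x - s i t x) \<in> carr VV'" by (rule carr_diff[OF seminormed_Hm1 ft st])
      show "ennreal (norm (f t w - s i t w)) <= ennreal (nrm VV' (%x. f t x - s i t x)) * ennreal (nrm VV w)"
       using antidual_pairing[OF seminormed_H10 d w] nrm_nonneg[OF seminormed_Hm1 d] nrm_nonneg[OF seminormed_H10 w]
       by (subst ennreal_mult[symmetric]) (auto intro!: ennreal_leI)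
     qed
    qed
    also have "\<dots> = (\<integral>\<^sup>+t. ennreal (nrm VV' (%x. f t x - s i t x)) \<partial>T) * ennreal (nrm VV w)"
     by (rule nn_integral_multc[OF dm])
    finally show "(\<integral>\<^sup>+t. norm (f t w - s i t w) \<partial>T)
     <= (\<integral>\<^sup>+t. ennreal (nrm VV' (%x. f t x - s i t x)) \<partial>T) * ennreal (nrm VV w)" .
   qed
  qed auto
  define z where "z i x = Bochner_Integration.simple_bochner_integral T (%t. s i t x)" for i x
  have z_sum: "z i x = (\<Sum>h\<in>s i ` space T. measure T {t\<in>space T. s i t = h} *\<^sub>R h x)" for i x
   unfolding z_def
   by (rule Bochner_Integration.simple_bochner_integral_partition[OF simple_bochner_integrable_T[OF simple_function_compose1[OF s(1)]] s(1)]) auto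
  have hs: "h \<in> carr VV'" if "h \<in> s i ` space T" for h i using that s(2)[of i] by auto
  have zc: "z i \<in> carr VV'" for i
   unfolding z_sum[abs_def] by (intro carr_sum[OF seminormed_Hm1] carr_scaleR[OF seminormed_Hm1] hs)
  have le: "norm (z i w - y w) <= nrm VV' (%x. z i x - y x) * nrm VV w" for i
   by (rule antidual_pairing[OF seminormed_H10 carr_diff[OF seminormed_Hm1 zc y] w])
  have "(%i. nrm VV' (%x. z i x - y x) * nrm VV w) \<longlonglongrightarrow> 0"
   using tendsto_mult[OF int tendsto_const[of "nrm VV w"]] by (simp add: z_def)
  then have "(%i. z i w - y w) \<longlonglongrightarrow> 0"
   by (rule Lim_null_comparison[OF always_eventually[OF allI[OF le]]])
  then show "(%i. Bochner_Integration.simple_bochner_integral T (%t. s i t w)) \<longlonglongrightarrow> y w"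
   by (simp add: z_def LIM_zero_iff)
 qed
 then show ?thesis by (rule has_bochner_integral_integral_eq)
qed

lemma embed_H_cong_right:
 assumes "sqint M h" "sqint M v" "sqint M w" "l2norm M (%x. v x - w x) = 0"
 shows "emb h v = emb h w"
proof -
 have "AE x in M. v x - w x = 0" using assms l2norm_eq_0_iff[OF sqint_diff] by blast
 then have "AE x in M. h x * cnj (v x) = h x * cnj (w x)" by eventually_elim simp
 then show ?thesis
  unfolding embed_H_def using embed_H_integrable[OF assms(1,2)] embed_H_integrable[OF assms(1,3)]
  by (intro integral_cong_AE) auto
qed

lemma embed_H_cong_left:
 assumes "sqint M h" "sqint M k" "sqint M w" "l2norm M (%x. h x - k x) = 0"
 shows "emb h w = emb k w"
 using embed_H_bound[OF sqint_diff[OF assms(1,2)] assms(3)] assms by (simp add: embed_H_diff)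

text \<open>Paired with a fixed element, the weak derivative in the antidual becomes a scalar weak derivative, and a scalar
function with an integrable weak derivative is its primitive. The element \<open>R\<close> is the representative that is continuous
in \<open>L2\<close>, which carries the initial value.\<close>

lemma lions_solution_integrated:
 assumes U: "lions_solution \<Omega> B F U"
 obtains R D where "continuous_in HH {0..1} R" "l2norm M (R 0) = 0"
  "AE t in T. U t \<in> carr VV \<and> l2norm M (%x. U t x - R t x) = 0"
  "AE t in T. \<forall>w\<in>carr VV. D t w + neg_div \<Omega> (B t) (U t) w = F t w"
  "!!w. w \<in> carr VV ==> integrable T (%t. D t w)"
  "!!w t. w \<in> carr VV ==> 0 < t ==> t < 1 ==> integral {0..t} (%s. D s w) = emb (R t) w"
proof -
 obtain D R where UL: "Lp_in VV 2 {0<..<1} U" and DL: "Lp_in VV' 2 {0<..<1} D"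
  and wd: "weak_derivative_in VV' {0<..<1} (%t. emb (U t)) D"
  and eq: "AE t in T. \<forall>w\<in>carr VV. D t w + neg_div \<Omega> (B t) (U t) w = F t w"
  and Rc: "continuous_in HH {0..1} R"
  and UR: "AE t in T. nrm HH (%x. U t x - R t x) = 0" and R0: "nrm HH (R 0) = 0"
  using U unfolding lions_solution_def by blast
 have Rsq: "sqint M (R t)" if "t \<in> {0..1}" for t using Rc that by (simp add: continuous_in_def L2_carr)
 have Uc: "AE t in T. U t \<in> carr VV"
  using UL unfolding Lp_in_def by (blast intro: strongly_measurable_carr)
 have good: "AE t in T. U t \<in> carr VV \<and> l2norm M (%x. U t x - R t x) = 0"
  using Uc UR by eventually_elim (simp add: L2_nrm)
 have Dm: "strongly_measurable_in VV' {0<..<1} D" and D2: "integrable T (%t. (nrm VV' (D t))\<^sup>2)"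
  using DL by (auto simp: Lp_in_2[OF seminormed_Hm1])
 have Dint: "integrable T (%t. D t w)" if w: "w \<in> carr VV" for w
 proof (rule Bochner_Integration.integrable_bound)
  show "integrable T (%t. ((nrm VV' (D t))\<^sup>2 + 1) * nrm VV w)"
   by (intro integrable_mult_left Bochner_Integration.integrable_add D2 finite_measure.integrable_const[OF T_finite])
  show "(%t. D t w) \<in> borel_measurable T" by (rule Hm1_pairing_measurable[OF Dm w])
  show "AE t in T. norm (D t w) <= norm (((nrm VV' (D t))\<^sup>2 + 1) * nrm VV w)"
   using strongly_measurable_carr[OF Dm]
  proof eventually_elim
   fix t assume Dt: "D t \<in> carr VV'"
   have "nrm VV' (D t) <= (nrm VV' (D t))\<^sup>2 + 1"
    using sum_squares_bound[of "nrm VV' (D t)" 1] nrm_nonneg[OF seminormed_Hm1 Dt] by simp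
   then have "nrm VV' (D t) * nrm VV w <= ((nrm VV' (D t))\<^sup>2 + 1) * nrm VV w"
    by (intro mult_right_mono nrm_nonneg[OF seminormed_H10 w])
   with antidual_pairing[OF seminormed_H10 Dt w]
   show "norm (D t w) <= norm (((nrm VV' (D t))\<^sup>2 + 1) * nrm VV w)"
    by (simp only: real_norm_def)
  qed
 qed
 have "integral {0..t} (%s. D s w) = emb (R t) w" if w: "w \<in> carr VV" and t: "0 < t" "t < 1" for w t
 proof -
  have cc: "continuous_on {0..1} (%t. emb (R t) w)"
   unfolding continuous_on_def
  proof
   fix t :: real assume t: "t \<in> {0..1}"
   have "((%s. emb (R s) w - emb (R t) w) \<longlongrightarrow> 0) (at t within {0..1})"
   proof (rule Lim_null_comparison)
    show "\<forall>\<^sub>F s in at t within {0..1}. norm (emb (R s) w - emb (R t) w) <= nrm HH (%x. R s x - R t x) * l2norm M w"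
     unfolding eventually_at_filter
    proof (intro always_eventually allI impI)
     fix s :: real assume s: "s \<in> {0..1}"
     show "norm (emb (R s) w - emb (R t) w) <= nrm HH (%x. R s x - R t x) * l2norm M w"
      using embed_H_bound[OF sqint_diff[OF Rsq[OF s] Rsq[OF t]] H10_sqint[OF w]]
      by (simp add: embed_H_diff[OF Rsq[OF s] Rsq[OF t] H10_sqint[OF w]] L2_nrm)
    qed
    have "((%s. nrm HH (%x. R s x - R t x)) \<longlongrightarrow> 0) (at t within {0..1})" using Rc t by (simp add: continuous_in_def)
    from tendsto_mult[OF this tendsto_const[of "l2norm M w"]]
    show "((%s. nrm HH (%x. R s x - R t x) * l2norm M w) \<longlongrightarrow> 0) (at t within {0..1})" by simp
   qed
   then show "((%t. emb (R t) w) \<longlongrightarrow> emb (R t) w) (at t within {0..1})" by (simp add: LIM_zero_iff)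
  qed
  have "integral {0..t} (%s. D s w) = emb (R t) w - emb (R 0) w"
  proof (rule du_bois_reymond[OF cc Dint[OF w] _ t])
   fix \<phi> :: "real => real" assume \<phi>: "\<phi> \<in> test_functions {0<..<1}"
   obtain y where y: "has_bochner_integral_in VV' {0<..<1} (%t x. deriv \<phi> t *\<^sub>R emb (U t) x) y"
    "has_bochner_integral_in VV' {0<..<1} (%t x. \<phi> t *\<^sub>R D t x) (%x. - y x)"
    using wd \<phi> unfolding weak_derivative_in_def by blast
   have s\<phi>: "smooth \<phi>" using \<phi> by (rule test_functions_smooth)
   have "(LINT t|T. deriv \<phi> t *\<^sub>R emb (R t) w) = (LINT t|T. deriv \<phi> t *\<^sub>R emb (U t) w)"
   proof (rule integral_cong_AE)
    have \<phi>m: "deriv \<phi> \<in> borel_measurable T"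
     by (rule continuous_imp_measurable_on_sets_lebesgue[OF smooth_continuous[OF smooth_deriv[OF s\<phi>]]]) simp
    show "(%t. deriv \<phi> t *\<^sub>R emb (R t) w) \<in> borel_measurable T"
     by (rule borel_measurable_scaleR[OF \<phi>m borel_measurable_integrable[OF integrable_T_continuous[OF cc]]])
    have "strongly_measurable_in VV' {0<..<1} (%t x. deriv \<phi> t *\<^sub>R emb (U t) x)"
     using y(1) by (simp add: has_bochner_integral_in_def)
    from Hm1_pairing_measurable[OF this w] show "(%t. deriv \<phi> t *\<^sub>R emb (U t) w) \<in> borel_measurable T" .
    show "AE t in T. deriv \<phi> t *\<^sub>R emb (R t) w = deriv \<phi> t *\<^sub>R emb (U t) w"
     using good AE_space
    proof eventually_elim
     fix t assume a: "U t \<in> carr VV \<and> l2norm M (%x. U t x - R t x) = 0" and "t \<in> space T"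
     then have "t \<in> {0..1}" by simp
     then have "emb (U t) w = emb (R t) w"
      using a by (intro embed_H_cong_left H10_sqint[OF w] Rsq) (auto intro: H10_sqint)
     then show "deriv \<phi> t *\<^sub>R emb (R t) w = deriv \<phi> t *\<^sub>R emb (U t) w" by simp
    qed
   qed
   then show "(LINT t|T. deriv \<phi> t *\<^sub>R emb (R t) w) = - (LINT t|T. \<phi> t *\<^sub>R D t w)"
    using Hm1_bochner_pairing[OF y(1) w] Hm1_bochner_pairing[OF y(2) w] by simp
  qed
  moreover have "emb (R 0) w = 0"
   using embed_H_bound[OF Rsq H10_sqint[OF w], of 0] R0 by (simp add: L2_nrm)
  ultimately show ?thesis by simp
 qed
 then show ?thesis using that[OF Rc _ good eq Dint] R0 by (simp add: L2_nrm)
qed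

end

context bounded_open
begin

lemma embed_H_self: "sqint M h ==> emb h h = of_real ((l2norm M h)\<^sup>2)"
proof -
 have "emb h h = (LINT x|M. of_real ((cmod (h x))\<^sup>2))"
  unfolding embed_H_def by (intro Bochner_Integration.integral_cong refl) (rule complex_norm_square[symmetric])
 then show ?thesis unfolding l2norm_sq by (simp only: integral_complex_of_real)
qed

lemma embed_H_add_right:
 "sqint M h ==> sqint M v ==> sqint M w ==> emb h (%x. v x + w x) = emb h v + emb h w"
 unfolding embed_H_def complex_cnj_add distrib_left by (intro Bochner_Integration.integral_add embed_H_integrable)

lemma embed_H_commute: "emb w h = cnj (emb h w)"
 unfolding embed_H_def complex_integral_cnj by (simp add: mult.commute)

lemma l2norm_sq_diff:
 assumes a: "sqint M a" and b: "sqint M b"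
 shows "(l2norm M a)\<^sup>2 - (l2norm M b)\<^sup>2 = Re (emb a (%x. a x + b x) - emb b (%x. a x + b x))"
 using embed_H_commute[of b a]
 by (simp add: embed_H_add_right a b embed_H_self)

lemma l2norm_triangle_le:
 fixes f g :: "real^'n => complex"
 shows "sqint M f ==> sqint M g ==> \<bar>l2norm M f - l2norm M g\<bar> <= l2norm M (%x. f x - g x)"
 using nrm_abs_diff_le[OF seminormed_L2, of f \<Omega> g] by (simp add: L2_carr L2_nrm)

text \<open>Let \<open>u\<close> be the difference of two solutions, \<open>R\<close> its continuous representative and \<open>f\<close> the squared norm of \<open>R\<close>. For almost
all \<open>s < t\<close>, \<open>f t - f s\<close> is the integral of the time derivative over \<open>(s,t)\<close>, paired with \<open>u t + u s\<close>. Replacing this sum by \<open>2 u\<close> at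
the intermediate time gives twice the coercive form; the error is controlled by the distance \<open>rho\<close> of \<open>u\<close> from a function
\<open>v\<close> that is continuous in time. Averaging over \<open>s\<close> and \<open>t\<close> shows that the gradient of \<open>u\<close> vanishes; then so do the time derivative
and \<open>R\<close>.\<close>

lemma lions_solution_unique:
 assumes bm: "!!t. t \<in> {0..1} ==> b t \<in> meas"
  and b: "!!t x. t \<in> {0..1} ==> x \<in> \<Omega> ==> c <= b t x \<and> b t x <= C" and c: "0 < c" and C: "0 <= C"
  and W: "lions_solution \<Omega> (isotropic b) F W" and U: "lions_solution \<Omega> (isotropic b) F U"
 shows "AE t in T. nrm VV (%x. W t x - U t x) = 0"
proof -
 have babs: "\<bar>b t x\<bar> <= C" if "t \<in> {0..1}" "x \<in> \<Omega>" for t x using b[OF that] c by simp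
 obtain R1 D1 where R1: "continuous_in HH {0..1} R1" "l2norm M (R1 0) = 0"
  "AE t in T. W t \<in> carr VV \<and> l2norm M (%x. W t x - R1 t x) = 0"
  and D1: "AE t in T. \<forall>w\<in>carr VV. D1 t w + neg_div \<Omega> (isotropic b t) (W t) w = F t w"
  "!!w. w \<in> carr VV ==> integrable T (%t. D1 t w)"
  "!!w t. w \<in> carr VV ==> 0 < t ==> t < 1 ==> integral {0..t} (%s. D1 s w) = emb (R1 t) w"
  by (rule lions_solution_integrated[OF W]) blast
 obtain R2 D2 where R2: "continuous_in HH {0..1} R2" "l2norm M (R2 0) = 0"
  "AE t in T. U t \<in> carr VV \<and> l2norm M (%x. U t x - R2 t x) = 0"
  and D2: "AE t in T. \<forall>w\<in>carr VV. D2 t w + neg_div \<Omega> (isotropic b t) (U t) w = F t w"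
  "!!w. w \<in> carr VV ==> integrable T (%t. D2 t w)"
  "!!w t. w \<in> carr VV ==> 0 < t ==> t < 1 ==> integral {0..t} (%s. D2 s w) = emb (R2 t) w"
  by (rule lions_solution_integrated[OF U]) blast
 define u where "u t x = W t x - U t x" for t x
 define R where "R t x = R1 t x - R2 t x" for t x
 define d where "d t w = D1 t w - D2 t w" for t w
 have sq1: "sqint M (R1 t)" and sq2: "sqint M (R2 t)" if "t \<in> {0..1}" for t
  using R1(1) R2(1) that by (simp_all add: continuous_in_def L2_carr)
 have Rsq: "sqint M (R t)" if "t \<in> {0..1}" for t
  unfolding R_def[abs_def] by (rule sqint_diff[OF sq1[OF that] sq2[OF that]])
 have uL: "Lp_in VV 2 {0<..<1} u"
  unfolding u_def[abs_def] using W U by (intro Lp_in_2_diff seminormed_H10) (auto simp: lions_solution_def)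
 note um = conjunct1[OF uL[unfolded Lp_in_2[OF seminormed_H10]]]
 have gi: "integrable T (%t. (nrm VV (u t))\<^sup>2)" using uL by (simp add: Lp_in_2[OF seminormed_H10])
 have Rc: "continuous_in HH {0..1} R"
  unfolding continuous_in_def
 proof (intro conjI ballI)
  fix t :: real assume t: "t \<in> {0..1}"
  show "R t \<in> carr HH" using Rsq[OF t] by (simp add: L2_carr)
  show "((%s. nrm HH (%x. R s x - R t x)) \<longlongrightarrow> 0) (at t within {0..1})"
  proof (rule Lim_null_comparison)
   show "((%s. nrm HH (%x. R1 s x - R1 t x) + nrm HH (%x. R2 s x - R2 t x)) \<longlongrightarrow> 0) (at t within {0..1})"
    using R1(1) R2(1) t unfolding continuous_in_def by (intro tendsto_add_zero) blast+
   show "\<forall>\<^sub>F s in at t within {0..1}. norm (nrm HH (%x. R s x - R t x))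
     <= nrm HH (%x. R1 s x - R1 t x) + nrm HH (%x. R2 s x - R2 t x)"
    unfolding eventually_at_filter
   proof (intro always_eventually allI impI)
    fix s :: real assume s: "s \<in> {0..1}"
    have "nrm HH (%x. (R1 s x - R1 t x) - (R2 s x - R2 t x)) <= nrm HH (%x. R1 s x - R1 t x) + nrm HH (%x. R2 s x - R2 t x)"
     using sqint_diff[OF sq1[OF s] sq1[OF t]] sqint_diff[OF sq2[OF s] sq2[OF t]]
     by (intro nrm_diff_le[OF seminormed_L2]) (simp_all add: L2_carr)
    moreover have "(%x. (R1 s x - R1 t x) - (R2 s x - R2 t x)) = (%x. R s x - R t x)"
     by (simp add: R_def algebra_simps)
    ultimately show "norm (nrm HH (%x. R s x - R t x))
     <= nrm HH (%x. R1 s x - R1 t x) + nrm HH (%x. R2 s x - R2 t x)"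
     by (simp add: L2_nrm l2norm_nonneg)
   qed
  qed
 qed
 have R0: "l2norm M (R 0) = 0"
  using nrm_diff_le[OF seminormed_L2, of "R1 0" \<Omega> "R2 0"] sq1[of 0] sq2[of 0] R1(2) R2(2) l2norm_nonneg[of M "R 0"]
  by (simp add: L2_carr L2_nrm R_def[abs_def])
 have dint: "integrable T (%t. d t w)" if "w \<in> carr VV" for w
  unfolding d_def using D1(2)[OF that] D2(2)[OF that] by (rule Bochner_Integration.integrable_diff)
 have dHK: "(%t. d t w) integrable_on {0..1}" if "w \<in> carr VV" for w
  using has_integral_T[OF dint[OF that]] by (rule has_integral_integrable)
 have dR: "integral {0..t} (%s. d s w) = emb (R t) w" if w: "w \<in> carr VV" and t: "0 < t" "t < 1" for w t
 proof -
  have i: "(%s. D1 s w) integrable_on {0..t}" "(%s. D2 s w) integrable_on {0..t}"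
   by (rule integrable_subinterval_real[OF has_integral_integrable[OF has_integral_T[OF D1(2)[OF w]]]],
     use t in simp,
     rule integrable_subinterval_real[OF has_integral_integrable[OF has_integral_T[OF D2(2)[OF w]]]], use t in simp)
  show ?thesis
   unfolding d_def R_def[abs_def]
   using D1(3)[OF w t] D2(3)[OF w t] t
   by (simp add: Henstock_Kurzweil_Integration.integral_diff[OF i] embed_H_diff sq1 sq2 H10_sqint[OF w])
 qed
 have good: "AE t in T. u t \<in> carr VV \<and> l2norm M (%x. u t x - R t x) = 0 \<and>
   (\<forall>w\<in>carr VV. d t w = - form (b t) (u t) w)"
  using R1(3) R2(3) D1(1) D2(1) AE_space
 proof eventually_elim
  fix t assume a1: "W t \<in> carr VV \<and> l2norm M (%x. W t x - R1 t x) = 0"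
   and a2: "U t \<in> carr VV \<and> l2norm M (%x. U t x - R2 t x) = 0"
   and e1: "\<forall>w\<in>carr VV. D1 t w + neg_div \<Omega> (isotropic b t) (W t) w = F t w"
   and e2: "\<forall>w\<in>carr VV. D2 t w + neg_div \<Omega> (isotropic b t) (U t) w = F t w"
   and "t \<in> space T"
  then have t: "t \<in> {0..1}" by simp
  have uc: "u t \<in> carr VV"
   unfolding u_def[abs_def] using a1 a2 by (intro carr_diff[OF seminormed_H10]) auto
  have "l2norm M (%x. (W t x - R1 t x) - (U t x - R2 t x)) <= l2norm M (%x. W t x - R1 t x) + l2norm M (%x. U t x - R2 t x)"
   using a1 a2 sqint_diff[OF H10_sqint sq1[OF t], of "W t"] sqint_diff[OF H10_sqint sq2[OF t], of "U t"]
    nrm_diff_le[OF seminormed_L2, of "%x. W t x - R1 t x" \<Omega> "%x. U t x - R2 t x"]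
   by (simp add: L2_carr L2_nrm)
  moreover have "(%x. (W t x - R1 t x) - (U t x - R2 t x)) = (%x. u t x - R t x)"
   by (simp add: u_def R_def algebra_simps)
  ultimately have "l2norm M (%x. u t x - R t x) = 0"
   using a1 a2 l2norm_nonneg[of M "%x. u t x - R t x"] by simp
  moreover have "d t w = - form (b t) (u t) w" if w: "w \<in> carr VV" for w
  proof -
   have eq: "D1 t w + form (b t) (W t) w = D2 t w + form (b t) (U t) w"
    using e1 e2 w by (simp add: neg_div_isotropic)
   have "D1 t w = (D1 t w + form (b t) (W t) w) - form (b t) (W t) w" by simp
   also have "\<dots> = D2 t w + form (b t) (U t) w - form (b t) (W t) w" by (simp only: eq)
   finally have "D1 t w = D2 t w + form (b t) (U t) w - form (b t) (W t) w" .
   moreover have "form (b t) (u t) w = form (b t) (W t) w - form (b t) (U t) w"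
    unfolding u_def[abs_def] using a1 a2 w babs[OF t]
    by (intro form_diff_left[OF bm[OF t] C]) auto
   ultimately show ?thesis by (simp add: d_def)
  qed
  ultimately show "u t \<in> carr VV \<and> l2norm M (%x. u t x - R t x) = 0 \<and>
   (\<forall>w\<in>carr VV. d t w = - form (b t) (u t) w)" using uc by blast
 qed
 obtain N where N: "negligible N" and goodN: "!!t. t \<in> {0<..<1} ==> t \<notin> N ==> u t \<in> carr VV \<and>
   l2norm M (%x. u t x - R t x) = 0 \<and> (\<forall>w\<in>carr VV. d t w = - form (b t) (u t) w)"
  by (rule AE_T_negligible[OF good]) blast
 have uc: "u t \<in> carr VV" and uR: "l2norm M (%x. u t x - R t x) = 0"
  and du: "!!w. w \<in> carr VV ==> d t w = - form (b t) (u t) w" if "t \<in> {0<..<1}" "t \<notin> N" for t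
  using goodN[OF that] by auto
 define f where "f t = (l2norm M (R t))\<^sup>2" for t
 define g where "g t = nrm VV (u t)" for t
 have fc: "continuous_on {0..1} f"
  unfolding f_def using continuous_in_nrm[OF seminormed_L2 Rc] by (auto simp: L2_nrm intro!: continuous_on_power)
 have fu: "f t = (l2norm M (u t))\<^sup>2" if t: "t \<in> {0<..<1}" "t \<notin> N" for t
  using l2norm_triangle_le[OF H10_sqint[OF uc[OF t]] Rsq[of t]] uR[OF t] t by (simp add: f_def)
 have g0: "(g t)\<^sup>2 - f t = (l2norm M (wg (u t)))\<^sup>2" if t: "t \<in> {0<..<1}" "t \<notin> N" for t
  using H10_nrm_sq[OF uc[OF t]] fu[OF t] by (simp add: g_def)
 have gi': "integrable T (%t. (g t)\<^sup>2)" using gi by (simp add: g_def)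
 have fi: "integrable T f" by (rule integrable_T_continuous[OF fc])
 define G where "G = (LINT t|T. (g t)\<^sup>2)"
 define I0 where "I0 = (LINT t|T. (g t)\<^sup>2 - f t)"
 have G0: "0 <= G" by (simp add: G_def)
 have main: "2 * c * I0 <= \<epsilon> * (C * (3 * G + 3))" if e: "0 < \<epsilon>" for \<epsilon>
 proof -
  obtain v h0 where v: "!!t. v t \<in> carr VV" and h0: "0 < h0"
   "!!s t. s \<in> {0..1} ==> t \<in> {0..1} ==> \<bar>s - t\<bar> <= h0 ==> nrm VV (%x. v s x - v t x) <= \<epsilon>"
   and uv: "Lp_in VV 2 {0<..<1} (%t x. u t x - v t x)"
   and P: "(LINT t|T. (nrm VV (%x. u t x - v t x))\<^sup>2) <= \<epsilon>\<^sup>2"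
   by (rule Lp_in_2_continuous_approx[OF seminormed_H10 uL e]) blast
  define \<rho> where "\<rho> t = nrm VV (%x. u t x - v t x)" for t
  have \<rho>i: "integrable T (%t. (\<rho> t)\<^sup>2)" using uv by (simp add: Lp_in_2[OF seminormed_H10] \<rho>_def)
  define r where "r t = C / (2 * \<epsilon>) * (\<rho> t)\<^sup>2" for t
  (* Young's inequality splits the error of the pairing into the parts below, each integrable in time. *)
  define \<gamma> where "\<gamma> t = - (2 * c) * ((g t)\<^sup>2 - f t) + C * (3 * \<epsilon> * (g t)\<^sup>2 + (\<rho> t)\<^sup>2 / \<epsilon> + \<epsilon>)" for t
  have ri: "integrable T r" unfolding r_def using \<rho>i by simp
  have const: "integrable T (%_. x :: real)" for x by (rule finite_measure.integrable_const[OF T_finite])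
  have \<gamma>i: "integrable T \<gamma>"
   unfolding \<gamma>_def using gi' fi \<rho>i const
   by (intro Bochner_Integration.integrable_add integrable_mult_right Bochner_Integration.integrable_diff
     integrable_divide) auto
  have T1: "measure T (space T) = 1" using measure_T by simp
  have rHK: "(r has_integral (LINT t|T. r t)) {0..1}" and \<gamma>HK: "(\<gamma> has_integral (LINT t|T. \<gamma> t)) {0..1}"
   using has_integral_T[OF ri] has_integral_T[OF \<gamma>i] .
  have "f 1 - f 0 <= integral {0..1} \<gamma> + 2 * integral {0..1} r"
  proof (rule increment_inequality[OF fc _ _ _ N h0(1)])
   show "\<gamma> integrable_on {0..1}" "r integrable_on {0..1}"
    using rHK \<gamma>HK by (auto intro: has_integral_integrable)
   show "0 <= r t" for t using C e by (simp add: r_def)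
   fix s t :: real assume st: "0 < s" "s < t" "t < 1" and sN: "s \<notin> N" and tN: "t \<notin> N" and sth: "t - s <= h0"
   have s01: "s \<in> {0<..<1}" and t01: "t \<in> {0<..<1}" using st by auto
   define w where "w x = u t x + u s x" for x
   have wc: "w \<in> carr VV"
    unfolding w_def[abs_def] by (intro carr_add[OF seminormed_H10] uc s01 t01 sN tN)
   have swap: "emb h (%x. R t x + R s x) = emb h w" if h: "sqint M h" for h
   proof -
    have "emb h w = emb h (u t) + emb h (u s)"
     unfolding w_def[abs_def] by (intro embed_H_add_right h H10_sqint uc s01 t01 sN tN)
    also have "\<dots> = emb h (R t) + emb h (R s)"
     using embed_H_cong_right[OF h H10_sqint[OF uc[OF t01 tN]] Rsq uR[OF t01 tN]]
      embed_H_cong_right[OF h H10_sqint[OF uc[OF s01 sN]] Rsq uR[OF s01 sN]] st by simp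
    also have "\<dots> = emb h (%x. R t x + R s x)"
     using st by (intro embed_H_add_right[symmetric] h Rsq) auto
    finally show ?thesis by simp
   qed
   have Rt: "sqint M (R t)" "sqint M (R s)" using Rsq st by auto
   have "f t - f s = Re (emb (R t) w - emb (R s) w)"
    unfolding f_def l2norm_sq_diff[OF Rt] swap[OF Rt(1)] swap[OF Rt(2)] ..
   also have "emb (R t) w - emb (R s) w = integral {s..t} (%\<sigma>. d \<sigma> w)"
   proof -
    have "(%\<sigma>. d \<sigma> w) integrable_on {0..t}"
     by (rule integrable_subinterval_real[OF dHK[OF wc]]) (use st in auto)
    then have "integral {0..s} (%\<sigma>. d \<sigma> w) + integral {s..t} (%\<sigma>. d \<sigma> w) = integral {0..t} (%\<sigma>. d \<sigma> w)"
     using st by (intro Henstock_Kurzweil_Integration.integral_combine) auto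
    then show ?thesis using dR[OF wc, of s] dR[OF wc, of t] st by (simp add: algebra_simps)
   qed
   also have "Re (integral {s..t} (%\<sigma>. d \<sigma> w)) = integral {s..t} (%\<sigma>. Re (d \<sigma> w))"
   proof -
    have "(%\<sigma>. d \<sigma> w) integrable_on {s..t}"
     by (rule integrable_subinterval_real[OF dHK[OF wc]]) (use st in auto)
    from has_integral_Re[OF integrable_integral[OF this]] show ?thesis by (rule integral_unique[symmetric])
   qed
   also have "\<dots> <= integral {s..t} (%\<sigma>. \<gamma> \<sigma> + (r s + r t))"
   proof (rule integral_le_negligible[OF _ _ N])
    have "(%\<sigma>. d \<sigma> w) integrable_on {s..t}"
     by (rule integrable_subinterval_real[OF dHK[OF wc]]) (use st in auto)
    from has_integral_Re[OF integrable_integral[OF this]]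
    show "(%\<sigma>. Re (d \<sigma> w)) integrable_on {s..t}" by (rule has_integral_integrable)
    have "\<gamma> integrable_on {s..t}"
     by (rule integrable_subinterval_real[OF has_integral_integrable[OF \<gamma>HK]]) (use st in auto)
    then show "(%\<sigma>. \<gamma> \<sigma> + (r s + r t)) integrable_on {s..t}"
     by (intro Henstock_Kurzweil_Integration.integrable_add Henstock_Kurzweil_Integration.integrable_const_ivl)
    fix \<sigma> assume \<sigma>: "\<sigma> \<in> {s..t}" and \<sigma>N: "\<sigma> \<notin> N"
    have \<sigma>01: "\<sigma> \<in> {0<..<1}" and \<sigma>01': "\<sigma> \<in> {0..1}" using \<sigma> st by auto
    note us = uc[OF s01 sN] and ut = uc[OF t01 tN] and u\<sigma> = uc[OF \<sigma>01 \<sigma>N]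
    define e1 e2 where "e1 x = u t x - u \<sigma> x" and "e2 x = u s x - u \<sigma> x" for x
    have ec: "e1 \<in> carr VV" "e2 \<in> carr VV"
     unfolding e1_def[abs_def] e2_def[abs_def] by (intro carr_diff[OF seminormed_H10] us ut u\<sigma>)+
    have w_eq: "w = (%x. (u \<sigma> x + u \<sigma> x) + (e1 x + e2 x))"
     by (simp add: w_def[abs_def] e1_def e2_def)
    have near: "nrm VV (%x. u a x - u \<sigma> x) <= \<rho> a + \<epsilon> + \<rho> \<sigma>"
     if a: "u a \<in> carr VV" "a \<in> {0..1}" "\<bar>a - \<sigma>\<bar> <= h0" for a
    proof -
     have "nrm VV (%x. u a x - u \<sigma> x) <= \<rho> a + nrm VV (%x. v a x - u \<sigma> x)"
      unfolding \<rho>_def by (rule nrm_triangle_sub[OF seminormed_H10 a(1) v u\<sigma>])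
     also have "nrm VV (%x. v a x - u \<sigma> x) <= nrm VV (%x. v a x - v \<sigma> x) + nrm VV (%x. v \<sigma> x - u \<sigma> x)"
      by (rule nrm_triangle_sub[OF seminormed_H10 v v u\<sigma>])
     also have "nrm VV (%x. v \<sigma> x - u \<sigma> x) = \<rho> \<sigma>"
      unfolding \<rho>_def by (rule nrm_diff_commute[OF seminormed_H10 v u\<sigma>])
     finally show ?thesis using h0(2)[OF a(2) \<sigma>01' a(3)] by simp
    qed
    have ne1: "nrm VV e1 <= \<rho> t + \<epsilon> + \<rho> \<sigma>" and ne2: "nrm VV e2 <= \<rho> s + \<epsilon> + \<rho> \<sigma>"
     unfolding e1_def[abs_def] e2_def[abs_def] using \<sigma> st sth by (auto intro!: near us ut)
    have b\<sigma>: "!!x. x \<in> \<Omega> ==> \<bar>b \<sigma> x\<bar> <= C" using babs[OF \<sigma>01'] .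
    note form_facts = bm[OF \<sigma>01'] C b\<sigma>
    have fw: "form (b \<sigma>) (u \<sigma>) w = 2 * form (b \<sigma>) (u \<sigma>) (u \<sigma>) + form (b \<sigma>) (u \<sigma>) (%x. e1 x + e2 x)"
     unfolding w_eq
     using form_add_right[OF form_facts carr_add[OF seminormed_H10 u\<sigma> u\<sigma>] carr_add[OF seminormed_H10 ec] u\<sigma>]
      form_add_right[OF form_facts u\<sigma> u\<sigma> u\<sigma>] by simp
    have "cmod (form (b \<sigma>) (u \<sigma>) (%x. e1 x + e2 x)) <= C * l2norm M (wg (u \<sigma>)) * l2norm M (wg (%x. e1 x + e2 x))"
     by (rule form_integrand(2)[OF form_facts u\<sigma> carr_add[OF seminormed_H10 ec]])
    also have "\<dots> <= C * g \<sigma> * nrm VV (%x. e1 x + e2 x)"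
     unfolding g_def using C l2norm_weak_gradient_le_H1[OF u\<sigma>] l2norm_weak_gradient_le_H1[OF carr_add[OF seminormed_H10 ec]]
     by (intro mult_mono mult_left_mono) (auto intro: l2norm_nonneg mult_nonneg_nonneg nrm_nonneg[OF seminormed_H10 u\<sigma>])
    also have "\<dots> <= C * g \<sigma> * ((\<rho> t + \<epsilon> + \<rho> \<sigma>) + (\<rho> s + \<epsilon> + \<rho> \<sigma>))"
     using nrm_triangle[OF seminormed_H10 ec] ne1 ne2 C nrm_nonneg[OF seminormed_H10 u\<sigma>]
     by (intro mult_left_mono) (auto simp: g_def)
    finally have err: "cmod (form (b \<sigma>) (u \<sigma>) (%x. e1 x + e2 x)) <= C * (g \<sigma> * (\<rho> t + \<rho> s + 2 * \<rho> \<sigma> + 2 * \<epsilon>))"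
     by (simp add: algebra_simps)
    have young: "g \<sigma> * y <= (\<epsilon> * (g \<sigma>)\<^sup>2 + y\<^sup>2 / \<epsilon>) / 2" for y
    proof -
     have "0 <= (\<epsilon> * g \<sigma> - y)\<^sup>2 / \<epsilon>" using e by simp
     also have "(\<epsilon> * g \<sigma> - y)\<^sup>2 / \<epsilon> = \<epsilon> * (g \<sigma>)\<^sup>2 + y\<^sup>2 / \<epsilon> - 2 * (g \<sigma> * y)"
      using e by (simp add: power2_eq_square field_simps)
     finally show ?thesis by simp
    qed
    have "g \<sigma> * (\<rho> t + \<rho> s + 2 * \<rho> \<sigma> + 2 * \<epsilon>) = g \<sigma> * \<rho> t + g \<sigma> * \<rho> s + 2 * (g \<sigma> * \<rho> \<sigma>) + 2 * (g \<sigma> * \<epsilon>)"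
     by (simp add: algebra_simps)
    also have "\<dots> <= 3 * \<epsilon> * (g \<sigma>)\<^sup>2 + (\<rho> \<sigma>)\<^sup>2 / \<epsilon> + \<epsilon> + ((\<rho> t)\<^sup>2 / \<epsilon> + (\<rho> s)\<^sup>2 / \<epsilon>) / 2"
     using young[of "\<rho> t"] young[of "\<rho> s"] young[of "\<rho> \<sigma>"] young[of \<epsilon>] e
     by (simp add: power2_eq_square[of \<epsilon>] add_divide_distrib)
    finally have prod: "g \<sigma> * (\<rho> t + \<rho> s + 2 * \<rho> \<sigma> + 2 * \<epsilon>)
      <= 3 * \<epsilon> * (g \<sigma>)\<^sup>2 + (\<rho> \<sigma>)\<^sup>2 / \<epsilon> + \<epsilon> + ((\<rho> t)\<^sup>2 / \<epsilon> + (\<rho> s)\<^sup>2 / \<epsilon>) / 2" .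
    have coer: "c * ((g \<sigma>)\<^sup>2 - f \<sigma>) <= Re (form (b \<sigma>) (u \<sigma>) (u \<sigma>))"
     unfolding g0[OF \<sigma>01 \<sigma>N] by (rule form_coercive[OF form_facts u\<sigma>]) (use b[OF \<sigma>01'] in auto)
    have "Re (d \<sigma> w) = - (2 * Re (form (b \<sigma>) (u \<sigma>) (u \<sigma>))) - Re (form (b \<sigma>) (u \<sigma>) (%x. e1 x + e2 x))"
     by (simp add: du[OF \<sigma>01 \<sigma>N wc] fw)
    also have "\<dots> <= - (2 * (c * ((g \<sigma>)\<^sup>2 - f \<sigma>))) + C * (g \<sigma> * (\<rho> t + \<rho> s + 2 * \<rho> \<sigma> + 2 * \<epsilon>))"
     using coer err abs_Re_le_cmod[of "form (b \<sigma>) (u \<sigma>) (%x. e1 x + e2 x)"] by linarith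
    also have "\<dots> <= - (2 * (c * ((g \<sigma>)\<^sup>2 - f \<sigma>))) +
      C * (3 * \<epsilon> * (g \<sigma>)\<^sup>2 + (\<rho> \<sigma>)\<^sup>2 / \<epsilon> + \<epsilon> + ((\<rho> t)\<^sup>2 / \<epsilon> + (\<rho> s)\<^sup>2 / \<epsilon>) / 2)"
     using mult_left_mono[OF prod C] by linarith
    also have "\<dots> = \<gamma> \<sigma> + (r s + r t)"
     using e by (simp add: \<gamma>_def r_def field_simps)
    finally show "Re (d \<sigma> w) <= \<gamma> \<sigma> + (r s + r t)" .
   qed
   also have "\<dots> = integral {s..t} \<gamma> + (t - s) * (r s + r t)"
   proof -
    have "\<gamma> integrable_on {s..t}"
     by (rule integrable_subinterval_real[OF has_integral_integrable[OF \<gamma>HK]]) (use st in auto)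
    then show ?thesis
     using st by (simp add: Henstock_Kurzweil_Integration.integral_add Henstock_Kurzweil_Integration.integrable_const_ivl)
   qed
   finally show "f t - f s <= integral {s..t} \<gamma> + (t - s) * (r s + r t)" .
  qed
  moreover have "f 0 = 0" "0 <= f 1" using R0 by (auto simp: f_def)
  ultimately have "0 <= (LINT t|T. \<gamma> t) + 2 * (LINT t|T. r t)"
   using integral_unique[OF rHK] integral_unique[OF \<gamma>HK] by simp
  moreover have "(LINT t|T. \<gamma> t) = - (2 * c) * I0 + C * (3 * \<epsilon> * G + (LINT t|T. (\<rho> t)\<^sup>2) / \<epsilon> + \<epsilon>)"
  proof -
   have "(LINT t|T. \<gamma> t) = (LINT t|T. - (2 * c) * ((g t)\<^sup>2 - f t)) + (LINT t|T. C * (3 * \<epsilon> * (g t)\<^sup>2 + (\<rho> t)\<^sup>2 / \<epsilon> + \<epsilon>))"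
    unfolding \<gamma>_def using gi' fi \<rho>i const
    by (intro Bochner_Integration.integral_add integrable_mult_right Bochner_Integration.integrable_diff
      Bochner_Integration.integrable_add integrable_divide) auto
   also have "(LINT t|T. C * (3 * \<epsilon> * (g t)\<^sup>2 + (\<rho> t)\<^sup>2 / \<epsilon> + \<epsilon>)) = C * ((LINT t|T. 3 * \<epsilon> * (g t)\<^sup>2 + (\<rho> t)\<^sup>2 / \<epsilon>) + \<epsilon>)"
    using gi' \<rho>i const T1 by (simp add: Bochner_Integration.integral_add)
   also have "(LINT t|T. 3 * \<epsilon> * (g t)\<^sup>2 + (\<rho> t)\<^sup>2 / \<epsilon>) = 3 * \<epsilon> * G + (LINT t|T. (\<rho> t)\<^sup>2) / \<epsilon>"
    using gi' \<rho>i by (simp add: G_def)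
   finally show ?thesis by (simp add: I0_def)
  qed
  moreover have "(LINT t|T. r t) = C / (2 * \<epsilon>) * (LINT t|T. (\<rho> t)\<^sup>2)" by (simp add: r_def)
  ultimately have "2 * c * I0 <= C * (3 * \<epsilon> * G + \<epsilon>) + 2 * C * ((LINT t|T. (\<rho> t)\<^sup>2) / \<epsilon>)"
   using e by (simp add: field_simps)
  also have "\<dots> <= C * (3 * \<epsilon> * G + \<epsilon>) + 2 * C * \<epsilon>"
  proof -
   have "(LINT t|T. (\<rho> t)\<^sup>2) / \<epsilon> <= \<epsilon>\<^sup>2 / \<epsilon>" using P e by (intro divide_right_mono) (auto simp: \<rho>_def)
   then have "(LINT t|T. (\<rho> t)\<^sup>2) / \<epsilon> <= \<epsilon>" using e by (simp add: power2_eq_square)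
   then show ?thesis using C by (intro add_left_mono mult_left_mono) auto
  qed
  also have "\<dots> = \<epsilon> * (C * (3 * G + 3))" by (simp add: algebra_simps)
  finally show ?thesis .
 qed
 define K where "K = C * (3 * G + 3)"
 have K0: "0 <= K" using C G0 by (simp add: K_def)
 have "2 * c * I0 <= 0 + \<eta>" if "0 < \<eta>" for \<eta>
 proof -
  have "2 * c * I0 <= \<eta> / (K + 1) * K" using main[of "\<eta> / (K + 1)"] that K0 by (simp add: K_def)
  also have "\<dots> <= \<eta>" using that K0 by (simp add: field_simps)
  finally show ?thesis by simp
 qed
 then have "2 * c * I0 <= 0" by (rule field_le_epsilon)
 then have I0: "I0 <= 0" using c by (simp add: mult_le_0_iff)
 have gfi: "integrable T (%t. (g t)\<^sup>2 - f t)" using gi' fi by simp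
 have goodT: "AE t in T. t \<in> {0<..<1} \<and> t \<notin> N"
  using N AE_space by (auto simp: AE_restrict_space_iff negligible_iff_null_sets dest!: AE_not_in elim!: eventually_mono)
 have nonneg: "AE t in T. 0 <= (g t)\<^sup>2 - f t" using goodT by eventually_elim (simp add: g0)
 have "I0 = 0" unfolding I0_def using I0 integral_nonneg_AE[OF nonneg] by (simp add: I0_def)
 then have z: "AE t in T. (g t)\<^sup>2 - f t = 0"
  unfolding I0_def using integral_nonneg_eq_0_iff_AE[OF gfi nonneg] by simp
 have good2: "AE t in T. t \<in> {0<..<1} \<and> t \<notin> N \<and> (g t)\<^sup>2 - f t = 0" using goodT z by eventually_elim simp
 obtain N2 where N2: "negligible N2" and goodN2: "!!t. t \<in> {0<..<1} ==> t \<notin> N2 ==> t \<notin> N \<and> (g t)\<^sup>2 - f t = 0"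
  by (rule AE_T_negligible[OF good2]) blast
 have d0: "d t w = 0" if t: "t \<in> {0<..<1}" "t \<notin> N2" and w: "w \<in> carr VV" for t w
 proof -
  have tN: "t \<notin> N" and "l2norm M (wg (u t)) = 0" using goodN2[OF t] g0[OF t(1)] by auto
  moreover have "cmod (form (b t) (u t) w) <= C * l2norm M (wg (u t)) * l2norm M (wg w)"
   using babs t by (intro form_integrand(2)[OF bm C _ uc[OF t(1) tN] w]) auto
  ultimately show ?thesis using du[OF t(1) tN w] by simp
 qed
 show ?thesis
  using good2
 proof eventually_elim
  fix t assume t: "t \<in> {0<..<1} \<and> t \<notin> N \<and> (g t)\<^sup>2 - f t = 0"
  then have t1: "t \<in> {0<..<1}" and tN: "t \<notin> N" by auto
  have "integral {0..t} (%s. d s (u t)) = integral {0..t} (%s. 0 :: complex)"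
   by (rule integral_spike[of "N2 \<union> {0}"]) (use N2 t1 d0[OF _ _ uc[OF t1 tN]] in auto)
  then have "emb (R t) (u t) = 0" using dR[OF uc[OF t1 tN], of t] t1 by simp
  then have "emb (R t) (R t) = 0"
   using embed_H_cong_right[OF Rsq H10_sqint[OF uc[OF t1 tN]] Rsq uR[OF t1 tN], of t] t1 by simp
  then have "f t = 0" using embed_H_self[OF Rsq, of t] t1 by (simp add: f_def)
  then have "g t = 0" using t by simp
  then show "nrm VV (%x. W t x - U t x) = 0" by (simp add: g_def u_def[abs_def])
 qed
qed

end

section \<open>The oscillating coefficient in one space dimension\<close>

subsection \<open>Frequencies and time profiles\<close>

text \<open>The factor \<open>4 ^ (j * j)\<close> makes the quotients of consecutive frequencies grow geometrically. The
other factor makes \<open>(freq j)^2 * onset j\<close> a multiple of \<open>2 * pi\<close>, so that the oscillation in a window begins and ends at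
a zero of the sine.\<close>

definition freq :: "nat => real" where "freq j = 4 * (real j + 1) * 4 ^ (j * j)"

text \<open>The \<open>j\<close>-th window is \<open>onset j <= 1 - t <= 2 * onset j\<close>. The lengths of the windows are not summable.\<close>

definition onset :: "nat => real" where "onset j = pi / (8 * (real j + 1))"

text \<open>Clamping the remaining time to the window freezes the oscillation outside.\<close>

definition phase :: "nat => real => real" where
 "phase j t = max (onset j) (min (2 * onset j) (1 - t))"

definition amp :: "nat => real => real" where "amp j t = (sin ((freq j)\<^sup>2 * phase j t))\<^sup>2"

definition damp :: "nat => real => real" where "damp j t = - sin (2 * ((freq j)\<^sup>2 * phase j t))"

text \<open>All terms with index \<open>cutoff t\<close> or larger are switched off at time \<open>t\<close>. The value at the final time is \<open>0\<close>, since \<open>1 / 0 = 0\<close>, in accordance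
with the fact that every window is closed by then.\<close>

definition cutoff :: "real => nat" where "cutoff t = nat \<lceil>1 / (1 - t)\<rceil>"

lemma freq_pos: "0 < freq j" and freq_ge_1: "1 <= freq j"
proof -
 show "0 < freq j" by (simp add: freq_def add_nonneg_pos)
 have "1 * 1 <= (4 * (real j + 1)) * 4 ^ (j * j)" by (intro mult_mono) auto
 then show "1 <= freq j" by (simp add: freq_def)
qed

lemma freq_Suc: "4 ^ (2 * j + 1) * freq j <= freq (Suc j)"
proof -
 have e: "(4::real) ^ (Suc j * Suc j) = 4 ^ (2 * j + 1) * 4 ^ (j * j)"
  by (simp flip: power_add)
 have "4 ^ (2 * j + 1) * freq j = 4 * (real j + 1) * (4 ^ (2 * j + 1) * 4 ^ (j * j))"
  by (simp add: freq_def)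
 also have "\<dots> <= 4 * (real (Suc j) + 1) * (4 ^ (2 * j + 1) * 4 ^ (j * j))"
  by (intro mult_right_mono) auto
 finally show ?thesis unfolding freq_def[of "Suc j"] e .
qed

lemma freq_Suc4: "4 * freq j <= freq (Suc j)"
proof -
 have "(4::real) ^ 1 <= 4 ^ (2 * j + 1)" by (rule power_increasing) auto
 then have "4 * freq j <= 4 ^ (2 * j + 1) * freq j" using freq_pos[of j] by (intro mult_right_mono) auto
 then show ?thesis using freq_Suc[of j] by simp
qed

lemma freq_ge_linear: "4 * (real j + 1) <= freq j"
proof -
 have "4 * (real j + 1) * 1 <= 4 * (real j + 1) * 4 ^ (j * j)" by (intro mult_left_mono) auto
 then show ?thesis by (simp add: freq_def)
qed

lemma onset_pos: "0 < onset j"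
 by (simp add: onset_def add_nonneg_pos)

lemma freq_onset: "(freq j)\<^sup>2 * onset j = real (2 * (j + 1) * 16 ^ (j * j)) * pi"
proof -
 have "(4::real) ^ (j * j) * 4 ^ (j * j) = 16 ^ (j * j)"
  by (simp flip: power_mult_distrib)
 moreover have "(freq j)\<^sup>2 = (4 * (real j + 1))\<^sup>2 * (4 ^ (j * j) * 4 ^ (j * j))"
  by (simp only: freq_def power2_eq_square mult_ac)
 ultimately have "(freq j)\<^sup>2 = 16 * (real j + 1)\<^sup>2 * 16 ^ (j * j)"
  by (simp only: power_mult_distrib) simp
 then show ?thesis by (simp add: onset_def power2_eq_square field_simps)
qed

text \<open>An open window at time \<open>t\<close> thus has frequency at least \<open>1 / (1 - t)\<close>.\<close>

lemma inverse_freq_le_onset: "1 / freq j <= onset j"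
proof -
 have "1 / freq j <= 1 / (4 * (real j + 1))"
  using freq_ge_linear[of j] by (intro divide_left_mono) (auto intro!: mult_pos_pos simp: freq_pos add_nonneg_pos)
 also have "\<dots> = 2 / (8 * (real j + 1))" by (simp add: field_simps)
 also have "\<dots> <= onset j" unfolding onset_def using pi_ge_two by (intro divide_right_mono) auto
 finally show ?thesis .
qed

lemma sum_freq_le: "(\<Sum>i<n. freq i) <= freq n / 3"
proof (induction n)
 case (Suc n) then show ?case using freq_Suc4[of n] by simp
qed (use freq_pos[of 0] in simp)

lemma sum_inverse_freq_le: "n <= m ==> (\<Sum>i=n..<m. 1 / freq i) <= 4/3 * (1 / freq n)"
proof -
 assume nm: "n <= m"
 have "1 / freq i <= 4/3 * (1 / freq i - 1 / freq (Suc i))" for i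
 proof -
  have "1 / freq (Suc i) <= 1 / (4 * freq i)"
   using freq_Suc4[of i] freq_pos by (intro divide_left_mono) (auto intro!: mult_pos_pos)
  also have "\<dots> = (1 / freq i) / 4" by simp
  finally show ?thesis by simp
 qed
 then have "(\<Sum>i=n..<m. 1 / freq i) <= (\<Sum>i=n..<m. 4/3 * (1 / freq i - 1 / freq (Suc i)))" by (intro sum_mono)
 also have "\<dots> = 4/3 * (1 / freq n - 1 / freq m)"
  using sum_Suc_diff'[OF nm, of "%i. - (1 / freq i)"] unfolding sum_distrib_left[symmetric] by simp
 also have "\<dots> <= 4/3 * (1 / freq n)" using freq_pos[of m] by simp
 finally show ?thesis .
qed

text \<open>Lacunarity: the low frequencies are summed by their Lipschitz bounds, the high ones by their size.\<close>

lemma lacunary_sum: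
 assumes "0 <= \<tau>" shows "(\<Sum>j<m. 1 / freq j * min 1 ((freq j)\<^sup>2 * \<tau>)) <= 3 * sqrt \<tau>"
proof -
 define J where "J = (LEAST j. j = m \<or> 1 < (freq j)\<^sup>2 * \<tau>)"
 have J: "J = m \<or> 1 < (freq J)\<^sup>2 * \<tau>" unfolding J_def by (rule LeastI[of _ m]) simp
 have Jm: "J <= m" unfolding J_def by (rule Least_le) simp
 have below: "(freq j)\<^sup>2 * \<tau> <= 1" if "j < J" for j
  using not_less_Least[of j "%j. j = m \<or> 1 < (freq j)\<^sup>2 * \<tau>"] that by (auto simp: J_def[symmetric])
 have "(\<Sum>j<m. 1 / freq j * min 1 ((freq j)\<^sup>2 * \<tau>)) =
   (\<Sum>j<J. 1 / freq j * min 1 ((freq j)\<^sup>2 * \<tau>)) + (\<Sum>j=J..<m. 1 / freq j * min 1 ((freq j)\<^sup>2 * \<tau>))"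
  using Jm by (simp add: sum.atLeastLessThan_concat lessThan_atLeast0)
 also have "(\<Sum>j<J. 1 / freq j * min 1 ((freq j)\<^sup>2 * \<tau>)) <= (\<Sum>j<J. freq j * \<tau>)"
 proof (rule sum_mono)
  fix j
  have "1 / freq j * min 1 ((freq j)\<^sup>2 * \<tau>) <= 1 / freq j * ((freq j)\<^sup>2 * \<tau>)"
   using freq_pos[of j] by (intro mult_left_mono) auto
  also have "\<dots> = freq j * \<tau>" using freq_pos[of j] by (simp add: power2_eq_square)
  finally show "1 / freq j * min 1 ((freq j)\<^sup>2 * \<tau>) <= freq j * \<tau>" .
 qed
 also have "(\<Sum>j<J. freq j * \<tau>) <= 4/3 * sqrt \<tau>"
 proof (cases J)
  case 0 then show ?thesis using assms by simp
 next
  case (Suc k)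
  have "(\<Sum>j<J. freq j * \<tau>) = (\<Sum>j<J. freq j) * \<tau>" by (simp add: sum_distrib_right)
  also have "\<dots> <= (4/3 * freq k) * \<tau>" using sum_freq_le[of k] assms by (intro mult_right_mono) (auto simp: Suc)
  also have "\<dots> = 4/3 * (freq k * sqrt \<tau>) * sqrt \<tau>" using assms by simp
  also have "\<dots> <= 4/3 * 1 * sqrt \<tau>"
  proof (intro mult_right_mono mult_left_mono)
   have "(freq k * sqrt \<tau>)\<^sup>2 <= 1\<^sup>2" using below[of k] Suc assms by (simp add: power_mult_distrib)
   then show "freq k * sqrt \<tau> <= 1" by (rule power2_le_imp_le) simp
  qed (use assms in auto)
  finally show ?thesis by simp
 qed
 also have "(\<Sum>j=J..<m. 1 / freq j * min 1 ((freq j)\<^sup>2 * \<tau>)) <= (\<Sum>j=J..<m. 1 / freq j)"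
  using freq_pos by (intro sum_mono mult_left_le) (auto simp: less_imp_le)
 also have "\<dots> <= 4/3 * sqrt \<tau>"
 proof (cases "J = m")
  case False
  then have "1 < (freq J)\<^sup>2 * \<tau>" using J by simp
  then have "1\<^sup>2 < (freq J * sqrt \<tau>)\<^sup>2" using assms by (simp add: power_mult_distrib)
  then have "1 < freq J * sqrt \<tau>" by (rule power2_less_imp_less) (use freq_pos[of J] assms in simp)
  then have "1 / freq J <= sqrt \<tau>" using freq_pos[of J] by (simp add: field_simps)
  then show ?thesis using sum_inverse_freq_le[OF Jm] by simp
 qed (use assms in simp)
 finally have "(\<Sum>j<m. 1 / freq j * min 1 ((freq j)\<^sup>2 * \<tau>)) <= 4/3 * sqrt \<tau> + 4/3 * sqrt \<tau>" by simp
 then show ?thesis using real_sqrt_ge_zero[OF assms] by linarith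
qed

lemma phase_lipschitz: "\<bar>phase j t - phase j s\<bar> <= \<bar>t - s\<bar>"
 unfolding phase_def by (auto simp: max_def min_def abs_if)

lemma abs_sin_diff_le: "\<bar>sin a - sin b\<bar> <= \<bar>a - b :: real\<bar>"
proof -
 have "\<bar>sin a - sin b\<bar> = 2 * \<bar>sin ((a - b) / 2)\<bar> * \<bar>cos ((a + b) / 2)\<bar>"
  by (simp add: sin_diff_sin abs_mult)
 also have "\<dots> <= 2 * \<bar>(a - b) / 2\<bar> * 1"
  by (intro mult_mono abs_sin_x_le_abs_x abs_cos_le_one) auto
 finally show ?thesis by simp
qed

lemma amp_bounds: "0 <= amp j t" "amp j t <= 1" and damp_bounds: "\<bar>damp j t\<bar> <= 1"
 using abs_sin_le_one[of "(freq j)\<^sup>2 * phase j t"] abs_sin_le_one[of "2 * ((freq j)\<^sup>2 * phase j t)"]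
 by (simp_all add: amp_def damp_def abs_square_le_1)

lemma amp_lipschitz: "\<bar>amp j t - amp j s\<bar> <= 2 * min 1 ((freq j)\<^sup>2 * \<bar>t - s\<bar>)"
proof -
 define a b where "a = (freq j)\<^sup>2 * phase j t" and "b = (freq j)\<^sup>2 * phase j s"
 have "\<bar>a - b\<bar> = (freq j)\<^sup>2 * \<bar>phase j t - phase j s\<bar>"
  by (simp add: a_def b_def abs_mult flip: right_diff_distrib)
 then have ab: "\<bar>a - b\<bar> <= (freq j)\<^sup>2 * \<bar>t - s\<bar>" using phase_lipschitz[of j t s] by (simp add: mult_left_mono)
 have "amp j t - amp j s = (sin a - sin b) * (sin a + sin b)"
  by (simp add: amp_def a_def b_def power2_eq_square algebra_simps)
 then have "\<bar>amp j t - amp j s\<bar> = \<bar>sin a - sin b\<bar> * \<bar>sin a + sin b\<bar>" by (simp add: abs_mult)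
 also have "\<dots> <= \<bar>a - b\<bar> * 2"
  using abs_sin_diff_le[of a b] abs_triangle_ineq[of "sin a" "sin b"] abs_sin_le_one[of a] abs_sin_le_one[of b]
  by (intro mult_mono) linarith+
 finally have "\<bar>amp j t - amp j s\<bar> <= 2 * ((freq j)\<^sup>2 * \<bar>t - s\<bar>)" using ab by simp
 moreover have "\<bar>amp j t - amp j s\<bar> <= 2" using amp_bounds[of j t] amp_bounds[of j s] by simp
 ultimately show ?thesis by (simp add: min_def)
qed

text \<open>The same bound as for \<open>amp\<close>, which is why \<open>phi_yy\<close> and \<open>phi_t\<close> share one Hoelder estimate.\<close>

lemma damp_lipschitz: "\<bar>damp j t - damp j s\<bar> <= 2 * min 1 ((freq j)\<^sup>2 * \<bar>t - s\<bar>)"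
proof -
 define a b where "a = (freq j)\<^sup>2 * phase j t" and "b = (freq j)\<^sup>2 * phase j s"
 have "\<bar>a - b\<bar> = (freq j)\<^sup>2 * \<bar>phase j t - phase j s\<bar>"
  by (simp add: a_def b_def abs_mult flip: right_diff_distrib)
 then have ab: "\<bar>a - b\<bar> <= (freq j)\<^sup>2 * \<bar>t - s\<bar>" using phase_lipschitz[of j t s] by (simp add: mult_left_mono)
 have "\<bar>damp j t - damp j s\<bar> <= 2 * ((freq j)\<^sup>2 * \<bar>t - s\<bar>)"
  using abs_sin_diff_le[of "2 * b" "2 * a"] ab by (simp add: damp_def a_def b_def)
 moreover have "\<bar>damp j t - damp j s\<bar> <= 2" using damp_bounds[of j t] damp_bounds[of j s] by simp
 ultimately show ?thesis by (simp add: min_def)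
qed

lemma sin_multiple_onset: "sin ((freq j)\<^sup>2 * onset j) = 0" "sin ((freq j)\<^sup>2 * (2 * onset j)) = 0"
proof -
 show "sin ((freq j)\<^sup>2 * onset j) = 0" unfolding freq_onset by (rule sin_npi)
 have "(freq j)\<^sup>2 * (2 * onset j) = real (2 * (2 * (j + 1) * 16 ^ (j * j))) * pi"
  using freq_onset[of j] by (simp add: algebra_simps)
 then show "sin ((freq j)\<^sup>2 * (2 * onset j)) = 0" by (simp only: sin_npi)
qed

lemma sin_phase_end:
 assumes "phase j t = onset j \<or> phase j t = 2 * onset j"
 shows "sin ((freq j)\<^sup>2 * phase j t) = 0"
 using assms sin_multiple_onset[of j] by auto

lemma inactive:
 assumes "\<not> (onset j < 1 - t \<and> 1 - t < 2 * onset j)"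
 shows "amp j t = 0" "damp j t = 0"
proof -
 have "phase j t = onset j \<or> phase j t = 2 * onset j"
  using assms onset_pos[of j] by (auto simp: phase_def max_def min_def)
 then have "sin ((freq j)\<^sup>2 * phase j t) = 0" by (rule sin_phase_end)
 then show "amp j t = 0" "damp j t = 0" by (simp_all add: amp_def damp_def sin_double)
qed

lemma cutoff_inactive:
 assumes "cutoff t <= j" shows "amp j t = 0" "damp j t = 0"
proof -
 have "\<not> (onset j < 1 - t \<and> 1 - t < 2 * onset j)"
 proof (cases "t < 1")
  case True
  have "1 / (1 - t) <= real j + 1" using assms True by (simp add: cutoff_def)
  then have "1 / (real j + 1) <= 1 - t" using True by (simp add: field_simps)
  moreover have "2 * onset j <= 1 / (real j + 1)"
  proof -
   have "2 * onset j = (pi / 4) / (real j + 1)" by (simp add: onset_def field_simps)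
   also have "\<dots> <= 1 / (real j + 1)" using pi_less_4 by (intro divide_right_mono) auto
   finally show ?thesis .
  qed
  ultimately show ?thesis by simp
 next
  case False then show ?thesis using onset_pos[of j] by simp
 qed
 then show "amp j t = 0" "damp j t = 0" by (rule inactive)+
qed

lemma cutoff_mono: "s <= t ==> t < 1 ==> cutoff s <= cutoff t"
 unfolding cutoff_def by (intro nat_mono ceiling_mono divide_left_mono) (auto intro: mult_pos_pos)

lemma cutoff_1: "cutoff 1 = 0"
 by (simp add: cutoff_def)

text \<open>At the ends of a window the squared sine has a double zero, so the frozen continuation is differentiable.\<close>

lemma amp_has_derivative: "(amp j has_real_derivative (freq j)\<^sup>2 * damp j t) (at t)"
proof (cases "onset j < 1 - t \<and> 1 - t < 2 * onset j")
 case True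
 have "((%s. (sin ((freq j)\<^sup>2 * (1 - s)))\<^sup>2) has_real_derivative
   2 * sin ((freq j)\<^sup>2 * (1 - t)) * (cos ((freq j)\<^sup>2 * (1 - t)) * (- (freq j)\<^sup>2))) (at t)"
  by (auto intro!: derivative_eq_intros)
 also have "2 * sin ((freq j)\<^sup>2 * (1 - t)) * (cos ((freq j)\<^sup>2 * (1 - t)) * (- (freq j)\<^sup>2)) = (freq j)\<^sup>2 * damp j t"
  using True by (simp add: damp_def phase_def sin_double max_def min_def)
 finally show ?thesis
  by (rule has_field_derivative_transform_within_open[where S="{1 - 2 * onset j<..<1 - onset j}"])
   (use True in \<open>auto simp: amp_def phase_def max_def min_def\<close>)
next
 case False
 have ends: "phase j t = onset j \<or> phase j t = 2 * onset j"
  using False onset_pos[of j] by (auto simp: phase_def max_def min_def)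
 define p where "p = (freq j)\<^sup>2 * phase j t"
 have s0: "sin p = 0" unfolding p_def by (rule sin_phase_end[OF ends])
 have bound: "\<bar>amp j s\<bar> <= ((freq j)\<^sup>2)\<^sup>2 * (s - t)\<^sup>2" for s
 proof -
  define x where "x = (freq j)\<^sup>2 * phase j s - p"
  have "sin ((freq j)\<^sup>2 * phase j s) = sin (p + x)" by (simp add: x_def)
  also have "\<dots> = cos p * sin x" by (simp add: sin_add s0)
  finally have "amp j s = (cos p)\<^sup>2 * (sin x)\<^sup>2" by (simp add: amp_def power_mult_distrib)
  also have "\<dots> <= 1 * x\<^sup>2"
  proof (intro mult_mono)
   show "(cos p)\<^sup>2 <= 1" by (simp add: abs_square_le_1)
   show "(sin x)\<^sup>2 <= x\<^sup>2" using abs_sin_x_le_abs_x[of x] by (simp only: abs_le_square_iff)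
  qed auto
  also have "x\<^sup>2 = ((freq j)\<^sup>2)\<^sup>2 * (phase j s - phase j t)\<^sup>2"
   by (simp add: x_def p_def power_mult_distrib flip: right_diff_distrib)
  also have "\<dots> <= ((freq j)\<^sup>2)\<^sup>2 * (s - t)\<^sup>2"
  proof (rule mult_left_mono)
   show "(phase j s - phase j t)\<^sup>2 <= (s - t)\<^sup>2"
    using phase_lipschitz[of j s t] by (simp only: abs_le_square_iff)
  qed simp
  finally show ?thesis using amp_bounds(1)[of j s] by simp
 qed
 have z: "amp j t = 0" "damp j t = 0" by (rule inactive[OF False])+
 have "((%s. (amp j s - amp j t) / (s - t)) \<longlongrightarrow> 0) (at t)"
 proof (rule Lim_null_comparison)
  show "\<forall>\<^sub>F s in at t. norm ((amp j s - amp j t) / (s - t)) <= ((freq j)\<^sup>2)\<^sup>2 * \<bar>s - t\<bar>"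
   unfolding eventually_at_filter
  proof (intro always_eventually allI impI)
   fix s assume "s ~= t"
   then have st: "0 < \<bar>s - t\<bar>" by simp
   have "\<bar>amp j s\<bar> <= ((freq j)\<^sup>2)\<^sup>2 * \<bar>s - t\<bar> * \<bar>s - t\<bar>"
    using bound[of s] power2_abs[of "s - t"] unfolding power2_eq_square[of "\<bar>s - t\<bar>"] by (simp only: mult.assoc)
   then show "norm ((amp j s - amp j t) / (s - t)) <= ((freq j)\<^sup>2)\<^sup>2 * \<bar>s - t\<bar>"
    using st z by (simp add: abs_divide pos_divide_le_eq)
  qed
  have "((%s. ((freq j)\<^sup>2)\<^sup>2 * \<bar>s - t\<bar>) \<longlongrightarrow> ((freq j)\<^sup>2)\<^sup>2 * \<bar>t - t\<bar>) (at t)"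
   by (intro tendsto_intros)
  then show "((%s. ((freq j)\<^sup>2)\<^sup>2 * \<bar>s - t\<bar>) \<longlongrightarrow> 0) (at t)" by simp
 qed
 then show ?thesis using z by (simp add: has_field_derivative_iff)
qed

lemma amp_continuous: "continuous_on S (amp j)" and damp_continuous: "continuous_on S (damp j)"
 unfolding amp_def[abs_def] damp_def[abs_def] phase_def by (auto intro!: continuous_intros)

text \<open>A window contains a whole number of periods, so the squared sine has the mean value one half.\<close>

lemma integral_damp_sq: "((%t. (damp j t)\<^sup>2) has_integral onset j / 2) {1 - 2 * onset j..1 - onset j}"
proof -
 define F where "F t = t / 2 - sin (4 * ((freq j)\<^sup>2 * t)) / (8 * (freq j)\<^sup>2)" for t
 have f0: "freq j ~= 0" using freq_pos[of j] by simp
 have F: "(F has_real_derivative (sin (2 * ((freq j)\<^sup>2 * t)))\<^sup>2) (at t)" for t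
 proof -
  have "(F has_real_derivative 1 / 2 - cos (4 * ((freq j)\<^sup>2 * t)) * (4 * (freq j)\<^sup>2) / (8 * (freq j)\<^sup>2)) (at t)"
   unfolding F_def[abs_def] using f0 by (auto intro!: derivative_eq_intros)
  also have "1 / 2 - cos (4 * ((freq j)\<^sup>2 * t)) * (4 * (freq j)\<^sup>2) / (8 * (freq j)\<^sup>2) = (sin (2 * ((freq j)\<^sup>2 * t)))\<^sup>2"
  proof -
   have "cos (4 * ((freq j)\<^sup>2 * t)) = 1 - 2 * (sin (2 * ((freq j)\<^sup>2 * t)))\<^sup>2"
    using cos_double_sin[of "2 * ((freq j)\<^sup>2 * t)"] by simp
   then show ?thesis using f0 by (simp add: field_simps)
  qed
  finally show ?thesis .
 qed
 have "((%t. (damp j t)\<^sup>2) has_integral - F (1 - (1 - onset j)) - - F (1 - (1 - 2 * onset j))) {1 - 2 * onset j..1 - onset j}"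
 proof (rule fundamental_theorem_of_calculus)
  show "1 - 2 * onset j <= 1 - onset j" using onset_pos[of j] by simp
  fix t assume t: "t \<in> {1 - 2 * onset j..1 - onset j}"
  have "((%t. 1 - t) has_real_derivative -1) (at t)" by (auto intro!: derivative_eq_intros)
  from DERIV_minus[OF DERIV_chain2[OF F this]]
  have "((%t. - F (1 - t)) has_real_derivative (sin (2 * ((freq j)\<^sup>2 * (1 - t))))\<^sup>2) (at t)" by simp
  moreover have "phase j t = 1 - t" using t by (auto simp: phase_def max_def min_def)
  ultimately show "((%t. - F (1 - t)) has_vector_derivative (damp j t)\<^sup>2) (at t within {1 - 2 * onset j..1 - onset j})"
   by (simp add: damp_def has_real_derivative_iff_has_vector_derivative has_vector_derivative_at_within)
 qed
 moreover have "sin (4 * ((freq j)\<^sup>2 * onset j)) = 0" "sin (4 * ((freq j)\<^sup>2 * (2 * onset j))) = 0"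
 proof -
  have "4 * ((freq j)\<^sup>2 * onset j) = real (4 * (2 * (j + 1) * 16 ^ (j * j))) * pi"
   "4 * ((freq j)\<^sup>2 * (2 * onset j)) = real (8 * (2 * (j + 1) * 16 ^ (j * j))) * pi"
   using freq_onset[of j] by (simp_all add: algebra_simps)
  then show "sin (4 * ((freq j)\<^sup>2 * onset j)) = 0" "sin (4 * ((freq j)\<^sup>2 * (2 * onset j))) = 0"
   by (simp_all only: sin_npi)
 qed
 ultimately show ?thesis by (simp add: F_def)
qed

subsection \<open>Smooth cutoff functions\<close>

definition plateau :: "real => real" where "plateau y = step (2 + y) * step (2 - y)"

lemma smooth_plateau: "smooth plateau"
proof -
 have "smooth (%y. step (2 + y))" "smooth (%y. step (2 - y))"
  using smooth_compose_scale[OF smooth_step, of 1 2] smooth_compose_scale[OF smooth_step, of "-1" 2]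
  by (simp_all add: add.commute)
 then show ?thesis unfolding plateau_def[abs_def] by (rule smooth_mult)
qed

lemma plateau_eq_1: "\<bar>y\<bar> <= 1 ==> plateau y = 1"
 and plateau_eq_0: "2 <= \<bar>y\<bar> ==> plateau y = 0"
 and plateau_bounds: "0 <= plateau y" "plateau y <= 1"
proof -
 show "plateau y = 1" if "\<bar>y\<bar> <= 1" using that by (simp add: plateau_def step_eq_1 abs_le_iff)
 show "plateau y = 0" if "2 <= \<bar>y\<bar>"
  using that step_eq_0[of "2 + y"] step_eq_0[of "2 - y"] by (cases "0 <= y") (auto simp: plateau_def)
 show "0 <= plateau y" "plateau y <= 1" by (simp_all add: plateau_def step_nonneg step_le_1 mult_le_one)
qed

lemma deriv_eq_0_open:
 fixes f :: "real => real"
 assumes "open S" "x \<in> S" "!!y. y \<in> S ==> f y = c"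
 shows "deriv f x = 0"
proof (rule DERIV_imp_deriv)
 have "((%_. c) has_real_derivative 0) (at x)" by simp
 then show "(f has_real_derivative 0) (at x)"
  by (rule has_field_derivative_transform_within_open[OF _ assms(1,2)]) (simp add: assms(3))
qed

subsection \<open>Modulated profiles\<close>

locale profile =
 fixes r :: real assumes r_pos: "0 < r"
begin

definition hat :: "real => real" where "hat y = plateau (4 * y / r)"

definition E0 :: "nat => real => real" where "E0 j y = hat y * cos (freq j * y)"

definition E1 :: "nat => real => real" where "E1 j = deriv (E0 j)"

definition E2 :: "nat => real => real" where "E2 j = deriv (E1 j)"

lemma smooth_hat: "smooth hat"
 unfolding hat_def[abs_def] using smooth_compose_scale[OF smooth_plateau, of "4 / r" 0] by simp

lemma hat_bounds: "0 <= hat y" "hat y <= 1"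
 by (simp_all add: hat_def plateau_bounds)

lemma hat_0: "hat 0 = 1"
 by (simp add: hat_def plateau_eq_1)

lemma hat_eq_0: "r / 2 <= \<bar>y\<bar> ==> hat y = 0"
proof -
 assume "r / 2 <= \<bar>y\<bar>"
 then have "2 <= \<bar>4 * y / r\<bar>" using r_pos by (simp add: abs_mult field_simps)
 then show ?thesis unfolding hat_def by (rule plateau_eq_0)
qed

lemma smooth_E0: "smooth (E0 j)" and smooth_E1: "smooth (E1 j)" and smooth_E2: "smooth (E2 j)"
proof -
 have "smooth (%y. cos (freq j * y))" using smooth_compose_scale[OF smooth_cos, of "freq j" 0] by simp
 then show 0: "smooth (E0 j)" unfolding E0_def[abs_def] by (intro smooth_mult smooth_hat)
 show 1: "smooth (E1 j)" unfolding E1_def by (rule smooth_deriv[OF 0])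
 show "smooth (E2 j)" unfolding E2_def by (rule smooth_deriv[OF 1])
qed

lemma E0_deriv: "(E0 j has_real_derivative E1 j y) (at y)" and E1_deriv: "(E1 j has_real_derivative E2 j y) (at y)"
 unfolding E2_def[of j] using smooth_has_real_derivative[OF smooth_E1] smooth_has_real_derivative[OF smooth_E0]
 by (auto simp: E1_def)

lemma E1_eq: "E1 j y = deriv hat y * cos (freq j * y) - freq j * (hat y * sin (freq j * y))"
proof -
 have "(E0 j has_real_derivative deriv hat y * cos (freq j * y) - freq j * (hat y * sin (freq j * y))) (at y)"
  unfolding E0_def[abs_def] using smooth_has_real_derivative[OF smooth_hat]
  by (auto intro!: derivative_eq_intros simp: algebra_simps)
 then show ?thesis unfolding E1_def by (rule DERIV_imp_deriv)
qed

lemma E2_eq: "E2 j y = deriv (deriv hat) y * cos (freq j * y) - 2 * freq j * (deriv hat y * sin (freq j * y))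
  - (freq j)\<^sup>2 * (hat y * cos (freq j * y))"
proof -
 have e: "E1 j = (%y. deriv hat y * cos (freq j * y) - freq j * (hat y * sin (freq j * y)))"
  using E1_eq by (rule ext)
 have "((%y. deriv hat y * cos (freq j * y) - freq j * (hat y * sin (freq j * y))) has_real_derivative
   deriv (deriv hat) y * cos (freq j * y) - 2 * freq j * (deriv hat y * sin (freq j * y))
   - (freq j)\<^sup>2 * (hat y * cos (freq j * y))) (at y)"
  using smooth_has_real_derivative[OF smooth_hat] smooth_has_real_derivative[OF smooth_deriv[OF smooth_hat]]
  by (auto intro!: derivative_eq_intros simp: algebra_simps power2_eq_square)
 then show ?thesis unfolding E2_def e by (rule DERIV_imp_deriv)
qed

lemma hat_deriv_eq_0: "r / 2 < \<bar>y\<bar> ==> deriv hat y = 0 \<and> deriv (deriv hat) y = 0"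
proof -
 assume y: "r / 2 < \<bar>y\<bar>"
 have op: "open {y::real. r / 2 < \<bar>y\<bar>}" by (intro open_Collect_less continuous_intros)
 have d: "deriv hat y = 0" if "r / 2 < \<bar>y\<bar>" for y
  by (rule deriv_eq_0_open[OF op, of _ _ 0]) (use that in \<open>auto intro!: hat_eq_0\<close>)
 have "deriv (deriv hat) y = 0"
  by (rule deriv_eq_0_open[OF op, of _ _ 0]) (use y d in auto)
 then show ?thesis using d[OF y] by simp
qed

lemma E_eq_0: "r / 2 < \<bar>y\<bar> ==> E0 j y = 0 \<and> E1 j y = 0 \<and> E2 j y = 0"
 using hat_eq_0[of y] hat_deriv_eq_0[of y] unfolding E1_eq E2_eq by (auto simp: E0_def)

lemma E_bounds:
 "\<exists>C>0. (\<forall>y. \<bar>deriv hat y\<bar> <= C) \<and> (\<forall>j y. \<bar>E0 j y\<bar> <= C \<and> \<bar>E1 j y\<bar> <= C * freq j \<and> \<bar>E2 j y\<bar> <= C * (freq j)\<^sup>2)"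
proof -
 have "\<exists>B. \<forall>y. \<bar>g y\<bar> <= B" if g: "continuous_on UNIV g" "!!y. r / 2 < \<bar>y\<bar> ==> g y = 0" for g :: "real => real"
 proof -
  have "compact (g ` {- (r/2)..r/2})" by (intro compact_continuous_image continuous_on_subset[OF g(1)]) auto
  then obtain B where "!!y. y \<in> {- (r/2)..r/2} ==> norm (g y) <= B"
   using compact_imp_bounded[of "g ` {- (r/2)..r/2}"] unfolding bounded_iff by blast
  moreover have "y \<in> {- (r/2)..r/2}" if "\<not> r / 2 < \<bar>y\<bar>" for y using that by auto
  ultimately have "\<bar>g y\<bar> <= \<bar>B\<bar>" for y
   using g(2)[of y] by (cases "r / 2 < \<bar>y\<bar>") (simp, metis real_norm_def abs_ge_self order_trans)
  then show ?thesis by blast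
 qed
 from this[OF smooth_continuous[OF smooth_deriv[OF smooth_hat]]] this[OF smooth_continuous[OF smooth_deriv[OF smooth_deriv[OF smooth_hat]]]]
 obtain B1 B2 where B: "!!y. \<bar>deriv hat y\<bar> <= B1" "!!y. \<bar>deriv (deriv hat) y\<bar> <= B2"
  using hat_deriv_eq_0 by blast
 define C where "C = 1 + 2 * B1 + B2"
 have B0: "0 <= B1" "0 <= B2" using B[of 0] by auto
 have hc: "\<bar>hat y * cos z\<bar> <= 1" "\<bar>hat y * sin z\<bar> <= 1" for y z
  using hat_bounds[of y] abs_cos_le_one[of z] abs_sin_le_one[of z] by (auto simp: abs_mult intro!: mult_le_one)
 have dc: "\<bar>deriv hat y * cos z\<bar> <= B1" "\<bar>deriv hat y * sin z\<bar> <= B1" "\<bar>deriv (deriv hat) y * cos z\<bar> <= B2" for y z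
  using B(1)[of y] B(2)[of y] abs_cos_le_one[of z] abs_sin_le_one[of z] mult_mono[of "\<bar>deriv hat y\<bar>" B1 "\<bar>cos z\<bar>" 1]
   mult_mono[of "\<bar>deriv hat y\<bar>" B1 "\<bar>sin z\<bar>" 1] mult_mono[of "\<bar>deriv (deriv hat) y\<bar>" B2 "\<bar>cos z\<bar>" 1] B0
  by (auto simp: abs_mult)
 have "\<bar>E0 j y\<bar> <= C \<and> \<bar>E1 j y\<bar> <= C * freq j \<and> \<bar>E2 j y\<bar> <= C * (freq j)\<^sup>2" for j y
 proof -
  define z where "z = freq j * y"
  have N: "1 <= freq j" by (rule freq_ge_1)
  have N2: "freq j <= (freq j)\<^sup>2" using N by (simp add: power2_eq_square)
  have e0: "\<bar>E0 j y\<bar> <= C" using hc(1)[of y z] B0 by (simp add: E0_def C_def z_def)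
  have "\<bar>E1 j y\<bar> <= B1 + freq j * 1"
   unfolding E1_eq z_def[symmetric]
   using dc(1)[of y z] mult_left_mono[OF hc(2)[of y z], of "freq j"] N
    abs_triangle_ineq4[of "deriv hat y * cos z" "freq j * (hat y * sin z)"] by (simp only: abs_mult[of "freq j"]) linarith
  also have "\<dots> <= B1 * freq j + freq j" using B0 N mult_left_mono[of 1 "freq j" B1] by simp
  also have "\<dots> <= C * freq j" using B0 N by (simp add: C_def algebra_simps)
  finally have e1: "\<bar>E1 j y\<bar> <= C * freq j" .
  have "\<bar>E2 j y\<bar> <= \<bar>deriv (deriv hat) y * cos z\<bar> + \<bar>2 * freq j * (deriv hat y * sin z)\<bar> + \<bar>(freq j)\<^sup>2 * (hat y * cos z)\<bar>"
   unfolding E2_eq z_def[symmetric] by linarith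
  also have "\<dots> <= B2 + 2 * freq j * B1 + (freq j)\<^sup>2 * 1"
   using dc(3)[of y z] mult_left_mono[OF dc(2)[of y z], of "2 * freq j"] mult_left_mono[OF hc(1)[of y z], of "(freq j)\<^sup>2"] N
   by (intro add_mono) (auto simp: abs_mult[of "2 * freq j"] abs_mult[of "(freq j)\<^sup>2"])
  also have "\<dots> <= B2 * (freq j)\<^sup>2 + 2 * (freq j)\<^sup>2 * B1 + (freq j)\<^sup>2"
   using B0 N N2 mult_left_mono[of 1 "(freq j)\<^sup>2" B2] mult_right_mono[OF N2, of B1] by (intro add_mono) auto
  also have "\<dots> = C * (freq j)\<^sup>2" by (simp add: C_def algebra_simps)
  finally have e2: "\<bar>E2 j y\<bar> <= C * (freq j)\<^sup>2" .
  show ?thesis using e0 e1 e2 by simp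
 qed
 moreover have "\<bar>deriv hat y\<bar> <= C" for y using B(1)[of y] B0 by (simp add: C_def)
 moreover have "0 < C" using B0 by (simp add: C_def)
 ultimately show ?thesis by blast
qed

text \<open>Differentiating \<open>E0\<close> costs a factor \<open>freq j\<close> each time; one constant serves for all frequencies.\<close>

definition Cb :: real where
 "Cb = (SOME C. C > 0 \<and> (\<forall>y. \<bar>deriv hat y\<bar> <= C) \<and> (\<forall>j y. \<bar>E0 j y\<bar> <= C \<and> \<bar>E1 j y\<bar> <= C * freq j \<and> \<bar>E2 j y\<bar> <= C * (freq j)\<^sup>2))"

lemma Cb: "0 < Cb" "\<bar>deriv hat y\<bar> <= Cb" "\<bar>E0 j y\<bar> <= Cb" "\<bar>E1 j y\<bar> <= Cb * freq j" "\<bar>E2 j y\<bar> <= Cb * (freq j)\<^sup>2"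
 using someI_ex[OF E_bounds] unfolding Cb_def by blast+

end

subsection \<open>The potential and the coefficient\<close>

locale oscillation = profile +
 fixes \<kappa> :: real assumes \<kappa>_pos: "0 < \<kappa>" and \<kappa>_small: "24 * \<kappa> * Cb <= 1"
begin

definition series :: "(nat => real) => (nat => real => real) => (nat => real => real) => real => real => real" where
 "series c f E t y = \<kappa> * (\<Sum>j<cutoff t. c j * f j t * E j y)"

text \<open>The weight \<open>P3\<close> belongs to the potential. One derivative in time or two in space cost \<open>(freq j)^2\<close>, which leaves the weight \<open>P1\<close>.\<close>

definition P1 :: "nat => real" where "P1 j = 1 / freq j"
definition P3 :: "nat => real" where "P3 j = 1 / freq j ^ 3"

abbreviation "phi \<equiv> series P3 amp E0"
abbreviation "phi_y \<equiv> series P3 amp E1"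
abbreviation "phi_yy \<equiv> series P3 amp E2"
abbreviation "phi_t \<equiv> series P1 damp E0"
abbreviation "phi_ty \<equiv> series P1 damp E1"

definition coef :: "real => real => real" where
 "coef t y = (1 + phi_t t y) / (1 + phi_yy t y)"

text \<open>Near a time before the end, all sums can be taken over a common finite index set.\<close>

lemma series_eq:
 assumes "f = amp \<or> f = damp" "cutoff t <= m"
 shows "series c f E t y = \<kappa> * (\<Sum>j<m. c j * f j t * E j y)"
 unfolding series_def
proof (intro arg_cong[where f="%x. \<kappa> * x"] sum.mono_neutral_left)
 show "\<forall>j\<in>{..<m} - {..<cutoff t}. c j * f j t * E j y = 0"
  using assms(1) cutoff_inactive[of t] by (auto simp: not_less)
qed (use assms(2) in auto)

lemma series_1: "series c f E 1 y = 0"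
 by (simp add: series_def cutoff_1)

lemma series_smooth: "(!!j. smooth (E j)) ==> smooth (series c f E t)"
 unfolding series_def[abs_def] by (intro smooth_mult smooth_const smooth_sum)

lemma series_y_deriv:
 assumes "!!j. (E j has_real_derivative E' j y) (at y)"
 shows "(series c f E t has_real_derivative series c f E' t y) (at y)"
 unfolding series_def[abs_def] using assms by (intro DERIV_cmult DERIV_sum) auto

lemma series_outside:
 assumes "!!j. E j y = 0" shows "series c f E t y = 0"
 by (simp add: series_def assms)

lemma phi_outside: "r / 2 < \<bar>y\<bar> ==> series c f E0 t y = 0 \<and> series c f E1 t y = 0 \<and> series c f E2 t y = 0"
 using E_eq_0 by (intro conjI series_outside) auto

lemma series_holder:
 assumes f: "f = amp \<or> f = damp" and K: "!!j. \<bar>c j * E j y\<bar> <= K / freq j"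
 shows "\<bar>series c f E t y - series c f E s y\<bar> <= 6 * \<kappa> * K * sqrt \<bar>t - s\<bar>"
proof -
 define m where "m = max (cutoff t) (cutoff s)"
 have "series c f E t y - series c f E s y = \<kappa> * (\<Sum>j<m. c j * E j y * (f j t - f j s))"
  using series_eq[OF f, of t m c E y] series_eq[OF f, of s m c E y]
  by (simp add: m_def sum_subtractf algebra_simps)
 also have "\<bar>\<dots>\<bar> <= \<kappa> * (\<Sum>j<m. K / freq j * (2 * min 1 ((freq j)\<^sup>2 * \<bar>t - s\<bar>)))"
 proof -
  have "\<bar>\<Sum>j<m. c j * E j y * (f j t - f j s)\<bar> <= (\<Sum>j<m. \<bar>c j * E j y\<bar> * \<bar>f j t - f j s\<bar>)"
   by (rule order_trans[OF sum_abs]) (simp add: abs_mult)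
  also have "\<dots> <= (\<Sum>j<m. K / freq j * (2 * min 1 ((freq j)\<^sup>2 * \<bar>t - s\<bar>)))"
   using f amp_lipschitz damp_lipschitz order_trans[OF abs_ge_zero K]
   by (intro sum_mono mult_mono K) auto
  finally show ?thesis using \<kappa>_pos by (simp add: abs_mult)
 qed
 also have "\<dots> = 2 * \<kappa> * K * (\<Sum>j<m. 1 / freq j * min 1 ((freq j)\<^sup>2 * \<bar>t - s\<bar>))"
  by (simp add: sum_distrib_left mult_ac)
 also have "\<dots> <= 2 * \<kappa> * K * (3 * sqrt \<bar>t - s\<bar>)"
 proof -
  have "0 <= K / freq 0" using order_trans[OF abs_ge_zero K] .
  then have "0 <= K" using freq_pos[of 0] by (simp add: zero_le_divide_iff)
  then show ?thesis using \<kappa>_pos by (intro mult_left_mono lacunary_sum) auto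
 qed
 finally show ?thesis by simp
qed

lemma coeff_bounds: "\<bar>P3 j * E0 j y\<bar> <= Cb / freq j" "\<bar>P3 j * E1 j y\<bar> <= Cb / freq j" "\<bar>P3 j * E2 j y\<bar> <= Cb / freq j"
 "\<bar>P1 j * E0 j y\<bar> <= Cb / freq j"
proof -
 have N: "1 <= freq j" "0 < freq j" by (rule freq_ge_1, rule freq_pos)
 have p: "\<bar>P3 j * x\<bar> = \<bar>x\<bar> / freq j ^ 3" "\<bar>P1 j * x\<bar> = \<bar>x\<bar> / freq j" for x
  using N by (simp_all add: P3_def P1_def abs_mult)
 have pw: "freq j ^ 1 <= freq j ^ 2" "1 <= freq j ^ 2"
  using N power_increasing[of 1 2 "freq j"] one_le_power[of "freq j" 2] by simp_all
 have gen: "\<bar>x\<bar> / freq j ^ 3 <= Cb / freq j" if "\<bar>x\<bar> <= Cb * (freq j)\<^sup>2" for x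
 proof -
  have "\<bar>x\<bar> / freq j ^ 3 <= Cb * (freq j)\<^sup>2 / freq j ^ 3" using that N by (intro divide_right_mono) auto
  also have "\<dots> = Cb / freq j" using N by (simp add: power2_eq_square power3_eq_cube)
  finally show ?thesis .
 qed
 show "\<bar>P3 j * E0 j y\<bar> <= Cb / freq j"
  unfolding p using Cb(1) Cb(3)[of j y] pw(2) mult_left_mono[OF pw(2), of Cb] by (intro gen) linarith
 show "\<bar>P3 j * E1 j y\<bar> <= Cb / freq j"
  unfolding p using Cb(1) Cb(4)[of j y] mult_left_mono[OF pw(1), of Cb] by (intro gen) (simp only: power_one_right, linarith)
 show "\<bar>P3 j * E2 j y\<bar> <= Cb / freq j" unfolding p by (intro gen Cb)
 show "\<bar>P1 j * E0 j y\<bar> <= Cb / freq j" unfolding p using N by (intro divide_right_mono Cb) auto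
qed

lemma phi_holder: "\<bar>phi t y - phi s y\<bar> <= 6 * \<kappa> * Cb * sqrt \<bar>t - s\<bar>"
 and phi_y_holder: "\<bar>phi_y t y - phi_y s y\<bar> <= 6 * \<kappa> * Cb * sqrt \<bar>t - s\<bar>"
 and phi_yy_holder: "\<bar>phi_yy t y - phi_yy s y\<bar> <= 6 * \<kappa> * Cb * sqrt \<bar>t - s\<bar>"
 and phi_t_holder: "\<bar>phi_t t y - phi_t s y\<bar> <= 6 * \<kappa> * Cb * sqrt \<bar>t - s\<bar>"
 by (intro series_holder coeff_bounds; simp)+

lemma small_bound: "\<bar>f t - f 1\<bar> <= 6 * \<kappa> * Cb * sqrt \<bar>t - 1\<bar> ==> f 1 = 0 ==> t \<in> {0..1} ==> \<bar>f t\<bar> <= 1 / 4 \<and> \<bar>f t\<bar> <= 6 * \<kappa> * Cb"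
 for f :: "real => real"
proof -
 assume h: "\<bar>f t - f 1\<bar> <= 6 * \<kappa> * Cb * sqrt \<bar>t - 1\<bar>" "f 1 = 0" and t: "t \<in> {0..1}"
 have "6 * \<kappa> * Cb * sqrt \<bar>t - 1\<bar> <= 6 * \<kappa> * Cb * 1"
  using t \<kappa>_pos Cb(1) by (intro mult_left_mono) auto
 then show ?thesis using h \<kappa>_small by simp
qed

lemma phi_small: "t \<in> {0..1} ==> \<bar>phi t y\<bar> <= 1/4"
 and phi_y_small: "t \<in> {0..1} ==> \<bar>phi_y t y\<bar> <= 1/4"
 and phi_yy_small: "t \<in> {0..1} ==> \<bar>phi_yy t y\<bar> <= 1/4" "t \<in> {0..1} ==> \<bar>phi_yy t y\<bar> <= 6 * \<kappa> * Cb"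
 and phi_t_small: "t \<in> {0..1} ==> \<bar>phi_t t y\<bar> <= 1/4" "t \<in> {0..1} ==> \<bar>phi_t t y\<bar> <= 6 * \<kappa> * Cb"
 using small_bound[of "%t. phi t y" t] small_bound[of "%t. phi_y t y" t] small_bound[of "%t. phi_yy t y" t]
  small_bound[of "%t. phi_t t y" t] phi_holder[of t y 1] phi_y_holder[of t y 1] phi_yy_holder[of t y 1] phi_t_holder[of t y 1]
 by (auto simp: series_1)

lemma series_t_deriv:
 assumes t: "t < 1"
 shows "((%t. series P3 amp E t y) has_real_derivative series P1 damp E t y) (at t)"
proof -
 define m where "m = cutoff ((1 + t) / 2)"
 have eq: "series P3 amp E s y = \<kappa> * (\<Sum>j<m. P3 j * amp j s * E j y)"
  "series P1 damp E s y = \<kappa> * (\<Sum>j<m. P1 j * damp j s * E j y)" if "s < (1 + t) / 2" for s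
  using that t by (auto intro!: series_eq cutoff_mono simp: m_def)
 have "((%t. \<kappa> * (\<Sum>j<m. P3 j * amp j t * E j y)) has_real_derivative
   \<kappa> * (\<Sum>j<m. P3 j * ((freq j)\<^sup>2 * damp j t) * E j y)) (at t)"
  by (intro DERIV_cmult DERIV_sum DERIV_cmult_right amp_has_derivative)
 also have "\<kappa> * (\<Sum>j<m. P3 j * ((freq j)\<^sup>2 * damp j t) * E j y) = series P1 damp E t y"
 proof -
  have "P3 j * ((freq j)\<^sup>2 * damp j t) * E j y = P1 j * damp j t * E j y" for j
   using freq_pos[of j] by (simp add: P3_def P1_def power2_eq_square power3_eq_cube)
  then show ?thesis using eq(2)[of t] t by (simp only: mult_less_cancel_left_pos) simp
 qed
 finally show ?thesis
  by (rule has_field_derivative_transform_within_open[where S="{..<(1 + t) / 2}"]) (use t eq in auto)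
qed

lemma series_t_continuous:
 assumes "f = amp \<or> f = damp" "b < 1"
 shows "continuous_on {..b} (%t. series c f E t y)"
proof -
 have "continuous_on {..b} (%t. \<kappa> * (\<Sum>j<cutoff b. c j * f j t * E j y))"
  using assms(1) amp_continuous damp_continuous by (intro continuous_intros) auto
 moreover have "series c f E t y = \<kappa> * (\<Sum>j<cutoff b. c j * f j t * E j y)" if "t \<in> {..b}" for t
  using that assms by (intro series_eq cutoff_mono) auto
 ultimately show ?thesis using continuous_on_cong[of "{..b}" "{..b}"] by (metis (no_types, lifting))
qed

lemma series_bounded:
 assumes "f = amp \<or> f = damp" "b < 1" and E: "!!j. \<exists>B. \<forall>y. \<bar>E j y\<bar> <= B"
 shows "\<exists>B. \<forall>t\<le>b. \<forall>y. \<bar>series c f E t y\<bar> <= B"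
proof -
 from E obtain B where B: "!!j y. \<bar>E j y\<bar> <= B j" by metis
 have f1: "\<bar>f j t\<bar> <= 1" for j t using assms(1) amp_bounds[of j t] damp_bounds[of j t] by auto
 have "\<bar>series c f E t y\<bar> <= \<kappa> * (\<Sum>j<cutoff b. \<bar>c j\<bar> * B j)" if "t <= b" for t y
 proof -
  have "series c f E t y = \<kappa> * (\<Sum>j<cutoff b. c j * f j t * E j y)"
   using that assms by (intro series_eq cutoff_mono) auto
  moreover have "\<bar>\<Sum>j<cutoff b. c j * f j t * E j y\<bar> <= (\<Sum>j<cutoff b. \<bar>c j\<bar> * B j)"
  proof (rule order_trans[OF sum_abs sum_mono])
   fix j
   have "\<bar>c j * f j t * E j y\<bar> = \<bar>c j\<bar> * (\<bar>f j t\<bar> * \<bar>E j y\<bar>)" by (simp add: abs_mult)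
   also have "\<dots> <= \<bar>c j\<bar> * (1 * B j)" using f1 B by (intro mult_left_mono mult_mono) auto
   finally show "\<bar>c j * f j t * E j y\<bar> <= \<bar>c j\<bar> * B j" by simp
  qed
  ultimately show ?thesis using \<kappa>_pos by (simp add: abs_mult)
 qed
 then show ?thesis by blast
qed

text \<open>Open windows at time \<open>s\<close> have \<open>1 / freq j <= 1 - s\<close>, so the weight \<open>P3\<close> supplies a factor \<open>(1 - s)^2\<close>.\<close>

lemma phi_t_deriv_1:
 "((%t. phi t y) has_real_derivative 0) (at 1 within {0..1})"
proof -
 have bound: "\<bar>phi s y\<bar> <= \<kappa> * Cb * 2 * (1 - s)\<^sup>2" if s: "s \<in> {0..<1}" for s
 proof -
  have "\<bar>P3 j * amp j s * E0 j y\<bar> <= (1 - s)\<^sup>2 * (Cb * (1 / freq j))" for j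
  proof (cases "onset j < 1 - s")
   case True
   have N: "0 < freq j" by (rule freq_pos)
   have "1 / freq j <= 1 - s" using inverse_freq_le_onset[of j] True by simp
   then have "(1 / freq j)\<^sup>2 <= (1 - s)\<^sup>2" using N by (intro power_mono) auto
   then have "(1 / freq j)\<^sup>2 * (Cb * (1 / freq j)) <= (1 - s)\<^sup>2 * (Cb * (1 / freq j))"
    using Cb(1) N by (intro mult_right_mono) auto
   moreover have "\<bar>P3 j * amp j s * E0 j y\<bar> <= (1 / freq j)\<^sup>2 * (Cb * (1 / freq j))"
   proof -
    have "\<bar>P3 j * amp j s * E0 j y\<bar> = P3 j * (amp j s * \<bar>E0 j y\<bar>)"
     using N amp_bounds(1)[of j s] by (simp add: abs_mult P3_def)
    also have "\<dots> <= P3 j * (1 * Cb)"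
     using N amp_bounds[of j s] Cb(3)[of j y] by (intro mult_left_mono mult_mono) (auto simp: P3_def)
    also have "\<dots> = (1 / freq j)\<^sup>2 * (Cb * (1 / freq j))"
     by (simp add: P3_def power2_eq_square power3_eq_cube)
    finally show ?thesis .
   qed
   ultimately show ?thesis by simp
  next
   case False
   then have "amp j s = 0" by (intro inactive) auto
   then show ?thesis using Cb(1) freq_pos[of j] by simp
  qed
  then have "\<bar>\<Sum>j<cutoff s. P3 j * amp j s * E0 j y\<bar> <= (\<Sum>j<cutoff s. (1 - s)\<^sup>2 * (Cb * (1 / freq j)))"
   by (intro order_trans[OF sum_abs sum_mono])
  also have "\<dots> = (1 - s)\<^sup>2 * (Cb * (\<Sum>j=0..<cutoff s. 1 / freq j))" by (simp add: sum_distrib_left lessThan_atLeast0)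
  also have "\<dots> <= (1 - s)\<^sup>2 * (Cb * (4/3 * (1 / freq 0)))"
   using Cb(1) by (intro mult_left_mono sum_inverse_freq_le) auto
  also have "\<dots> <= (1 - s)\<^sup>2 * (Cb * 2)"
   using Cb(1) by (intro mult_left_mono) (auto simp: freq_def)
  finally show ?thesis using \<kappa>_pos by (simp add: series_def abs_mult mult_ac)
 qed
 have "((%s. (phi s y - phi 1 y) / (s - 1)) \<longlongrightarrow> 0) (at 1 within {0..1})"
 proof (rule Lim_null_comparison)
  show "\<forall>\<^sub>F s in at 1 within {0..1}. norm ((phi s y - phi 1 y) / (s - 1)) <= \<kappa> * Cb * 2 * (1 - s)"
   unfolding eventually_at_filter
  proof (intro always_eventually allI impI)
   fix s :: real assume "s ~= 1" "s \<in> {0..1}"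
   then have s: "s \<in> {0..<1}" by auto
   show "norm ((phi s y - phi 1 y) / (s - 1)) <= \<kappa> * Cb * 2 * (1 - s)"
   proof -
    have pos: "0 < 1 - s" and e: "\<bar>s - 1\<bar> = 1 - s" using s by auto
    show ?thesis
     unfolding real_norm_def abs_divide e pos_divide_le_eq[OF pos]
     using bound[OF s] by (simp only: series_1 power2_eq_square mult.assoc diff_0_right)
   qed
  qed
  have "((%s. \<kappa> * Cb * 2 * (1 - s)) \<longlongrightarrow> \<kappa> * Cb * 2 * (1 - 1)) (at 1 within {0..1})" by (intro tendsto_intros)
  then show "((%s. \<kappa> * Cb * 2 * (1 - s)) \<longlongrightarrow> 0) (at 1 within {0..1})" by simp
 qed
 then show ?thesis by (simp add: has_field_derivative_iff)
qed

subsection \<open>Hoelder regularity of the coefficient\<close>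

lemma denominator: "t \<in> {0..1} ==> 3/4 <= 1 + phi_yy t y \<and> 1 + phi_yy t y <= 5/4"
 using phi_yy_small(1)[of t y] by linarith

lemma numerator: "t \<in> {0..1} ==> 3/4 <= 1 + phi_t t y \<and> 1 + phi_t t y <= 5/4"
 using phi_t_small(1)[of t y] by linarith

lemma coef_minus_1: "t \<in> {0..1} ==> \<bar>coef t y - 1\<bar> <= 16 * \<kappa> * Cb"
proof -
 assume t: "t \<in> {0..1}"
 have "coef t y - 1 = (phi_t t y - phi_yy t y) / (1 + phi_yy t y)"
  using denominator[OF t, of y] by (simp add: coef_def field_simps)
 then have "\<bar>coef t y - 1\<bar> = \<bar>phi_t t y - phi_yy t y\<bar> / (1 + phi_yy t y)"
  using denominator[OF t, of y] by (simp add: abs_divide)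
 also have "\<dots> <= (12 * \<kappa> * Cb) / (3/4)"
  using denominator[OF t, of y] phi_t_small(2)[OF t, of y] phi_yy_small(2)[OF t, of y]
  by (intro frac_le) auto
 finally show ?thesis by simp
qed

lemma coef_bounds: "t \<in> {0..1} ==> 1/3 <= coef t y \<and> coef t y <= 5/3"
 using coef_minus_1[of t y] \<kappa>_small by (simp add: abs_le_iff)

lemma coef_diff:
 assumes "s \<in> {0..1}" "t \<in> {0..1}"
 shows "coef t y - coef s y = ((phi_t t y - phi_t s y) * (1 + phi_yy s y) - (1 + phi_t s y) * (phi_yy t y - phi_yy s y))
   / ((1 + phi_yy t y) * (1 + phi_yy s y))"
 using denominator[OF assms(1), of y] denominator[OF assms(2), of y] by (simp add: coef_def field_simps)

lemma coef_holder:
 assumes s: "s \<in> {0..1}" and t: "t \<in> {0..1}"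
 shows "\<bar>coef t y - coef s y\<bar> <= 30 * \<kappa> * Cb * sqrt \<bar>t - s\<bar>"
proof -
 define \<eta> where "\<eta> = 6 * \<kappa> * Cb * sqrt \<bar>t - s\<bar>"
 have \<eta>0: "0 <= \<eta>" using \<kappa>_pos Cb(1) by (simp add: \<eta>_def)
 have "\<bar>(phi_t t y - phi_t s y) * (1 + phi_yy s y)\<bar> <= \<eta> * (5/4)"
  unfolding abs_mult using phi_t_holder[of t y s] denominator[OF s, of y] \<eta>0 by (intro mult_mono) (auto simp: \<eta>_def)
 moreover have "\<bar>(1 + phi_t s y) * (phi_yy t y - phi_yy s y)\<bar> <= (5/4) * \<eta>"
  unfolding abs_mult using phi_yy_holder[of t y s] numerator[OF s, of y] \<eta>0 by (intro mult_mono) (auto simp: \<eta>_def)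
 ultimately have num: "\<bar>(phi_t t y - phi_t s y) * (1 + phi_yy s y) - (1 + phi_t s y) * (phi_yy t y - phi_yy s y)\<bar> <= 5/2 * \<eta>"
  by linarith
 have den: "9/16 <= (1 + phi_yy t y) * (1 + phi_yy s y)"
  using mult_mono[of "3/4" "1 + phi_yy t y" "3/4" "1 + phi_yy s y"] denominator[OF s, of y] denominator[OF t, of y] by simp
 have "\<bar>coef t y - coef s y\<bar> <= (5/2 * \<eta>) / (9/16)"
  unfolding coef_diff[OF s t] abs_divide using num den \<eta>0 by (intro frac_le) auto
 also have "\<dots> <= 5 * \<eta>" using \<eta>0 by simp
 finally show ?thesis by (simp add: \<eta>_def)
qed

end

context oscillation begin

text \<open>No better exponent: between two instants of the \<open>j\<close>-th window, only the \<open>j\<close>-th term of \<open>phi_t\<close>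
 changes substantially.\<close>

lemma coef_not_holder:
 assumes \<alpha>: "1/2 < \<alpha>" and K: "0 <= K"
 shows "\<exists>s\<in>{0..1}. \<exists>t\<in>{0..1}. s ~= t \<and> K * \<bar>t - s\<bar> powr \<alpha> < \<bar>coef t 0 - coef s 0\<bar>"
proof -
 define \<beta> where "\<beta> = 2 * \<alpha> - 1"
 have \<beta>: "0 < \<beta>" using \<alpha> by (simp add: \<beta>_def)
 (* Large enough for the upper bound at the end: N^(2 alpha - 1) has to beat K / kappa. *)
 define X where "X = (10 * (pi/2) powr \<alpha> * K / \<kappa> + 1) powr (1 / \<beta>)"
 obtain j :: nat where j: "X <= real j" "16 * Cb <= real j" "1 <= j"
 proof -
  obtain n :: nat where "max 1 (max X (16 * Cb)) < real n" using reals_Archimedean2 by blast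
  then show thesis by (intro that[of n]) auto
 qed
 define N where "N = freq j"
 have N: "0 < N" "real j <= N" unfolding N_def using freq_pos freq_ge_linear[of j] by auto
 have p4: "real k <= 4 ^ k" for k
 proof (induction k)
  case (Suc k)
  moreover have "(1::real) <= 4 ^ k" by simp
  ultimately show ?case unfolding power_Suc of_nat_Suc by linarith
 qed simp
 define m where "m = 2 * (j + 1) * 16 ^ (j * j)"
 have m: "N\<^sup>2 * onset j = real m * pi" unfolding N_def m_def by (rule freq_onset)
 have "m ~= 0" by (simp add: m_def)
 then have m1: "1 <= real m" by linarith
 (* Two instants where amp agrees while damp has its two extreme values. *)
 define s t where "s = 1 - (real m * pi + pi/4) / N\<^sup>2" and "t = 1 - (real m * pi + 3 * pi/4) / N\<^sup>2"
 have on: "onset j = real m * pi / N\<^sup>2" using m N by (simp add: field_simps)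
 have win: "onset j <= 1 - s" "1 - s <= 2 * onset j" "onset j <= 1 - t" "1 - t <= 2 * onset j"
 proof -
  have "3 * pi / 4 <= real m * pi" using m1 pi_gt_zero mult_right_mono[OF m1, of pi] by simp
  then show "onset j <= 1 - s" "1 - s <= 2 * onset j" "onset j <= 1 - t" "1 - t <= 2 * onset j"
   unfolding s_def t_def on using N pi_gt_zero by (auto simp: divide_right_mono field_simps)
 qed
 have "2 * onset j <= 1"
 proof -
  have "2 * onset j = (pi / 4) / (real j + 1)" by (simp add: onset_def field_simps)
  also have "\<dots> <= 1 / 1" using pi_less_4 by (intro frac_le) auto
  finally show ?thesis by simp
 qed
 then have s01: "s \<in> {0..1}" and t01: "t \<in> {0..1}" using win onset_pos[of j] by auto
 have ph: "phase j s = 1 - s" "phase j t = 1 - t" using win by (auto simp: phase_def)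
 have arg: "N\<^sup>2 * (1 - s) = real m * pi + pi/4" "N\<^sup>2 * (1 - t) = real m * pi + 3 * pi/4"
  using N by (auto simp: s_def t_def)
 have sc: "sin (real m * pi) = 0" "(cos (real m * pi))\<^sup>2 = 1" by (auto simp: cos_npi simp flip: power_mult)
 have dbl: "2 * (real m * pi + x) = real (2 * m) * pi + 2 * x" for x by simp
 have sd: "sin (real (2 * m) * pi) = 0" "cos (real (2 * m) * pi) = 1" unfolding sin_npi cos_npi by simp_all
 have damp_st: "damp j s = -1" "damp j t = 1"
 proof -
  have "2 * ((freq j)\<^sup>2 * phase j s) = real (2 * m) * pi + pi/2" using arg(1) by (simp add: ph N_def)
  then show "damp j s = -1" by (simp only: damp_def sin_add sd; simp)
  have "2 * ((freq j)\<^sup>2 * phase j t) = real (2 * m) * pi + 3 * pi/2" using arg(2) by (simp add: ph N_def)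
  moreover have "sin (3 * pi / 2) = -1" using sin_3over2_pi by simp
  ultimately show "damp j t = 1" by (simp only: damp_def sin_add sd; simp)
 qed
 have amp_st: "amp j s = amp j t"
 proof -
  have "amp j s = (1 + 0) / 2" "amp j t = (1 + 0) / 2"
  proof -
   have cs: "(sin z)\<^sup>2 = (1 - cos (2 * z)) / 2" for z :: real by (simp add: cos_double_sin)
   have "2 * ((freq j)\<^sup>2 * phase j s) = real (2 * m) * pi + pi/2" using arg(1) by (simp add: ph N_def)
   then show "amp j s = (1 + 0) / 2" unfolding amp_def cs by (simp only: cos_add sd; simp)
   have "2 * ((freq j)\<^sup>2 * phase j t) = real (2 * m) * pi + 3 * pi/2" using arg(2) by (simp add: ph N_def)
   moreover have "cos (3 * pi / 2) = 0" using cos_3over2_pi by simp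
   ultimately show "amp j t = (1 + 0) / 2" unfolding amp_def cs by (simp only: cos_add sd; simp)
  qed
  then show ?thesis by simp
 qed
 define \<tau> where "\<tau> = \<bar>t - s\<bar>"
 have \<tau>: "\<tau> = pi / (2 * N\<^sup>2)"
 proof -
  have "s - t = pi / (2 * N\<^sup>2)" using N by (simp add: s_def t_def field_simps)
  moreover have "0 < pi / (2 * N\<^sup>2)" using N by simp
  ultimately show ?thesis unfolding \<tau>_def by linarith
 qed
 define M where "M = max (Suc j) (max (cutoff s) (cutoff t))"
 have M: "cutoff s <= M" "cutoff t <= M" "j < M" by (auto simp: M_def)
 define \<omega> where "\<omega> = Cb * 8 / (real j * N)"
 have others: "(\<Sum>i\<in>{..<M} - {j}. Cb / freq i * (2 * min 1 ((freq i)\<^sup>2 * \<tau>))) <= \<omega>"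
 proof -
  have split: "{..<M} - {j} = {..<j} \<union> {Suc j..<M}" using M(3) by auto
  have "(\<Sum>i\<in>{..<M} - {j}. Cb / freq i * (2 * min 1 ((freq i)\<^sup>2 * \<tau>)))
   = (\<Sum>i<j. Cb / freq i * (2 * min 1 ((freq i)\<^sup>2 * \<tau>))) + (\<Sum>i=Suc j..<M. Cb / freq i * (2 * min 1 ((freq i)\<^sup>2 * \<tau>)))"
   unfolding split by (rule sum.union_disjoint) auto
  also have "(\<Sum>i<j. Cb / freq i * (2 * min 1 ((freq i)\<^sup>2 * \<tau>))) <= (\<Sum>i<j. 2 * Cb * \<tau> * freq i)"
  proof (rule sum_mono)
   fix i
   have "Cb / freq i * (2 * min 1 ((freq i)\<^sup>2 * \<tau>)) <= Cb / freq i * (2 * ((freq i)\<^sup>2 * \<tau>))"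
    using Cb(1) freq_pos[of i] by (intro mult_left_mono) auto
   also have "\<dots> = 2 * Cb * \<tau> * freq i" using freq_pos[of i] by (simp add: power2_eq_square)
   finally show "Cb / freq i * (2 * min 1 ((freq i)\<^sup>2 * \<tau>)) <= 2 * Cb * \<tau> * freq i" .
  qed
  also have "\<dots> = 2 * Cb * \<tau> * (\<Sum>i<j. freq i)" by (simp add: sum_distrib_left)
  also have "\<dots> <= 2 * Cb * \<tau> * (4/3 * (N / 4 ^ j))"
  proof -
   obtain k where k: "j = Suc k" using j(3) by (cases j) auto
   have "(\<Sum>i<j. freq i) <= 4/3 * freq k" using sum_freq_le[of k] by (simp add: k)
   also have "freq k <= N / 4 ^ j"
   proof -
    have "(4::real) ^ j <= 4 ^ (2 * k + 1)" by (rule power_increasing) (auto simp: k)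
    then have "4 ^ j * freq k <= 4 ^ (2 * k + 1) * freq k" using freq_pos[of k] by (intro mult_right_mono) auto
    also have "\<dots> <= N" unfolding N_def k by (rule freq_Suc)
    finally show ?thesis by (simp add: field_simps)
   qed
   finally show ?thesis using Cb(1) by (intro mult_left_mono) (auto simp: \<tau>_def)
  qed
  also have "(\<Sum>i=Suc j..<M. Cb / freq i * (2 * min 1 ((freq i)\<^sup>2 * \<tau>))) <= (\<Sum>i=Suc j..<M. 2 * Cb * (1 / freq i))"
  proof (rule sum_mono)
   fix i
   have "Cb / freq i * (2 * min 1 ((freq i)\<^sup>2 * \<tau>)) <= Cb / freq i * (2 * 1)"
    using Cb(1) freq_pos[of i] by (intro mult_left_mono) auto
   then show "Cb / freq i * (2 * min 1 ((freq i)\<^sup>2 * \<tau>)) <= 2 * Cb * (1 / freq i)" by (simp add: mult.commute)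
  qed
  also have "\<dots> = 2 * Cb * (\<Sum>i=Suc j..<M. 1 / freq i)" by (simp add: sum_distrib_left)
  also have "\<dots> <= 2 * Cb * (4/3 * (1 / (4 ^ j * N)))"
  proof -
   have "(\<Sum>i=Suc j..<M. 1 / freq i) <= 4/3 * (1 / freq (Suc j))" by (rule sum_inverse_freq_le) (use M in simp)
   also have "1 / freq (Suc j) <= 1 / (4 ^ j * N)"
   proof (rule divide_left_mono)
    have "(4::real) ^ j <= 4 ^ (2 * j + 1)" by (rule power_increasing) auto
    then have "4 ^ j * N <= 4 ^ (2 * j + 1) * N" using N by (intro mult_right_mono) auto
    then show "4 ^ j * N <= freq (Suc j)" using freq_Suc[of j] by (simp add: N_def)
   qed (use N freq_pos in auto)
   finally show ?thesis using Cb(1) by (intro mult_left_mono) auto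
  qed
  also have "2 * Cb * \<tau> * (4/3 * (N / 4 ^ j)) + 2 * Cb * (4/3 * (1 / (4 ^ j * N))) = Cb / (4 ^ j * N) * (4/3 * (pi + 2))"
   using N by (simp add: \<tau> field_simps power2_eq_square)
  also have "\<dots> <= Cb / (4 ^ j * N) * 8" using Cb(1) N pi_less_4 by (intro mult_left_mono) auto
  also have "\<dots> <= Cb / (real j * N) * 8"
   using Cb(1) N p4 j(3) by (intro mult_right_mono divide_left_mono) auto
  finally show ?thesis by (simp add: \<omega>_def)
 qed
 have diff: "\<bar>series c f E t 0 - series c f E s 0 - \<kappa> * (c j * E j 0 * (f j t - f j s))\<bar> <= \<kappa> * \<omega>"
  if f: "f = amp \<or> f = damp" and c: "!!i. \<bar>c i * E i 0\<bar> <= Cb / freq i" for c f E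
 proof -
  have "series c f E t 0 - series c f E s 0 = \<kappa> * (\<Sum>i<M. c i * E i 0 * (f i t - f i s))"
   using series_eq[OF f M(2), of c E 0] series_eq[OF f M(1), of c E 0]
   by (simp add: sum_subtractf algebra_simps)
  also have "(\<Sum>i<M. c i * E i 0 * (f i t - f i s)) = c j * E j 0 * (f j t - f j s) + (\<Sum>i\<in>{..<M} - {j}. c i * E i 0 * (f i t - f i s))"
   using M(3) by (subst sum.remove[of _ j]) auto
  finally have "series c f E t 0 - series c f E s 0 - \<kappa> * (c j * E j 0 * (f j t - f j s)) = \<kappa> * (\<Sum>i\<in>{..<M} - {j}. c i * E i 0 * (f i t - f i s))"
   by (simp add: algebra_simps)
  moreover have "\<bar>\<Sum>i\<in>{..<M} - {j}. c i * E i 0 * (f i t - f i s)\<bar> <= (\<Sum>i\<in>{..<M} - {j}. Cb / freq i * (2 * min 1 ((freq i)\<^sup>2 * \<tau>)))"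
  proof (rule order_trans[OF sum_abs sum_mono])
   fix i
   show "\<bar>c i * E i 0 * (f i t - f i s)\<bar> <= Cb / freq i * (2 * min 1 ((freq i)\<^sup>2 * \<tau>))"
    unfolding abs_mult[of "c i * E i 0"] \<tau>_def
    using f amp_lipschitz[of i t s] damp_lipschitz[of i t s] Cb(1) freq_pos[of i] by (intro mult_mono c) auto
  qed
  ultimately show ?thesis using others \<kappa>_pos by (simp add: abs_mult)
 qed
 have \<omega>: "0 <= \<omega>" "2 * \<omega> <= 1 / N"
 proof -
  show "0 <= \<omega>" using Cb(1) N j(3) by (simp add: \<omega>_def)
  have "2 * \<omega> = 16 * Cb / real j * (1 / N)" by (simp add: \<omega>_def)
  also have "\<dots> <= 1 * (1 / N)" using j N by (intro mult_right_mono) (auto simp: field_simps)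
  finally show "2 * \<omega> <= 1 / N" by simp
 qed
 have dt: "2 * \<kappa> / N - \<kappa> * \<omega> <= phi_t t 0 - phi_t s 0"
  using diff[of damp P1 E0, OF _ coeff_bounds(4)] damp_st by (simp add: P1_def E0_def hat_0 N_def abs_le_iff algebra_simps)
 have dyy: "\<bar>phi_yy t 0 - phi_yy s 0\<bar> <= \<kappa> * \<omega>"
  using diff[of amp P3 E2, OF _ coeff_bounds(3)] amp_st by simp
 have num: "\<kappa> / (2 * N) <= (phi_t t 0 - phi_t s 0) * (1 + phi_yy s 0) - (1 + phi_t s 0) * (phi_yy t 0 - phi_yy s 0)"
 proof -
  have dpos: "0 <= 2 * \<kappa> / N - \<kappa> * \<omega>"
   using mult_left_mono[OF \<omega>(2), of \<kappa>] \<kappa>_pos \<omega>(1) N by (simp add: field_simps)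
  have "(2 * \<kappa> / N - \<kappa> * \<omega>) * (3/4) <= (phi_t t 0 - phi_t s 0) * (1 + phi_yy s 0)"
   using dt dpos denominator[OF s01, of 0] by (intro mult_mono) auto
  moreover have "(1 + phi_t s 0) * (phi_yy t 0 - phi_yy s 0) <= (5/4) * (\<kappa> * \<omega>)"
  proof -
   have "(1 + phi_t s 0) * (phi_yy t 0 - phi_yy s 0) <= (1 + phi_t s 0) * \<bar>phi_yy t 0 - phi_yy s 0\<bar>"
    using numerator[OF s01, of 0] by (intro mult_left_mono) auto
   also have "\<dots> <= (5/4) * (\<kappa> * \<omega>)" using numerator[OF s01, of 0] dyy by (intro mult_mono) auto
   finally show ?thesis .
  qed
  moreover have "2 * (\<kappa> * \<omega>) <= \<kappa> / N" using mult_left_mono[OF \<omega>(2), of \<kappa>] \<kappa>_pos by simp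
  ultimately show ?thesis by (simp add: algebra_simps)
 qed
 have den: "0 < (1 + phi_yy t 0) * (1 + phi_yy s 0)" "(1 + phi_yy t 0) * (1 + phi_yy s 0) <= 25/16"
  using denominator[OF s01, of 0] denominator[OF t01, of 0] mult_mono[of "1 + phi_yy t 0" "5/4" "1 + phi_yy s 0" "5/4"] by auto
 have "\<kappa> / (10 * N) < (\<kappa> / (2 * N)) / (25/16)" using \<kappa>_pos N by (simp add: field_simps)
 also have "\<dots> <= coef t 0 - coef s 0"
  unfolding coef_diff[OF s01 t01]
 proof (rule frac_le[OF _ num den])
  show "0 <= (phi_t t 0 - phi_t s 0) * (1 + phi_yy s 0) - (1 + phi_t s 0) * (phi_yy t 0 - phi_yy s 0)"
   using \<kappa>_pos N by (intro order_trans[OF _ num]) simp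
 qed
 finally have lower: "\<kappa> / (10 * N) < \<bar>coef t 0 - coef s 0\<bar>" by linarith
 have upper: "K * \<tau> powr \<alpha> <= \<kappa> / (10 * N)"
 proof -
  have "\<tau> powr \<alpha> = (pi/2) powr \<alpha> * (1 / N\<^sup>2) powr \<alpha>"
   using N by (simp add: \<tau> powr_mult[symmetric])
  also have "(1 / N\<^sup>2) powr \<alpha> = N powr (- (2 * \<alpha>))"
   using N by (simp add: powr_minus_divide powr_divide powr_powr flip: powr_numeral)
  finally have tp: "\<tau> powr \<alpha> = (pi/2) powr \<alpha> * N powr (- (2 * \<alpha>))" .
  have "10 * (pi/2) powr \<alpha> * K / \<kappa> + 1 = X powr \<beta>"
   unfolding X_def powr_powr using \<beta> K \<kappa>_pos by (simp add: add_nonneg_pos)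
  also have "\<dots> <= N powr \<beta>" using j(1) N \<beta> by (intro powr_mono2) (auto simp: X_def)
  finally have "10 * (pi/2) powr \<alpha> * K / \<kappa> <= N powr \<beta>" by simp
  then have "10 * (pi/2) powr \<alpha> * K <= \<kappa> * N powr \<beta>" using \<kappa>_pos by (simp add: field_simps)
  then have "10 * (pi/2) powr \<alpha> * K * N powr (- (2 * \<alpha>)) <= \<kappa> * N powr \<beta> * N powr (- (2 * \<alpha>))"
   by (intro mult_right_mono) auto
  also have "\<dots> = \<kappa> * N powr (-1)" by (simp add: \<beta>_def mult.assoc flip: powr_add)
  also have "\<dots> = \<kappa> / N" using N by (simp add: powr_minus_divide)
  finally show ?thesis by (simp add: tp mult_ac)
 qed
 have "s ~= t" using \<tau> N pi_gt_zero by (auto simp: \<tau>_def)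
 then show ?thesis using lower upper s01 t01 by (intro bexI[of _ s] bexI[of _ t]) (auto simp: \<tau>_def)
qed

end

section \<open>The solution in a cube inside the domain\<close>

abbreviation pd :: "'n => (real^'n => real) => real^'n => real" where
 "pd i f x \<equiv> frechet_derivative f (at x) (axis i 1)"

lemma smooth_ident: "smooth (%x::'a::euclidean_space. x)"
 unfolding smooth_def
proof
 fix k show "Ck k (%x::'a. x)"
 proof (cases k)
  case 0 then show ?thesis by simp
 next
  case (Suc n)
  show ?thesis unfolding Suc by (rule Ck_SucI[where D="%x v. v"]) (auto intro: Ck_const derivative_eq_intros)
 qed
qed

lemma frechet_derivative_of_real:
 assumes "smooth f"
 shows "frechet_derivative (%x. cr (f x)) (at x) v = of_real (frechet_derivative f (at x) v)"
proof -
 have "((%x. cr (f x)) has_derivative (%v. of_real (frechet_derivative f (at x) v))) (at x)"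
  by (rule has_derivative_of_real[OF smooth_has_derivative[OF assms]])
 from frechet_derivative_at[OF this] show ?thesis by (rule fun_cong[symmetric])
qed

lemma frechet_derivative_add:
 assumes "smooth f" "smooth g"
 shows "frechet_derivative (%x. f x + g x) (at x) v = frechet_derivative f (at x) v + frechet_derivative g (at x) v"
proof -
 have "((%x. f x + g x) has_derivative (%v. frechet_derivative f (at x) v + frechet_derivative g (at x) v)) (at x)"
  by (intro has_derivative_add smooth_has_derivative assms)
 from frechet_derivative_at[OF this] show ?thesis by (rule fun_cong[symmetric])
qed

lemma frechet_derivative_cmult:
 fixes f :: "'a::euclidean_space => real"
 assumes "smooth f"
 shows "frechet_derivative (%x. c * f x) (at x) v = c * frechet_derivative f (at x) v"
proof -
 have "((%x. c * f x) has_derivative (%v. c * frechet_derivative f (at x) v)) (at x)"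
  by (intro has_derivative_mult_right smooth_has_derivative assms)
 from frechet_derivative_at[OF this] show ?thesis by (rule fun_cong[symmetric])
qed

lemma pd_coord:
 fixes g :: "real => real"
 assumes "smooth g"
 shows "pd i (%x. g (x $ k - c)) (x :: real^'n) = (if i = k then deriv g (x $ k - c) else 0)"
proof -
 have "((%x::real^'n. x $ k - c) has_derivative (%v. v $ k)) (at x)"
  by (auto intro!: derivative_eq_intros bounded_linear_imp_has_derivative bounded_linear_vec_nth)
 from DERIV_compose_FDERIV[OF smooth_has_real_derivative[OF assms] this]
 have "((%x. g (x $ k - c)) has_derivative (%v. v $ k * deriv g (x $ k - c))) (at x)" .
 from fun_cong[OF frechet_derivative_at[OF this], of "axis i 1"] show ?thesis
  unfolding axis_def by (cases "i = k") simp_all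
qed

lemma test_functions_of_real:
 "f \<in> test_functions S ==> (%x. cr (f x)) \<in> test_functions S"
 by (rule test_functions_bounded_linear[OF _ bounded_linear_of_real])

context bounded_open
begin

lemma test_measurable: "f \<in> test_functions S ==> (f :: _ => real) \<in> meas"
 by (rule smooth_measurable[OF test_functions_smooth])

lemma test_measurable_of_real: "f \<in> test_functions S ==> (%x. cr (f x)) \<in> meas"
 by (rule borel_measurable_of_real[OF test_measurable])

text \<open>Dominated convergence for a function together with its gradient.\<close>

lemma continuous_in_H10:
 assumes test: "!!t. t \<in> S ==> f t \<in> tests"
  and cont: "!!x. x \<in> \<Omega> ==> continuous_on S (%t. f t x)" "!!x i. x \<in> \<Omega> ==> continuous_on S (%t. pd i (f t) x)"
  and bnd: "!!t x. t \<in> S ==> x \<in> \<Omega> ==> \<bar>f t x\<bar> <= C" "!!t x i. t \<in> S ==> x \<in> \<Omega> ==> \<bar>pd i (f t) x\<bar> <= C"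
 shows "continuous_in VV S (%t x. cr (f t x))"
 unfolding continuous_in_def
proof (intro conjI ballI)
 fix t assume t: "t \<in> S"
 show "(%x. cr (f t x)) \<in> carr VV"
  by (intro test_H10 test_functions_of_real test t)
 define h where "h s x = f s x + (-1) * f t x" for s x
 have h_test: "h s \<in> tests" if "s \<in> S" for s
  unfolding h_def by (intro test_functions_add test_functions_mult_smooth[OF _ smooth_const] test that t)
 have pdh: "pd i (h s) x = pd i (f s) x - pd i (f t) x" if "s \<in> S" for s i x
 proof -
  have "pd i (h s) x = pd i (f s) x + pd i (%x. (-1) * f t x) x"
   unfolding h_def[abs_def]
   by (rule frechet_derivative_add[OF test_functions_smooth[OF test[OF that]] smooth_mult[OF smooth_const test_functions_smooth[OF test[OF t]]]])
  also have "pd i (%x. (-1) * f t x) x = (-1) * pd i (f t) x"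
   by (rule frechet_derivative_cmult[OF test_functions_smooth[OF test[OF t]]])
  finally show ?thesis by simp
 qed
 define H where "H s x = (cr (h s x), grad (%x. cr (h s x)) x)" for s x
 have gr: "grad (%x. cr (h s x)) x $ i = of_real (pd i (f s) x - pd i (f t) x)" if "s \<in> S" for s x i
  using frechet_derivative_of_real[OF test_functions_smooth[OF h_test[OF that]], of x "axis i 1"] pdh[OF that]
  by (simp add: grad_def)
 have "((%s. l2norm M (H s)) \<longlongrightarrow> 0) (at t within S)"
 proof (rule l2norm_dominated_at[where C="2 * C + (\<Sum>i\<in>(UNIV::'n set). 2 * C)"])
  fix s assume s: "s \<in> S"
  have "(%x. cr (h s x)) \<in> tests" by (rule test_functions_of_real[OF h_test[OF s]])
  then have "(%x. cr (h s x)) \<in> meas" "grad (%x. cr (h s x)) \<in> meas"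
   using test_sqint is_weak_gradient_grad sqint_vec[of "grad (%x. cr (h s x))"]
   by (auto simp: is_weak_gradient_def L2_carr sqint_def)
  then show "H s \<in> meas" unfolding H_def[abs_def] by (rule borel_measurable_Pair)
 next
  fix s x assume s: "s \<in> S" and x: "x \<in> \<Omega>"
  have "norm (H s x) <= norm (cr (h s x)) + norm (grad (%x. cr (h s x)) x)"
   unfolding H_def by (rule norm_Pair_le)
  also have "norm (grad (%x. cr (h s x)) x) <= (\<Sum>i\<in>UNIV. norm (grad (%x. cr (h s x)) x $ i))"
   unfolding norm_vec_def by (rule L2_set_le_sum) simp
  also have "\<dots> <= (\<Sum>i\<in>(UNIV::'n set). 2 * C)"
  proof (rule sum_mono)
   fix i
   show "norm (grad (%x. cr (h s x)) x $ i) <= 2 * C"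
    unfolding gr[OF s] norm_of_real using bnd(2)[OF s x, of i] bnd(2)[OF t x, of i] by linarith
  qed
  also have "norm (cr (h s x)) <= 2 * C"
   unfolding norm_of_real h_def using bnd(1)[OF s x] bnd(1)[OF t x] by linarith
  finally show "norm (H s x) <= 2 * C + (\<Sum>i\<in>(UNIV::'n set). 2 * C)" by simp
 next
  fix x assume x: "x \<in> \<Omega>"
  have c1: "((%s. f s x) \<longlongrightarrow> f t x) (at t within S)" and c2: "!!i. ((%s. pd i (f s) x) \<longlongrightarrow> pd i (f t) x) (at t within S)"
   using cont[OF x] t by (auto simp: continuous_on_def)
  have "((%s. cr (h s x)) \<longlongrightarrow> of_real (f t x + (-1) * f t x)) (at t within S)"
   unfolding h_def by (intro tendsto_intros c1)
  moreover have "((%s. \<chi> i. cr (pd i (f s) x - pd i (f t) x)) \<longlongrightarrow> (\<chi> i. of_real (pd i (f t) x - pd i (f t) x))) (at t within S)"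
   by (rule vec_tendstoI, simp only: vec_lambda_beta) (intro tendsto_intros c2)
  ultimately have lim: "((%s. (cr (h s x), \<chi> i. cr (pd i (f s) x - pd i (f t) x)))
    \<longlongrightarrow> (of_real (f t x + (-1) * f t x), \<chi> i. of_real (pd i (f t) x - pd i (f t) x))) (at t within S)"
   by (rule tendsto_Pair)
  have z: "(of_real (f t x + (-1) * f t x), \<chi> i. of_real (pd i (f t) x - pd i (f t) x)) = (0 :: complex \<times> (complex^'n))"
   by (simp add: zero_prod_def vec_eq_iff)
  have ev: "\<forall>\<^sub>F s in at t within S. (cr (h s x), \<chi> i. cr (pd i (f s) x - pd i (f t) x)) = H s x"
   unfolding eventually_at_filter
  proof (intro always_eventually allI impI)
   fix s assume "s \<in> S"
   then show "(cr (h s x), \<chi> i. cr (pd i (f s) x - pd i (f t) x)) = H s x"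
    unfolding H_def by (simp add: vec_eq_iff gr)
  qed
  show "((%s. H s x) \<longlongrightarrow> 0) (at t within S)" by (rule Lim_transform_eventually[OF lim[unfolded z] ev])
 qed
 moreover have "\<forall>\<^sub>F s in at t within S. l2norm M (H s) = nrm VV (%x. cr (f s x) - cr (f t x))"
  unfolding eventually_at_filter
 proof (intro always_eventually allI impI)
  fix s assume s: "s \<in> S"
  have "(%x. cr (f s x) - cr (f t x)) = (%x. cr (h s x))"
   by (auto simp: h_def)
  then show "l2norm M (H s) = nrm VV (%x. cr (f s x) - cr (f t x))"
   using H10_nrm_test[OF test_functions_of_real[OF h_test[OF s]]] by (simp add: H_def[abs_def])
 qed
 ultimately show "((%s. nrm VV (%x. cr (f s x) - cr (f t x))) \<longlongrightarrow> 0) (at t within S)"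
  by (rule Lim_transform_eventually)
qed

end

locale construction = bounded_open \<Omega> + oscillation r \<kappa>
 for \<Omega> :: "(real^'n) set" and r \<kappa> :: real +
 fixes i0 :: 'n and p :: "real^'n"
 assumes cube: "{x. \<forall>i. \<bar>x $ i - p $ i\<bar> <= 2 * r} \<subseteq> \<Omega>"
begin

abbreviation ht :: "real^'n => real" where "ht x \<equiv> x $ i0 - p $ i0"

definition theta :: "real^'n => real" where "theta x = (\<Prod>i\<in>UNIV. plateau ((x $ i - p $ i) / r))"

definition theta1 :: "'n => real^'n => real" where "theta1 i = pd i theta"

definition theta2 :: "'n => real^'n => real" where "theta2 i = pd i (theta1 i)"

lemma cube_compact: "compact {x. \<forall>i. \<bar>x $ i - p $ i\<bar> <= 2 * r}"
proof -
 have "{x. \<forall>i. \<bar>x $ i - p $ i\<bar> <= 2 * r} = cbox (\<chi> i. p $ i - 2 * r) (\<chi> i. p $ i + 2 * r)"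
  by (auto simp: mem_box_cart abs_le_iff algebra_simps)
 then show ?thesis by simp
qed

lemma theta_test: "theta \<in> tests"
proof (rule test_functionsI[OF _ cube_compact cube])
 have "smooth (%y. plateau (y / r))" using smooth_compose_scale[OF smooth_plateau, of "1 / r" 0] by simp
 then have "smooth (%x::real^'n. plateau ((x $ i - p $ i) / r))" for i by (rule smooth_compose_coord)
 then show "smooth theta" unfolding theta_def[abs_def] by (rule smooth_prod)
 fix x assume "x \<notin> {x. \<forall>i. \<bar>x $ i - p $ i\<bar> <= 2 * r}"
 then obtain i where "2 * r < \<bar>x $ i - p $ i\<bar>" by (auto simp: not_le)
 then have "2 <= \<bar>(x $ i - p $ i) / r\<bar>" using r_pos by (simp add: field_simps)
 then have "plateau ((x $ i - p $ i) / r) = 0" by (rule plateau_eq_0)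
 then show "theta x = 0" unfolding theta_def by (intro prod_zero) auto
qed

lemma theta1_test: "theta1 i \<in> tests"
 using test_functions_frechet_derivative[OF theta_test axis_Basis[of i]] by (simp add: theta1_def[abs_def])

lemma theta2_test: "theta2 i \<in> tests"
 using test_functions_frechet_derivative[OF theta1_test[of i] axis_Basis[of i]] by (simp add: theta2_def[abs_def])

lemmas theta_smooth = test_functions_smooth[OF theta_test] test_functions_smooth[OF theta1_test] test_functions_smooth[OF theta2_test]

lemma theta_bounds: "0 <= theta x" "theta x <= 1"
 unfolding theta_def by (auto intro!: prod_nonneg prod_le_1 plateau_bounds)

lemma theta_derivative_bounds: "\<exists>C\<ge>0. \<forall>i x. \<bar>theta1 i x\<bar> <= C \<and> \<bar>theta2 i x\<bar> <= C"
proof -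
 have "\<exists>B. \<forall>x. \<bar>theta1 i x\<bar> <= B" "\<exists>B. \<forall>x. \<bar>theta2 i x\<bar> <= B" for i
  using test_functions_bounded[OF theta1_test[of i]] test_functions_bounded[OF theta2_test[of i]] by (metis real_norm_def)+
 then obtain B B' where B: "!!i x. \<bar>theta1 i x\<bar> <= B i" "!!i x. \<bar>theta2 i x\<bar> <= B' i" by metis
 have B0: "0 <= B i" "0 <= B' i" for i using B(1)[of i 0] B(2)[of i 0] by auto
 have le: "B i <= (\<Sum>i\<in>UNIV. B i)" "B' i <= (\<Sum>i\<in>UNIV. B' i)" for i
  by (auto intro!: member_le_sum B0)
 have s0: "0 <= (\<Sum>i\<in>UNIV. B i)" "0 <= (\<Sum>i\<in>UNIV. B' i)" by (auto intro!: sum_nonneg B0)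
 have "\<bar>theta1 i x\<bar> <= (\<Sum>i\<in>UNIV. B i) + (\<Sum>i\<in>UNIV. B' i) \<and> \<bar>theta2 i x\<bar> <= (\<Sum>i\<in>UNIV. B i) + (\<Sum>i\<in>UNIV. B' i)" for i x
  using B[of i x] le[of i] s0 by linarith
 then show ?thesis using s0 by (intro exI[of _ "(\<Sum>i\<in>UNIV. B i) + (\<Sum>i\<in>UNIV. B' i)"]) auto
qed

text \<open>Where the oscillation lives, \<open>theta\<close> does not depend on the distinguished coordinate.\<close>

lemma theta1_eq_0:
 assumes x: "\<bar>ht x\<bar> < r" shows "theta1 i0 x = 0"
proof -
 define e :: "real^'n" where "e = axis i0 1"
 have "(theta has_derivative frechet_derivative theta (at x)) (at x)"
  by (rule smooth_has_derivative[OF theta_smooth(1)])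
 then have "(theta has_derivative frechet_derivative theta (at x)) (at ((%s. x + s *\<^sub>R e) 0))" by simp
 moreover have "((%s. x + s *\<^sub>R e) has_derivative (%s. s *\<^sub>R e)) (at 0)"
  by (auto intro!: derivative_eq_intros)
 ultimately have "((%s. theta (x + s *\<^sub>R e)) has_derivative (%s. frechet_derivative theta (at x) (s *\<^sub>R e))) (at 0)"
  using has_derivative_compose by fastforce
 moreover have "((%s. theta (x + s *\<^sub>R e)) has_derivative (%s. 0)) (at 0)"
 proof (rule has_derivative_transform_within_open[where s="{- (r - \<bar>ht x\<bar>)<..<r - \<bar>ht x\<bar>}"])
  show "((%s. theta x) has_derivative (%s. 0)) (at (0::real))" by simp
  fix s :: real assume s: "s \<in> {- (r - \<bar>ht x\<bar>)<..<r - \<bar>ht x\<bar>}"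
  have "plateau (((x + s *\<^sub>R e) $ i - p $ i) / r) = plateau ((x $ i - p $ i) / r)" for i
  proof (cases "i = i0")
   case True
   have "\<bar>((x + s *\<^sub>R e) $ i - p $ i) / r\<bar> <= 1" "\<bar>(x $ i - p $ i) / r\<bar> <= 1"
    using s x r_pos by (auto simp: True e_def abs_divide)
   then show ?thesis by (simp add: plateau_eq_1)
  qed (simp add: e_def axis_def)
  then show "theta x = theta (x + s *\<^sub>R e)" by (simp add: theta_def)
 qed (use x in auto)
 ultimately have "(%s. frechet_derivative theta (at x) (s *\<^sub>R e)) = (%s. 0)" by (rule has_derivative_unique)
 from fun_cong[OF this, of 1] show ?thesis by (simp add: theta1_def e_def)
qed

lemma theta1_series_0:
 "theta1 i0 x * series c f E0 t (ht x) = 0" "theta1 i0 x * series c f E1 t (ht x) = 0" "theta1 i0 x * series c f E2 t (ht x) = 0"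
 using theta1_eq_0[of x] phi_outside[of "ht x"] r_pos by (cases "\<bar>ht x\<bar> < r"; simp)+

lemma theta1_E_0: "theta1 i0 x * E0 j (ht x) = 0" "theta1 i0 x * E1 j (ht x) = 0"
 using theta1_eq_0[of x] E_eq_0[of "ht x"] r_pos by (cases "\<bar>ht x\<bar> < r"; simp)+

definition Z :: "real => real => real" where "Z t y = y + phi_y t y"

definition u :: "real => real^'n => real" where "u t x = t * (theta x * Z t (ht x))"

definition u' :: "real => real^'n => real" where
 "u' t x = theta x * (Z t (ht x) + t * phi_ty t (ht x))"

text \<open>What remains of \<open>u'\<close> minus the divergence of the flux: the terms with \<open>phi_ty\<close> have cancelled.\<close>

definition force :: "real => real^'n => real" where
 "force t x = theta x * Z t (ht x) - t * (2 * theta1 i0 x + ht x * theta2 i0 x)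
   - t * (coef t (ht x) * Z t (ht x) * (\<Sum>i\<in>UNIV - {i0}. theta2 i x))"

definition flux :: "'n => real => real^'n => real" where
 "flux i t x = (if i = i0 then t * (theta1 i0 x * ht x + theta x * (1 + phi_t t (ht x)))
   else t * (theta1 i x * (coef t (ht x) * Z t (ht x))))"

lemma smooth_series: "smooth (phi t)" "smooth (phi_y t)" "smooth (phi_yy t)" "smooth (phi_t t)" "smooth (phi_ty t)"
 by (intro series_smooth smooth_E0 smooth_E1 smooth_E2)+

lemma smooth_Z: "smooth (Z t)"
 unfolding Z_def[abs_def] by (intro smooth_add smooth_ident smooth_series)

lemma smooth_coef: "t \<in> {0..1} ==> smooth (coef t)"
 unfolding coef_def[abs_def]
proof (intro smooth_divide smooth_add smooth_const smooth_series)
 fix y assume "t \<in> {0..1}"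
 then show "1 + phi_yy t y ~= 0" using denominator[of t y] by auto
qed

lemma deriv_Z: "deriv (Z t) y = 1 + phi_yy t y"
 unfolding Z_def[abs_def] by (intro DERIV_imp_deriv DERIV_add DERIV_ident series_y_deriv E1_deriv)

lemma deriv_phi_t: "deriv (%y. 1 + phi_t t y) y = phi_ty t y"
proof (rule DERIV_imp_deriv)
 have "((%y. 1 + phi_t t y) has_real_derivative 0 + phi_ty t y) (at y)"
  by (intro DERIV_add DERIV_const series_y_deriv E0_deriv)
 then show "((%y. 1 + phi_t t y) has_real_derivative phi_ty t y) (at y)" by simp
qed

lemma pd_mult_coord:
 assumes "smooth A" "smooth g"
 shows "pd i (%x. A x * g (ht x)) x = pd i A x * g (ht x) + (if i = i0 then A x * deriv g (ht x) else 0)"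
 unfolding frechet_derivative_mult[OF assms(1) smooth_compose_coord[OF assms(2)]] pd_coord[OF assms(2)] by simp

lemma test_mult_coord: "A \<in> tests ==> smooth g ==> (%x. A x * g (ht x)) \<in> tests"
 for A :: "real^'n => real"
 using test_functions_mult_smooth[OF _ smooth_compose_coord, of A \<Omega> g] by (simp add: mult.commute)

lemma test_cmult: "A \<in> tests ==> (%x. c * A x) \<in> tests" for A :: "real^'n => real"
 by (rule test_functions_mult_smooth[OF _ smooth_const])

lemma u_test: "u t \<in> tests"
 unfolding u_def[abs_def] by (intro test_cmult test_mult_coord theta_test smooth_Z)

lemma u'_test: "u' t \<in> tests"
 unfolding u'_def[abs_def]
 by (rule test_mult_coord[where g="%y. Z t y + t * phi_ty t y"])
  (intro theta_test smooth_add smooth_Z smooth_mult smooth_const smooth_series)+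

lemma pd_u: "pd i (u t) x = t * (theta1 i x * Z t (ht x) + (if i = i0 then theta x * (1 + phi_yy t (ht x)) else 0))"
proof -
 have "pd i (u t) x = t * pd i (%x. theta x * Z t (ht x)) x"
  unfolding u_def[abs_def]
  by (rule frechet_derivative_cmult[OF test_functions_smooth[OF test_mult_coord[OF theta_test smooth_Z]]])
 then show ?thesis by (simp add: pd_mult_coord[OF theta_smooth(1) smooth_Z] deriv_Z theta1_def)
qed

text \<open>The choice of the coefficient turns the oscillating flux \<open>b (1 + phi_yy)\<close> into \<open>1 + phi_t\<close>, whose
 divergence is the oscillating part of the time derivative.\<close>

lemma coef_pd_u:
 assumes t: "t \<in> {0..1}" shows "coef t (ht x) * pd i (u t) x = flux i t x"
proof (cases "i = i0")
 case True
 have d: "1 + phi_yy t (ht x) ~= 0" using denominator[OF t, of "ht x"] by auto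
 have "coef t (ht x) * (theta1 i0 x * Z t (ht x)) = theta1 i0 x * ht x"
 proof (cases "\<bar>ht x\<bar> < r")
  case True then show ?thesis using theta1_eq_0[OF True] by simp
 next
  case False
  then have "r / 2 < \<bar>ht x\<bar>" using r_pos by simp
  from phi_outside[OF this] show ?thesis by (simp add: coef_def Z_def)
 qed
 moreover have "coef t (ht x) * (theta x * (1 + phi_yy t (ht x))) = theta x * (1 + phi_t t (ht x))"
  using d by (simp add: coef_def)
 ultimately have "coef t (ht x) * (theta1 i0 x * Z t (ht x) + theta x * (1 + phi_yy t (ht x))) =
   theta1 i0 x * ht x + theta x * (1 + phi_t t (ht x))"
  by (simp only: distrib_left)
 then show ?thesis by (simp only: True pd_u flux_def if_True refl mult.left_commute[of _ t])
qed (simp add: pd_u flux_def)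

lemma flux_test: "t \<in> {0..1} ==> flux i t \<in> tests"
proof (cases "i = i0")
 case True
 have 1: "(%x. theta1 i0 x * ht x) \<in> tests" by (rule test_mult_coord[OF theta1_test smooth_ident])
 have 2: "(%x. theta x * (1 + phi_t t (ht x))) \<in> tests"
  by (rule test_mult_coord[OF theta_test, where g="%y. 1 + phi_t t y"]) (intro smooth_add smooth_const smooth_series)
 show ?thesis using test_cmult[OF test_functions_add[OF 1 2], of t] by (simp add: flux_def[abs_def] True)
next
 case False
 assume t: "t \<in> {0..1}"
 have "(%x. theta1 i x * (coef t (ht x) * Z t (ht x))) \<in> tests"
  by (rule test_mult_coord[OF theta1_test, where g="%y. coef t y * Z t y"]) (intro smooth_mult smooth_coef t smooth_Z)
 from test_cmult[OF this, of t] show ?thesis by (simp add: flux_def[abs_def] False)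
qed

lemma pd_flux_i0:
 "pd i0 (flux i0 t) x = t * (2 * theta1 i0 x + ht x * theta2 i0 x + theta x * phi_ty t (ht x))"
proof -
 have g: "smooth (%y. 1 + phi_t t y)" by (intro smooth_add smooth_const smooth_series)
 have s1: "smooth (%x. theta1 i0 x * ht x)" by (rule test_functions_smooth[OF test_mult_coord[OF theta1_test smooth_ident]])
 have s2: "smooth (%x. theta x * (1 + phi_t t (ht x)))" by (rule test_functions_smooth[OF test_mult_coord[OF theta_test g]])
 have "pd i0 (flux i0 t) x = t * (pd i0 (%x. theta1 i0 x * ht x) x + pd i0 (%x. theta x * (1 + phi_t t (ht x))) x)"
  unfolding frechet_derivative_add[OF s1 s2, symmetric] frechet_derivative_cmult[OF smooth_add[OF s1 s2], symmetric]
  by (simp add: flux_def[abs_def])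
 also have "pd i0 (%x. theta1 i0 x * ht x) x = theta2 i0 x * ht x + theta1 i0 x"
  using pd_mult_coord[OF theta_smooth(2) smooth_ident, where i=i0 and x=x] by (simp add: theta2_def)
 also have "pd i0 (%x. theta x * (1 + phi_t t (ht x))) x = theta1 i0 x + theta1 i0 x * phi_t t (ht x) + theta x * phi_ty t (ht x)"
  using pd_mult_coord[OF theta_smooth(1) g, where i=i0 and x=x] by (simp add: theta1_def deriv_phi_t algebra_simps)
 finally show ?thesis by (simp add: theta1_series_0 algebra_simps)
qed

lemma divergence_flux:
 assumes t: "t \<in> {0..1}" shows "(\<Sum>i\<in>UNIV. pd i (flux i t) x) = u' t x - force t x"
proof -
 have other: "pd i (flux i t) x = t * (coef t (ht x) * Z t (ht x)) * theta2 i x" if "i ~= i0" for i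
 proof -
  have g: "smooth (%y. coef t y * Z t y)" by (intro smooth_mult smooth_coef t smooth_Z)
  have "pd i (flux i t) x = t * pd i (%x. theta1 i x * (coef t (ht x) * Z t (ht x))) x"
   unfolding frechet_derivative_cmult[OF test_functions_smooth[OF test_mult_coord[OF theta1_test g]], symmetric]
   using that by (simp add: flux_def[abs_def])
  then show ?thesis using that pd_mult_coord[OF theta_smooth(2) g, where i=i and x=x] by (simp add: theta2_def)
 qed
 have "(\<Sum>i\<in>UNIV. pd i (flux i t) x) = pd i0 (flux i0 t) x + (\<Sum>i\<in>UNIV - {i0}. pd i (flux i t) x)"
  by (rule sum.remove) auto
 also have "(\<Sum>i\<in>UNIV - {i0}. pd i (flux i t) x) = t * (coef t (ht x) * Z t (ht x)) * (\<Sum>i\<in>UNIV - {i0}. theta2 i x)"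
  unfolding sum_distrib_left by (intro sum.cong refl other) auto
 finally show ?thesis by (simp add: pd_flux_i0 u'_def force_def algebra_simps)
qed

abbreviation U where "U t x \<equiv> cr (u t x)"
abbreviation U' where "U' t x \<equiv> cr (u' t x)"
abbreviation F where "F t x \<equiv> cr (force t x)"
abbreviation bco where "bco t x \<equiv> coef t (ht x)"

lemma force_test: "t \<in> {0..1} ==> force t \<in> tests"
proof -
 assume t: "t \<in> {0..1}"
 have f: "(%x. pd i (flux i t) x) \<in> tests" for i
  by (rule test_functions_frechet_derivative[OF flux_test[OF t] axis_Basis])
 have "finite A ==> (%x. \<Sum>i\<in>A. (-1) * pd i (flux i t) x) \<in> tests" for A
 proof (induction A rule: finite_induct)
  case (insert i A)
  then show ?case using test_functions_add[OF test_cmult[OF f[of i], of "-1"] insert.IH] by simp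
 qed (simp add: test_functions_zero)
 then have "(%x. u' t x + (\<Sum>i\<in>UNIV. (-1) * pd i (flux i t) x)) \<in> tests"
  by (intro test_functions_add u'_test) auto
 moreover have "(%x. u' t x + (\<Sum>i\<in>UNIV. (-1) * pd i (flux i t) x)) = force t"
  using divergence_flux[OF t] by (intro ext) (simp add: sum_negf)
 ultimately show ?thesis by simp
qed

lemma equation:
 assumes t: "t \<in> {0..1}" and w: "w \<in> carr VV"
 shows "emb (U' t) w + neg_div \<Omega> (isotropic bco t) (U t) w = emb (F t) w"
proof -
 have flux_s: "smooth (flux i t)" for i by (rule test_functions_smooth[OF flux_test[OF t]])
 have flux_c: "(%x. cr (flux i t x)) \<in> tests" for i
  by (rule test_functions_of_real[OF flux_test[OF t]])
 have flux_pd: "frechet_derivative (%x. cr (flux i t x)) (at x) (axis i 1) = of_real (pd i (flux i t) x)" for i x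
  by (rule frechet_derivative_of_real[OF flux_s])
 have pd_sq: "sqint M (%x. cr (pd i (flux i t) x))" for i
  using test_sqint[OF test_functions_frechet_derivative[OF flux_c[of i] axis_Basis[of i]]] by (simp only: flux_pd)
 have sqw: "sqint M w" by (rule H10_sqint[OF w])
 have wgw: "sqint M (%x. wg w x $ i)" for i
  using weak_gradient_works[OF H10_H1[OF w]] by (simp add: is_weak_gradient_def L2_carr)
 have AE1: "AE x in M. wg (U t) x = grad (U t) x"
  by (rule weak_gradient_eq[OF is_weak_gradient_grad[OF test_functions_of_real[OF u_test]]])
 have int: "integrable M (%x. of_real (flux i t x) * cnj (wg w x $ i))" for i
  by (rule sqint_mult_integrable(1)[OF test_sqint[OF flux_c] sqint_cnj[OF wgw]])
 have g: "grad (U t) x $ i = of_real (pd i (u t) x)" for x i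
  using frechet_derivative_of_real[OF test_functions_smooth[OF u_test]] by (simp add: grad_def)
 have "neg_div \<Omega> (isotropic bco t) (U t) w = (LINT x|M. of_real (bco t x) * (\<Sum>i\<in>UNIV. wg (U t) x $ i * cnj (wg w x $ i)))"
  unfolding neg_div_isotropic form_def ..
 also have "\<dots> = (LINT x|M. (\<Sum>i\<in>UNIV. of_real (flux i t x) * cnj (wg w x $ i)))"
 proof (rule integral_cong_AE)
  have bm: "(%x. cr (bco t x)) \<in> meas"
   by (intro borel_measurable_of_real smooth_measurable smooth_compose_coord smooth_coef t)
  have gm: "(%x. wg (U t) x $ i) \<in> meas" for i
   using weak_gradient_works[OF test_H1[OF test_functions_of_real[OF u_test[of t]]]]
   by (simp add: is_weak_gradient_def L2_carr sqint_def)
  have wm: "(%x. cnj (wg w x $ i)) \<in> meas" for i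
   using sqint_cnj[OF wgw[of i]] by (simp add: sqint_def)
  show "(%x. of_real (bco t x) * (\<Sum>i\<in>UNIV. wg (U t) x $ i * cnj (wg w x $ i))) \<in> meas"
   by (intro borel_measurable_times borel_measurable_sum bm gm wm)
  show "(%x. \<Sum>i\<in>UNIV. of_real (flux i t x) * cnj (wg w x $ i)) \<in> meas"
   by (intro borel_measurable_sum borel_measurable_integrable int)
  show "AE x in M. of_real (bco t x) * (\<Sum>i\<in>UNIV. wg (U t) x $ i * cnj (wg w x $ i)) = (\<Sum>i\<in>UNIV. of_real (flux i t x) * cnj (wg w x $ i))"
   using AE1
  proof eventually_elim
   case (elim x)
   show ?case
    unfolding elim g sum_distrib_left coef_pd_u[OF t, symmetric]
    by (intro sum.cong refl) (simp add: mult.assoc)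
  qed
 qed
 also have "\<dots> = (\<Sum>i\<in>UNIV. LINT x|M. of_real (flux i t x) * cnj (wg w x $ i))"
  by (rule Bochner_Integration.integral_sum[OF int])
 also have "\<dots> = (\<Sum>i\<in>UNIV. - emb (%x. cr (pd i (flux i t) x)) w)"
 proof (rule sum.cong[OF refl])
  fix i
  show "(LINT x|M. of_real (flux i t x) * cnj (wg w x $ i)) = - emb (%x. cr (pd i (flux i t) x)) w"
   using embed_H_derivative[OF flux_c[of i] w, of i] by (simp only: flux_pd) simp
 qed
 also have "\<dots> = - emb (%x. \<Sum>i\<in>UNIV. cr (pd i (flux i t) x)) w"
 proof -
  have "integrable M (%x. of_real (pd i (flux i t) x) * cnj (w x))" for i
   by (rule sqint_mult_integrable(1)[OF pd_sq sqint_cnj[OF sqw]])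
  from Bochner_Integration.integral_sum[where I=UNIV and f="%i x. of_real (pd i (flux i t) x) * cnj (w x)" and M=M, OF this]
  show ?thesis
   unfolding embed_H_def sum_distrib_right sum_negf by simp
 qed
 also have "(%x. \<Sum>i\<in>UNIV. cr (pd i (flux i t) x)) = (%x. U' t x - F t x)"
  using divergence_flux[OF t] by (intro ext) (simp flip: of_real_sum of_real_diff)
 also have "emb (%x. U' t x - F t x) w = emb (U' t) w - emb (F t) w"
  by (intro embed_H_diff test_sqint[where S=\<Omega>] test_functions_of_real u'_test force_test t sqw)
 finally show ?thesis by simp
qed

end

subsection \<open>Regularity in time\<close>

context construction
begin

lemma continuous_on_holder:
 fixes f :: "real => real"
 assumes "!!s t. \<bar>f t - f s\<bar> <= C * sqrt \<bar>t - s\<bar>" shows "continuous_on S f"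
 unfolding continuous_on_def
proof
 fix t
 have "((%s. f s - f t) \<longlongrightarrow> 0) (at t within S)"
 proof (rule Lim_null_comparison)
  show "\<forall>\<^sub>F s in at t within S. norm (f s - f t) <= C * sqrt \<bar>s - t\<bar>"
   using assms by (simp add: always_eventually)
  have "((%s. C * sqrt \<bar>s - t\<bar>) \<longlongrightarrow> C * sqrt \<bar>t - t\<bar>) (at t within S)" by (intro tendsto_intros)
  then show "((%s. C * sqrt \<bar>s - t\<bar>) \<longlongrightarrow> 0) (at t within S)" by simp
 qed
 then show "(f \<longlongrightarrow> f t) (at t within S)" by (simp add: LIM_zero_iff)
qed

lemma phi_time_continuous:
 "continuous_on S (%t. phi t y)" "continuous_on S (%t. phi_y t y)" "continuous_on S (%t. phi_yy t y)" "continuous_on S (%t. phi_t t y)"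
 by (rule continuous_on_holder, rule phi_holder phi_y_holder phi_yy_holder phi_t_holder)+

lemma Z_time_continuous: "continuous_on S (%t. Z t y)"
 unfolding Z_def by (intro continuous_intros phi_time_continuous)

lemma coef_time_continuous: "continuous_on {0..1} (%t. coef t y)"
 unfolding coef_def
proof (intro continuous_intros phi_time_continuous ballI)
 fix t :: real assume "t \<in> {0..1}"
 then show "1 + phi_yy t y ~= 0" using denominator[of t y] by auto
qed

lemma ht_bounded: "\<exists>R\<ge>0. \<forall>x\<in>\<Omega>. \<bar>ht x\<bar> <= R"
proof -
 obtain R where R: "!!x. x \<in> \<Omega> ==> norm x <= R" using bounded_Omega unfolding bounded_iff by blast
 have "\<bar>ht x\<bar> <= \<bar>R\<bar> + \<bar>p $ i0\<bar>" if "x \<in> \<Omega>" for x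
  using R[OF that] component_le_norm_cart[of x i0] by linarith
 then show ?thesis by (intro exI[of _ "\<bar>R\<bar> + \<bar>p $ i0\<bar>"]) auto
qed

lemma Z_bounded: "\<exists>R\<ge>0. \<forall>t\<in>{0..1}. \<forall>x\<in>\<Omega>. \<bar>Z t (ht x)\<bar> <= R \<and> \<bar>ht x\<bar> <= R"
proof -
 obtain R where R: "0 <= R" "!!x. x \<in> \<Omega> ==> \<bar>ht x\<bar> <= R" using ht_bounded by blast
 have "\<bar>Z t (ht x)\<bar> <= R + 1 \<and> \<bar>ht x\<bar> <= R + 1" if "t \<in> {0..1}" "x \<in> \<Omega>" for t x
  using R(2)[OF that(2)] phi_y_small[OF that(1), of "ht x"] unfolding Z_def by linarith
 then show ?thesis using R(1) by (intro exI[of _ "R + 1"]) auto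
qed

lemma abs_mult_le: "\<bar>a\<bar> <= A ==> \<bar>c\<bar> <= B ==> \<bar>a * c\<bar> <= A * B" for a c :: real
 unfolding abs_mult by (rule mult_mono) auto

lemma U_continuous_H10: "continuous_in VV {0..1} U"
proof -
 obtain R where R: "0 <= R" "!!t x. t \<in> {0..1} ==> x \<in> \<Omega> ==> \<bar>Z t (ht x)\<bar> <= R" using Z_bounded by blast
 obtain C where C: "0 <= C" "!!i x. \<bar>theta1 i x\<bar> <= C" using theta_derivative_bounds by blast
 have th: "\<bar>theta x\<bar> <= 1" for x using theta_bounds[of x] by simp
 have a: "\<bar>u t x\<bar> <= R" if "t \<in> {0..1}" "x \<in> \<Omega>" for t x
  using abs_mult_le[of t 1, OF _ abs_mult_le[OF th R(2)[OF that]]] that by (simp add: u_def)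
 have c: "\<bar>pd i (u t) x\<bar> <= C * R + 2" if t: "t \<in> {0..1}" and x: "x \<in> \<Omega>" for i t x
 proof -
  have "\<bar>1 + phi_yy t (ht x)\<bar> <= 2" using denominator[OF t, of "ht x"] by auto
  from abs_mult_le[OF th[of x] this] have "\<bar>if i = i0 then theta x * (1 + phi_yy t (ht x)) else 0\<bar> <= 2" by simp
  moreover have "\<bar>theta1 i x * Z t (ht x)\<bar> <= C * R" by (rule abs_mult_le[OF C(2) R(2)[OF t x]])
  ultimately have "\<bar>theta1 i x * Z t (ht x) + (if i = i0 then theta x * (1 + phi_yy t (ht x)) else 0)\<bar> <= C * R + 2" by linarith
  from abs_mult_le[of t 1, OF _ this] t show ?thesis by (simp add: pd_u)
 qed
 show ?thesis
 proof (rule continuous_in_H10[where C="R + (C * R + 2)"])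
  fix x
  show "continuous_on {0..1} (%t. u t x)" unfolding u_def by (intro continuous_intros Z_time_continuous)
  fix i
  show "continuous_on {0..1} (%t. pd i (u t) x)"
   unfolding pd_u by (cases "i = i0") (auto intro!: continuous_intros Z_time_continuous phi_time_continuous)
 next
  fix t :: real and x i assume tx: "t \<in> {0..1}" "x \<in> \<Omega>"
  have "0 <= C * R" using C R by simp
  then show "\<bar>u t x\<bar> <= R + (C * R + 2)" "\<bar>pd i (u t) x\<bar> <= R + (C * R + 2)"
   using a[OF tx] c[OF tx, of i] R(1) by linarith+
 qed (rule u_test)
qed

lemma U_continuous_L2: "continuous_in HH {0..1} U"
 unfolding continuous_in_def
proof (intro conjI ballI)
 fix t :: real assume t: "t \<in> {0..1}"
 have car: "U s \<in> carr VV" for s by (intro test_H10 test_functions_of_real u_test)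
 show "U t \<in> carr HH" using H10_sqint[OF car] by (simp add: L2_carr)
 have lim: "((%s. nrm VV (%x. U s x - U t x)) \<longlongrightarrow> 0) (at t within {0..1})"
  using U_continuous_H10 t unfolding continuous_in_def by blast
 show "((%s. nrm HH (%x. U s x - U t x)) \<longlongrightarrow> 0) (at t within {0..1})"
 proof (rule Lim_null_comparison[OF _ lim], rule always_eventually, rule allI)
  fix s
  show "norm (nrm HH (%x. U s x - U t x)) <= nrm VV (%x. U s x - U t x)"
   using l2norm_le_H1[OF carr_diff[OF seminormed_H10 car car]] by (simp add: L2_nrm l2norm_nonneg)
 qed
qed

lemma F_continuous_L2: "continuous_in HH {0..1} F"
proof (rule continuous_in_L2)
 fix t :: real assume t: "t \<in> {0..1}"
 show "F t \<in> meas" by (rule test_measurable_of_real[OF force_test[OF t]])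
 obtain R where R: "0 <= R" "!!t x. t \<in> {0..1} ==> x \<in> \<Omega> ==> \<bar>Z t (ht x)\<bar> <= R" "!!x. x \<in> \<Omega> ==> \<bar>ht x\<bar> <= R"
  using Z_bounded by (metis atLeastAtMost_iff order_refl zero_le_one)
 obtain C where C: "0 <= C" "!!i x. \<bar>theta1 i x\<bar> <= C" "!!i x. \<bar>theta2 i x\<bar> <= C" using theta_derivative_bounds by blast
 have "\<bar>force s x\<bar> <= R + (2 * C + R * C) + 2 * R * (\<Sum>i\<in>UNIV - {i0}. C)" if s: "s \<in> {0..1}" and x: "x \<in> \<Omega>" for s x
 proof -
  have s1: "\<bar>s\<bar> <= 1" using s by simp
  have "\<bar>theta x\<bar> <= 1" using theta_bounds[of x] by simp
  from abs_mult_le[OF this R(2)[OF s x]] have 1: "\<bar>theta x * Z s (ht x)\<bar> <= R" by simp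
  have "\<bar>2 * theta1 i0 x + ht x * theta2 i0 x\<bar> <= 2 * C + R * C"
   using C(2)[of i0 x] abs_mult_le[OF R(3)[OF x] C(3)[of i0 x]] by linarith
  from abs_mult_le[OF s1 this] have 2: "\<bar>s * (2 * theta1 i0 x + ht x * theta2 i0 x)\<bar> <= 2 * C + R * C" by simp
  have "\<bar>\<Sum>i\<in>UNIV - {i0}. theta2 i x\<bar> <= (\<Sum>i\<in>UNIV - {i0}. C)"
   by (rule order_trans[OF sum_abs sum_mono]) (rule C)
  moreover have "\<bar>coef s (ht x)\<bar> <= 2" using coef_bounds[OF s, of "ht x"] by auto
  from abs_mult_le[OF this R(2)[OF s x]] have "\<bar>coef s (ht x) * Z s (ht x)\<bar> <= 2 * R" .
  ultimately have "\<bar>coef s (ht x) * Z s (ht x) * (\<Sum>i\<in>UNIV - {i0}. theta2 i x)\<bar> <= 2 * R * (\<Sum>i\<in>UNIV - {i0}. C)"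
   by (rule abs_mult_le[rotated])
  from abs_mult_le[OF s1 this]
  have 3: "\<bar>s * (coef s (ht x) * Z s (ht x) * (\<Sum>i\<in>UNIV - {i0}. theta2 i x))\<bar> <= 2 * R * (\<Sum>i\<in>UNIV - {i0}. C)" by simp
  show ?thesis unfolding force_def using 1 2 3 by linarith
 qed
 then show "\<exists>e>0. \<exists>C. \<forall>s\<in>{0..1}. \<bar>s - t\<bar> < e \<longrightarrow> (\<forall>x\<in>\<Omega>. cmod (F s x) <= C)"
  by (intro exI[of _ 1] conjI exI[of _ "R + (2 * C + R * C) + 2 * R * (\<Sum>i\<in>UNIV - {i0}. C)"]) auto
next
 fix x
 show "continuous_on {0..1} (%t. F t x)"
  unfolding force_def by (intro continuous_intros Z_time_continuous coef_time_continuous)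
qed

text \<open>The oscillating parts of \<open>u\<close> and \<open>u'\<close> are \<open>y\<close>-derivatives of small functions, hence small in the
 antidual space.\<close>

definition q :: "real => real^'n => real" where "q t x = t * (theta x * phi t (ht x))"

definition q' :: "real => real^'n => real" where "q' t x = theta x * (phi t (ht x) + t * phi_t t (ht x))"

lemma q_test: "q t \<in> tests" and q'_test: "q' t \<in> tests"
proof -
 show "q t \<in> tests"
  unfolding q_def[abs_def] by (intro test_cmult test_mult_coord theta_test smooth_series)
 show "q' t \<in> tests" unfolding q'_def[abs_def]
  by (rule test_mult_coord[where g="%y. phi t y + t * phi_t t y"])
   (intro theta_test smooth_add smooth_mult smooth_const smooth_series)+
qed

lemma u_potential: "u t x = t * (theta x * ht x) + pd i0 (q t) x"
 and u'_potential: "u' t x = theta x * ht x + pd i0 (q' t) x"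
proof -
 have d0: "deriv (phi t) y = phi_y t y" "deriv (phi_t t) y = phi_ty t y" for y
  by (rule DERIV_imp_deriv, rule series_y_deriv, rule E0_deriv)+
 have "pd i0 (q t) x = t * pd i0 (%x. theta x * phi t (ht x)) x"
  unfolding q_def[abs_def]
  by (rule frechet_derivative_cmult[OF test_functions_smooth[OF test_mult_coord[OF theta_test smooth_series(1)]]])
 also have "pd i0 (%x. theta x * phi t (ht x)) x = theta x * phi_y t (ht x)"
  unfolding pd_mult_coord[OF theta_smooth(1) smooth_series(1)] using theta1_series_0(1)[of x P3 amp t]
  by (simp add: theta1_def d0)
 finally show "u t x = t * (theta x * ht x) + pd i0 (q t) x" by (simp add: u_def Z_def algebra_simps)
 have g: "smooth (%y. phi t y + t * phi_t t y)" by (intro smooth_add smooth_mult smooth_const smooth_series)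
 have dg: "deriv (%y. phi t y + t * phi_t t y) y = phi_y t y + t * phi_ty t y" for y
  by (intro DERIV_imp_deriv DERIV_add DERIV_cmult series_y_deriv E0_deriv)
 have "theta1 i0 x * (phi t (ht x) + t * phi_t t (ht x)) = theta1 i0 x * phi t (ht x) + t * (theta1 i0 x * phi_t t (ht x))"
  by (simp add: algebra_simps)
 then have "theta1 i0 x * (phi t (ht x) + t * phi_t t (ht x)) = 0" by (simp add: theta1_series_0)
 moreover have "pd i0 (q' t) x = theta1 i0 x * (phi t (ht x) + t * phi_t t (ht x)) + theta x * (phi_y t (ht x) + t * phi_ty t (ht x))"
  using pd_mult_coord[OF theta_smooth(1) g, where i=i0 and x=x] by (simp add: q'_def[abs_def] theta1_def dg)
 ultimately show "u' t x = theta x * ht x + pd i0 (q' t) x" by (simp add: u'_def Z_def algebra_simps)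
qed

text \<open>Integration by parts moves the derivative to the element it is paired with, whose norm contains its gradient.\<close>

lemma Hm1_norm_le:
 assumes g: "g \<in> tests" and l: "!!w. w \<in> carr VV ==> l w = emb (%x. cr (pd i0 g x)) w"
 shows "nrm VV' l <= l2norm M (%x. cr (g x))"
proof (rule nrm_antidual_le[OF seminormed_H10 _ l2norm_nonneg])
 fix w assume w: "w \<in> carr VV"
 have "(%x. frechet_derivative (%x. cr (g x)) (at x) (axis i0 1)) = (%x. cr (pd i0 g x))"
  using frechet_derivative_of_real[OF test_functions_smooth[OF g]] by (rule ext)
 with embed_H_derivative_bound[OF test_functions_of_real[OF g] w, of i0]
 show "cmod (l w) <= l2norm M (%x. cr (g x)) * nrm VV w" by (simp add: l[OF w])
qed

lemma phi_time_derivative: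
 assumes t: "t \<in> {0..1}" shows "((%t. phi t y) has_real_derivative phi_t t y) (at t within {0..1})"
proof (cases "t < 1")
 case True then show ?thesis by (rule has_field_derivative_at_within[OF series_t_deriv])
next
 case False
 then have "t = 1" using t by simp
 then show ?thesis using phi_t_deriv_1[of y] by (simp add: series_1)
qed

lemma q_derivative:
 assumes t: "t \<in> {0..1}" shows "((%t. q t x) has_real_derivative q' t x) (at t within {0..1})"
 unfolding q_def q'_def by (rule derivative_eq_intros phi_time_derivative t refl | simp add: algebra_simps)+

lemma q'_bounded: "t \<in> {0..1} ==> \<bar>q' t x\<bar> <= 1"
proof -
 assume t: "t \<in> {0..1}"
 have "\<bar>t * phi_t t (ht x)\<bar> <= 1 * (1/4)" by (rule abs_mult_le) (use t phi_t_small(1)[OF t, of "ht x"] in auto)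
 then have "\<bar>phi t (ht x) + t * phi_t t (ht x)\<bar> <= 1" using phi_small[OF t, of "ht x"] by linarith
 moreover have "\<bar>theta x\<bar> <= 1" using theta_bounds[of x] by simp
 ultimately have "\<bar>theta x * (phi t (ht x) + t * phi_t t (ht x))\<bar> <= 1 * 1" by (intro abs_mult_le)
 then show ?thesis by (simp add: q'_def)
qed

text \<open>This bounds the difference quotients, as dominated convergence requires.\<close>

lemma q_lipschitz: "s \<in> {0..1} ==> t \<in> {0..1} ==> \<bar>q s x - q t x\<bar> <= \<bar>s - t\<bar>"
 using field_differentiable_bound[of "{0..1::real}" "%t. q t x" "%t. q' t x" 1 s t] q_derivative q'_bounded by simp

lemma q'_time_continuous: "continuous_on S (%t. q' t x)"
 unfolding q'_def by (intro continuous_intros phi_time_continuous)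

text \<open>Difference quotients in time and their limits, as test functions.\<close>

lemma test_combination:
 fixes A B C :: "real^'n => real"
 assumes "A \<in> tests" "B \<in> tests" "C \<in> tests"
 shows "(%x. a * (A x + (-1) * B x) + (-1) * C x) \<in> tests"
  "pd i (%x. a * (A x + (-1) * B x) + (-1) * C x) x = a * (pd i A x - pd i B x) - pd i C x"
proof -
 note T = test_cmult[OF assms(2), of "-1"] test_cmult[OF assms(3), of "-1"]
 note T2 = test_functions_add[OF assms(1) T(1)]
 note T3 = test_cmult[OF T2, of a]
 show "(%x. a * (A x + (-1) * B x) + (-1) * C x) \<in> tests" by (rule test_functions_add[OF T3 T(2)])
 show "pd i (%x. a * (A x + (-1) * B x) + (-1) * C x) x = a * (pd i A x - pd i B x) - pd i C x"
  unfolding frechet_derivative_add[OF test_functions_smooth[OF T3] test_functions_smooth[OF T(2)]]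
   frechet_derivative_cmult[OF test_functions_smooth[OF T2]]
   frechet_derivative_add[OF test_functions_smooth[OF assms(1)] test_functions_smooth[OF T(1)]]
   frechet_derivative_cmult[OF test_functions_smooth[OF assms(2)]] frechet_derivative_cmult[OF test_functions_smooth[OF assms(3)]]
  by simp
qed

abbreviation D where "D t \<equiv> embed_H \<Omega> (U' t)"

lemma U_sqint: "sqint M (U t)" and U'_sqint: "sqint M (U' t)"
 by (rule test_sqint[OF test_functions_of_real], rule u_test u'_test)+

lemma D_continuous: "continuous_in VV' {0..1} D"
 unfolding continuous_in_def
proof (intro conjI ballI)
 fix t :: real assume t: "t \<in> {0..1}"
 have car: "D s \<in> carr VV'" for s by (rule embed_H_antidual[OF U'_sqint])
 show "D t \<in> carr VV'" by (rule car)
 define g where "g s x = 1 * (q' s x + (-1) * q' t x) + (-1) * (%x. 0) x" for s x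
 have g: "g s \<in> tests" "pd i0 (g s) x = u' s x - u' t x" for s x
  unfolding g_def[abs_def] using test_combination(1)[OF q'_test[of s] q'_test[of t] test_functions_zero, where a=1]
   test_combination(2)[OF q'_test[of s] q'_test[of t] test_functions_zero, where a=1 and i=i0]
  by (simp_all add: u'_potential)
 have "((%s. l2norm M (%x. cr (g s x))) \<longlongrightarrow> 0) (at t within {0..1})"
 proof (rule l2norm_dominated_at[where C=2])
  fix s x assume s: "s \<in> {0..1::real}"
  show "norm (cr (g s x)) <= 2"
   using q'_bounded[OF s, of x] q'_bounded[OF t, of x] unfolding norm_of_real g_def by simp
 next
  fix x
  have "((%s. q' s x) \<longlongrightarrow> q' t x) (at t within {0..1})" using q'_time_continuous[of "{0..1}" x] t by (simp add: continuous_on_def)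
  then have "((%s. cr (1 * (q' s x + (-1) * q' t x) + (-1) * 0)) \<longlongrightarrow> of_real (1 * (q' t x + (-1) * q' t x) + (-1) * 0)) (at t within {0..1})"
   by (intro tendsto_intros)
  then show "((%s. cr (g s x)) \<longlongrightarrow> 0) (at t within {0..1})" by (simp add: g_def)
 qed (rule test_measurable_of_real[OF g(1)])
 then show "((%s. nrm VV' (%w. D s w - D t w)) \<longlongrightarrow> 0) (at t within {0..1})"
 proof (rule Lim_null_comparison[rotated], intro always_eventually allI)
  fix s
  have "nrm VV' (%w. D s w - D t w) <= l2norm M (%x. cr (g s x))"
  proof (rule Hm1_norm_le[OF g(1)])
   fix w assume "w \<in> carr VV"
   from embed_H_diff[OF U'_sqint U'_sqint H10_sqint[OF this]]
   show "D s w - D t w = emb (%x. cr (pd i0 (g s) x)) w" by (simp add: g(2))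
  qed
  then show "norm (nrm VV' (%w. D s w - D t w)) <= l2norm M (%x. cr (g s x))"
   using nrm_antidual_nonneg[OF seminormed_H10 carr_diff[OF seminormed_Hm1 car car], of s t] by simp
 qed
qed

lemma U_C1: "C1_derivative_in VV' {0..1} (%t. emb (U t)) D"
 unfolding C1_derivative_in_def
proof (intro conjI ballI)
 show "continuous_in VV' {0..1} (%t. emb (U t))" by (rule continuous_in_Hm1[OF U_continuous_L2])
 show "continuous_in VV' {0..1} D" by (rule D_continuous)
 fix t :: real assume t: "t \<in> {0..1}"
 define g where "g s x = inverse (s - t) * (q s x + (-1) * q t x) + (-1) * q' t x" for s x
 have g: "g s \<in> tests" "pd i0 (g s) x = inverse (s - t) * (pd i0 (q s) x - pd i0 (q t) x) - pd i0 (q' t) x" for s x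
  unfolding g_def[abs_def] by (rule test_combination[OF q_test q_test q'_test])+
 have "((%s. l2norm M (%x. cr (g s x))) \<longlongrightarrow> 0) (at t within {0..1})"
 proof (rule l2norm_dominated_at[where C=2])
  fix s x assume s: "s \<in> {0..1::real}"
  have "\<bar>inverse (s - t) * (q s x - q t x)\<bar> <= 1"
  proof (cases "s = t")
   case False
   then show ?thesis using q_lipschitz[OF s t, of x] by (simp add: abs_mult abs_inverse field_simps)
  qed simp
  then show "norm (cr (g s x)) <= 2"
   using q'_bounded[OF t, of x] unfolding norm_of_real g_def by simp
 next
  fix x
  have "((%s. (q s x - q t x) / (s - t)) \<longlongrightarrow> q' t x) (at t within {0..1})"
   using q_derivative[OF t, of x] by (simp add: has_field_derivative_iff)
  then have "((%s. cr ((q s x - q t x) / (s - t) - q' t x)) \<longlongrightarrow> of_real (q' t x - q' t x)) (at t within {0..1})"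
   by (intro tendsto_intros)
  then show "((%s. cr (g s x)) \<longlongrightarrow> 0) (at t within {0..1})" by (simp add: g_def divide_inverse mult.commute)
 qed (rule test_measurable_of_real[OF g(1)])
 then show "((%s. nrm VV' (%w. (emb (U s) w - emb (U t) w) /\<^sub>R (s - t) - D t w)) \<longlongrightarrow> 0) (at t within {0..1})"
 proof (rule Lim_null_comparison[rotated])
  show "\<forall>\<^sub>F s in at t within {0..1}. norm (nrm VV' (%w. (emb (U s) w - emb (U t) w) /\<^sub>R (s - t) - D t w))
    <= l2norm M (%x. cr (g s x))"
   unfolding eventually_at_filter
  proof (intro always_eventually allI impI)
   fix s :: real assume st: "s ~= t"
   have quot: "inverse (s - t) * (u s x - u t x) - u' t x = pd i0 (g s) x" for x
   proof -
    have "inverse (s - t) * (s * (theta x * ht x) - t * (theta x * ht x)) = theta x * ht x"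
     using st by (simp add: field_simps)
    then show ?thesis unfolding g(2) u_potential u'_potential by (simp add: algebra_simps)
   qed
   have "nrm VV' (%w. (emb (U s) w - emb (U t) w) /\<^sub>R (s - t) - D t w)
     <= l2norm M (%x. cr (g s x))"
   proof (rule Hm1_norm_le[OF g(1)])
    fix w assume "w \<in> carr VV"
    then have w: "sqint M w" by (rule H10_sqint)
    have d: "sqint M (%x. U s x - U t x)" by (rule sqint_diff[OF U_sqint U_sqint])
    have i: "sqint M (%x. inverse (s - t) *\<^sub>R (U s x - U t x))"
     using l2norm_cmult(1)[OF d, of "of_real (inverse (s - t))"] by (simp add: scaleR_conv_of_real)
    have "(emb (U s) w - emb (U t) w) /\<^sub>R (s - t) - D t w
      = emb (%x. inverse (s - t) *\<^sub>R (U s x - U t x) - U' t x) w"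
     unfolding embed_H_diff[OF i U'_sqint w] embed_H_scaleR embed_H_diff[OF U_sqint U_sqint w] ..
    also have "(%x. inverse (s - t) *\<^sub>R (U s x - U t x) - U' t x) = (%x. cr (pd i0 (g s) x))"
     unfolding quot[symmetric] by (simp add: scaleR_conv_of_real)
    finally show "(emb (U s) w - emb (U t) w) /\<^sub>R (s - t) - D t w = emb (%x. cr (pd i0 (g s) x)) w" .
   qed
   moreover have "0 <= nrm VV' (%w. (emb (U s) w - emb (U t) w) /\<^sub>R (s - t) - D t w)"
    by (rule nrm_antidual_nonneg[OF seminormed_H10]) (intro carr_diff[OF seminormed_Hm1] carr_scaleR[OF seminormed_Hm1] embed_H_antidual U_sqint U'_sqint)
   ultimately show "norm (nrm VV' (%w. (emb (U s) w - emb (U t) w) /\<^sub>R (s - t) - D t w))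
    <= l2norm M (%x. cr (g s x))" by simp
  qed
 qed
qed

lemma u_time_derivative:
 assumes t: "t < 1" shows "((%t. u t x) has_real_derivative u' t x) (at t)"
 unfolding u_def u'_def Z_def
 by (rule derivative_eq_intros series_t_deriv t refl | simp add: algebra_simps)+

lemma phi_ty_bounded: "c < 1 ==> \<exists>B\<ge>0. \<forall>t\<le>c. \<forall>y. \<bar>phi_ty t y\<bar> <= B"
proof -
 assume c: "c < 1"
 have "\<exists>B. \<forall>y. \<bar>E1 j y\<bar> <= B" for j using Cb(4) by blast
 from series_bounded[of damp c E1 P1, OF _ c this] obtain B where B: "\<forall>t\<le>c. \<forall>y. \<bar>phi_ty t y\<bar> <= B" by blast
 have "0 <= B" using B[rule_format, of c 0] by simp
 then show ?thesis using B by blast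
qed

lemma u'_bounded:
 assumes c: "c < 1" shows "\<exists>C. \<forall>t\<in>{0..c}. \<forall>x\<in>\<Omega>. \<bar>u t x\<bar> <= C \<and> \<bar>u' t x\<bar> <= C"
proof -
 obtain R where R: "0 <= R" "!!t x. t \<in> {0..1} ==> x \<in> \<Omega> ==> \<bar>Z t (ht x)\<bar> <= R" using Z_bounded by blast
 obtain B where B: "0 <= B" "!!t y. t <= c ==> \<bar>phi_ty t y\<bar> <= B" using phi_ty_bounded[OF c] by blast
 have "\<bar>u t x\<bar> <= R + B \<and> \<bar>u' t x\<bar> <= R + B" if t: "t \<in> {0..c}" and x: "x \<in> \<Omega>" for t x
 proof -
  have t1: "t \<in> {0..1}" "\<bar>t\<bar> <= 1" "t <= c" using t c by auto
  have th: "\<bar>theta x\<bar> <= 1" using theta_bounds[of x] by simp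
  note r = R(2)[OF t1(1) x]
  have "\<bar>t * (theta x * Z t (ht x))\<bar> <= 1 * (1 * R)" by (intro abs_mult_le t1 th r)
  moreover have "\<bar>t * phi_ty t (ht x)\<bar> <= 1 * B" by (intro abs_mult_le t1 B)
  then have "\<bar>Z t (ht x) + t * phi_ty t (ht x)\<bar> <= R + B" using r by linarith
  then have "\<bar>theta x * (Z t (ht x) + t * phi_ty t (ht x))\<bar> <= 1 * (R + B)" by (intro abs_mult_le th)
  ultimately show ?thesis using B(1) by (simp add: u_def u'_def)
 qed
 then show ?thesis by blast
qed

lemma u'_time_continuous: "continuous_on {0<..<1} (%t. u' t x)"
proof (rule continuous_at_imp_continuous_on, rule ballI)
 fix t :: real assume t: "t \<in> {0<..<1}"
 have "continuous_on {..(1 + t) / 2} (%t. u' t x)"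
  unfolding u'_def using t by (intro continuous_intros Z_time_continuous series_t_continuous) auto
 then show "isCont (%t. u' t x) t"
  by (rule continuous_on_interior) (use t in auto)
qed

lemma U_weak_derivative:
 assumes "\<phi> \<in> test_functions {0<..<1}"
 shows "\<exists>y. has_bochner_integral_in HH {0<..<1} (%t x. deriv \<phi> t *\<^sub>R U t x) y \<and>
   has_bochner_integral_in HH {0<..<1} (%t x. \<phi> t *\<^sub>R U' t x) (%x. - y x)"
proof (rule weak_derivative_L2[OF _ _ _ _ _ assms])
 fix t :: real and x assume t: "t \<in> {0<..<1}"
 from u_time_derivative[of t x] t
 have "((%t. u t x) has_vector_derivative u' t x) (at t)" by (simp add: has_real_derivative_iff_has_vector_derivative)
 from bounded_linear.has_vector_derivative[OF bounded_linear_of_real this]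
 show "((%t. U t x) has_vector_derivative U' t x) (at t)" .
next
 fix a c :: real assume ac: "0 < a" "c < 1"
 obtain C where "!!t x. t \<in> {0..c} ==> x \<in> \<Omega> ==> \<bar>u t x\<bar> <= C \<and> \<bar>u' t x\<bar> <= C" using u'_bounded[OF ac(2)] by blast
 then show "\<exists>C. \<forall>t\<in>{a..c}. \<forall>x\<in>\<Omega>. cmod (U t x) <= C \<and> cmod (U' t x) <= C"
  using ac(1) by (intro exI[of _ C]) auto
next
 fix x show "continuous_on {0<..<1} (%t. U' t x)" by (intro continuous_intros u'_time_continuous)
qed (rule test_measurable_of_real, rule u_test u'_test)+

lemma U_weak_derivative_L2: "weak_derivative_in HH {0<..<1} U U'"
 unfolding weak_derivative_in_def using U_weak_derivative by blast

lemma U_weak_derivative_Hm1: "weak_derivative_in VV' {0<..<1} (%t. emb (U t)) D"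
 unfolding weak_derivative_in_def
proof
 fix \<phi> :: "real => real" assume \<phi>: "\<phi> \<in> test_functions {0<..<1}"
 obtain y where y: "has_bochner_integral_in HH {0<..<1} (%t x. deriv \<phi> t *\<^sub>R U t x) y"
   "has_bochner_integral_in HH {0<..<1} (%t x. \<phi> t *\<^sub>R U' t x) (%x. - y x)"
  using U_weak_derivative[OF \<phi>] by blast
 have e: "(%t. emb (%x. deriv \<phi> t *\<^sub>R U t x)) = (%t w. deriv \<phi> t *\<^sub>R emb (U t) w)"
  "(%t. emb (%x. \<phi> t *\<^sub>R U' t x)) = (%t w. \<phi> t *\<^sub>R D t w)"
  "emb (%x. - y x) = (%w. - emb y w)"
  by (intro ext, simp only: embed_H_scaleR embed_H_minus)+
 from bochner_integral_Hm1[OF y(1)] bochner_integral_Hm1[OF y(2)]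
 show "\<exists>y. has_bochner_integral_in VV' {0<..<1} (%t w. deriv \<phi> t *\<^sub>R emb (U t) w) y \<and>
    has_bochner_integral_in VV' {0<..<1} (%t w. \<phi> t *\<^sub>R D t w) (%w. - y w)"
  unfolding e by (intro exI[of _ "emb y"] conjI)
qed

lemma U'_strongly_measurable: "strongly_measurable_in HH {0<..<1} U'"
proof (rule strongly_measurable_continuous[OF seminormed_L2 continuous_in_L2])
 fix t :: real assume t: "t \<in> {0<..<1}"
 show "U' t \<in> meas" by (rule test_measurable_of_real[OF u'_test])
 obtain C where C: "!!s x. s \<in> {0..(1 + t) / 2} ==> x \<in> \<Omega> ==> \<bar>u s x\<bar> <= C \<and> \<bar>u' s x\<bar> <= C"
 proof -
  have "(1 + t) / 2 < 1" using t by simp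
  from u'_bounded[OF this] show thesis using that by blast
 qed
 have "\<bar>u' s x\<bar> <= C" if "s \<in> {0<..<1}" "\<bar>s - t\<bar> < (1 - t) / 2" "x \<in> \<Omega>" for s x
 proof -
  have "s \<in> {0..(1 + t) / 2}" using that t by (auto simp: abs_if split: if_splits)
  then show ?thesis using C that(3) by blast
 qed
 then show "\<exists>e>0. \<exists>C. \<forall>s\<in>{0<..<1}. \<bar>s - t\<bar> < e \<longrightarrow> (\<forall>x\<in>\<Omega>. cmod (U' s x) <= C)"
  using t by (intro exI[of _ "(1 - t) / 2"] conjI exI[of _ C]) auto
next
 fix x show "continuous_on {0<..<1} (%t. U' t x)" by (intro continuous_intros u'_time_continuous)
qed

end

section \<open>The time derivative leaves L2 in time\<close>

lemma sum_freq_less: "(\<Sum>i<j. freq i) <= 2 * (freq j / 4 ^ j)"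
proof (cases j)
 case (Suc k)
 have "(\<Sum>i<j. freq i) <= 4/3 * freq k" using sum_freq_le[of k] by (simp add: Suc)
 also have "\<dots> <= 2 * freq k" using freq_pos[of k] by simp
 also have "freq k <= freq j / 4 ^ j"
 proof -
  have "(4::real) ^ j <= 4 ^ (2 * k + 1)" by (rule power_increasing) (auto simp: Suc)
  then have "4 ^ j * freq k <= 4 ^ (2 * k + 1) * freq k" using freq_pos[of k] by (intro mult_right_mono) auto
  also have "\<dots> <= freq j" unfolding Suc by (rule freq_Suc)
  finally show ?thesis by (simp add: field_simps)
 qed
 finally show ?thesis by simp
qed (use freq_pos[of 0] in simp)

text \<open>Bounded uniformly in the number of terms: all cross terms together are a bounded perturbation.\<close>

lemma sum_freq_ratio: "(\<Sum>j<m. \<Sum>i<j. freq i / freq j) <= 8/3"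
proof -
 have "(\<Sum>i<j. freq i / freq j) <= 2 * (1/4) ^ j" for j
 proof -
  have "(\<Sum>i<j. freq i / freq j) = (\<Sum>i<j. freq i) / freq j" by (simp add: sum_divide_distrib)
  also have "\<dots> <= 2 * (freq j / 4 ^ j) / freq j" using sum_freq_less[of j] freq_pos[of j] by (intro divide_right_mono) auto
  also have "\<dots> = 2 * (1/4) ^ j" using freq_pos[of j] by (simp add: power_divide)
  finally show ?thesis .
 qed
 then have "(\<Sum>j<m. \<Sum>i<j. freq i / freq j) <= (\<Sum>j<m. 2 * (1/4) ^ j)" by (intro sum_mono)
 also have "\<dots> = 2 * ((1 - (1/4) ^ m) / (1 - 1/4))"
  unfolding sum_distrib_left[symmetric] by (simp add: sum_gp_strict)
 also have "\<dots> <= 8/3" by simp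
 finally show ?thesis .
qed

lemma sum_square_split:
 fixes a :: "nat => nat => real"
 assumes "!!i j. a i j = a j i"
 shows "(\<Sum>i<m. \<Sum>j<m. a i j) = (\<Sum>j<m. a j j) + 2 * (\<Sum>j<m. \<Sum>i<j. a i j)"
proof (induction m)
 case (Suc m)
 have "(\<Sum>i<Suc m. \<Sum>j<Suc m. a i j) = (\<Sum>i<m. \<Sum>j<m. a i j) + (\<Sum>i<m. a i m) + (\<Sum>j<m. a m j) + a m m"
  by (simp add: sum.distrib)
 also have "(\<Sum>j<m. a m j) = (\<Sum>i<m. a i m)" by (rule sum.cong[OF refl assms])
 finally show ?case using Suc.IH by simp
qed simp

context bounded_open
begin

lemma test_integrable:
 fixes f :: "real^'n => real"
 assumes "f \<in> tests" shows "integrable M f"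
 using sqint_integrable[OF test_sqint[OF test_functions_of_real[OF assms]]] by (simp add: complex_of_real_integrable_eq)

lemma integral_pd_eq_0:
 assumes f: "f \<in> tests" shows "(LINT x|M. pd i f x) = 0"
proof -
 have "(LINT x|M. cr (pd i f x)) = 0"
  using integral_by_parts[OF smooth_const[of 1] test_functions_of_real[OF f], of i]
  by (simp add: frechet_derivative_of_real[OF test_functions_smooth[OF f]])
 then show ?thesis by simp
qed

lemma abs_integral_le:
 fixes f :: "real^'n => real"
 assumes f: "integrable M f" and C: "!!x. x \<in> \<Omega> ==> \<bar>f x\<bar> <= C"
 shows "\<bar>LINT x|M. f x\<bar> <= C * measure M \<Omega>"
proof -
 have sp: "space M = \<Omega>" by simp
 have "\<bar>LINT x|M. f x\<bar> <= (LINT x|M. \<bar>f x\<bar>)" by (rule integral_abs_bound)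
 also have "\<dots> <= (LINT x|M. C)"
  using C by (intro integral_mono integrable_abs f) (auto simp: sp)
 also have "\<dots> = C * measure M \<Omega>" by (simp add: sp mult.commute)
 finally show ?thesis .
qed

lemma open_not_AE_empty:
 assumes S: "open S" "S \<subseteq> \<Omega>" "x \<in> S" shows "\<not> (AE x in M. x \<notin> S)"
proof
 assume "AE x in M. x \<notin> S"
 then have "AE x in lebesgue. x \<in> \<Omega> \<longrightarrow> x \<notin> S"
  by (subst (asm) AE_restrict_space_iff) (use Omega_lebesgue in auto)
 then have "AE x in lebesgue. x \<notin> S" by eventually_elim (use S in auto)
 then have "negligible S" by (simp add: negligible_iff_null_sets AE_iff_null_sets[of S lebesgue] S(1) lebesgue_openin)
 then show False using open_not_negligible[OF S(1)] S(3) by auto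
qed

lemma l2norm_real_sq: "(l2norm M (%x. cr (f x)))\<^sup>2 = (LINT x|M. (f x)\<^sup>2)"
 unfolding l2norm_sq norm_of_real by simp

end

context construction
begin

subsection \<open>Almost orthogonality\<close>

definition osc :: "nat => real^'n => real" where "osc j x = theta x * (P1 j * E1 j (ht x))"

definition gram :: "nat => nat => real" where "gram i j = (LINT x|M. osc i x * osc j x)"

lemma osc_test: "osc j \<in> tests"
 unfolding osc_def[abs_def]
 by (rule test_mult_coord[where g="%y. P1 j * E1 j y"]) (intro theta_test smooth_mult smooth_const smooth_E1)+

lemma osc_mult_test: "(%x. osc i x * osc j x) \<in> tests"
 by (rule test_functions_mult_smooth[OF osc_test test_functions_smooth[OF osc_test]])

lemma osc_mult_integrable: "integrable M (%x. osc i x * osc j x)"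
 by (rule test_integrable[OF osc_mult_test])

lemma gram_commute: "gram i j = gram j i"
 by (simp add: gram_def mult.commute)

abbreviation theta_sq where "theta_sq x \<equiv> theta x * theta x"

lemma theta_sq_mult_test: "smooth g ==> (%x. theta_sq x * g (ht x)) \<in> tests"
 by (rule test_mult_coord[OF test_functions_mult_smooth[OF theta_test theta_smooth(1)]])

lemma theta_sq_bounds: "0 <= theta_sq x" "theta_sq x <= 1"
 using theta_bounds[of x] by (auto intro: mult_le_one)

text \<open>Integration by parts: the factor \<open>theta\<close> is not differentiated, as it is constant along the
 oscillation.\<close>

lemma gram_by_parts: "gram i j = - (LINT x|M. theta_sq x * (P1 i * P1 j * (E2 i (ht x) * E0 j (ht x))))"
proof -
 define g where "g y = P1 i * P1 j * (E1 i y * E0 j y)" for y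
 have g: "smooth g" unfolding g_def[abs_def] by (intro smooth_mult smooth_const smooth_E0 smooth_E1)
 have dg: "deriv g y = P1 i * P1 j * (E2 i y * E0 j y) + P1 i * P1 j * (E1 i y * E1 j y)" for y
 proof (rule DERIV_imp_deriv)
  show "(g has_real_derivative P1 i * P1 j * (E2 i y * E0 j y) + P1 i * P1 j * (E1 i y * E1 j y)) (at y)"
   unfolding g_def[abs_def]
   by (rule derivative_eq_intros E0_deriv E1_deriv refl | simp add: algebra_simps)+
 qed
 have sq: "smooth theta_sq" by (intro smooth_mult theta_smooth)
 have pdsq: "pd i0 theta_sq x * g (ht x) = 0" for x
 proof -
  have "pd i0 theta_sq x = 2 * (theta x * theta1 i0 x)"
   unfolding frechet_derivative_mult[OF theta_smooth(1) theta_smooth(1)] by (simp add: theta1_def)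
  moreover have "theta1 i0 x * g (ht x) = P1 i * P1 j * E1 i (ht x) * (theta1 i0 x * E0 j (ht x))"
   by (simp add: g_def)
  ultimately show ?thesis by (simp add: theta1_E_0)
 qed
 have "pd i0 (%x. theta_sq x * g (ht x)) x
   = theta_sq x * (P1 i * P1 j * (E2 i (ht x) * E0 j (ht x))) + osc i x * osc j x" for x
  unfolding pd_mult_coord[OF sq g] pdsq dg by (simp add: osc_def algebra_simps)
 with integral_pd_eq_0[OF theta_sq_mult_test[OF g], of i0]
 have z: "(LINT x|M. theta_sq x * (P1 i * P1 j * (E2 i (ht x) * E0 j (ht x))) + osc i x * osc j x) = 0" by simp
 have int: "integrable M (%x. theta_sq x * (P1 i * P1 j * (E2 i (ht x) * E0 j (ht x))))"
  by (rule test_integrable[OF theta_sq_mult_test[where g="%y. P1 i * P1 j * (E2 i y * E0 j y)"]])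
   (intro smooth_mult smooth_const smooth_E0 smooth_E2)
 show ?thesis using z unfolding Bochner_Integration.integral_add[OF int osc_mult_integrable] gram_def by simp
qed

text \<open>The higher frequency is integrated, the lower one is differentiated.\<close>

lemma gram_off_diagonal: "\<bar>gram i j\<bar> <= Cb\<^sup>2 * measure M \<Omega> * (freq i / freq j)"
proof -
 have "\<bar>theta_sq x * (P1 i * P1 j * (E2 i (ht x) * E0 j (ht x)))\<bar> <= 1 * (freq i / freq j * Cb\<^sup>2)" for x
 proof (rule abs_mult_le)
  show "\<bar>theta_sq x\<bar> <= 1" using theta_sq_bounds[of x] by simp
  have "\<bar>E2 i (ht x) * E0 j (ht x)\<bar> <= (Cb * (freq i)\<^sup>2) * Cb" by (intro abs_mult_le Cb)
  then have "\<bar>P1 i * P1 j * (E2 i (ht x) * E0 j (ht x))\<bar> <= P1 i * P1 j * ((Cb * (freq i)\<^sup>2) * Cb)"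
   by (rule abs_mult_le[rotated]) (use freq_pos[of i] freq_pos[of j] in \<open>simp add: P1_def\<close>)
  also have "\<dots> = freq i / freq j * Cb\<^sup>2" using freq_pos[of i] by (simp add: P1_def power2_eq_square)
  finally show "\<bar>P1 i * P1 j * (E2 i (ht x) * E0 j (ht x))\<bar> <= freq i / freq j * Cb\<^sup>2" .
 qed
 then have "\<bar>LINT x|M. theta_sq x * (P1 i * P1 j * (E2 i (ht x) * E0 j (ht x)))\<bar> <= 1 * (freq i / freq j * Cb\<^sup>2) * measure M \<Omega>"
  by (intro abs_integral_le test_integrable theta_sq_mult_test[where g="%y. P1 i * P1 j * (E2 i y * E0 j y)"]
   smooth_mult smooth_const smooth_E0 smooth_E2)
 then show ?thesis unfolding gram_by_parts by (simp add: mult_ac)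
qed

lemma gram_diagonal_nonneg: "0 <= gram j j"
 unfolding gram_def by (rule Bochner_Integration.integral_nonneg) simp

lemma gram_diagonal_le: "gram j j <= Cb\<^sup>2 * measure M \<Omega>"
 using gram_off_diagonal[of j j] freq_pos[of j] by simp

definition mass :: real where "mass = (LINT x|M. theta_sq x * (hat (ht x) * hat (ht x)))"

lemma mass_pos: "0 < mass"
proof -
 have test: "(%x. theta_sq x * (hat (ht x) * hat (ht x))) \<in> tests"
  by (rule theta_sq_mult_test[where g="%y. hat y * hat y"]) (intro smooth_mult smooth_hat)
 have nn: "0 <= theta_sq x * (hat (ht x) * hat (ht x))" for x
  using theta_sq_bounds[of x] hat_bounds[of "ht x"] by simp
 have "p \<in> \<Omega>" using cube r_pos by auto
 have "mass ~= 0"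
 proof
  assume "mass = 0"
  then have "AE x in M. theta_sq x * (hat (ht x) * hat (ht x)) = 0"
   using integral_nonneg_eq_0_iff_AE[OF test_integrable[OF test]] nn by (simp add: mass_def)
  then have "AE x in M. x \<notin> {x \<in> \<Omega>. theta_sq x * (hat (ht x) * hat (ht x)) ~= 0}" by eventually_elim simp
  moreover have "open {x \<in> \<Omega>. theta_sq x * (hat (ht x) * hat (ht x)) ~= 0}"
  proof -
   have "open {x. theta_sq x * (hat (ht x) * hat (ht x)) ~= 0}"
    by (rule open_Collect_neq[OF smooth_continuous[OF test_functions_smooth[OF test]] continuous_on_const])
   then show ?thesis using open_Int[OF open_Omega] by (simp add: Collect_conj_eq)
  qed
  moreover have "p \<in> {x \<in> \<Omega>. theta_sq x * (hat (ht x) * hat (ht x)) ~= 0}"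
   using \<open>p \<in> \<Omega>\<close> by (simp add: theta_def hat_0 plateau_eq_1)
  ultimately show False using open_not_AE_empty[of "{x \<in> \<Omega>. theta_sq x * (hat (ht x) * hat (ht x)) ~= 0}" p] by auto
 qed
 moreover have "0 <= mass" unfolding mass_def by (rule Bochner_Integration.integral_nonneg) (rule nn)
 ultimately show ?thesis by simp
qed

text \<open>When the Gram entry is added to its integrated by parts form, the squares of sine and cosine add up to one, and the mixed terms of order
\<open>freq j\<close> cancel.\<close>

lemma gram_diagonal_ge: "\<exists>j0\<ge>1. \<forall>j\<ge>j0. mass / 4 <= gram j j"
proof -
 define k where "k y = deriv hat y * deriv hat y - hat y * deriv (deriv hat) y" for y
 have k: "smooth k" unfolding k_def[abs_def] by (intro smooth_diff smooth_mult smooth_hat smooth_deriv)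
 obtain B where B: "!!x. \<bar>theta_sq x * k (ht x)\<bar> <= B"
  using test_functions_bounded[OF theta_sq_mult_test[OF k]] by (metis real_norm_def)
 define V where "V = measure M \<Omega>"
 have hh: "integrable M (%x. theta_sq x * (hat (ht x) * hat (ht x)))"
  by (rule test_integrable[OF theta_sq_mult_test[where g="%y. hat y * hat y"]]) (intro smooth_mult smooth_hat)
 have low: "mass - B * V / freq j <= 2 * gram j j" for j
 proof -
  define N where "N = freq j"
  have N: "0 < N" "1 <= N" unfolding N_def by (rule freq_pos, rule freq_ge_1)
  define c where "c x = cos (N * ht x) * cos (N * ht x)" for x
  define e where "e x = theta_sq x * (P1 j * P1 j * (k (ht x) * c x))" for x
  have cs: "smooth (%y. cos (N * y))" using smooth_compose_scale[OF smooth_cos, of N 0] by simp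
  have e_int: "integrable M e" unfolding e_def[abs_def] c_def
   by (rule test_integrable[OF theta_sq_mult_test[where g="%y. P1 j * P1 j * (k y * (cos (N * y) * cos (N * y)))"]])
    (intro smooth_mult smooth_const k cs)
  have id: "E1 j y * E1 j y - E2 j y * E0 j y = N\<^sup>2 * (hat y * hat y) + k y * (cos (N * y) * cos (N * y))" for y
  proof -
   have alg: "(d * C - N * (h * S)) * (d * C - N * (h * S)) - (d' * C - 2 * N * (d * S) - N\<^sup>2 * (h * C)) * (h * C)
     = N\<^sup>2 * (h * h) * (S * S + C * C) + (d * d - h * d') * (C * C)" for d d' h S C :: real
    by (simp add: algebra_simps power2_eq_square)
   have "sin (N * y) * sin (N * y) + cos (N * y) * cos (N * y) = 1"
    using sin_cos_squared_add[of "N * y"] by (simp only: power2_eq_square)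
   then show ?thesis unfolding E1_eq E2_eq E0_def N_def[symmetric] k_def alg by (simp only: mult_1_right)
  qed
  have "2 * gram j j = gram j j + gram j j" by simp
  also have "\<dots> = (LINT x|M. osc j x * osc j x) - (LINT x|M. theta_sq x * (P1 j * P1 j * (E2 j (ht x) * E0 j (ht x))))"
   using gram_by_parts[of j j] by (simp add: gram_def)
  also have "\<dots> = (LINT x|M. osc j x * osc j x - theta_sq x * (P1 j * P1 j * (E2 j (ht x) * E0 j (ht x))))"
   by (rule Bochner_Integration.integral_diff[symmetric, OF osc_mult_integrable
     test_integrable[OF theta_sq_mult_test[where g="%y. P1 j * P1 j * (E2 j y * E0 j y)"]]])
    (intro smooth_mult smooth_const smooth_E0 smooth_E2)
  also have "\<dots> = (LINT x|M. theta_sq x * (hat (ht x) * hat (ht x)) + e x)"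
  proof (rule Bochner_Integration.integral_cong[OF refl])
   fix x
   have "osc j x * osc j x - theta_sq x * (P1 j * P1 j * (E2 j (ht x) * E0 j (ht x)))
     = theta_sq x * (P1 j * P1 j * (E1 j (ht x) * E1 j (ht x) - E2 j (ht x) * E0 j (ht x)))"
    by (simp add: osc_def algebra_simps)
   also have "\<dots> = theta_sq x * (P1 j * P1 j * (N\<^sup>2 * (hat (ht x) * hat (ht x)))) + e x"
    unfolding id e_def c_def by (simp add: algebra_simps)
   also have "P1 j * P1 j * (N\<^sup>2 * (hat (ht x) * hat (ht x))) = hat (ht x) * hat (ht x)"
    using N(1) by (simp add: P1_def N_def power2_eq_square)
   finally show "osc j x * osc j x - theta_sq x * (P1 j * P1 j * (E2 j (ht x) * E0 j (ht x)))
     = theta_sq x * (hat (ht x) * hat (ht x)) + e x" .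
  qed
  also have "\<dots> = mass + (LINT x|M. e x)"
   unfolding mass_def by (rule Bochner_Integration.integral_add[OF hh e_int])
  finally have eq: "2 * gram j j = mass + (LINT x|M. e x)" .
  have "\<bar>e x\<bar> <= B * (1 / N)" for x
  proof -
   have "\<bar>c x\<bar> <= 1 * 1" unfolding c_def by (intro abs_mult_le abs_cos_le_one)
   moreover have "\<bar>P1 j * P1 j\<bar> <= 1 / N"
   proof -
    have "P1 j * P1 j = (1 / N) * (1 / N)" by (simp add: P1_def N_def)
    also have "\<dots> <= (1 / N) * 1" using N by (intro mult_left_mono) auto
    finally show ?thesis using N by (simp add: P1_def N_def)
   qed
   ultimately have "\<bar>(theta_sq x * k (ht x)) * (P1 j * P1 j * c x)\<bar> <= B * (1 / N * (1 * 1))"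
    by (intro abs_mult_le B)
   then show ?thesis by (simp add: e_def mult_ac)
  qed
  then have "\<bar>LINT x|M. e x\<bar> <= B * (1 / N) * V" unfolding V_def by (intro abs_integral_le e_int)
  then show ?thesis using eq by (simp add: N_def abs_le_iff)
 qed
 have m0: "0 < mass" by (rule mass_pos)
 obtain j0 :: nat where j0: "2 * (B * V) / mass < real j0" using reals_Archimedean2 by blast
 have "mass / 4 <= gram j j" if "max 1 j0 <= j" for j
 proof -
  have "2 * (B * V) / mass < real j" using j0 that by linarith
  also have "real j <= freq j" using freq_ge_linear[of j] by simp
  finally have "2 * (B * V) < mass * freq j" using m0 by (simp add: field_simps)
  then have "B * V / freq j < mass / 2" using freq_pos[of j] by (simp add: field_simps)
  then show ?thesis using low[of j] by simp
 qed
 then show ?thesis by (intro exI[of _ "max 1 j0"]) auto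
qed

subsection \<open>Two-sided bounds for the oscillating part\<close>

definition osc_part :: "real => real^'n => real" where "osc_part t x = theta x * phi_ty t (ht x)"

lemma osc_part_eq: "osc_part t x = \<kappa> * (\<Sum>j<cutoff t. damp j t * osc j x)"
 by (simp add: osc_part_def series_def osc_def sum_distrib_left mult_ac)

lemma osc_part_test: "osc_part t \<in> tests"
 unfolding osc_part_def[abs_def] by (intro test_mult_coord theta_test smooth_series)

abbreviation O' where "O' t x \<equiv> cr (osc_part t x)"

lemma osc_part_norm: "(l2norm M (O' t))\<^sup>2
  = \<kappa>\<^sup>2 * ((\<Sum>j<cutoff t. (damp j t)\<^sup>2 * gram j j) + 2 * (\<Sum>j<cutoff t. \<Sum>i<j. damp i t * damp j t * gram i j))"
proof -
 define m where "m = cutoff t"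
 have "(l2norm M (O' t))\<^sup>2 = (LINT x|M. (osc_part t x)\<^sup>2)" by (rule l2norm_real_sq)
 also have "\<dots> = (LINT x|M. (\<Sum>i<m. \<Sum>j<m. \<kappa>\<^sup>2 * (damp i t * damp j t) * (osc i x * osc j x)))"
  unfolding osc_part_eq m_def[symmetric] power_mult_distrib power2_eq_square[of "sum _ _"] sum_product
  by (simp add: sum_distrib_left mult_ac)
 also have "\<dots> = (\<Sum>i<m. \<Sum>j<m. \<kappa>\<^sup>2 * (damp i t * damp j t) * gram i j)"
  unfolding gram_def
  by (simp only: Bochner_Integration.integral_sum integrable_mult_right osc_mult_integrable Bochner_Integration.integrable_sum
   integral_mult_right_zero)
 also have "\<dots> = \<kappa>\<^sup>2 * (\<Sum>i<m. \<Sum>j<m. damp i t * damp j t * gram i j)"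
  by (simp add: sum_distrib_left mult_ac)
 also have "(\<Sum>i<m. \<Sum>j<m. damp i t * damp j t * gram i j)
   = (\<Sum>j<m. damp j t * damp j t * gram j j) + 2 * (\<Sum>j<m. \<Sum>i<j. damp i t * damp j t * gram i j)"
  by (rule sum_square_split) (simp add: gram_commute mult_ac)
 finally show ?thesis by (simp add: m_def power2_eq_square)
qed

definition Cg :: real where "Cg = Cb\<^sup>2 * measure M \<Omega>"

lemma Cg_nonneg: "0 <= Cg" by (simp add: Cg_def)

lemma cross_terms: "\<bar>\<Sum>j<m. \<Sum>i<j. damp i t * damp j t * gram i j\<bar> <= 3 * Cg"
proof -
 have "\<bar>damp i t * damp j t * gram i j\<bar> <= Cg * (freq i / freq j)" for i j
 proof -
  have "\<bar>damp i t * damp j t\<bar> <= 1 * 1" by (intro abs_mult_le damp_bounds)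
  from abs_mult_le[OF this gram_off_diagonal[of i j]] show ?thesis by (simp add: Cg_def)
 qed
 then have "\<bar>\<Sum>j<m. \<Sum>i<j. damp i t * damp j t * gram i j\<bar> <= (\<Sum>j<m. \<Sum>i<j. Cg * (freq i / freq j))"
  by (intro order_trans[OF sum_abs sum_mono] order_trans[OF sum_abs sum_mono])
 also have "\<dots> = Cg * (\<Sum>j<m. \<Sum>i<j. freq i / freq j)" by (simp add: sum_distrib_left)
 also have "\<dots> <= Cg * (8/3)" by (intro mult_left_mono sum_freq_ratio Cg_nonneg)
 finally show ?thesis using Cg_nonneg by simp
qed

lemma osc_part_upper: "(l2norm M (O' t))\<^sup>2 <= \<kappa>\<^sup>2 * (Cg * (real (cutoff t) + 6))"
proof -
 have "(damp j t)\<^sup>2 * gram j j <= Cg" for j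
 proof -
  have "(damp j t)\<^sup>2 <= 1" using damp_bounds[of j t] by (simp add: abs_square_le_1)
  moreover have "gram j j <= Cg" unfolding Cg_def by (rule gram_diagonal_le)
  ultimately have "(damp j t)\<^sup>2 * gram j j <= 1 * Cg" using gram_diagonal_nonneg[of j] by (intro mult_mono) auto
  then show ?thesis by simp
 qed
 then have "(\<Sum>j<cutoff t. (damp j t)\<^sup>2 * gram j j) <= (\<Sum>j<cutoff t. Cg)" by (intro sum_mono)
 then have "(\<Sum>j<cutoff t. (damp j t)\<^sup>2 * gram j j) + 2 * (\<Sum>j<cutoff t. \<Sum>i<j. damp i t * damp j t * gram i j)
   <= Cg * (real (cutoff t) + 6)"
  using cross_terms[of t "cutoff t"] by (simp add: algebra_simps abs_le_iff)
 then show ?thesis unfolding osc_part_norm by (intro mult_left_mono) auto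
qed

text \<open>Only the windows from \<open>j0\<close> to \<open>J\<close> are kept; the bound holds at all times, as the others contribute nonnegative terms.\<close>

lemma osc_part_lower:
 assumes j0: "!!j. j0 <= j ==> mass / 4 <= gram j j"
 shows "\<kappa>\<^sup>2 * (mass / 4 * (\<Sum>j=j0..<J. (damp j t)\<^sup>2) - 6 * Cg) <= (l2norm M (O' t))\<^sup>2"
proof -
 have "(\<Sum>j=j0..<J. (damp j t)\<^sup>2 * gram j j) <= (\<Sum>j<max J (cutoff t). (damp j t)\<^sup>2 * gram j j)"
  by (rule sum_mono2) (auto simp: gram_diagonal_nonneg)
 also have "\<dots> = (\<Sum>j<cutoff t. (damp j t)\<^sup>2 * gram j j)"
  by (rule sum.mono_neutral_right) (auto simp: cutoff_inactive)
 finally have "(\<Sum>j=j0..<J. (damp j t)\<^sup>2 * gram j j) <= (\<Sum>j<cutoff t. (damp j t)\<^sup>2 * gram j j)" .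
 moreover have "mass / 4 * (\<Sum>j=j0..<J. (damp j t)\<^sup>2) <= (\<Sum>j=j0..<J. (damp j t)\<^sup>2 * gram j j)"
  unfolding sum_distrib_left
 proof (rule sum_mono)
  fix j assume "j \<in> {j0..<J}"
  then have "mass / 4 <= gram j j" by (intro j0) simp
  then show "mass / 4 * (damp j t)\<^sup>2 <= (damp j t)\<^sup>2 * gram j j" using mult_right_mono[of "mass / 4" "gram j j" "(damp j t)\<^sup>2"]
   by (simp only: mult.commute[of _ "gram j j"] zero_le_power2)
 qed
 ultimately have "mass / 4 * (\<Sum>j=j0..<J. (damp j t)\<^sup>2) - 6 * Cg
   <= (\<Sum>j<cutoff t. (damp j t)\<^sup>2 * gram j j) + 2 * (\<Sum>j<cutoff t. \<Sum>i<j. damp i t * damp j t * gram i j)"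
  using cross_terms[of t "cutoff t"] unfolding abs_le_iff by linarith
 then show ?thesis unfolding osc_part_norm by (intro mult_left_mono) auto
qed

subsection \<open>Integrability in time\<close>

lemma smooth_part: "\<exists>A\<ge>0. \<forall>t\<in>{0..1}. l2norm M (%x. cr (theta x * Z t (ht x))) <= A"
proof -
 obtain R where R: "0 <= R" "!!t x. t \<in> {0..1} ==> x \<in> \<Omega> ==> \<bar>Z t (ht x)\<bar> <= R" using Z_bounded by blast
 have "l2norm M (%x. cr (theta x * Z t (ht x))) <= \<bar>R\<bar> * sqrt (measure M \<Omega>)" if t: "t \<in> {0..1}" for t
 proof (rule sqint_bounded(2))
  show "(%x. cr (theta x * Z t (ht x))) \<in> meas"
   by (rule test_measurable_of_real[OF test_mult_coord[OF theta_test smooth_Z]])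
  fix x assume x: "x \<in> \<Omega>"
  have "\<bar>theta x\<bar> <= 1" using theta_bounds[of x] by simp
  from abs_mult_le[OF this R(2)[OF t x]] show "norm (cr (theta x * Z t (ht x))) <= R"
   unfolding norm_of_real by simp
 qed
 then show ?thesis using R(1) by (intro exI[of _ "\<bar>R\<bar> * sqrt (measure M \<Omega>)"]) auto
qed

lemma U'_split: "U' t x = cr (theta x * Z t (ht x)) + of_real t * O' t x"
 by (simp add: u'_def osc_part_def algebra_simps)

lemma U'_upper:
 assumes A: "l2norm M (%x. cr (theta x * Z t (ht x))) <= A" and t: "t \<in> {0..1}"
 shows "l2norm M (U' t) <= A + l2norm M (O' t)" "t * l2norm M (O' t) <= l2norm M (U' t) + A"
proof -
 have osq: "sqint M (O' t)" by (rule test_sqint[OF test_functions_of_real[OF osc_part_test]])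
 note to = l2norm_cmult(1)[OF osq, of "of_real t"] l2norm_cmult(2)[of M "of_real t" "O' t"]
 have s: "sqint M (%x. cr (theta x * Z t (ht x)))"
  by (rule test_sqint[OF test_functions_of_real[OF test_mult_coord[OF theta_test smooth_Z]]])
 have "l2norm M (U' t) <= l2norm M (%x. cr (theta x * Z t (ht x))) + l2norm M (%x. of_real t * O' t x)"
  using sqint_add_l2norm_triangle(2)[OF s to(1)] by (simp only: U'_split[symmetric])
 moreover have "t * l2norm M (O' t) <= 1 * l2norm M (O' t)" using t by (intro mult_right_mono l2norm_nonneg) auto
 ultimately show "l2norm M (U' t) <= A + l2norm M (O' t)" using A to(2) t by simp
 have "\<bar>l2norm M (%x. of_real t * O' t x) - l2norm M (%x. - cr (theta x * Z t (ht x)))\<bar>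
   <= l2norm M (%x. of_real t * O' t x - - cr (theta x * Z t (ht x)))"
  by (rule l2norm_triangle_le[OF to(1)]) (use l2norm_cmult(1)[OF s, of "-1"] in simp)
 moreover have "(%x. of_real t * O' t x - - cr (theta x * Z t (ht x))) = U' t"
  by (rule ext) (simp only: U'_split, simp)
 moreover have "l2norm M (%x. - cr (theta x * Z t (ht x))) = l2norm M (%x. cr (theta x * Z t (ht x)))"
  using l2norm_cmult(2)[of M "-1" "%x. cr (theta x * Z t (ht x))"] by simp
 ultimately show "t * l2norm M (O' t) <= l2norm M (U' t) + A" using A to(2) t by (simp add: abs_le_iff)
qed

lemma integrable_inverse_sqrt: "integrable T (%t. 1 / sqrt (1 - t))"
proof -
 have "((%t::real. 1 / sqrt (1 - t)) has_integral (- 2 * sqrt (1 - 1)) - (- 2 * sqrt (1 - 0))) {0..1}"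
 proof (rule fundamental_theorem_of_calculus_interior)
  show "continuous_on {0..1} (%t::real. - 2 * sqrt (1 - t))" by (intro continuous_intros)
  fix t :: real assume t: "t \<in> {0<..<1}"
  then have "((%t. - 2 * sqrt (1 - t)) has_real_derivative 1 / sqrt (1 - t)) (at t)"
   by (auto intro!: derivative_eq_intros simp: field_simps)
  then show "((%t. - 2 * sqrt (1 - t)) has_vector_derivative 1 / sqrt (1 - t)) (at t)"
   by (simp add: has_real_derivative_iff_has_vector_derivative)
 qed simp
 then have "(%t::real. 1 / sqrt (1 - t)) integrable_on {0..1}" by blast
 then have "(%t::real. 1 / sqrt (1 - t)) absolutely_integrable_on {0..1}"
  by (rule nonnegative_absolutely_integrable_1) simp
 then have "(%t::real. 1 / sqrt (1 - t)) absolutely_integrable_on {0<..<1}"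
  by (rule set_integrable_subset) auto
 then show ?thesis
  unfolding set_integrable_def by (subst integrable_restrict_space) auto
qed

text \<open>The number of open windows is \<open>O(1/(1 - t))\<close>; almost orthogonality turns it into its square root, without which the
bound would not be integrable.\<close>

lemma U'_Lp_1: "Lp_in HH 1 {0<..<1} U'"
 unfolding Lp_in_def
proof (intro conjI U'_strongly_measurable)
 obtain A where A: "0 <= A" "!!t. t \<in> {0..1} ==> l2norm M (%x. cr (theta x * Z t (ht x))) <= A"
  using smooth_part by blast
 define C where "C = \<kappa> * sqrt (8 * Cg)"
 have C0: "0 <= C" using \<kappa>_pos Cg_nonneg by (simp add: C_def)
 have bound: "l2norm M (U' t) <= A + C * (1 / sqrt (1 - t))" if t: "t \<in> {0<..<1}" for t
 proof -
  have i1: "1 <= 1 / (1 - t)" using t by (simp add: field_simps)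
  have "real (cutoff t) <= 1 / (1 - t) + 1" using t unfolding cutoff_def by (simp add: of_nat_ceiling of_int_ceiling_le_add_one)
  then have "real (cutoff t) + 6 <= 8 * (1 / (1 - t))" using i1 by simp
  then have "\<kappa>\<^sup>2 * (Cg * (real (cutoff t) + 6)) <= \<kappa>\<^sup>2 * (Cg * (8 * (1 / (1 - t))))"
   using Cg_nonneg by (intro mult_left_mono) auto
  also have "\<dots> = (C * (1 / sqrt (1 - t)))\<^sup>2"
   using t Cg_nonneg by (simp add: C_def power_mult_distrib power_divide)
  finally have "(l2norm M (O' t))\<^sup>2 <= (C * (1 / sqrt (1 - t)))\<^sup>2" using osc_part_upper[of t] by linarith
  then have "l2norm M (O' t) <= C * (1 / sqrt (1 - t))" by (rule power2_le_imp_le) (use C0 t in simp)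
  then show ?thesis using U'_upper(1)[OF A(2), of t] t by simp
 qed
 have m: "(%t. nrm HH (U' t)) \<in> borel_measurable T"
  by (rule strongly_measurable_nrm[OF seminormed_L2 U'_strongly_measurable])
 have "integrable T (%t. nrm HH (U' t))"
 proof (rule Bochner_Integration.integrable_bound[OF _ m])
  show "integrable T (%t. A + C * (1 / sqrt (1 - t)))"
   by (intro Bochner_Integration.integrable_add integrable_mult_right integrable_inverse_sqrt integrable_T_continuous continuous_intros)
  show "AE t in T. norm (nrm HH (U' t)) <= norm (A + C * (1 / sqrt (1 - t)))"
  proof (rule AE_I2)
   fix t assume "t \<in> space T"
   then have "t \<in> {0<..<1}" by simp
   from bound[OF this] show "norm (nrm HH (U' t)) <= norm (A + C * (1 / sqrt (1 - t)))"
    by (simp add: L2_nrm l2norm_nonneg)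
  qed
 qed
 then show "integrable T (%t. nrm HH (U' t) powr 1)" by (simp add: L2_nrm l2norm_nonneg)
qed

lemma damp_sq_integral_ge: "onset j / 2 <= (LINT t|T. (damp j t)\<^sup>2)"
proof -
 have c: "continuous_on {0..1} (%t. (damp j t)\<^sup>2)" by (intro continuous_intros damp_continuous)
 have "2 * onset j <= 1"
 proof -
  have "2 * onset j = (pi / 4) / (real j + 1)" by (simp add: onset_def field_simps)
  also have "\<dots> <= 1 / 1" using pi_less_4 by (intro frac_le) auto
  finally show ?thesis by simp
 qed
 then show ?thesis
  by (intro has_integral_subset_le[OF _ integral_damp_sq has_integral_T[OF integrable_T_continuous[OF c]]])
   (use onset_pos[of j] in auto)
qed

text \<open>The first windows are left out, so that the diagonal entries are bounded below and all windows lie in the second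
half of the time interval, where the factor \<open>t\<close> in \<open>u\<close> does no harm.\<close>

lemma U'_not_square_integrable: "\<not> integrable T (%t. (l2norm M (U' t))\<^sup>2)"
proof
 assume int: "integrable T (%t. (l2norm M (U' t))\<^sup>2)"
 obtain A where A: "0 <= A" "!!t. t \<in> {0..1} ==> l2norm M (%x. cr (theta x * Z t (ht x))) <= A"
  using smooth_part by blast
 obtain j0 where j0: "1 <= j0" "!!j. j0 <= j ==> mass / 4 <= gram j j" using gram_diagonal_ge by blast
 define c where "c = \<kappa>\<^sup>2 * (mass / 4)"
 have c: "0 < c" using \<kappa>_pos mass_pos by (simp add: c_def)
 define K where "K = \<kappa>\<^sup>2 * (6 * Cg) + 8 * A\<^sup>2"
 have K: "0 <= K" using Cg_nonneg by (simp add: K_def)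
 define L where "L = K + 8 * (LINT t|T. (l2norm M (U' t))\<^sup>2)"
 have le: "c * (\<Sum>j=j0..<J. (damp j t)\<^sup>2) <= K + 8 * (l2norm M (U' t))\<^sup>2" if t: "t \<in> {0<..<1}" for t J
 proof (cases "1/2 < t")
  case True
  have "c * (\<Sum>j=j0..<J. (damp j t)\<^sup>2) - \<kappa>\<^sup>2 * (6 * Cg) <= (l2norm M (O' t))\<^sup>2"
   using osc_part_lower[of j0 t J, OF j0(2)] by (simp add: c_def algebra_simps)
  also have "(l2norm M (O' t))\<^sup>2 <= (2 * (l2norm M (U' t) + A))\<^sup>2"
  proof (rule power_mono)
   have "1/2 * l2norm M (O' t) <= t * l2norm M (O' t)" using True by (intro mult_right_mono l2norm_nonneg) auto
   also have "\<dots> <= l2norm M (U' t) + A" using U'_upper(2)[OF A(2), of t] t by simp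
   finally show "l2norm M (O' t) <= 2 * (l2norm M (U' t) + A)" by simp
  qed (rule l2norm_nonneg)
  also have "\<dots> <= 8 * (l2norm M (U' t))\<^sup>2 + 8 * A\<^sup>2"
   using sum_squares_bound[of "l2norm M (U' t)" A] by (simp add: power2_eq_square algebra_simps)
  finally show ?thesis by (simp add: K_def)
 next
  case False
  have "damp j t = 0" if "j \<in> {j0..<J}" for j
  proof (rule inactive(2))
   have "1 <= real j" using j0(1) that by simp
   then have "(pi / 4) / (real j + 1) <= (pi / 4) / 2" by (intro divide_left_mono) auto
   moreover have "2 * onset j = (pi / 4) / (real j + 1)" by (simp add: onset_def field_simps)
   ultimately have "2 * onset j <= (pi / 4) / 2" by simp
   also have "\<dots> <= 1/2" using pi_less_4 by simp
   finally show "\<not> (onset j < 1 - t \<and> 1 - t < 2 * onset j)" using False by linarith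
  qed
  then have "(\<Sum>j=j0..<J. (damp j t)\<^sup>2) = 0" by simp
  then show ?thesis using K by simp
 qed
 have bounded: "c * (\<Sum>j=j0..<J. onset j / 2) <= L" for J
 proof -
  have di: "integrable T (%t. (damp j t)\<^sup>2)" for j
   by (intro integrable_T_continuous continuous_intros damp_continuous)
  have "c * (\<Sum>j=j0..<J. onset j / 2) <= c * (\<Sum>j=j0..<J. LINT t|T. (damp j t)\<^sup>2)"
   using c by (intro mult_left_mono sum_mono damp_sq_integral_ge) auto
  also have "\<dots> = (LINT t|T. c * (\<Sum>j=j0..<J. (damp j t)\<^sup>2))"
   by (simp add: Bochner_Integration.integral_sum[OF di])
  also have "\<dots> <= (LINT t|T. K + 8 * (l2norm M (U' t))\<^sup>2)"
  proof (rule integral_mono)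
   show "integrable T (%t. c * (\<Sum>j=j0..<J. (damp j t)\<^sup>2))"
    by (intro integrable_mult_right Bochner_Integration.integrable_sum di)
   show "integrable T (%t. K + 8 * (l2norm M (U' t))\<^sup>2)"
    by (intro Bochner_Integration.integrable_add integrable_mult_right int integrable_T_continuous continuous_intros)
  qed (use le in simp)
  also have "\<dots> = (LINT t|T. K) + (LINT t|T. 8 * (l2norm M (U' t))\<^sup>2)"
   by (intro Bochner_Integration.integral_add integrable_mult_right int integrable_T_continuous continuous_intros)
  also have "\<dots> = L" using measure_T by (simp add: L_def)
  finally show ?thesis .
 qed
 have "summable (%j. onset (j + j0))"
 proof (rule summableI_nonneg_bounded)
  fix n
  have "(\<Sum>j<n. onset (j + j0)) = (\<Sum>j=j0..<n + j0. onset j)"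
   using sum.shift_bounds_nat_ivl[of onset 0 j0 n] by (simp add: lessThan_atLeast0)
  also have "\<dots> <= 2 * L / c" using bounded[of "n + j0"] c by (simp add: field_simps flip: sum_divide_distrib)
  finally show "(\<Sum>j<n. onset (j + j0)) <= 2 * L / c" .
 qed (simp add: onset_pos less_imp_le)
 then have "summable onset" by (simp add: summable_iff_shift)
 then have "summable (%j. 8 / pi * onset j)" by (rule summable_mult)
 moreover have "(%j. 8 / pi * onset j) = (%j. inverse (real (Suc j)))"
  by (intro ext) (simp add: onset_def field_simps)
 ultimately have "summable (%j. inverse (real (Suc j)))" by (simp only:)
 then have "summable (%j. inverse (real j))" using summable_Suc_iff[of "%j. inverse (real j)"] by blast
 then show False using not_summable_harmonic[where 'a=real] by simp
qed

end

section \<open>The essential supremum norm of scalar multiples of the identity\<close>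

locale matrix_norm = bounded_open \<Omega> for \<Omega> :: "(real^'n) set" +
 fixes \<nu> :: "real^'n^'n => real" assumes norm: "is_norm \<nu>"
begin

definition unit :: real where "unit = \<nu> (mat 1)"

lemma unit_pos: "0 < unit"
proof -
 have "(mat 1 :: real^'n^'n) ~= 0" by (simp add: vec_eq_iff mat_def)
 then have "\<nu> (mat 1) ~= 0" "0 <= \<nu> (mat 1)" using norm by (simp_all add: is_norm_def)
 then show ?thesis by (simp add: unit_def)
qed

lemma scalar_norm: "\<nu> (c *\<^sub>R mat 1) = \<bar>c\<bar> * unit"
 using norm by (simp add: is_norm_def unit_def)

text \<open>The essential supremum of a continuous function dominates every value, because nonempty open sets have positive
measure.\<close>

lemma scalar_Linf:
 assumes g: "continuous_on UNIV g" and C: "!!x. x \<in> \<Omega> ==> \<bar>g x\<bar> <= C" and x0: "x0 \<in> \<Omega>"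
 shows "(%x. g x *\<^sub>R mat 1) \<in> carr (Linf \<nu> \<Omega>)"
  "nrm (Linf \<nu> \<Omega>) (%x. g x *\<^sub>R mat 1) <= C * unit"
  "\<bar>g x0\<bar> * unit <= nrm (Linf \<nu> \<Omega>) (%x. g x *\<^sub>R mat 1)"
proof -
 define f where "f x = ereal (\<bar>g x\<bar> * unit)" for x
 define e where "e = esssup M f"
 have fc: "continuous_on UNIV f" unfolding f_def[abs_def]
  by (intro continuous_on_ereal continuous_intros g)
 have fm: "f \<in> meas" by (rule continuous_measurable[OF fc])
 have up: "e <= ereal (C * unit)" unfolding e_def
 proof (rule esssup_I[OF fm AE_I2])
  fix x assume "x \<in> space M"
  then have "\<bar>g x\<bar> * unit <= C * unit" using C[of x] unit_pos by (intro mult_right_mono) auto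
  then show "f x <= ereal (C * unit)" by (simp add: f_def)
 qed
 have lo: "ereal (\<bar>g x0\<bar> * unit) <= e"
 proof (rule ccontr)
  assume "\<not> ereal (\<bar>g x0\<bar> * unit) <= e"
  then have less: "e < f x0" by (simp add: f_def)
  define S where "S = {x. e < f x} \<inter> \<Omega>"
  have "open S" unfolding S_def by (intro open_Int open_Omega open_Collect_less continuous_on_const fc)
  moreover have "AE x in M. x \<notin> S" using esssup_AE[of f M] by eventually_elim (simp add: S_def e_def not_less)
  ultimately show False using open_not_AE_empty[of S x0] x0 less by (simp add: S_def)
 qed
 have eq: "esssup M (%x. ereal (\<nu> (g x *\<^sub>R mat 1))) = e" by (simp add: scalar_norm e_def f_def[abs_def])
 have "(%x. g x *\<^sub>R (mat 1 :: real^'n^'n)) \<in> meas"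
  by (intro continuous_measurable continuous_intros g)
 moreover have "e < \<infinity>" using up by (rule order_le_less_trans) simp
 ultimately show "(%x. g x *\<^sub>R mat 1) \<in> carr (Linf \<nu> \<Omega>)" by (simp add: Linf_def eq)
 obtain z where z: "e = ereal z" using lo up by (cases e) auto
 show "nrm (Linf \<nu> \<Omega>) (%x. g x *\<^sub>R mat 1) <= C * unit" using up by (simp add: Linf_def eq z)
 show "\<bar>g x0\<bar> * unit <= nrm (Linf \<nu> \<Omega>) (%x. g x *\<^sub>R mat 1)" using lo by (simp add: Linf_def eq z)
qed

end

section \<open>The coefficient and the solution\<close>

context construction
begin

lemma p_mem: "p \<in> \<Omega>"
 using cube r_pos by auto

lemma coef_continuous: "t \<in> {0..1} ==> continuous_on UNIV (bco t)"
 by (rule smooth_continuous[OF smooth_compose_coord[OF smooth_coef]])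

text \<open>Continuity in space at a fixed time suffices, as the Hoelder continuity in time is uniform in space.\<close>

lemma coef_joint_continuous: "continuous_on ({0..1} \<times> UNIV) (%(t, x). bco t x)"
 unfolding continuous_on_def
proof
 fix z :: "real \<times> (real^'n)" assume z: "z \<in> {0..1} \<times> UNIV"
 obtain t x where tx: "z = (t, x)" "t \<in> {0..1}" using z by auto
 let ?F = "at z within {0..1} \<times> UNIV"
 have lim: "(snd \<longlongrightarrow> x) ?F" "(fst \<longlongrightarrow> t) ?F"
  using tendsto_snd[OF tendsto_ident_at, of z] tendsto_fst[OF tendsto_ident_at, of z] by (auto simp: tx)
 have "isCont (bco t) x" using coef_continuous[OF tx(2)] by (simp add: continuous_on_eq_continuous_at)
 from isCont_tendsto_compose[OF this lim(1)]
 have x_lim: "((%w. bco t (snd w)) \<longlongrightarrow> bco t x) ?F" .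
 have t_lim: "((%w. bco (fst w) (snd w) - bco t (snd w)) \<longlongrightarrow> 0) ?F"
 proof (rule Lim_null_comparison)
  show "\<forall>\<^sub>F w in ?F. norm (bco (fst w) (snd w) - bco t (snd w)) <= 30 * \<kappa> * Cb * sqrt \<bar>fst w - t\<bar>"
   unfolding eventually_at_filter
  proof (rule always_eventually, intro allI impI)
   fix w :: "real \<times> (real^'n)" assume "w \<in> {0..1} \<times> UNIV"
   then have "fst w \<in> {0..1}" by auto
   from coef_holder[OF tx(2) this] show "norm (bco (fst w) (snd w) - bco t (snd w)) <= 30 * \<kappa> * Cb * sqrt \<bar>fst w - t\<bar>"
    by simp
  qed
  have "((%w. 30 * \<kappa> * Cb * sqrt \<bar>fst w - t\<bar>) \<longlongrightarrow> 30 * \<kappa> * Cb * sqrt \<bar>t - t\<bar>) ?F"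
   by (intro tendsto_intros lim)
  then show "((%w. 30 * \<kappa> * Cb * sqrt \<bar>fst w - t\<bar>) \<longlongrightarrow> 0) ?F" by simp
 qed
 from tendsto_add[OF t_lim x_lim] show "((%(t, x). bco t x) \<longlongrightarrow> (case z of (t, x) => bco t x)) ?F"
  by (simp add: tx case_prod_unfold)
qed

lemma coef_joint_measurable: "(%(t, x). bco t x) \<in> borel_measurable (lebesgue_on ({0..1} \<times> \<Omega>))"
proof (rule continuous_imp_measurable_on_sets_lebesgue)
 show "continuous_on ({0..1} \<times> \<Omega>) (%(t, x). bco t x)"
  by (rule continuous_on_subset[OF coef_joint_continuous]) auto
 have "{0..1::real} \<times> \<Omega> \<in> sets (borel \<Otimes>\<^sub>M borel)" using open_Omega by (intro pair_measureI) auto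
 then have "{0..1::real} \<times> \<Omega> \<in> sets borel" by (simp only: borel_prod)
 then show "{0..1::real} \<times> \<Omega> \<in> sets lebesgue" by (simp add: sets_completionI_sets)
qed

lemma coef_elliptic: "uniformly_elliptic \<Omega> bco"
 unfolding uniformly_elliptic_def
proof (intro exI conjI)
 show "AE (t, x) in lebesgue_on ({0..1} \<times> \<Omega>). 1/3 <= bco t x \<and> bco t x <= 5/3"
 proof (rule AE_I2)
  fix z :: "real \<times> (real^'n)" assume "z \<in> space (lebesgue_on ({0..1} \<times> \<Omega>))"
  then have "fst z \<in> {0..1}" by auto
  from coef_bounds[OF this] show "case z of (t, x) => 1/3 <= bco t x \<and> bco t x <= 5/3" by (simp add: case_prod_beta)
 qed
qed auto

lemma coef_abs_le: "t \<in> {0..1} ==> \<bar>bco t x\<bar> <= 5/3"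
 using coef_bounds[of t "ht x"] by auto

lemma U_lions: "lions_solution \<Omega> (isotropic bco) (%t. emb (F t)) U"
 unfolding lions_solution_def
proof (intro conjI)
 show "Lp_in VV 2 {0<..<1} U" by (rule Lp_in_continuous[OF seminormed_H10 U_continuous_H10]) simp
 have "AE t in T. \<forall>w\<in>carr VV. D t w + neg_div \<Omega> (isotropic bco t) (U t) w = emb (F t) w"
  by (rule AE_I2) (auto intro: equation)
 moreover have "Lp_in VV' 2 {0<..<1} D" by (rule Lp_in_continuous[OF seminormed_Hm1 D_continuous]) simp
 ultimately show "\<exists>D. Lp_in VV' 2 {0<..<1} D \<and>
     weak_derivative_in VV' {0<..<1} (%t. emb (U t)) D \<and>
     (AE t in T. \<forall>w\<in>carr VV. D t w + neg_div \<Omega> (isotropic bco t) (U t) w = emb (F t) w)"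
  using U_weak_derivative_Hm1 by (intro exI[of _ D] conjI)
 have "nrm HH (U 0) = 0" by (simp add: L2_nrm u_def l2norm_def)
 moreover have "AE t in T. nrm HH (%x. U t x - U t x) = 0" by (simp add: L2_nrm l2norm_def)
 ultimately show "\<exists>W. continuous_in HH {0..1} W \<and>
     (AE t in T. nrm HH (%x. U t x - W t x) = 0) \<and> nrm HH (W 0) = 0"
  using U_continuous_L2 by (intro exI[of _ U] conjI)
qed

lemma U_unique: "unique_lions_solution \<Omega> (isotropic bco) (%t. emb (F t)) U"
 unfolding unique_lions_solution_def
proof (intro conjI allI impI U_lions)
 fix W assume W: "lions_solution \<Omega> (isotropic bco) (%t. emb (F t)) W"
 show "AE t in T. nrm VV (%x. W t x - U t x) = 0"
 proof (rule lions_solution_unique[OF _ _ _ _ W U_lions])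
  fix t :: real assume t: "t \<in> {0..1}"
  show "bco t \<in> meas" by (rule continuous_measurable[OF coef_continuous[OF t]])
  show "1/3 <= bco t x \<and> bco t x <= 5/3" for x using coef_bounds[OF t] by simp
 qed auto
qed

text \<open>A square integrable representative would agree with \<open>U'\<close> almost everywhere, by injectivity of the embedding.\<close>

lemma D_not_in_L2: "\<not> in_L2_H \<Omega> D"
proof
 assume "in_L2_H \<Omega> D"
 then obtain G where G: "Lp_in HH 2 {0<..<1} G" "AE t in T. \<forall>w\<in>carr VV. D t w = emb (G t) w"
  unfolding in_L2_H_def by blast
 have sm: "strongly_measurable_in HH {0<..<1} G" and int: "integrable T (%t. (nrm HH (G t))\<^sup>2)"
  using G(1) Lp_in_2[OF seminormed_L2] by auto
 have "AE t in T. (nrm HH (G t))\<^sup>2 = (nrm HH (U' t))\<^sup>2"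
  using G(2) strongly_measurable_carr[OF sm]
 proof eventually_elim
  case (elim t)
  have Gt: "sqint M (G t)" using elim(2) by (simp add: L2_carr)
  have "AE x in M. U' t x - G t x = 0"
  proof (rule embed_H_eq_0[OF sqint_diff[OF U'_sqint Gt]])
   fix w assume w: "w \<in> carr VV"
   show "emb (%x. U' t x - G t x) w = 0"
    using elim(1) w by (simp add: embed_H_diff[OF U'_sqint Gt H10_sqint[OF w]])
  qed
  then have "AE x in M. U' t x = G t x" by eventually_elim simp
  then have "l2norm M (U' t) = l2norm M (G t)"
   using U'_sqint[of t] Gt by (intro l2norm_cong_AE) (auto simp: sqint_def)
  then show ?case by (simp add: L2_nrm)
 qed
 moreover have "(%t. (nrm HH (U' t))\<^sup>2) \<in> borel_measurable T"
  by (intro borel_measurable_power strongly_measurable_nrm[OF seminormed_L2 U'_strongly_measurable])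
 ultimately have "integrable T (%t. (nrm HH (U' t))\<^sup>2)"
  using int by (subst integrable_cong_AE[where g="%t. (nrm HH (G t))\<^sup>2"]) (auto elim: AE_mp)
 then show False using U'_not_square_integrable by (simp add: L2_nrm)
qed

lemma divergence_not_in_L2: "\<not> in_L2_H \<Omega> (%t. neg_div \<Omega> (isotropic bco t) (U t))"
proof
 assume "in_L2_H \<Omega> (%t. neg_div \<Omega> (isotropic bco t) (U t))"
 then obtain G where G: "Lp_in HH 2 {0<..<1} G"
   "AE t in T. \<forall>w\<in>carr VV. neg_div \<Omega> (isotropic bco t) (U t) w = emb (G t) w"
  unfolding in_L2_H_def by blast
 have sm: "strongly_measurable_in HH {0<..<1} G" using G(1) by (simp add: Lp_in_def)
 have FL: "Lp_in HH 2 {0<..<1} F" by (rule Lp_in_continuous[OF seminormed_L2 F_continuous_L2]) simp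
 have "AE t in T. \<forall>w\<in>carr VV. D t w = emb (%x. F t x - G t x) w"
  using G(2) strongly_measurable_carr[OF sm] AE_space
 proof eventually_elim
  case (elim t)
  have t: "t \<in> {0..1}" using elim(3) by simp
  show ?case
  proof
   fix w assume w: "w \<in> carr VV"
   have "emb (%x. F t x - G t x) w = emb (F t) w - emb (G t) w"
    using elim(2) by (intro embed_H_diff H10_sqint[OF w] test_sqint[OF test_functions_of_real[OF force_test[OF t]]]) (simp add: L2_carr)
   then show "D t w = emb (%x. F t x - G t x) w"
    using equation[OF t w] bspec[OF elim(1) w] by (simp only: eq_diff_eq) (metis add_right_cancel)
  qed
 qed
 with Lp_in_2_diff[OF seminormed_L2 FL G(1)] have "in_L2_H \<Omega> D"
  unfolding in_L2_H_def by (intro exI[of _ "%t x. F t x - G t x"] conjI)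
 then show False using D_not_in_L2 by simp
qed

lemma solution_properties:
 "\<exists>(F :: real => real^'n => complex) (U :: real => real^'n => complex) D.
    real_valued \<Omega> F \<and>
    continuous_in HH {0..1} F \<and> Lp_in HH 2 {0<..<1} F \<and>
    real_valued \<Omega> U \<and>
    continuous_in VV {0..1} U \<and>
    C1_derivative_in VV' {0..1} (%t. emb (U t)) D \<and>
    W1p_in HH 1 {0<..<1} U \<and>
    Lp_in VV 2 {0<..<1} U \<and> W1p_in VV' 2 {0<..<1} (%t. emb (U t)) \<and>
    nrm VV (U 0) = 0 \<and>
    unique_lions_solution \<Omega> (isotropic bco) (%t. emb (F t)) U \<and>
    (\<forall>t\<in>{0..1}. \<forall>w\<in>carr VV.
      D t w + neg_div \<Omega> (isotropic bco t) (U t) w = emb (F t) w) \<and>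
    \<not> in_L2_H \<Omega> D \<and>
    \<not> in_L2_H \<Omega> (%t. neg_div \<Omega> (isotropic bco t) (U t))"
proof (intro exI conjI)
 show "real_valued \<Omega> F" "real_valued \<Omega> U" by (simp_all add: real_valued_def)
 show "continuous_in HH {0..1} F" by (rule F_continuous_L2)
 show "Lp_in HH 2 {0<..<1} F" by (rule Lp_in_continuous[OF seminormed_L2 F_continuous_L2]) simp
 show "continuous_in VV {0..1} U" by (rule U_continuous_H10)
 show "C1_derivative_in VV' {0..1} (%t. emb (U t)) D" by (rule U_C1)
 have "Lp_in HH 1 {0<..<1} U" by (rule Lp_in_continuous[OF seminormed_L2 U_continuous_L2]) simp
 then show "W1p_in HH 1 {0<..<1} U" unfolding W1p_in_def using U'_Lp_1 U_weak_derivative_L2 by blast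
 show "Lp_in VV 2 {0<..<1} U" by (rule Lp_in_continuous[OF seminormed_H10 U_continuous_H10]) simp
 have "Lp_in VV' 2 {0<..<1} (%t. emb (U t))"
  by (rule Lp_in_continuous[OF seminormed_Hm1 continuous_in_Hm1[OF U_continuous_L2]]) simp
 moreover have "Lp_in VV' 2 {0<..<1} D" by (rule Lp_in_continuous[OF seminormed_Hm1 D_continuous]) simp
 ultimately show "W1p_in VV' 2 {0<..<1} (%t. emb (U t))"
  unfolding W1p_in_def using U_weak_derivative_Hm1 by (intro conjI exI[of _ D])
 have "U 0 = (%x. 0)" by (simp add: u_def)
 then show "nrm VV (U 0) = 0" using nrm_zero[OF seminormed_H10] by simp
 show "unique_lions_solution \<Omega> (isotropic bco) (%t. emb (F t)) U" by (rule U_unique)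
 show "\<forall>t\<in>{0..1}. \<forall>w\<in>carr VV. D t w + neg_div \<Omega> (isotropic bco t) (U t) w = emb (F t) w"
  by (intro ballI equation)
 show "\<not> in_L2_H \<Omega> D" by (rule D_not_in_L2)
 show "\<not> in_L2_H \<Omega> (%t. neg_div \<Omega> (isotropic bco t) (U t))" by (rule divergence_not_in_L2)
qed

lemma not_maximal: "\<not> maximal_L2_regularity \<Omega> (isotropic bco)"
proof
 assume max: "maximal_L2_regularity \<Omega> (isotropic bco)"
 have "Lp_in HH 2 {0<..<1} F" by (rule Lp_in_continuous[OF seminormed_L2 F_continuous_L2]) simp
 moreover have "Lp_in VV' 2 {0<..<1} D" by (rule Lp_in_continuous[OF seminormed_Hm1 D_continuous]) simp
 ultimately have "in_L2_H \<Omega> D"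
  using max[unfolded maximal_L2_regularity_def, rule_format, of F U D] U_lions U_weak_derivative_Hm1 by blast
 then show False using D_not_in_L2 by simp
qed

end

locale normed_construction = construction \<Omega> r \<kappa> i0 p + matrix_norm \<Omega> \<nu>
 for \<Omega> :: "(real^'n) set" and r \<kappa> i0 p and \<nu> :: "real^'n^'n => real"
begin

abbreviation X where "X \<equiv> Linf \<nu> \<Omega>"

lemma isotropic_diff: "(%x. isotropic bco t x - isotropic bco s x) = (%x. (bco t x - bco s x) *\<^sub>R mat 1)"
 by (simp add: isotropic_def scaleR_diff_left)

lemma isotropic_shift: "(%x. isotropic bco t x - mat 1) = (%x. (bco t x - 1) *\<^sub>R mat 1)"
 by (simp add: isotropic_def scaleR_diff_left)

lemma quotient_norm:
 assumes s: "s \<in> {0..1}" and t: "t \<in> {0..1}" and st: "s ~= t"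
 shows "nrm X (%x. isotropic bco t x - isotropic bco s x) / \<bar>t - s\<bar> powr (1/2) <= 30 * \<kappa> * Cb * unit"
proof -
 have "nrm X (%x. isotropic bco t x - isotropic bco s x) <= (30 * \<kappa> * Cb * sqrt \<bar>t - s\<bar>) * unit"
  unfolding isotropic_diff
  by (rule scalar_Linf(2)[OF _ _ p_mem]) (intro continuous_on_diff coef_continuous s t, rule coef_holder[OF s t])
 then show ?thesis using st by (simp add: powr_half_sqrt pos_divide_le_eq mult_ac)
qed

lemma shifted_norm: "t \<in> {0..1} ==> nrm X (%x. isotropic bco t x - mat 1) <= 16 * \<kappa> * Cb * unit"
 unfolding isotropic_shift
 by (rule scalar_Linf(2)[OF _ _ p_mem]) (intro continuous_on_diff coef_continuous continuous_on_const, assumption, rule coef_minus_1)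

lemma holder_half: "holder_in X (1/2) 1 (isotropic bco)"
 unfolding holder_in_def
proof (intro conjI ballI)
 fix t :: real assume t: "t \<in> {0..1}"
 show "isotropic bco t \<in> carr X"
  using scalar_Linf(1)[OF coef_continuous[OF t] coef_abs_le[OF t] p_mem] by (simp add: isotropic_def[abs_def])
next
 have "nrm X (isotropic bco t) <= 5/3 * unit" if t: "t \<in> {0..1}" for t
  using scalar_Linf(2)[OF coef_continuous[OF t] coef_abs_le[OF t] p_mem] by (simp add: isotropic_def[abs_def])
 then show "bdd_above {nrm X (isotropic bco t) |t. t \<in> {0..1}}" by (intro bdd_aboveI[of _ "5/3 * unit"]) blast
 show "bdd_above {nrm X (%x. isotropic bco t x - isotropic bco s x) / \<bar>t - s\<bar> powr (1/2) |s t. s \<in> {0..1} \<and> t \<in> {0..1} \<and> s ~= t}"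
  using quotient_norm by (intro bdd_aboveI[of _ "30 * \<kappa> * Cb * unit"]) blast
qed

lemma holder_norm_le: "holder_norm X (1/2) 1 (%t x. isotropic bco t x - mat 1) <= 46 * \<kappa> * Cb * unit"
proof -
 have "Sup {nrm X (%x. isotropic bco t x - mat 1) |t. t \<in> {0..1}} <= 16 * \<kappa> * Cb * unit"
  by (rule cSup_least) (use shifted_norm in auto)
 moreover have "Sup {nrm X (%x. (isotropic bco t x - mat 1) - (isotropic bco s x - mat 1)) / \<bar>t - s\<bar> powr (1/2) |s t.
   s \<in> {0..1} \<and> t \<in> {0..1} \<and> s ~= t} <= 30 * \<kappa> * Cb * unit"
 proof (rule cSup_least)
  have "nrm X (%x. (isotropic bco 1 x - mat 1) - (isotropic bco 0 x - mat 1)) / \<bar>1 - 0\<bar> powr (1/2)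
   \<in> {nrm X (%x. (isotropic bco t x - mat 1) - (isotropic bco s x - mat 1)) / \<bar>t - s\<bar> powr (1/2) |s t. s \<in> {0..1} \<and> t \<in> {0..1} \<and> s ~= t}"
   by (rule CollectI, rule exI[of _ 0], rule exI[of _ 1]) simp
  then show "{nrm X (%x. (isotropic bco t x - mat 1) - (isotropic bco s x - mat 1)) / \<bar>t - s\<bar> powr (1/2) |s t.
   s \<in> {0..1} \<and> t \<in> {0..1} \<and> s ~= t} ~= {}" by blast
 qed (use quotient_norm in auto)
 ultimately show ?thesis unfolding holder_norm_def by simp
qed

lemma not_holder:
 assumes \<alpha>: "1/2 < \<alpha>" shows "\<not> holder_in X \<alpha> 1 (isotropic bco)"
proof
 assume "holder_in X \<alpha> 1 (isotropic bco)"
 then obtain B where B: "!!s t. s \<in> {0..1} ==> t \<in> {0..1} ==> s ~= t ==>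
   nrm X (%x. isotropic bco t x - isotropic bco s x) / \<bar>t - s\<bar> powr \<alpha> <= B"
  unfolding holder_in_def bdd_above_def by blast
 obtain s t where st: "s \<in> {0..1}" "t \<in> {0..1}" "s ~= t" "\<bar>B\<bar> / unit * \<bar>t - s\<bar> powr \<alpha> < \<bar>coef t 0 - coef s 0\<bar>"
  using coef_not_holder[OF \<alpha>, of "\<bar>B\<bar> / unit"] unit_pos by auto
 have "\<bar>bco t p - bco s p\<bar> * unit <= nrm X (%x. isotropic bco t x - isotropic bco s x)"
  unfolding isotropic_diff
  by (rule scalar_Linf(3)[OF _ _ p_mem]) (intro continuous_on_diff coef_continuous st, rule coef_holder[OF st(1,2)])
 also have "\<dots> <= \<bar>B\<bar> * \<bar>t - s\<bar> powr \<alpha>"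
 proof -
  have "nrm X (%x. isotropic bco t x - isotropic bco s x) <= B * \<bar>t - s\<bar> powr \<alpha>"
   using B[OF st(1,2,3)] st(3) by (simp add: pos_divide_le_eq)
  also have "\<dots> <= \<bar>B\<bar> * \<bar>t - s\<bar> powr \<alpha>" by (intro mult_right_mono) auto
  finally show ?thesis .
 qed
 finally have "\<bar>coef t 0 - coef s 0\<bar> <= \<bar>B\<bar> / unit * \<bar>t - s\<bar> powr \<alpha>" using unit_pos by (simp add: field_simps)
 then show False using st(4) by simp
qed

end

theorem corollary1p2:
  fixes \<Omega> :: "(real^'n) set" and \<delta> :: real and \<nu> :: "real^'n^'n \<Rightarrow> real"
  assumes "domain \<Omega>" and "bounded \<Omega>" and "\<delta> > 0" and "is_norm \<nu>"
  shows "\<exists>b :: real \<Rightarrow> real^'n \<Rightarrow> real.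
     (\<lambda>(t, x). b t x) \<in> borel_measurable (lebesgue_on ({0..1} \<times> \<Omega>)) \<and>
     (\<exists>C. \<forall>t\<in>{0..1}. \<forall>x\<in>\<Omega>. \<bar>b t x\<bar> \<le> C) \<and>
     (\<forall>t\<in>{0..1}. \<forall>x\<in>\<Omega>. transpose (isotropic b t x) = isotropic b t x) \<and>
     uniformly_elliptic \<Omega> b \<and>
     holder_in (Linf \<nu> \<Omega>) (1/2) 1 (isotropic b) \<and>
     holder_norm (Linf \<nu> \<Omega>) (1/2) 1 (\<lambda>t x. isotropic b t x - mat 1) < \<delta> \<and>
     (\<forall>\<alpha>. 1/2 < \<alpha> \<and> \<alpha> < 1 \<longrightarrow> \<not> holder_in (Linf \<nu> \<Omega>) \<alpha> 1 (isotropic b)) \<and>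
     (\<exists>(F :: real \<Rightarrow> real^'n \<Rightarrow> complex) (U :: real \<Rightarrow> real^'n \<Rightarrow> complex) D.
        real_valued \<Omega> F \<and>
        continuous_in (L2 \<Omega>) {0..1} F \<and> Lp_in (L2 \<Omega>) 2 {0<..<1} F \<and>
        real_valued \<Omega> U \<and>
        continuous_in (H10 \<Omega>) {0..1} U \<and>
        C1_derivative_in (Hm1 \<Omega>) {0..1} (\<lambda>t. embed_H \<Omega> (U t)) D \<and>
        W1p_in (L2 \<Omega>) 1 {0<..<1} U \<and>
        Lp_in (H10 \<Omega>) 2 {0<..<1} U \<and> W1p_in (Hm1 \<Omega>) 2 {0<..<1} (\<lambda>t. embed_H \<Omega> (U t)) \<and>
        nrm (H10 \<Omega>) (U 0) = 0 \<and>
        unique_lions_solution \<Omega> (isotropic b) (\<lambda>t. embed_H \<Omega> (F t)) U \<and>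
        (\<forall>t\<in>{0..1}. \<forall>w\<in>carr (H10 \<Omega>).
           D t w + neg_div \<Omega> (isotropic b t) (U t) w = embed_H \<Omega> (F t) w) \<and>
        \<not> in_L2_H \<Omega> D \<and>
        \<not> in_L2_H \<Omega> (\<lambda>t. neg_div \<Omega> (isotropic b t) (U t))) \<and>
     \<not> maximal_L2_regularity \<Omega> (isotropic b)"
proof -
 have op: "open \<Omega>" and ne: "\<Omega> ~= {}" using assms(1) by (auto simp: domain_def)
 obtain p where p: "p \<in> \<Omega>" using ne by blast
 obtain e where e: "0 < e" "cball p e \<subseteq> \<Omega>" using op p open_contains_cball by blast
 define r where "r = e / (2 * real CARD('n))"
 have r: "0 < r" using e by (simp add: r_def)
 have cube: "{x. \<forall>i. \<bar>x $ i - p $ i\<bar> <= 2 * r} \<subseteq> \<Omega>"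
 proof
  fix x assume "x \<in> {x. \<forall>i. \<bar>x $ i - p $ i\<bar> <= 2 * r}"
  then have "(\<Sum>i\<in>UNIV. \<bar>(x - p) $ i\<bar>) <= (\<Sum>i\<in>(UNIV::'n set). 2 * r)" by (intro sum_mono) auto
  also have "\<dots> = e" by (simp add: r_def)
  finally have "norm (x - p) <= e" using norm_le_l1_cart[of "x - p"] by linarith
  then show "x \<in> \<Omega>" using e(2) by (auto simp: dist_norm norm_minus_commute)
 qed
 define C where "C = profile.Cb r"
 have prof: "profile r" using r by (rule profile.intro)
 have C: "0 < C" unfolding C_def by (rule profile.Cb(1)[OF prof])
 have bo: "bounded_open \<Omega>" using op assms(2) by (rule bounded_open.intro)
 have mn: "matrix_norm \<Omega> \<nu>" using bo assms(4) by (intro matrix_norm.intro matrix_norm_axioms.intro)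
 define n where "n = matrix_norm.unit \<nu>"
 have n: "0 < n" unfolding n_def by (rule matrix_norm.unit_pos[OF mn])
 (* The first bound keeps the denominator of the coefficient away from 0, the second one controls the norm. *)
 define \<kappa> where "\<kappa> = min (1 / (24 * C)) (\<delta> / (47 * C * n))"
 have \<kappa>: "0 < \<kappa>" using C n assms(3) by (simp add: \<kappa>_def)
 have "\<kappa> <= 1 / (24 * C)" by (simp add: \<kappa>_def)
 then have small: "24 * \<kappa> * C <= 1" using C by (simp add: field_simps)
 have "\<kappa> <= \<delta> / (47 * C * n)" by (simp add: \<kappa>_def)
 then have "47 * \<kappa> * C * n <= \<delta>" using C n by (simp add: field_simps)
 moreover have "0 < \<kappa> * C * n" using C n \<kappa> by simp
 ultimately have close: "46 * \<kappa> * C * n < \<delta>" by linarith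
 define i0 :: 'n where "i0 = undefined"
 have osc: "oscillation r \<kappa>"
  using prof \<kappa> small unfolding C_def by (intro oscillation.intro oscillation_axioms.intro)
 have con: "construction \<Omega> r \<kappa> p"
  using bo osc cube by (intro construction.intro construction_axioms.intro)
 interpret normed_construction \<Omega> r \<kappa> i0 p \<nu>
  using con mn by (intro normed_construction.intro)
 show ?thesis
 proof (intro exI[of _ bco] conjI allI impI ballI)
  show "(%(t, x). bco t x) \<in> borel_measurable (lebesgue_on ({0..1} \<times> \<Omega>))" by (rule coef_joint_measurable)
  show "\<exists>C. \<forall>t\<in>{0..1}. \<forall>x\<in>\<Omega>. \<bar>bco t x\<bar> <= C" using coef_abs_le by blast
  show "transpose (isotropic bco t x) = isotropic bco t x" for t x
   by (simp add: isotropic_def transpose_def mat_def vec_eq_iff)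
  show "uniformly_elliptic \<Omega> bco" by (rule coef_elliptic)
  show "holder_in (Linf \<nu> \<Omega>) (1/2) 1 (isotropic bco)" by (rule holder_half)
  show "holder_norm (Linf \<nu> \<Omega>) (1/2) 1 (%t x. isotropic bco t x - mat 1) < \<delta>"
   using holder_norm_le close by (simp add: C_def n_def)
  show "\<not> holder_in (Linf \<nu> \<Omega>) \<alpha> 1 (isotropic bco)" if "1/2 < \<alpha> \<and> \<alpha> < 1" for \<alpha>
   using that by (intro not_holder) simp
  show "\<not> maximal_L2_regularity \<Omega> (isotropic bco)" by (rule not_maximal)
 qed (rule solution_properties)
qed

end
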